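(* Let $(u,c,f,\rho_0,\rho_{\mathrm{in}},\mathcal G)$ be admissible data, with $\alpha(t)=\|(u_x(t,\cdot)+c(t,\cdot))^-\|_{L^\infty(\Omega)^n}$, with $F_+(t)\in\mathbb R^n$ given by $(F_+)_i(t)=\int_0^t\exp\left(-\int_0^s\alpha(r)\,\mathrm dr\right)\|(f_i(s,\cdot))^+\|_{L^\infty(\Omega)}\,\mathrm ds$, and with $\rho_{\max}\in\mathbb R^n$ a constant vector as in the definition of admissibility. Let $\mathcal H(\rho)=\rho_{\mathrm{in}}+\mathcal G(\rho)$ and let $\rho$ be a solution, with trace $\gamma\rho$, of $$\rho_t+(\mathbf U\rho)_x+\mathbf C\rho=f\ \text{in }(0,T)\times\Omega,\qquad \rho(0,\cdot)=\rho_0\ \text{in }\Omega,\qquad (\nu\mathbf U)^-\rho=(\nu\mathbf U)^-\mathcal H(\rho|_{\Gamma_T})\ \text{on }\Gamma_T .$$ Then, componentwise, for all $t\in[0,T]$ $$0\le\rho(t,\cdot)\le\left(\rho_{\max}+F_+(t)\right)\exp\left(\int_0^t\alpha(s)\,\mathrm ds\right)\quad\text{almost everywhere in }\Omega,$$ and $$0\le\gamma\rho(t,\omega)\le\left(\rho_{\max}+F_+(t)\right)\exp\left(\int_0^t\alpha(s)\,\mathrm ds\right)\quad\text{for }|\mathrm d\mu_u|\text{-almost all }(t,\omega)\in\Gamma_T.$$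
   Context: Notation. $T>0$, $n\ge 1$, $\Omega=(0,1)$, $\Gamma=\partial\Omega=\{0,1\}$, $\Gamma_T=[0,T]\times\Gamma$; $\nu(0)=-1$, $\nu(1)=1$ is the outer normal; $\mathrm d\omega$ is the counting measure on $\Gamma$. For real $a$: $a^+=\max(a,0)$, $a^-=\max(-a,0)$. Positive/negative parts, absolute values and inequalities of vectors are componentwise. $\|g\|_{L^\infty(\Omega)^n}=\max_j\|g^j\|_{L^\infty(\Omega)}$. For $u=(u^1,\dots,u^n)$, $c=(c^1,\dots,c^n)$ put $\mathbf U=\operatorname{diag}(u)$, $\mathbf C=\operatorname{diag}(c)$. Componentwise measures on $\Gamma_T$: $\mathrm d\mu_u=(\nu u)\,\mathrm d\omega\,\mathrm dt$, $\mathrm d\mu_u^\pm=(\nu u)^\pm\mathrm d\omega\,\mathrm dt$, $|\mathrm d\mu_u|=\mathrm d\mu_u^++\mathrm d\mu_u^-$. $L^\infty(\Gamma_T,\mathrm d\mu_u^\pm)$ is the space of $\mathbb R^n$-valued $g$ whose $j$-th component is essentially bounded with respect to $(\nu u^j)^\pm\mathrm d\omega\,\mathrm dt$ (similarly for $|\mathrm d\mu_u|$); "$\mathrm d\mu_u^\pm$-almost everywhere" is also understood componentwise. For a positive definite diagonal matrix $\overline{\mathbf W}\in\mathbb R^{n\times n}$ put $\|g\|_{1,w,\pm}=\int_0^T\int_\Gamma |g|^T\overline{\mathbf W}(\nu u)^\pm\,\mathrm d\omega\,\mathrm dt$. Functions on $\Gamma_T$ defined only with respect to $\mathrm d\mu_u^\pm$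 are extended by zero where necessary. Admissible data. $(u,c,f,\rho_0,\rho_{\mathrm{in}},\mathcal G)$ is called admissible if: (i) $u\in L^1((0,T),W^{1,1}(\Omega)^n)$, $c\in L^1((0,T)\times\Omega)^n$, $(u_x+c)^-\in L^1((0,T),L^\infty(\Omega)^n)$, $(u_x)^+\in L^1((0,T),L^\infty(\Omega)^n)$, $f\in L^1((0,T),L^\infty(\Omega)^n)$ with $f\ge0$; (ii) $\rho_0\in L^\infty(\Omega)^n$, $\rho_0\ge 0$ a.e.; $\rho_{\mathrm{in}}\in L^\infty(\Gamma_T,\mathrm d\mu_u^-)$, $\rho_{\mathrm{in}}\ge0$ $\mathrm d\mu_u^-$-a.e.; (iii) $\mathcal G:L^\infty(\Gamma_T,\mathrm d\mu_u^+)\to L^\infty(\Gamma_T,\mathrm d\mu_u^-)$ is linear and (a) weakly-$\star$ continuous: $\rho_k\overset{\star}{\rightharpoonup}\rho$ in $L^\infty(\Gamma_T,\mathrm d\mu_u^+)$ implies $\mathcal G(\rho_k)\overset{\star}{\rightharpoonup}\mathcal G(\rho)$ in $L^\infty(\Gamma_T,\mathrm d\mu_u^-)$; (b) there is a positive definite diagonal weight matrix $\overline{\mathbf W}\in\mathbb R^{n\times n}$ with $\|\mathcal G(\rho)\|_{1,w,-}\le\|\rho\|_{1,w,+}$ for all $\rho\in L^\infty(\Gamma_T,\mathrm d\mu_u^+)$; (c) causal: $\chi_{[0,t]}\mathcal G(\chi_{[0,t]}\rho)=\chi_{[0,t]}\mathcal G(\rho)$ for all $\rho\in L^\infty(\Gamma_T,\mathrm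 d\mu_u^+)$ and almost all $t\in[0,T]$; (d) positive: $\rho\ge0$ $\mathrm d\mu_u^+$-a.e. implies $\mathcal G(\rho)\ge0$ $\mathrm d\mu_u^-$-a.e.; (iv) with $\alpha(s)=\|(u_x(s,\cdot)+c(s,\cdot))^-\|_{L^\infty(\Omega)^n}$ and $F_+(t)\in\mathbb R^n$ given by $(F_+)_i(t)=\int_0^t\exp\left(-\int_0^s\alpha(r)\,\mathrm dr\right)\|(f_i(s,\cdot))^+\|_{L^\infty(\Omega)}\,\mathrm ds$, there is a constant vector $\rho_{\max}\in\mathbb R^n$ with $\rho_0\le\rho_{\max}$ a.e. in $\Omega$ and $$\rho_{\mathrm{in}}\exp\left(-\int_0^t\alpha(s)\,\mathrm ds\right)-F_++\mathcal G(F_+)+\mathcal G(\rho_{\max})\le\rho_{\max}\quad\text{for }\mathrm d\mu_u^-\text{-almost all }(t,\omega)\in\Gamma_T.$$ Weak solutions and traces. $\rho\in L^\infty((0,T)\times\Omega)^n$ is a weak solution of $\rho_t+(\mathbf U\rho)_x+\mathbf C\rho=f$ if $0=\int_0^T\int_\Omega\rho^T(\varphi_t+\mathbf U\varphi_x-\mathbf C\varphi)+f^T\varphi\,\mathrm dx\,\mathrm dt$ for all $\varphi\in C^{0,1}([0,T]\times\overline\Omega,\mathbb R^n)$ with $\varphi(0,\cdot)=\varphi(T,\cdot)=0$ and $\varphi=0$ on $\Gamma_T$. It is known (Boyer) that such $\rho$ lies in $C([0,T],L^p(\Omega)^n)$ for all $p\in[1,\infty)$ and has a unique trace $\gamma\rho\in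 L^\infty(\Gamma_T,|\mathrm d\mu_u|)$, characterized by $$0=\int_{t_0}^{t_1}\int_\Omega\rho^T(\varphi_t+\mathbf U\varphi_x-\mathbf C\varphi)+f^T\varphi\,\mathrm dx\,\mathrm dt-\int_{t_0}^{t_1}\int_\Gamma\gamma\rho^T(\nu\mathbf U)\varphi\,\mathrm d\omega\,\mathrm dt+\int_\Omega\rho(t_0)^T\varphi(t_0)\,\mathrm dx-\int_\Omega\rho(t_1)^T\varphi(t_1)\,\mathrm dx$$ for all $[t_0,t_1]\subset[0,T]$ and $\varphi\in C^{0,1}([0,T]\times\overline\Omega,\mathbb R^n)$. Solution of the initial-boundary-value problem: $\rho\in L^\infty((0,T)\times\Omega)^n$ that is a weak solution of the transport equation, satisfies $\rho(0)=\rho_0$, and whose trace satisfies $\gamma\rho=\mathcal H(\gamma\rho)$ $\mathrm d\mu_u^-$-almost everywhere on $\Gamma_T$. *)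

theory Defs
  imports "HOL-Analysis.Analysis" "HOL-Probability.Essential_Supremum"
begin

text \<open>
  The space dimension \<open>n\<close> of the state is \<open>CARD('n)\<close>. Elements of Lebesgue spaces are
  represented by Borel measurable functions; identities between them hold almost everywhere.
  Functions on \<open>[0,T] \<times> [0,1]\<close> and on the lateral boundary take the pair
  \<open>(t, x)\<close> as argument. Order, absolute value and \<^const>\<open>sup\<close> on \<^typ>\<open>real^'n\<close> are componentwise.
\<close>

section \<open>Domains and measures\<close>

definition Omega :: "real measure" where
  "Omega = restrict_space lborel {0<..<1}"

definition timeT :: "real \<Rightarrow> real measure" where
  "timeT T = restrict_space lborel {0..T}"

text \<open>The cylinder is open in time so that two-sided derivatives of functions on \<open>[0,T] \<times> [0,1]\<close>
  make sense at all of its points.\<close>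

definition QT :: "real \<Rightarrow> (real \<times> real) measure" where
  "QT T = restrict_space lborel {0<..<T} \<Otimes>\<^sub>M Omega"

definition GammaT :: "real \<Rightarrow> (real \<times> real) measure" where
  "GammaT T = timeT T \<Otimes>\<^sub>M count_space {0, 1}"

definition nu :: "real \<Rightarrow> real" where
  "nu \<omega> = (if \<omega> = 0 then - 1 else 1)"

definition vpos :: "real^'n \<Rightarrow> real^'n" where "vpos v = sup v 0"

definition vneg :: "real^'n \<Rightarrow> real^'n" where "vneg v = sup (- v) 0"

definition diag :: "real^'n \<Rightarrow> real^'n^'n" where
  "diag v = (\<chi> i j. if i = j then v $ i else 0)"

definition nuu :: "(real \<times> real \<Rightarrow> real^'n) \<Rightarrow> real \<times> real \<Rightarrow> real^'n" where
  "nuu u z = nu (snd z) *\<^sub>R u z"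

text \<open>The boundary measures form a family indexed by the components.\<close>

definition mu_pos :: "real \<Rightarrow> (real \<times> real \<Rightarrow> real^'n) \<Rightarrow> 'n \<Rightarrow> (real \<times> real) measure" where
  "mu_pos T u j = density (GammaT T) (\<lambda>z. ennreal (vpos (nuu u z) $ j))"

definition mu_neg :: "real \<Rightarrow> (real \<times> real \<Rightarrow> real^'n) \<Rightarrow> 'n \<Rightarrow> (real \<times> real) measure" where
  "mu_neg T u j = density (GammaT T) (\<lambda>z. ennreal (vneg (nuu u z) $ j))"

definition mu_abs :: "real \<Rightarrow> (real \<times> real \<Rightarrow> real^'n) \<Rightarrow> 'n \<Rightarrow> (real \<times> real) measure" where
  "mu_abs T u j = density (GammaT T) (\<lambda>z. ennreal ((vpos (nuu u z) + vneg (nuu u z)) $ j))"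

section \<open>Function spaces\<close>

definition Linf :: "('n \<Rightarrow> 'a measure) \<Rightarrow> ('a \<Rightarrow> real^'n) set" where
  "Linf \<mu> = {g. \<forall>j. (\<lambda>z. g z $ j) \<in> borel_measurable (\<mu> j) \<and> (\<exists>C. AE z in \<mu> j. \<bar>g z $ j\<bar> \<le> C)}"

definition ae_eq :: "('n \<Rightarrow> 'a measure) \<Rightarrow> ('a \<Rightarrow> real^'n) \<Rightarrow> ('a \<Rightarrow> real^'n) \<Rightarrow> bool" where
  "ae_eq \<mu> g h \<longleftrightarrow> (\<forall>j. AE z in \<mu> j. g z $ j = h z $ j)"

definition ae_nonneg :: "('n \<Rightarrow> 'a measure) \<Rightarrow> ('a \<Rightarrow> real^'n) \<Rightarrow> bool" where
  "ae_nonneg \<mu> g \<longleftrightarrow> (\<forall>j. AE z in \<mu> j. 0 \<le> g z $ j)"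

definition Linf_norm :: "'a measure \<Rightarrow> ('a \<Rightarrow> real) \<Rightarrow> real" where
  "Linf_norm M g = real_of_ereal (esssup M (\<lambda>x. ereal \<bar>g x\<bar>))"

definition Linf_norm_vec :: "'a measure \<Rightarrow> ('a \<Rightarrow> real^'n) \<Rightarrow> real" where
  "Linf_norm_vec M g = Max (range (\<lambda>j. Linf_norm M (\<lambda>x. g x $ j)))"

text \<open>\<open>L\<^sup>1((0,T), L\<^sup>\<infinity>(\<Omega>)\<^sup>n)\<close>, as jointly measurable functions whose spatial norm is integrable in
  time. Strong measurability of \<open>t \<mapsto> g(t, \<cdot>)\<close> into \<open>L\<^sup>\<infinity>(\<Omega>)\<close> is not demanded, so that the Bochner
  space is contained in this one.\<close>

definition L1_Linf :: "real \<Rightarrow> (real \<times> real \<Rightarrow> real^'n) \<Rightarrow> bool" where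
  "L1_Linf T g \<longleftrightarrow>
     g \<in> borel_measurable (QT T) \<and>
     (AE t in timeT T. (\<lambda>x. g (t, x)) \<in> Linf (\<lambda>_. Omega)) \<and>
     integrable (timeT T) (\<lambda>t. Linf_norm_vec Omega (\<lambda>x. g (t, x)))"

definition test_function :: "(real \<Rightarrow> real) \<Rightarrow> bool" where
  "test_function \<phi> \<longleftrightarrow>
     (\<forall>k. (deriv ^^ k) \<phi> differentiable_on UNIV) \<and>
     compact (closure {x. \<phi> x \<noteq> 0}) \<and> closure {x. \<phi> x \<noteq> 0} \<subseteq> {0<..<1}"

text \<open>\<open>g \<in> W\<^sup>1\<^sup>,\<^sup>1(\<Omega>)\<^sup>n\<close> with weak derivative \<open>g'\<close>, where \<open>g\<close> is the unique representative of its
  class that is continuous on the closed interval; its boundary values are the traces.\<close>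

definition W11 :: "(real \<Rightarrow> real^'n) \<Rightarrow> (real \<Rightarrow> real^'n) \<Rightarrow> bool" where
  "W11 g g' \<longleftrightarrow>
     integrable Omega g \<and> integrable Omega g' \<and> continuous_on {0..1} g \<and>
     (\<forall>\<phi>. test_function \<phi> \<longrightarrow>
        (\<integral>x. deriv \<phi> x *\<^sub>R g x \<partial>Omega) = - (\<integral>x. \<phi> x *\<^sub>R g' x \<partial>Omega))"

text \<open>The first conjunct, measurability of the boundary values, only excludes bad choices of
  \<open>u(t, \<cdot>)\<close> on a null set of times: for almost all \<open>t\<close> these values are limits of spatial means.\<close>

definition L1_W11 :: "real \<Rightarrow> (real \<times> real \<Rightarrow> real^'n) \<Rightarrow> (real \<times> real \<Rightarrow> real^'n) \<Rightarrow> bool" where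
  "L1_W11 T u u\<^sub>x \<longleftrightarrow>
     u \<in> borel_measurable (GammaT T) \<and>
     integrable (QT T) u \<and> integrable (QT T) u\<^sub>x \<and>
     (AE t in timeT T. W11 (\<lambda>x. u (t, x)) (\<lambda>x. u\<^sub>x (t, x)))"

definition weak_star_conv ::
  "('n::finite \<Rightarrow> 'a measure) \<Rightarrow> (nat \<Rightarrow> 'a \<Rightarrow> real^'n) \<Rightarrow> ('a \<Rightarrow> real^'n) \<Rightarrow> bool" where
  "weak_star_conv \<mu> gs g \<longleftrightarrow>
     (\<forall>\<psi>::'a \<Rightarrow> real^'n. (\<forall>j. integrable (\<mu> j) (\<lambda>z. \<psi> z $ j)) \<longrightarrow>
        (\<lambda>k. \<Sum>j\<in>UNIV. \<integral>z. gs k z $ j * \<psi> z $ j \<partial>\<mu> j)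
          \<longlonglongrightarrow> (\<Sum>j\<in>UNIV. \<integral>z. g z $ j * \<psi> z $ j \<partial>\<mu> j))"

definition C_Lp :: "real \<Rightarrow> real \<Rightarrow> (real \<times> real \<Rightarrow> real^'n) \<Rightarrow> bool" where
  "C_Lp T p \<rho> \<longleftrightarrow>
     (\<forall>t\<in>{0..T}. (\<lambda>x. \<rho> (t, x)) \<in> borel_measurable Omega \<and>
        integrable Omega (\<lambda>x. norm (\<rho> (t, x)) powr p) \<and>
        ((\<lambda>s. \<integral>x. norm (\<rho> (s, x) - \<rho> (t, x)) powr p \<partial>Omega) \<longlongrightarrow> 0) (at t within {0..T}))"

section \<open>Admissible data\<close>

definition pos_def_diagonal :: "real^'n^'n \<Rightarrow> bool" where
  "pos_def_diagonal W \<longleftrightarrow>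
     (\<forall>i j. i \<noteq> j \<longrightarrow> W $ i $ j = 0) \<and> (\<forall>v. v \<noteq> 0 \<longrightarrow> v \<bullet> (W *v v) > 0)"

definition norm_1w_pos ::
  "real \<Rightarrow> (real \<times> real \<Rightarrow> real^'n) \<Rightarrow> real^'n^'n \<Rightarrow> (real \<times> real \<Rightarrow> real^'n) \<Rightarrow> real" where
  "norm_1w_pos T u W g = (\<integral>z. \<bar>g z\<bar> \<bullet> (W *v vpos (nuu u z)) \<partial>GammaT T)"

definition norm_1w_neg ::
  "real \<Rightarrow> (real \<times> real \<Rightarrow> real^'n) \<Rightarrow> real^'n^'n \<Rightarrow> (real \<times> real \<Rightarrow> real^'n) \<Rightarrow> real" where
  "norm_1w_neg T u W g = (\<integral>z. \<bar>g z\<bar> \<bullet> (W *v vneg (nuu u z)) \<partial>GammaT T)"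

definition cut :: "real \<Rightarrow> (real \<times> real \<Rightarrow> real^'n) \<Rightarrow> real \<times> real \<Rightarrow> real^'n" where
  "cut t g z = indicator {0..t} (fst z) *\<^sub>R g z"

text \<open>The operator acts on representatives; the first two conjuncts say that it induces a map
  between the spaces of almost-everywhere classes.\<close>

definition admissible_operator ::
  "real \<Rightarrow> (real \<times> real \<Rightarrow> real^'n) \<Rightarrow>
   ((real \<times> real \<Rightarrow> real^'n) \<Rightarrow> real \<times> real \<Rightarrow> real^'n) \<Rightarrow> bool" where
  "admissible_operator T u G \<longleftrightarrow>
     (\<forall>g\<in>Linf (mu_pos T u). G g \<in> Linf (mu_neg T u)) \<and>
     (\<forall>g\<in>Linf (mu_pos T u). \<forall>h\<in>Linf (mu_pos T u).
        ae_eq (mu_pos T u) g h \<longrightarrow> ae_eq (mu_neg T u) (G g) (G h)) \<and>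
     (\<forall>g\<in>Linf (mu_pos T u). \<forall>h\<in>Linf (mu_pos T u). \<forall>a b.
        ae_eq (mu_neg T u) (G (\<lambda>z. a *\<^sub>R g z + b *\<^sub>R h z)) (\<lambda>z. a *\<^sub>R G g z + b *\<^sub>R G h z)) \<and>
     (\<forall>gs. \<forall>g\<in>Linf (mu_pos T u). (\<forall>k. gs k \<in> Linf (mu_pos T u)) \<and>
        weak_star_conv (mu_pos T u) gs g \<longrightarrow>
        weak_star_conv (mu_neg T u) (\<lambda>k. G (gs k)) (G g)) \<and>
     (\<exists>W. pos_def_diagonal W \<and>
        (\<forall>g\<in>Linf (mu_pos T u). norm_1w_neg T u W (G g) \<le> norm_1w_pos T u W g)) \<and>
     (\<forall>g\<in>Linf (mu_pos T u). AE t in timeT T.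
        ae_eq (mu_neg T u) (cut t (G (cut t g))) (cut t (G g))) \<and>
     (\<forall>g\<in>Linf (mu_pos T u). ae_nonneg (mu_pos T u) g \<longrightarrow> ae_nonneg (mu_neg T u) (G g))"

definition alpha :: "(real \<times> real \<Rightarrow> real^'n) \<Rightarrow> (real \<times> real \<Rightarrow> real^'n) \<Rightarrow> real \<Rightarrow> real" where
  "alpha u\<^sub>x c t = Linf_norm_vec Omega (\<lambda>x. vneg (u\<^sub>x (t, x) + c (t, x)))"

definition int_alpha :: "(real \<times> real \<Rightarrow> real^'n) \<Rightarrow> (real \<times> real \<Rightarrow> real^'n) \<Rightarrow> real \<Rightarrow> real" where
  "int_alpha u\<^sub>x c t = (LINT s:{0..t}|lborel. alpha u\<^sub>x c s)"

definition F_plus ::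
  "(real \<times> real \<Rightarrow> real^'n) \<Rightarrow> (real \<times> real \<Rightarrow> real^'n) \<Rightarrow> (real \<times> real \<Rightarrow> real^'n) \<Rightarrow> real \<Rightarrow> real^'n" where
  "F_plus u\<^sub>x c f t =
     (\<chi> i. LINT s:{0..t}|lborel.
        exp (- int_alpha u\<^sub>x c s) * Linf_norm Omega (\<lambda>x. vpos (f (s, x)) $ i))"

definition is_rho_max ::
  "real \<Rightarrow> (real \<times> real \<Rightarrow> real^'n) \<Rightarrow> (real \<times> real \<Rightarrow> real^'n) \<Rightarrow> (real \<times> real \<Rightarrow> real^'n) \<Rightarrow>
   (real \<times> real \<Rightarrow> real^'n) \<Rightarrow> (real \<Rightarrow> real^'n) \<Rightarrow> (real \<times> real \<Rightarrow> real^'n) \<Rightarrow>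
   ((real \<times> real \<Rightarrow> real^'n) \<Rightarrow> real \<times> real \<Rightarrow> real^'n) \<Rightarrow> real^'n \<Rightarrow> bool" where
  "is_rho_max T u u\<^sub>x c f \<rho>\<^sub>0 \<rho>\<^sub>i\<^sub>n G \<rho>\<^sub>m\<^sub>a\<^sub>x \<longleftrightarrow>
     (AE x in Omega. \<rho>\<^sub>0 x \<le> \<rho>\<^sub>m\<^sub>a\<^sub>x) \<and>
     (\<forall>j. AE z in mu_neg T u j.
        \<rho>\<^sub>i\<^sub>n z $ j * exp (- int_alpha u\<^sub>x c (fst z)) - F_plus u\<^sub>x c f (fst z) $ j
          + G (\<lambda>y. F_plus u\<^sub>x c f (fst y)) z $ j + G (\<lambda>_. \<rho>\<^sub>m\<^sub>a\<^sub>x) z $ j \<le> \<rho>\<^sub>m\<^sub>a\<^sub>x $ j)"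

definition admissible ::
  "real \<Rightarrow> (real \<times> real \<Rightarrow> real^'n) \<Rightarrow> (real \<times> real \<Rightarrow> real^'n) \<Rightarrow> (real \<times> real \<Rightarrow> real^'n) \<Rightarrow>
   (real \<times> real \<Rightarrow> real^'n) \<Rightarrow> (real \<Rightarrow> real^'n) \<Rightarrow> (real \<times> real \<Rightarrow> real^'n) \<Rightarrow>
   ((real \<times> real \<Rightarrow> real^'n) \<Rightarrow> real \<times> real \<Rightarrow> real^'n) \<Rightarrow> bool" where
  "admissible T u u\<^sub>x c f \<rho>\<^sub>0 \<rho>\<^sub>i\<^sub>n G \<longleftrightarrow>
     L1_W11 T u u\<^sub>x \<and>
     integrable (QT T) c \<and>
     L1_Linf T (\<lambda>z. vneg (u\<^sub>x z + c z)) \<and>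
     L1_Linf T (\<lambda>z. vpos (u\<^sub>x z)) \<and>
     L1_Linf T f \<and> (AE z in QT T. 0 \<le> f z) \<and>
     \<rho>\<^sub>0 \<in> Linf (\<lambda>_. Omega) \<and> (AE x in Omega. 0 \<le> \<rho>\<^sub>0 x) \<and>
     \<rho>\<^sub>i\<^sub>n \<in> Linf (mu_neg T u) \<and> ae_nonneg (mu_neg T u) \<rho>\<^sub>i\<^sub>n \<and>
     admissible_operator T u G \<and>
     (\<exists>\<rho>\<^sub>m\<^sub>a\<^sub>x. is_rho_max T u u\<^sub>x c f \<rho>\<^sub>0 \<rho>\<^sub>i\<^sub>n G \<rho>\<^sub>m\<^sub>a\<^sub>x)"

section \<open>Weak solutions and traces\<close>

definition C01 :: "real \<Rightarrow> (real \<times> real \<Rightarrow> real^'n) \<Rightarrow> bool" where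
  "C01 T \<phi> \<longleftrightarrow> (\<exists>L. L-lipschitz_on ({0..T} \<times> {0..1}) \<phi>)"

text \<open>Partial derivatives of Lipschitz functions exist almost everywhere; elsewhere
  \<^const>\<open>vector_derivative\<close> returns a fixed value.\<close>

definition d_t :: "(real \<times> real \<Rightarrow> real^'n) \<Rightarrow> real \<times> real \<Rightarrow> real^'n" where
  "d_t \<phi> z = vector_derivative (\<lambda>s. \<phi> (s, snd z)) (at (fst z))"

definition d_x :: "(real \<times> real \<Rightarrow> real^'n) \<Rightarrow> real \<times> real \<Rightarrow> real^'n" where
  "d_x \<phi> z = vector_derivative (\<lambda>y. \<phi> (fst z, y)) (at (snd z))"

definition weak_integrand ::
  "(real \<times> real \<Rightarrow> real^'n) \<Rightarrow> (real \<times> real \<Rightarrow> real^'n) \<Rightarrow> (real \<times> real \<Rightarrow> real^'n) \<Rightarrow>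
   (real \<times> real \<Rightarrow> real^'n) \<Rightarrow> (real \<times> real \<Rightarrow> real^'n) \<Rightarrow> real \<times> real \<Rightarrow> real" where
  "weak_integrand u c f \<rho> \<phi> z =
     \<rho> z \<bullet> (d_t \<phi> z + diag (u z) *v d_x \<phi> z - diag (c z) *v \<phi> z) + f z \<bullet> \<phi> z"

definition weak_solution ::
  "real \<Rightarrow> (real \<times> real \<Rightarrow> real^'n) \<Rightarrow> (real \<times> real \<Rightarrow> real^'n) \<Rightarrow> (real \<times> real \<Rightarrow> real^'n) \<Rightarrow>
   (real \<times> real \<Rightarrow> real^'n) \<Rightarrow> bool" where
  "weak_solution T u c f \<rho> \<longleftrightarrow>
     \<rho> \<in> Linf (\<lambda>_. QT T) \<and>
     (\<forall>\<phi>. C01 T \<phi> \<and> (\<forall>x\<in>{0..1}. \<phi> (0, x) = 0 \<and> \<phi> (T, x) = 0) \<and>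
        (\<forall>t\<in>{0..T}. \<phi> (t, 0) = 0 \<and> \<phi> (t, 1) = 0) \<longrightarrow>
        0 = (\<integral>z. weak_integrand u c f \<rho> \<phi> z \<partial>QT T))"

definition is_trace ::
  "real \<Rightarrow> (real \<times> real \<Rightarrow> real^'n) \<Rightarrow> (real \<times> real \<Rightarrow> real^'n) \<Rightarrow> (real \<times> real \<Rightarrow> real^'n) \<Rightarrow>
   (real \<times> real \<Rightarrow> real^'n) \<Rightarrow> (real \<times> real \<Rightarrow> real^'n) \<Rightarrow> bool" where
  "is_trace T u c f \<rho> \<gamma> \<longleftrightarrow>
     \<gamma> \<in> Linf (mu_abs T u) \<and>
     (\<forall>t\<^sub>0 t\<^sub>1 \<phi>. 0 \<le> t\<^sub>0 \<and> t\<^sub>0 \<le> t\<^sub>1 \<and> t\<^sub>1 \<le> T \<and> C01 T \<phi> \<longrightarrow>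
        0 = (LINT z:{t\<^sub>0..t\<^sub>1} \<times> {0<..<1}|QT T. weak_integrand u c f \<rho> \<phi> z)
          - (LINT z:{t\<^sub>0..t\<^sub>1} \<times> {0, 1}|GammaT T. \<gamma> z \<bullet> (diag (nuu u z) *v \<phi> z))
          + (\<integral>x. \<rho> (t\<^sub>0, x) \<bullet> \<phi> (t\<^sub>0, x) \<partial>Omega)
          - (\<integral>x. \<rho> (t\<^sub>1, x) \<bullet> \<phi> (t\<^sub>1, x) \<partial>Omega))"

definition H_op ::
  "(real \<times> real \<Rightarrow> real^'n) \<Rightarrow> ((real \<times> real \<Rightarrow> real^'n) \<Rightarrow> real \<times> real \<Rightarrow> real^'n) \<Rightarrow>
   (real \<times> real \<Rightarrow> real^'n) \<Rightarrow> real \<times> real \<Rightarrow> real^'n" where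
  "H_op \<rho>\<^sub>i\<^sub>n G g z = \<rho>\<^sub>i\<^sub>n z + G g z"

text \<open>\<open>\<rho>\<close> is the representative of the solution for which \<open>\<rho>(t, \<cdot>)\<close> is meaningful for every \<open>t\<close>:
  the one continuous in time with values in \<open>L\<^sup>p(\<Omega>)\<^sup>n\<close>. It exists, and has a unique trace \<open>\<gamma>\<close>,
  for every bounded weak solution (Boyer).\<close>

definition ibvp_solution ::
  "real \<Rightarrow> (real \<times> real \<Rightarrow> real^'n) \<Rightarrow> (real \<times> real \<Rightarrow> real^'n) \<Rightarrow> (real \<times> real \<Rightarrow> real^'n) \<Rightarrow>
   (real \<Rightarrow> real^'n) \<Rightarrow> (real \<times> real \<Rightarrow> real^'n) \<Rightarrow>
   ((real \<times> real \<Rightarrow> real^'n) \<Rightarrow> real \<times> real \<Rightarrow> real^'n) \<Rightarrow>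
   (real \<times> real \<Rightarrow> real^'n) \<Rightarrow> (real \<times> real \<Rightarrow> real^'n) \<Rightarrow> bool" where
  "ibvp_solution T u c f \<rho>\<^sub>0 \<rho>\<^sub>i\<^sub>n G \<rho> \<gamma> \<longleftrightarrow>
     weak_solution T u c f \<rho> \<and>
     (\<forall>p\<ge>1. C_Lp T p \<rho>) \<and>
     is_trace T u c f \<rho> \<gamma> \<and>
     (AE x in Omega. \<rho> (0, x) = \<rho>\<^sub>0 x) \<and>
     ae_eq (mu_neg T u) \<gamma> (H_op \<rho>\<^sub>i\<^sub>n G \<gamma>)"

end

(*
  Each component of the solution satisfies a scalar balance law whose velocity is only Sobolev in space.
  Averaging it in space with a one-sided kernel makes it absolutely continuous in time up to a commutator
  that vanishes in the mean, so smooth functions of the solution, and in the limit its positive part,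
  satisfy the balance law with the composed boundary traces. This is applied to the excess of the solution
  over the claimed bound (and to its negative), multiplied by an integrating factor that gives its source
  the right sign. Since the boundary operator is positive and causal, the positive part of the boundary
  excess is dominated by its own image, and the contraction of the weighted norms makes the total excess
  nonpositive.
*)
theory Submission
 imports Defs "HOL-Real_Asymp.Real_Asymp"
begin

text \<open>The obstacle is the trace. The balance law knows it only through linear fluxes, while a
  nonlinear function of the solution needs strong convergence of the mollified boundary values.
  These are Cauchy: in the energy identity for the difference of two mollifications, with the square
  as nonlinearity, every other term tends to 0. Their weak limit is the given trace, found by
  testing with a cutoff whose derivative is minus the kernel. Both facts come with the signed
  boundary velocity as weight and on initial time intervals only; they extend to all Borel sets of
  times, where the two signs can be separated. The kernel looks to the right, so averages exist up
  to the left end; the weight 1 - x suppresses the right end, which reflection recovers. The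
  integrating factor compensates c, which is bounded below only by minus the norms of (u_x + c)^-
  and (u_x)^+. It depends on time and so does not commute with the boundary operator; causality and
  positivity give one inequality because it decreases. For the upper bound an inequality of this
  kind is applied to the trace itself, which must therefore be known to be nonnegative
  beforehand.\<close>

lemmas L_integrable_bound = Bochner_Integration.integrable_bound
lemmas L_integral_cong = Bochner_Integration.integral_cong
lemmas L_integrable_diff = Bochner_Integration.integrable_diff
lemmas L_integrable_add = Bochner_Integration.integrable_add
lemmas L_integral_add = Bochner_Integration.integral_add
lemmas L_integrable_cong = Bochner_Integration.integrable_cong
lemmas L_integral_diff = Bochner_Integration.integral_diff
lemmas L_integral_nonneg = Bochner_Integration.integral_nonneg
lemmas L_integral_sum = Bochner_Integration.integral_sum

section \<open>Calculus of absolutely continuous functions in integral form\<close>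

text \<open>Bisecting where \<open>Q\<close>, not its argument, takes the mean value halves the
  bound at every level: the two pieces together contribute \<open>2 * (1/2)^2 = 1/2\<close> of the
  previous bound. Continuity of \<open>Q\<close> provides the point, so no modulus of continuity
  enters.\<close>

lemma quadratic_increments_imp_eq:
 fixes \<Psi> Q :: "real => real"
 assumes "a <= b" "continuous_on {a..b} Q" "0 <= L"
 and mono: "!!s t. a <= s ==> s <= t ==> t <= b ==> Q s <= Q t"
 and incr: "!!s t. a <= s ==> s <= t ==> t <= b ==> \<bar>\<Psi> t - \<Psi> s\<bar> <= L * (Q t - Q s)^2"
 shows "\<Psi> b = \<Psi> a"
proof -
 have bisect: "\<bar>\<Psi> t - \<Psi> s\<bar> <= L * (Q t - Q s)^2 / 2^n" if "a <= s" "s <= t" "t <= b" for n s t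
 using that
 proof (induction n arbitrary: s t)
 case (Suc n)
 have "continuous_on {s..t} Q"
 using Suc.prems assms(2) by (auto intro: continuous_on_subset)
 moreover have "Q s <= Q t" using mono Suc.prems by auto
 ultimately obtain m where m: "s <= m" "m <= t" "Q m = (Q s + Q t) / 2"
 using IVT'[of Q s "(Q s + Q t) / 2" t] Suc.prems(2) by fastforce
 have "\<bar>\<Psi> m - \<Psi> s\<bar> <= L * ((Q t - Q s)/2)^2 / 2^n" "\<bar>\<Psi> t - \<Psi> m\<bar> <= L * ((Q t - Q s)/2)^2 / 2^n"
 using Suc.IH[of s m] Suc.IH[of m t] m Suc.prems by (auto simp: field_simps)
 then have "\<bar>\<Psi> t - \<Psi> s\<bar> <= 2 * (L * ((Q t - Q s)/2)^2 / 2^n)" by linarith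
 then show ?case by (simp add: power2_eq_square field_simps)
 qed (use incr in simp)
 have "(%n. L * (Q b - Q a)^2 / 2^n) \<longlonglongrightarrow> 0" by real_asymp
 then have "\<bar>\<Psi> b - \<Psi> a\<bar> <= 0"
 using bisect[of a b] \<open>a <= b\<close> by (intro tendsto_lowerbound[where F=sequentially]) auto
 then show ?thesis by simp
qed

text \<open>Absolute continuity on \<open>[0,b]\<close> with prescribed almost-everywhere derivative.\<close>

definition ac_on :: "real => (real => real) => (real => real) => bool" where
 "ac_on b V q \<longleftrightarrow> set_integrable lborel {0..b} q \<and>
 (\<forall>t\<in>{0..b}. V t - V 0 = (LBINT s:{0..t}. q s))"

lemma set_integral_increment:
 fixes q :: "real => real"
 assumes "set_integrable lborel {0..b} q" "0 <= s" "s <= t" "t <= b"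
 shows "(LBINT r:{0..t}. q r) - (LBINT r:{0..s}. q r) = (LBINT r:{s<..t}. q r)"
proof -
 have *: "{0..t} = {0..s} \<union> {s<..t}" "{0..s} \<inter> {s<..t} = {}" using assms by auto
 have "set_integrable lborel {0..s} q" "set_integrable lborel {s<..t} q"
 using assms by (auto intro!: set_integrable_subset[OF assms(1)])
 from set_integral_Un[OF *(2) this] show ?thesis by (simp add: *(1))
qed

lemma continuous_on_set_integral:
 fixes q :: "real => real"
 assumes "set_integrable lborel {0..b} q"
 shows "continuous_on {0..b} (%t. LBINT s:{0..t}. q s)"
proof -
 have "q integrable_on {0..b}"
 using assms by (rule set_borel_integral_eq_integral)
 then have "continuous_on {0..b} (%t. integral {0..t} q)"
 by (rule indefinite_integral_continuous_1)
 moreover have "integral {0..t} q = (LBINT s:{0..t}. q s)" if "t \<in> {0..b}" for t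
 using set_integrable_subset[OF assms, of "{0..t}"] that
 by (intro set_borel_integral_eq_integral(2)[symmetric]) auto
 ultimately show ?thesis by (rule continuous_on_eq)
qed

lemma ac_on_integral: "set_integrable lborel {0..b} q ==> ac_on b (%t. LBINT s:{0..t}. q s) q"
 by (simp add: ac_on_def set_integral_at_point)

lemma ac_on_cong:
 assumes "ac_on b V q" "!!t. 0 <= t ==> t <= b ==> V t = V' t" "!!t. 0 <= t ==> t <= b ==> q t = q' t"
 shows "ac_on b V' q'"
proof -
 have "set_integrable lborel {0..b} q'"
 using assms(1) assms(3) set_integrable_cong[of lborel lborel "{0..b}" "{0..b}" q q'] by (simp add: ac_on_def)
 moreover have "(LBINT s:{0..t}. q s) = (LBINT s:{0..t}. q' s)" if "t <= b" for t
 using assms(3) that by (intro set_lebesgue_integral_cong) auto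
 ultimately show ?thesis using assms unfolding ac_on_def by auto
qed

lemma ac_on_subinterval: "ac_on b V q ==> 0 <= b' ==> b' <= b ==> ac_on b' V q"
 using set_integrable_subset[of lborel "{0..b}" q "{0..b'}"] by (simp add: ac_on_def)

lemma ac_on_continuous:
 assumes "ac_on b V q" shows "continuous_on {0..b} V"
proof -
 have "continuous_on {0..b} (%t. V 0 + (LBINT s:{0..t}. q s))"
 using assms by (intro continuous_intros continuous_on_set_integral) (simp add: ac_on_def)
 then show ?thesis
 proof (rule continuous_on_eq)
 fix t assume "t \<in> {0..b}"
 then have "V t - V 0 = (LBINT s:{0..t}. q s)" using assms unfolding ac_on_def by blast
 then show "V 0 + (LBINT s:{0..t}. q s) = V t" by linarith
 qed
qed

lemma ac_on_increment:
 assumes "ac_on b V q" "0 <= s" "s <= t" "t <= b"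
 shows "V t - V s = (LBINT r:{s<..t}. q r)"
proof -
 have "V t - V 0 = (LBINT r:{0..t}. q r)" "V s - V 0 = (LBINT r:{0..s}. q r)"
 using assms by (auto simp: ac_on_def)
 moreover have "(LBINT r:{0..t}. q r) - (LBINT r:{0..s}. q r) = (LBINT r:{s<..t}. q r)"
 using assms set_integral_increment[of b q s t] by (simp add: ac_on_def)
 ultimately show ?thesis by linarith
qed

text \<open>The running integral of the modulus of the derivative is the monotone \<open>Q\<close>
  that both calculus rules below feed into the bisection argument.\<close>

lemma ac_on_increment_le:
 assumes "ac_on b V q" "0 <= s" "s <= t" "t <= b"
 shows "\<bar>V t - V s\<bar> <= (LBINT r:{0..t}. \<bar>q r\<bar>) - (LBINT r:{0..s}. \<bar>q r\<bar>)"
proof -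
 have q: "set_integrable lborel {0..b} q" using assms by (simp add: ac_on_def)
 have "V t - V s = (LBINT r:{s<..t}. q r)"
 by (rule ac_on_increment[OF assms])
 also have "\<bar>\<dots>\<bar> <= (LBINT r:{s<..t}. \<bar>q r\<bar>)"
 unfolding set_lebesgue_integral_def
 by (rule order_trans[OF integral_abs_bound]) (simp add: abs_mult)
 finally show ?thesis
 using set_integral_increment[OF set_integrable_abs[OF q], of s t] assms by simp
qed

lemma set_integrable_mult_bounded:
 fixes f g :: "real => real"
 assumes "set_integrable lborel A f" "g \<in> borel_measurable borel" "!!x. x \<in> A ==> \<bar>g x\<bar> <= B"
 shows "set_integrable lborel A (%x. g x * f x)"
 unfolding set_integrable_def
proof (rule L_integrable_bound)
 show "integrable lborel (%x. B * (indicat_real A x *\<^sub>R f x))"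
 using assms(1) by (simp add: set_integrable_def)
 show "AE x in lborel. norm (indicat_real A x *\<^sub>R (g x * f x)) <= norm (B * (indicat_real A x *\<^sub>R f x))"
 using assms(3) by (auto simp: indicator_def abs_mult intro!: AE_I2 mult_right_mono) (meson abs_ge_self order_trans)
 have "(%x. g x * (indicat_real A x *\<^sub>R f x)) \<in> borel_measurable lborel"
 using assms(1,2) by (intro borel_measurable_times) (auto simp: set_integrable_def)
 then show "(%x. indicat_real A x *\<^sub>R (g x * f x)) \<in> borel_measurable lborel"
 by (simp add: mult.left_commute)
qed

lemma set_integrable_mult_continuous:
 fixes f g :: "real => real"
 assumes "set_integrable lborel {a..b} f" "continuous_on {a..b} g"
 shows "set_integrable lborel {a..b} (%x. g x * f x)"
proof -
 have "bounded (g ` {a..b})"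
 using assms(2) by (intro compact_imp_bounded compact_continuous_image) auto
 then obtain B where B: "!!x. x \<in> {a..b} ==> \<bar>g x\<bar> <= B" unfolding bounded_iff by fastforce
 have "set_integrable lborel {a..b} (%x. (indicat_real {a..b} x *\<^sub>R g x) * f x)"
 using B borel_measurable_continuous_on_indicator[OF _ assms(2)]
 by (intro set_integrable_mult_bounded[OF assms(1), where B=B]) auto
 then show ?thesis by (rule set_integrable_cong[THEN iffD1, rotated 3]) auto
qed

text \<open>Both calculus rules hold because the defect has quadratic increments.\<close>

lemma ac_on_quadratic_defect:
 assumes p: "set_integrable lborel {0..b} p" and Q: "continuous_on {0..b} Q"
 and mono: "!!s t. 0 <= s ==> s <= t ==> t <= b ==> Q s <= Q t" and "0 <= L"
 and defect: "!!s t. 0 <= s ==> s <= t ==> t <= b ==>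
 \<bar>W t - W s - (LBINT r:{s<..t}. p r)\<bar> <= L * (Q t - Q s)^2"
 shows "ac_on b W p"
proof -
 have "W t - (LBINT r:{0..t}. p r) = W 0 - (LBINT r:{0..0}. p r)" if t: "0 <= t" "t <= b" for t
 proof (rule quadratic_increments_imp_eq[where L=L and Q=Q and \<Psi>="%t. W t - (LBINT r:{0..t}. p r)"])
 show "continuous_on {0..t} Q" using Q t by (auto intro: continuous_on_subset)
 fix r s assume rs: "0 <= r" "r <= s" "s <= t"
 then show "\<bar>W s - (LBINT r:{0..s}. p r) - (W r - (LBINT r:{0..r}. p r))\<bar> <= L * (Q s - Q r)^2"
 using defect[of r s] set_integral_increment[OF p, of r s] t by (simp add: algebra_simps)
 qed (use t mono \<open>0 <= L\<close> in auto)
 then have "W t - W 0 = (LBINT r:{0..t}. p r)" if "0 <= t" "t <= b" for t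
 using that by (simp add: set_integral_at_point) (smt (verit))
 then show ?thesis using p by (simp add: ac_on_def)
qed

lemma set_integral_abs_le:
 fixes f g :: "real => real"
 assumes "set_integrable lborel A f" "set_integrable lborel A g" "!!x. x \<in> A ==> \<bar>f x\<bar> <= g x"
 shows "\<bar>LBINT x:A. f x\<bar> <= (LBINT x:A. g x)"
proof -
 have "\<bar>LBINT x:A. f x\<bar> <= (LBINT x:A. \<bar>f x\<bar>)"
 unfolding set_lebesgue_integral_def by (rule order_trans[OF integral_abs_bound]) (simp add: abs_mult)
 also have "\<dots> <= (LBINT x:A. g x)"
 using assms by (intro set_integral_mono set_integrable_abs) auto
 finally show ?thesis .
qed

text \<open>Freezing \<open>\<beta>'\<close> at the left end of an increment costs at most
  \<open>L\<close> times the squared variation, and so does the Taylor remainder; hence the constant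
  \<open>2 * L\<close> in the proof. The Lipschitz bound is asked only on the range of
  \<open>V\<close>, so that exponentials qualify.\<close>

lemma ac_on_compose:
 assumes V: "ac_on b V q" and L: "0 <= L"
 and der: "!!x. (\<beta> has_real_derivative \<beta>' x) (at x)"
 and lip: "!!x y. \<bar>x\<bar> <= R ==> \<bar>y\<bar> <= R ==> \<bar>\<beta>' y - \<beta>' x\<bar> <= L * \<bar>y - x\<bar>"
 and bnd: "!!t. 0 <= t ==> t <= b ==> \<bar>V t\<bar> <= R"
 shows "ac_on b (%t. \<beta> (V t)) (%t. \<beta>' (V t) * q t)"
proof -
 have q: "set_integrable lborel {0..b} q" using V by (simp add: ac_on_def)
 have cV: "continuous_on {0..b} V" by (rule ac_on_continuous[OF V])
 have "L-lipschitz_on {-R..R} \<beta>'"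
 using lip L by (intro lipschitz_onI) (auto simp: dist_real_def abs_minus_commute)
 then have cont: "continuous_on {-R..R} \<beta>'" by (rule lipschitz_on_continuous_on)
 have cb: "continuous_on {0..b} (%t. \<beta>' (V t))"
 using bnd by (intro continuous_on_compose2[OF cont cV]) (auto simp: abs_le_iff, (meson minus_le_iff)?)
 have bq: "set_integrable lborel {0..b} (%t. \<beta>' (V t) * q t)"
 by (rule set_integrable_mult_continuous[OF q cb])
 \<comment> \<open>By the mean value theorem alone, which gives the factor \<open>L\<close> instead
   of the sharp \<open>L / 2\<close>.\<close>
 have taylor: "\<bar>\<beta> y - \<beta> x - \<beta>' x * (y - x)\<bar> <= L * \<bar>y - x\<bar>^2" if "\<bar>x\<bar> <= R" "\<bar>y\<bar> <= R" for x y
 proof -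
 obtain z where z: "\<beta> y - \<beta> x = (y - x) * \<beta>' z" "\<bar>z - x\<bar> <= \<bar>y - x\<bar>" "\<bar>z\<bar> <= R"
 proof (cases x y rule: linorder_cases)
 case less
 then obtain z where "x < z" "z < y" "\<beta> y - \<beta> x = (y - x) * \<beta>' z"
 using MVT2[OF less, of \<beta> \<beta>'] der by auto
 then show ?thesis using \<open>\<bar>x\<bar> <= R\<close> \<open>\<bar>y\<bar> <= R\<close> by (intro that[of z]) auto
 next
 case greater
 then obtain z where "y < z" "z < x" "\<beta> x - \<beta> y = (x - y) * \<beta>' z"
 using MVT2[OF greater, of \<beta> \<beta>'] der by auto
 then show ?thesis using \<open>\<bar>x\<bar> <= R\<close> \<open>\<bar>y\<bar> <= R\<close> by (intro that[of z]) (auto simp: algebra_simps)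
 next
 case equal
 then show ?thesis using \<open>\<bar>x\<bar> <= R\<close> by (intro that[of x]) auto
 qed
 have "\<beta> y - \<beta> x - \<beta>' x * (y - x) = (\<beta>' z - \<beta>' x) * (y - x)" using z(1) by (simp add: algebra_simps)
 moreover have "\<bar>\<beta>' z - \<beta>' x\<bar> <= L * \<bar>y - x\<bar>"
 using lip[of x z] z that mult_left_mono[OF z(2) L] by linarith
 ultimately show ?thesis
 using mult_right_mono[of "\<bar>\<beta>' z - \<beta>' x\<bar>" "L * \<bar>y - x\<bar>" "\<bar>y - x\<bar>"]
 by (simp only: abs_mult power2_eq_square mult.assoc[symmetric] abs_ge_zero)
 qed
 define Q where "Q t = (LBINT r:{0..t}. \<bar>q r\<bar>)" for t
 have Vincr: "\<bar>V t - V s\<bar> <= Q t - Q s" if "0 <= s" "s <= t" "t <= b" for s t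
 unfolding Q_def by (rule ac_on_increment_le[OF V that])
 have Q_mono: "Q s <= Q t" if "0 <= s" "s <= t" "t <= b" for s t using Vincr[OF that] by linarith
 show ?thesis
 proof (rule ac_on_quadratic_defect[OF bq, where Q=Q and L="2*L"])
 show "continuous_on {0..b} Q" unfolding Q_def by (intro continuous_on_set_integral set_integrable_abs q)
 next
 fix r s assume rs: "0 <= r" "r <= s" "s <= b"
 have qi: "set_integrable lborel {r<..s} q" and bqi: "set_integrable lborel {r<..s} (%t. \<beta>' (V t) * q t)"
 using rs by (auto intro: set_integrable_subset[OF q] set_integrable_subset[OF bq])
 have "\<beta>' (V r) * (V s - V r) = (LBINT x:{r<..s}. \<beta>' (V r) * q x)"
 by (simp add: ac_on_increment[OF V rs])
 then have "\<beta>' (V r) * (V s - V r) - (LBINT x:{r<..s}. \<beta>' (V x) * q x)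
 = (LBINT x:{r<..s}. \<beta>' (V r) * q x - \<beta>' (V x) * q x)"
 using qi bqi by (simp add: set_integral_diff)
 also have "\<bar>\<dots>\<bar> <= (LBINT x:{r<..s}. L * (Q s - Q r) * \<bar>q x\<bar>)"
 proof (rule set_integral_abs_le)
 fix x assume x: "x \<in> {r<..s}"
 have "\<bar>\<beta>' (V r) - \<beta>' (V x)\<bar> <= L * \<bar>V r - V x\<bar>" using x rs by (intro lip bnd) auto
 also have "\<dots> <= L * (Q s - Q r)"
 using Vincr[of r x] Q_mono[of x s] x rs L by (intro mult_left_mono) auto
 finally show "\<bar>\<beta>' (V r) * q x - \<beta>' (V x) * q x\<bar> <= L * (Q s - Q r) * \<bar>q x\<bar>"
 by (simp add: left_diff_distrib[symmetric] abs_mult mult_right_mono)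
 qed (use qi bqi in \<open>auto intro!: set_integral_diff set_integrable_abs\<close>)
 also have "\<dots> = L * (Q s - Q r)^2"
 using set_integral_increment[OF set_integrable_abs[OF q] rs] by (simp add: Q_def power2_eq_square)
 finally have 1: "\<bar>\<beta>' (V r) * (V s - V r) - (LBINT x:{r<..s}. \<beta>' (V x) * q x)\<bar> <= L * (Q s - Q r)^2" .
 have "\<bar>\<beta> (V s) - \<beta> (V r) - \<beta>' (V r) * (V s - V r)\<bar> <= L * \<bar>V s - V r\<bar>^2"
 using rs by (intro taylor bnd) auto
 also have "\<dots> <= L * (Q s - Q r)^2"
 using Vincr[OF rs] L by (intro mult_left_mono power_mono) auto
 finally show "\<bar>\<beta> (V s) - \<beta> (V r) - (LBINT x:{r<..s}. \<beta>' (V x) * q x)\<bar> <= 2 * L * (Q s - Q r)^2"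
 using 1 by linarith
 qed (use Q_mono L in auto)
qed

text \<open>The defect splits into the product of the two increments and the two errors of freezing
  one factor. Each is at most the product of the two variations, whence the constant 3; the sum of
  the variations is a common \<open>Q\<close>.\<close>

lemma ac_on_mult:
 assumes V: "ac_on b V p" and W: "ac_on b W q"
 shows "ac_on b (%t. V t * W t) (%t. W t * p t + V t * q t)"
proof -
 have p: "set_integrable lborel {0..b} p" and q: "set_integrable lborel {0..b} q"
 using V W by (auto simp: ac_on_def)
 have Wp: "set_integrable lborel {0..b} (%t. W t * p t)" and Vq: "set_integrable lborel {0..b} (%t. V t * q t)"
 by (auto intro!: set_integrable_mult_continuous p q ac_on_continuous[OF V] ac_on_continuous[OF W])
 define P where "P t = (LBINT r:{0..t}. \<bar>p r\<bar>)" for t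
 define Q where "Q t = (LBINT r:{0..t}. \<bar>q r\<bar>)" for t
 have Vincr: "\<bar>V t - V s\<bar> <= P t - P s" if "0 <= s" "s <= t" "t <= b" for s t
 unfolding P_def by (rule ac_on_increment_le[OF V that])
 have Wincr: "\<bar>W t - W s\<bar> <= Q t - Q s" if "0 <= s" "s <= t" "t <= b" for s t
 unfolding Q_def by (rule ac_on_increment_le[OF W that])
 have mono: "P s <= P t" "Q s <= Q t" if "0 <= s" "s <= t" "t <= b" for s t
 using Vincr[OF that] Wincr[OF that] by linarith+
 show ?thesis
 proof (rule ac_on_quadratic_defect[where Q="%t. P t + Q t" and L=3])
 show "set_integrable lborel {0..b} (%t. W t * p t + V t * q t)" using Wp Vq by (rule set_integral_add)
 show "continuous_on {0..b} (%t. P t + Q t)" unfolding P_def Q_def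
 by (intro continuous_intros continuous_on_set_integral set_integrable_abs p q)
 next
 fix r s assume rs: "0 <= r" "r <= s" "s <= b"
 have i: "set_integrable lborel {r<..s} p" "set_integrable lborel {r<..s} q"
 "set_integrable lborel {r<..s} (%t. W t * p t)" "set_integrable lborel {r<..s} (%t. V t * q t)"
 using rs by (auto intro: set_integrable_subset[OF p] set_integrable_subset[OF q]
 set_integrable_subset[OF Wp] set_integrable_subset[OF Vq])
 have Pe: "P s - P r = (LBINT x:{r<..s}. \<bar>p x\<bar>)" "Q s - Q r = (LBINT x:{r<..s}. \<bar>q x\<bar>)"
 unfolding P_def Q_def
 using set_integral_increment[OF set_integrable_abs[OF p] rs] set_integral_increment[OF set_integrable_abs[OF q] rs] by auto
 have 1: "V s - V r = (LBINT x:{r<..s}. p x)" "W s - W r = (LBINT x:{r<..s}. q x)"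
 by (rule ac_on_increment[OF V rs], rule ac_on_increment[OF W rs])
 have a: "\<bar>W r * (V s - V r) - (LBINT x:{r<..s}. W x * p x)\<bar> <= (Q s - Q r) * (P s - P r)"
 proof -
 have "W r * (V s - V r) - (LBINT x:{r<..s}. W x * p x) = (LBINT x:{r<..s}. W r * p x - W x * p x)"
 using i 1 by (simp add: set_integral_diff)
 also have "\<bar>\<dots>\<bar> <= (LBINT x:{r<..s}. (Q s - Q r) * \<bar>p x\<bar>)"
 proof (rule set_integral_abs_le)
 fix x assume x: "x \<in> {r<..s}"
 have "\<bar>W r - W x\<bar> <= Q s - Q r" using Wincr[of r x] mono(2)[of x s] x rs by auto
 then show "\<bar>W r * p x - W x * p x\<bar> <= (Q s - Q r) * \<bar>p x\<bar>"
 by (simp add: left_diff_distrib[symmetric] abs_mult mult_right_mono)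
 qed (use i in \<open>auto intro!: set_integral_diff set_integrable_abs\<close>)
 finally show ?thesis by (simp add: Pe)
 qed
 have b: "\<bar>V r * (W s - W r) - (LBINT x:{r<..s}. V x * q x)\<bar> <= (P s - P r) * (Q s - Q r)"
 proof -
 have "V r * (W s - W r) - (LBINT x:{r<..s}. V x * q x) = (LBINT x:{r<..s}. V r * q x - V x * q x)"
 using i 1 by (simp add: set_integral_diff)
 also have "\<bar>\<dots>\<bar> <= (LBINT x:{r<..s}. (P s - P r) * \<bar>q x\<bar>)"
 proof (rule set_integral_abs_le)
 fix x assume x: "x \<in> {r<..s}"
 have "\<bar>V r - V x\<bar> <= P s - P r" using Vincr[of r x] mono(1)[of x s] x rs by auto
 then show "\<bar>V r * q x - V x * q x\<bar> <= (P s - P r) * \<bar>q x\<bar>"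
 by (simp add: left_diff_distrib[symmetric] abs_mult mult_right_mono)
 qed (use i in \<open>auto intro!: set_integral_diff set_integrable_abs\<close>)
 finally show ?thesis by (simp add: Pe)
 qed
 have c: "\<bar>(V s - V r) * (W s - W r)\<bar> <= (P s - P r) * (Q s - Q r)"
 unfolding abs_mult using Vincr[OF rs] Wincr[OF rs] mono[OF rs] by (intro mult_mono) auto
 have "(LBINT x:{r<..s}. W x * p x + V x * q x)
 = (LBINT x:{r<..s}. W x * p x) + (LBINT x:{r<..s}. V x * q x)"
 by (rule set_integral_add(2)[OF i(3,4)])
 then have "V s * W s - V r * W r - (LBINT x:{r<..s}. W x * p x + V x * q x)
 = (V s - V r) * (W s - W r) + (W r * (V s - V r) - (LBINT x:{r<..s}. W x * p x))
 + (V r * (W s - W r) - (LBINT x:{r<..s}. V x * q x))"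
 by (simp add: algebra_simps)
 then have "\<bar>V s * W s - V r * W r - (LBINT x:{r<..s}. W x * p x + V x * q x)\<bar>
 <= 3 * ((P s - P r) * (Q s - Q r))"
 using a b c by (simp add: mult.commute)
 also have "(P s - P r) * (Q s - Q r) <= (P s + Q s - (P r + Q r))^2"
 unfolding power2_eq_square using mono[OF rs] by (intro mult_mono) auto
 finally show "\<bar>V s * W s - V r * W r - (LBINT x:{r<..s}. W x * p x + V x * q x)\<bar>
 <= 3 * (P s + Q s - (P r + Q r))^2" by simp
 qed (use mono in \<open>auto intro!: add_mono\<close>)
qed

lemma ac_on_add:
 assumes "ac_on b V p" "ac_on b W q"
 shows "ac_on b (%t. V t + W t) (%t. p t + q t)"
 unfolding ac_on_def
proof (intro conjI ballI)
 show "set_integrable lborel {0..b} (%t. p t + q t)" using assms by (auto simp: ac_on_def)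
 fix t assume t: "t \<in> {0..b}"
 have "set_integrable lborel {0..t} p" "set_integrable lborel {0..t} q"
 using assms t by (auto simp only: ac_on_def intro!: set_integrable_subset[of lborel "{0..b}" _ "{0..t}"]) auto
 then show "V t + W t - (V 0 + W 0) = (LBINT s:{0..t}. p s + q s)"
 using assms t unfolding ac_on_def by (subst set_integral_add) (auto simp: add_diff_add)
qed

lemma ac_on_cmult: "ac_on b V q ==> ac_on b (%t. c * V t) (%t. c * q t)"
 unfolding ac_on_def by (simp add: right_diff_distrib[symmetric])

lemma ac_on_const: "ac_on b (%_. c) (%_. 0)"
 by (simp add: ac_on_def set_integrable_def)

lemma ac_on_ident: "ac_on b (%t. t) (%_. 1)"
 by (auto simp: ac_on_def set_integral_const intro!: borel_integrable_atLeastAtMost')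

section \<open>Convergence in the mean: truncation, sets of times, translations, averages\<close>

text \<open>Split where \<open>\<bar>G\<bar>\<close> exceeds a level: below it the L1 convergence of
  \<open>f\<close> decides, above it the uniform bound \<open>C\<close> and the small tail of
  \<open>G\<close>. The filter is arbitrary because it will also be a product of two index filters;
  dominated convergence is applied only in the truncation level, which is a sequence.\<close>

lemma tendsto_integral_mult_of_L1:
 fixes f :: "'i => 'a => real" and G :: "'a => real"
 assumes f: "!!i. integrable M (f i)" and lim: "((%i. \<integral>z. \<bar>f i z\<bar> \<partial>M) \<longlongrightarrow> 0) F"
 and bnd: "!!i z. \<bar>f i z\<bar> <= C" and G: "integrable M G"
 shows "((%i. \<integral>z. \<bar>f i z\<bar> * \<bar>G z\<bar> \<partial>M) \<longlongrightarrow> 0) F"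
proof (rule tendstoI)
 fix e :: real assume e: "0 < e"
 have [measurable]: "!!i. f i \<in> borel_measurable M" "G \<in> borel_measurable M" using f G by auto
 have C0: "0 <= C" if "z \<in> space M" for z using bnd[of undefined z] by linarith
 have "(%n. \<integral>z. (if \<bar>G z\<bar> > real n then \<bar>G z\<bar> else 0) \<partial>M) \<longlonglongrightarrow> (\<integral>z. 0 \<partial>M)"
 proof (rule integral_dominated_convergence[where w="%z. \<bar>G z\<bar>"])
 show "AE z in M. (%n. if \<bar>G z\<bar> > real n then \<bar>G z\<bar> else 0) \<longlonglongrightarrow> 0"
 proof (rule AE_I2)
 fix z
 obtain n0 where "\<bar>G z\<bar> <= real n0" using real_arch_simple by blast
 then have "\<forall>\<^sub>F n in sequentially. (if \<bar>G z\<bar> > real n then \<bar>G z\<bar> else 0) = 0"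
 by (intro eventually_sequentiallyI[of n0]) auto
 then show "(%n. if \<bar>G z\<bar> > real n then \<bar>G z\<bar> else 0) \<longlonglongrightarrow> 0" by (rule tendsto_eventually)
 qed
 qed (use G in auto)
 \<comment> \<open>Adding 1 to \<open>\<bar>C\<bar>\<close> here, and to \<open>real n\<close>
   below, keeps the denominators positive when the bound or the level is 0.\<close>
 then have "\<forall>\<^sub>F n in sequentially. (\<integral>z. (if \<bar>G z\<bar> > real n then \<bar>G z\<bar> else 0) \<partial>M) < e / (2 * (\<bar>C\<bar> + 1))"
 using e by (intro order_tendstoD(2)) auto
 then obtain n where n: "(\<integral>z. (if \<bar>G z\<bar> > real n then \<bar>G z\<bar> else 0) \<partial>M) < e / (2 * (\<bar>C\<bar> + 1))"
 by (auto simp: eventually_sequentially)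
 have iG: "integrable M (%z. if \<bar>G z\<bar> > real n then \<bar>G z\<bar> else 0)"
 by (rule L_integrable_bound[OF G]) auto
 have "\<forall>\<^sub>F i in F. (\<integral>z. \<bar>f i z\<bar> \<partial>M) < e / (2 * (real n + 1))"
 using e by (intro order_tendstoD(2)[OF lim]) auto
 then show "\<forall>\<^sub>F i in F. dist (\<integral>z. \<bar>f i z\<bar> * \<bar>G z\<bar> \<partial>M) 0 < e"
 proof eventually_elim
 case (elim i)
 have "(\<integral>z. \<bar>f i z\<bar> * \<bar>G z\<bar> \<partial>M) <= (\<integral>z. real n * \<bar>f i z\<bar> + C * (if \<bar>G z\<bar> > real n then \<bar>G z\<bar> else 0) \<partial>M)"
 proof (rule integral_mono')
 show "integrable M (%z. real n * \<bar>f i z\<bar> + C * (if \<bar>G z\<bar> > real n then \<bar>G z\<bar> else 0))"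
 using f iG by auto
 fix z assume z: "z \<in> space M"
 show "\<bar>f i z\<bar> * \<bar>G z\<bar> <= real n * \<bar>f i z\<bar> + C * (if \<bar>G z\<bar> > real n then \<bar>G z\<bar> else 0)"
 proof (cases "\<bar>G z\<bar> > real n")
 case True
 then show ?thesis using mult_right_mono[OF bnd[of i z], of "\<bar>G z\<bar>"]
 mult_nonneg_nonneg[of "real n" "\<bar>f i z\<bar>"] by (simp add: add_increasing)
 next
 case False
 then show ?thesis using mult_left_mono[of "\<bar>G z\<bar>" "real n" "\<bar>f i z\<bar>"] by (simp add: mult.commute)
 qed
 show "0 <= real n * \<bar>f i z\<bar> + C * (if \<bar>G z\<bar> > real n then \<bar>G z\<bar> else 0)" using C0[OF z] by auto
 qed
 also have "\<dots> = real n * (\<integral>z. \<bar>f i z\<bar> \<partial>M) + C * (\<integral>z. (if \<bar>G z\<bar> > real n then \<bar>G z\<bar> else 0) \<partial>M)"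
 using f iG by simp
 also have "\<dots> <= (real n + 1) * (\<integral>z. \<bar>f i z\<bar> \<partial>M) + (\<bar>C\<bar> + 1) * (\<integral>z. (if \<bar>G z\<bar> > real n then \<bar>G z\<bar> else 0) \<partial>M)"
 by (intro add_mono mult_right_mono integral_nonneg_AE) auto
 also have "\<dots> < (real n + 1) * (e / (2 * (real n + 1))) + (\<bar>C\<bar> + 1) * (e / (2 * (\<bar>C\<bar> + 1)))"
 using elim n by (intro add_strict_mono mult_strict_left_mono) auto
 also have "\<dots> = e"
 proof -
 have "(real n + 1) * (e / (2 * (real n + 1))) = e / 2" "(\<bar>C\<bar> + 1) * (e / (2 * (\<bar>C\<bar> + 1))) = e / 2"
 by (auto simp: field_simps)
 then show ?thesis by (simp only: field_sum_of_halves)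
 qed
 finally show ?case by (simp add: integral_nonneg_AE)
 qed
qed

text \<open>A Dynkin argument: the half-lines \<open>{..a}\<close> generate the Borel sets, and domination makes the
 class of sets with the stated property closed under countable disjoint unions.\<close>

lemma tendsto_set_integral_of_half_lines:
 fixes g :: "'i => real => real"
 assumes g[measurable]: "!!i. g i \<in> borel_measurable borel" and H: "integrable lborel H"
 and dom: "!!i t. \<bar>g i t\<bar> <= H t"
 and UNIV: "((%i. \<integral>t. g i t \<partial>lborel) \<longlongrightarrow> 0) F"
 and half: "!!a. ((%i. LBINT t:{..a}. g i t) \<longlongrightarrow> 0) F"
 and A: "A \<in> sets borel"
 shows "((%i. LBINT t:A. g i t) \<longlongrightarrow> 0) F"
proof -
 have gi: "integrable lborel (g i)" for i
 proof (rule L_integrable_bound[OF H])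
 show "AE t in lborel. norm (g i t) <= norm (H t)"
 using order_trans[OF dom abs_ge_self] by auto
 qed auto
 have si: "set_integrable lborel B (g i)" if "B \<in> sets borel" for B i
 using that gi integrable_mult_indicator[of B lborel "g i"] by (simp add: set_integrable_def)
 have A': "A \<in> sigma_sets UNIV (range atMost)"
 using A unfolding borel_eq_atMost by simp
 have "Int_stable (range (atMost :: real => _))"
 by (auto simp: Int_stable_def)
 moreover have "range (atMost :: real => _) \<subseteq> Pow UNIV" by simp
 ultimately show ?thesis using A'
 proof (induction rule: sigma_sets_induct_disjoint)
 case (basic B)
 then show ?case using half by auto
 next
 case empty
 show ?case by (simp add: set_lebesgue_integral_def)
 next
 case (compl B)
 then have B: "B \<in> sets borel" unfolding borel_eq_atMost by simp
 have "(LBINT t:UNIV-B. g i t) = (LBINT t. g i t) - (LBINT t:B. g i t)" for i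
 using set_integral_Un[of B "UNIV - B" lborel "g i"] si[of B i] si[of "UNIV - B" i] B
 by (auto simp: Compl_eq_Diff_UNIV[symmetric] set_lebesgue_integral_def)
 then show ?case using tendsto_diff[OF UNIV compl(2)] by simp
 next
 case (union B)
 then have B: "B i \<in> sets borel" for i unfolding borel_eq_atMost by auto
 \<comment> \<open>Finite unions exhaust \<open>E\<close>, and what is left over carries at most the
   \<open>H\<close>-mass of \<open>E - D n\<close>, uniformly in \<open>i\<close>. This separates
   the limit in \<open>n\<close> from the limit along \<open>F\<close>.\<close>
 define D where "D n = (\<Union>i\<in>{..<n}. B i)" for n :: nat
 define E where "E = (\<Union>i. B i)"
 have [measurable]: "D n \<in> sets borel" "E \<in> sets borel" for n unfolding D_def E_def using B by auto
 have D: "((%i. LBINT t:D n. g i t) \<longlongrightarrow> 0) F" for n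
 proof -
 have "(LBINT t:D n. g i t) = (\<Sum>k<n. LBINT t:B k. g i t)" for i
 unfolding D_def using union(1) B si
 by (intro set_integral_finite_Union) (auto simp: disjoint_family_on_def)
 then show ?thesis using tendsto_sum[of "{..<n}" "%k i. LBINT t:B k. g i t" "%_. 0" F] union(3) by simp
 qed
 have "(%n. \<integral>t. indicat_real (E - D n) t * H t \<partial>lborel) \<longlonglongrightarrow> (\<integral>t. 0 \<partial>(lborel :: real measure))"
 proof (rule integral_dominated_convergence[where w="%t. \<bar>H t\<bar>"])
 show "AE t in lborel. (%n. indicat_real (E - D n) t * H t) \<longlonglongrightarrow> 0"
 proof (rule AE_I2)
 fix t
 have "\<forall>\<^sub>F n in sequentially. indicat_real (E - D n) t = 0"
 proof (cases "t \<in> E")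
 case True
 then obtain k where "t \<in> B k" by (auto simp: E_def)
 then show ?thesis by (intro eventually_sequentiallyI[of "Suc k"]) (auto simp: D_def indicator_def)
 qed auto
 then show "(%n. indicat_real (E - D n) t * H t) \<longlonglongrightarrow> 0"
 by (intro tendsto_eventually) (auto elim: eventually_mono)
 qed
 show "integrable lborel (%t. \<bar>H t\<bar>)" using H by simp
 qed (use H in \<open>auto simp: indicator_def\<close>)
 then have tail: "(%n. \<integral>t. indicat_real (E - D n) t * H t \<partial>lborel) \<longlonglongrightarrow> 0" by simp
 have split: "\<bar>LBINT t:E. g i t\<bar> <= \<bar>LBINT t:D n. g i t\<bar> + (LBINT t. indicat_real (E - D n) t * H t)" for i n
 proof -
 have "E = D n \<union> (E - D n)" by (auto simp: D_def E_def)
 then have "(LBINT t:E. g i t) = (LBINT t:D n. g i t) + (LBINT t:E - D n. g i t)"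
 using set_integral_Un[of "D n" "E - D n" lborel "g i"] si[of "D n" i] si[of "E - D n" i] by auto
 moreover have "\<bar>LBINT t:E - D n. g i t\<bar> <= (LBINT t. indicat_real (E - D n) t * H t)"
 unfolding set_lebesgue_integral_def
 proof (rule order_trans[OF integral_abs_bound], rule integral_mono_AE)
 show "integrable lborel (%t. \<bar>indicat_real (E - D n) t *\<^sub>R g i t\<bar>)"
 using si[of "E - D n" i] by (auto simp: set_integrable_def)
 show "integrable lborel (%t. indicat_real (E - D n) t * H t)"
 using integrable_mult_indicator[OF _ H, of "E - D n"] by simp
 show "AE t in lborel. \<bar>indicat_real (E - D n) t *\<^sub>R g i t\<bar> <= indicat_real (E - D n) t * H t"
 using dom by (auto simp: indicator_def)
 qed
 ultimately show ?thesis by linarith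
 qed
 have "((%i. LBINT t:E. g i t) \<longlongrightarrow> 0) F"
 proof (rule tendstoI)
 fix e :: real assume "0 < e"
 then have "\<forall>\<^sub>F n in sequentially. (LBINT t. indicat_real (E - D n) t * H t) < e/2"
 by (intro order_tendstoD(2)[OF tail]) auto
 then obtain n where n: "(LBINT t. indicat_real (E - D n) t * H t) < e/2"
 by (auto simp: eventually_sequentially)
 have "\<forall>\<^sub>F i in F. dist (LBINT t:D n. g i t) 0 < e/2"
 using \<open>0 < e\<close> by (intro tendstoD[OF D]) auto
 then show "\<forall>\<^sub>F i in F. dist (LBINT t:E. g i t) 0 < e"
 proof eventually_elim
 case (elim i)
 then show ?case using split[where i=i and n=n] n unfolding dist_real_def by linarith
 qed
 qed
 then show ?case by (simp add: E_def)
 qed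
qed

lemma integrable_lborel_translate:
 fixes f :: "'a::euclidean_space => real"
 assumes "integrable lborel f"
 shows "integrable lborel (%x. f (x + e))" "(LBINT x. f (x + e)) = integral\<^sup>L lborel f"
proof -
 have "distr lborel borel (%x. x + e) = (lborel :: 'a measure)"
 using lborel_distr_plus[of e] by (simp add: add.commute[of _ e])
 then have *: "lborel = distr lborel borel (%x::'a. x + e)" by simp
 have [measurable]: "f \<in> borel_measurable borel" using borel_measurable_integrable[OF assms] by simp
 have "integrable (distr lborel borel (%x. x + e)) f" using assms * by simp
 then show "integrable lborel (%x. f (x + e))" by (subst (asm) integrable_distr_eq) auto
 have "integral\<^sup>L (distr lborel borel (%x. x + e)) f = (LBINT x. f (x + e))"
 using assms by (intro integral_distr) auto
 then show "(LBINT x. f (x + e)) = integral\<^sup>L lborel f" using * by simp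
qed

text \<open>Expanding the modulus of the difference of two indicators leaves twice the measure of
  \<open>U\<close> minus twice an overlap. Openness makes the overlap converge pointwise: a point of
  \<open>U\<close> stays in \<open>U\<close> under small shifts, and off \<open>U\<close> the
  product is 0, so a boundary of positive measure does no harm.\<close>

lemma tendsto_translate_indicator_open:
 fixes U :: "'a::euclidean_space set" and e :: "nat => 'a"
 assumes U: "open U" "emeasure lborel U < \<infinity>" and e: "e \<longlonglongrightarrow> 0"
 shows "(%n. \<integral>x. \<bar>indicat_real U (x + e n) - indicat_real U x\<bar> \<partial>lborel) \<longlonglongrightarrow> 0"
proof -
 have [measurable]: "U \<in> sets borel" using U by auto
 have i: "integrable lborel (indicat_real U)" using U by (intro integrable_real_indicator) auto
 note ie = integrable_lborel_translate[OF i]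
 have ip: "integrable lborel (%x. indicat_real U (x + e n) * indicat_real U x)" for n
 by (rule L_integrable_bound[OF i]) (auto simp: indicator_def)
 have "(%n. \<integral>x. indicat_real U (x + e n) * indicat_real U x \<partial>lborel) \<longlonglongrightarrow> integral\<^sup>L lborel (indicat_real U)"
 proof (rule integral_dominated_convergence[where w="indicat_real U"])
 show "AE x in lborel. (%n. indicat_real U (x + e n) * indicat_real U x) \<longlonglongrightarrow> indicat_real U x"
 proof (rule AE_I2)
 fix x
 show "(%n. indicat_real U (x + e n) * indicat_real U x) \<longlonglongrightarrow> indicat_real U x"
 proof (cases "x \<in> U")
 case True
 have "(%n. x + e n) \<longlonglongrightarrow> x" using tendsto_add[OF tendsto_const e, of x] by simp
 then have "\<forall>\<^sub>F n in sequentially. x + e n \<in> U" using True U by (intro topological_tendstoD) auto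
 then show ?thesis using True by (intro tendsto_eventually) (auto elim: eventually_mono)
 qed simp
 qed
 qed (use i in \<open>auto simp: indicator_def\<close>)
 then have "(%n. integral\<^sup>L lborel (indicat_real U) + integral\<^sup>L lborel (indicat_real U)
 - 2 * (LBINT x. indicat_real U (x + e n) * indicat_real U x)) \<longlonglongrightarrow>
 integral\<^sup>L lborel (indicat_real U) + integral\<^sup>L lborel (indicat_real U) - 2 * integral\<^sup>L lborel (indicat_real U)"
 by (intro tendsto_intros)
 moreover have "(LBINT x. \<bar>indicat_real U (x + e n) - indicat_real U x\<bar>)
 = integral\<^sup>L lborel (indicat_real U) + integral\<^sup>L lborel (indicat_real U)
 - 2 * (LBINT x. indicat_real U (x + e n) * indicat_real U x)" for n
 proof -
 have "(LBINT x. \<bar>indicat_real U (x + e n) - indicat_real U x\<bar>)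
 = (LBINT x. indicat_real U (x + e n) + indicat_real U x - 2 * (indicat_real U (x + e n) * indicat_real U x))"
 by (intro L_integral_cong) (auto simp: indicator_def)
 also have "\<dots> = (LBINT x. indicat_real U (x + e n)) + integral\<^sup>L lborel (indicat_real U)
 - 2 * (LBINT x. indicat_real U (x + e n) * indicat_real U x)"
 using ie(1) i ip by simp
 finally show ?thesis by (simp only: ie(2))
 qed
 ultimately show ?thesis by simp
qed

text \<open>Outer regularity passes from open sets to Borel sets of finite measure, and the L1
  distance of two functions does not change when both are translated, so simple functions
  approximate uniformly in the shift. Used on the line and in the plane.\<close>

lemma tendsto_translate_L1:
 fixes f :: "'a::euclidean_space => real" and e :: "nat => 'a"
 assumes "integrable lborel f" and e: "e \<longlonglongrightarrow> 0"
 shows "(%n. \<integral>x. \<bar>f (x + e n) - f x\<bar> \<partial>lborel) \<longlonglongrightarrow> 0"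
 using assms(1)
proof (induction rule: integrable_induct)
 case (base A c)
 then have A[measurable]: "A \<in> sets borel" by simp
 have iA: "integrable lborel (indicat_real A)" using base by (intro integrable_real_indicator) auto
 have "(%n. \<integral>x. \<bar>indicat_real A (x + e n) - indicat_real A x\<bar> \<partial>lborel) \<longlonglongrightarrow> 0"
 proof (rule tendstoI)
 fix r :: real assume r: "0 < r"
 obtain U where U: "open U" "A \<subseteq> U" "emeasure lborel (U - A) < ennreal (r / 4)"
 using outer_regular_lborel[OF A, of "r/4"] r by auto
 have [measurable]: "U \<in> sets borel" using U by auto
 have "emeasure lborel U = emeasure lborel A + emeasure lborel (U - A)"
 using U by (subst plus_emeasure) (auto simp: Un_absorb1)
 also have "\<dots> < \<infinity>" using base(2) U(3) by (auto simp: less_top[symmetric] ennreal_add_eq_top)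
 finally have Uf: "emeasure lborel U < \<infinity>" .
 have iU: "integrable lborel (indicat_real U)" using Uf by (intro integrable_real_indicator) auto
 have iD: "integrable lborel (indicat_real (U - A))"
 using U(3) by (intro integrable_real_indicator) (auto intro: less_trans)
 have D: "integral\<^sup>L lborel (indicat_real (U - A)) < r / 4"
 proof -
 have "emeasure lborel (U - A) ~= \<infinity>" using U(3) by (auto simp: top_unique)
 then have "ennreal (measure lborel (U - A)) < ennreal (r / 4)"
 using U(3) by (simp add: emeasure_eq_ennreal_measure)
 then show ?thesis using r by (simp add: ennreal_less_iff)
 qed
 \<comment> \<open>\<open>A\<close> and \<open>U\<close> differ by \<open>U - A\<close>, once at
   \<open>x\<close> and once at the shifted point; hence the factor 2.\<close>
 have bound: "(LBINT x. \<bar>indicat_real A (x + e n) - indicat_real A x\<bar>)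
 <= (LBINT x. \<bar>indicat_real U (x + e n) - indicat_real U x\<bar>) + 2 * integral\<^sup>L lborel (indicat_real (U - A))" for n
 proof -
 note i = integrable_lborel_translate[OF iU, of "e n"] integrable_lborel_translate[OF iD, of "e n"]
 integrable_lborel_translate[OF iA, of "e n"]
 have "(LBINT x. \<bar>indicat_real A (x + e n) - indicat_real A x\<bar>)
 <= (LBINT x. \<bar>indicat_real U (x + e n) - indicat_real U x\<bar> + (indicat_real (U - A) (x + e n) + indicat_real (U - A) x))"
 proof (rule integral_mono)
 show "integrable lborel (%x. \<bar>indicat_real A (x + e n) - indicat_real A x\<bar>)"
 using i(5) iA by (intro integrable_abs L_integrable_diff)
 show "integrable lborel (%x. \<bar>indicat_real U (x + e n) - indicat_real U x\<bar> + (indicat_real (U - A) (x + e n) + indicat_real (U - A) x))"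
 using i(1,3) iU iD by (intro integrable_abs L_integrable_diff L_integrable_add)
 show "\<bar>indicat_real A (x + e n) - indicat_real A x\<bar>
 <= \<bar>indicat_real U (x + e n) - indicat_real U x\<bar> + (indicat_real (U - A) (x + e n) + indicat_real (U - A) x)" for x
 using U(2) by (auto simp: indicator_def)
 qed
 also have "\<dots> = (LBINT x. \<bar>indicat_real U (x + e n) - indicat_real U x\<bar>) + 2 * integral\<^sup>L lborel (indicat_real (U - A))"
 proof -
 have "integrable lborel (%x. \<bar>indicat_real U (x + e n) - indicat_real U x\<bar>)"
 using i(1) iU by (intro integrable_abs L_integrable_diff)
 then show ?thesis
 using i(3,4) iD by (simp only: L_integral_add L_integrable_add)
 qed
 finally show ?thesis .
 qed
 have "\<forall>\<^sub>F n in sequentially. (LBINT x. \<bar>indicat_real U (x + e n) - indicat_real U x\<bar>) < r / 2"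
 using r by (intro order_tendstoD(2)[OF tendsto_translate_indicator_open[OF U(1) Uf e]]) auto
 then show "\<forall>\<^sub>F n in sequentially. dist (LBINT x. \<bar>indicat_real A (x + e n) - indicat_real A x\<bar>) 0 < r"
 proof eventually_elim
 case (elim n)
 then show ?case using bound[of n] D by (simp add: integral_nonneg_AE)
 qed
 qed
 then have "(%n. \<bar>c\<bar> * (LBINT x. \<bar>indicat_real A (x + e n) - indicat_real A x\<bar>)) \<longlonglongrightarrow> \<bar>c\<bar> * 0"
 by (intro tendsto_intros)
 moreover have "\<bar>indicat_real A (x + e n) *\<^sub>R c - indicat_real A x *\<^sub>R c\<bar> = \<bar>c\<bar> * \<bar>indicat_real A (x + e n) - indicat_real A x\<bar>" for x n
 by (auto simp: indicator_def)
 ultimately show ?case by simp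
next
 case (add f g)
 have *: "(LBINT x. \<bar>f (x + e n) + g (x + e n) - (f x + g x)\<bar>)
 <= (LBINT x. \<bar>f (x + e n) - f x\<bar>) + (LBINT x. \<bar>g (x + e n) - g x\<bar>)" for n
 proof -
 note i = add(1,2) integrable_lborel_translate[OF add(1), of "e n"] integrable_lborel_translate[OF add(2), of "e n"]
 have "(LBINT x. \<bar>f (x + e n) + g (x + e n) - (f x + g x)\<bar>)
 <= (LBINT x. \<bar>f (x + e n) - f x\<bar> + \<bar>g (x + e n) - g x\<bar>)"
 using i by (intro integral_mono) auto
 then show ?thesis using i by simp
 qed
 show ?case
 by (rule tendsto_sandwich[OF _ _ tendsto_const tendsto_add[OF add(3,4), simplified]])
 (use * in \<open>auto simp: integral_nonneg_AE\<close>)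
next
 case (lim f s)
 show ?case
 proof (rule tendstoI)
 fix r :: real assume r: "0 < r"
 \<comment> \<open>The approximants satisfy \<open>\<bar>s k x\<bar> <= 2 * \<bar>f x\<bar>\<close>,
   which explains the dominating function \<open>3 * \<bar>f x\<bar>\<close>.\<close>
 have "(%k. \<integral>x. \<bar>s k x - f x\<bar> \<partial>lborel) \<longlonglongrightarrow> (\<integral>x. 0 \<partial>(lborel :: 'a measure))"
 proof (rule integral_dominated_convergence[where w="%x. 3 * \<bar>f x\<bar>"])
 show "AE x in lborel. (%k. \<bar>s k x - f x\<bar>) \<longlonglongrightarrow> 0"
 using LIM_zero[OF lim(2)] by (intro AE_I2) (auto intro: tendsto_rabs_zero)
 show "AE x in lborel. norm \<bar>s k x - f x\<bar> <= 3 * \<bar>f x\<bar>" for k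
 proof (rule AE_I2)
 fix x :: 'a
 show "norm \<bar>s k x - f x\<bar> <= 3 * \<bar>f x\<bar>"
 using lim(3)[of x k] abs_triangle_ineq4[of "s k x" "f x"] by simp
 qed
 qed (use lim in auto)
 then have "\<forall>\<^sub>F k in sequentially. (LBINT x. \<bar>s k x - f x\<bar>) < r / 3"
 using r by (intro order_tendstoD(2)) auto
 then obtain k where k: "(LBINT x. \<bar>s k x - f x\<bar>) < r / 3" by (auto simp: eventually_sequentially)
 have ik: "integrable lborel (%x. \<bar>s k x - f x\<bar>)" using lim by auto
 have bound: "(LBINT x. \<bar>f (x + e n) - f x\<bar>)
 <= (LBINT x. \<bar>s k (x + e n) - s k x\<bar>) + 2 * (LBINT x. \<bar>s k x - f x\<bar>)" for n
 proof -
 note i = lim(1,4) integrable_lborel_translate[OF lim(1)[of k], of "e n"] integrable_lborel_translate[OF lim(4), of "e n"]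
 integrable_lborel_translate[OF ik, of "e n"]
 have "(LBINT x. \<bar>f (x + e n) - f x\<bar>)
 <= (LBINT x. \<bar>s k (x + e n) - s k x\<bar> + (\<bar>s k (x + e n) - f (x + e n)\<bar> + \<bar>s k x - f x\<bar>))"
 using i by (intro integral_mono) auto
 also have "\<dots> = (LBINT x. \<bar>s k (x + e n) - s k x\<bar>) + 2 * (LBINT x. \<bar>s k x - f x\<bar>)"
 using i ik by simp
 finally show ?thesis .
 qed
 have "\<forall>\<^sub>F n in sequentially. (LBINT x. \<bar>s k (x + e n) - s k x\<bar>) < r / 3"
 using r by (intro order_tendstoD(2)[OF lim(5)]) auto
 then show "\<forall>\<^sub>F n in sequentially. dist (LBINT x. \<bar>f (x + e n) - f x\<bar>) 0 < r"
 proof eventually_elim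
 case (elim n)
 then show ?case using bound[of n] k by (simp add: integral_nonneg_AE)
 qed
 qed
qed

text \<open>Minkowski's integral inequality: the L1 norm of an average over \<open>s\<close> is at
  most the average of the L1 norms, which tends to 0 by domination through \<open>D\<close>. The
  averaging weight is part of \<open>F\<close>, so that a mollification and the commutator, averaged
  over two parameters, are both covered.\<close>

lemma tendsto_integral_of_averages:
 fixes F :: "nat => 'a::euclidean_space => 's::euclidean_space => real"
 assumes F[measurable]: "!!n. (%p. F n (fst p) (snd p)) \<in> borel_measurable borel"
 and int: "!!n s. integrable lborel (%z. F n z s)"
 and bnd: "!!n s. (LBINT z. \<bar>F n z s\<bar>) <= D s" and D: "integrable lborel D"
 and lim: "!!s. (%n. \<integral>z. \<bar>F n z s\<bar> \<partial>lborel) \<longlonglongrightarrow> 0"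
 shows "integrable lborel (%z. \<integral>s. F n z s \<partial>lborel)"
 and "AE z in lborel. integrable lborel (F n z)"
 and "(%n. \<integral>z. \<bar>\<integral>s. F n z s \<partial>lborel\<bar> \<partial>lborel) \<longlonglongrightarrow> 0"
proof -
 have [measurable]: "case_prod (F n) \<in> borel_measurable (lborel \<Otimes>\<^sub>M lborel)" for n
 using F[of n] by (simp add: lborel_prod case_prod_beta' measurable_lborel1)
 have [measurable]: "(%(s, z). F n z s) \<in> borel_measurable (lborel \<Otimes>\<^sub>M lborel)" for n
 by (rule measurable_pair_swap[of "case_prod (F n)", simplified]) measurable
 have swap: "integrable (lborel \<Otimes>\<^sub>M lborel) (%(s, z). F n z s)" for n
 proof (rule lborel_pair.Fubini_integrable)
 show "integrable lborel (%s. \<integral>z. norm (case (s, z) of (s, z) => F n z s) \<partial>lborel)"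
 by (rule L_integrable_bound[OF D])
 (auto intro!: AE_I2 order_trans[OF bnd] simp: integral_nonneg_AE)
 qed (use int in auto)
 then have int2: "integrable (lborel \<Otimes>\<^sub>M lborel) (case_prod (F n))" for n
 using lborel_pair.integrable_product_swap_iff[of "case_prod (F n)"] by simp
 show "integrable lborel (%z. \<integral>s. F n z s \<partial>lborel)" for n
 by (rule lborel_pair.integrable_fst[OF int2])
 show "AE z in lborel. integrable lborel (F n z)" for n
 by (rule lborel_pair.AE_integrable_fst[OF int2])
 have abs2: "integrable (lborel \<Otimes>\<^sub>M lborel) (%(z, s). \<bar>F n z s\<bar>)" for n
 using integrable_abs[OF int2[of n]] by (simp add: case_prod_beta')
 have "(%n. \<integral>s. (LBINT z. \<bar>F n z s\<bar>) \<partial>lborel) \<longlonglongrightarrow> (\<integral>s. 0 \<partial>(lborel :: 's measure))"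
 proof (rule integral_dominated_convergence[where w=D])
 show "(%s. \<integral>z. \<bar>F n z s\<bar> \<partial>lborel) \<in> borel_measurable lborel" for n
 using lborel_pair.integrable_snd[OF abs2] by (rule borel_measurable_integrable)
 show "AE s in lborel. norm (LBINT z. \<bar>F n z s\<bar>) <= D s" for n
 using bnd by (intro AE_I2) (simp add: integral_nonneg_AE)
 show "AE s in lborel. (%n. \<integral>z. \<bar>F n z s\<bar> \<partial>lborel) \<longlonglongrightarrow> 0"
 using lim by (intro AE_I2) simp
 qed (use D in simp_all)
 then have "(%n. \<integral>s. (LBINT z. \<bar>F n z s\<bar>) \<partial>lborel) \<longlonglongrightarrow> 0" by simp
 moreover have "(\<integral>z. \<bar>\<integral>s. F n z s \<partial>lborel\<bar> \<partial>lborel) <= (LBINT s. (LBINT z. \<bar>F n z s\<bar>))" for n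
 proof -
 have "(\<integral>z. \<bar>\<integral>s. F n z s \<partial>lborel\<bar> \<partial>lborel) <= (LBINT z. (LBINT s. \<bar>F n z s\<bar>))"
 using lborel_pair.integrable_fst[OF int2] lborel_pair.integrable_fst[OF abs2] by (intro integral_mono) auto
 then show ?thesis using lborel_pair.integral_fst[OF abs2[of n]] lborel_pair.integral_snd[OF abs2[of n]] by simp
 qed
 ultimately show "(%n. \<integral>z. \<bar>\<integral>s. F n z s \<partial>lborel\<bar> \<partial>lborel) \<longlonglongrightarrow> 0"
 using Lim_null_comparison[OF always_eventually,
 of "%n. \<integral>z. \<bar>\<integral>s. F n z s \<partial>lborel\<bar> \<partial>lborel" "%n. \<integral>s. (LBINT z. \<bar>F n z s\<bar>) \<partial>lborel"]
 by (simp add: integral_nonneg_AE)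
qed

lemma integrable_lborel_pair:
 fixes f :: "real \<times> real => real"
 assumes f: "integrable lborel f"
 shows "AE t in lborel. integrable lborel (%x. f (t, x))"
 and "AE x in lborel. integrable lborel (%t. f (t, x))"
 and "integrable lborel (%t. \<integral>x. f (t, x) \<partial>lborel)"
 and "integrable lborel (%x. \<integral>t. f (t, x) \<partial>lborel)"
 and "(LBINT t. (LBINT x. f (t, x))) = integral\<^sup>L lborel f"
 and "(LBINT x. (LBINT t. f (t, x))) = integral\<^sup>L lborel f"
proof -
 have f1: "integrable (lborel \<Otimes>\<^sub>M lborel) f" using f by (simp add: lborel_prod)
 have f2: "integrable (lborel \<Otimes>\<^sub>M lborel) (case_prod (%t x. f (t, x)))"
 using f1 by (simp add: case_prod_beta')
 show "AE t in lborel. integrable lborel (%x. f (t, x))" by (rule lborel_pair.AE_integrable_fst'[OF f1])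
 show "AE x in lborel. integrable lborel (%t. f (t, x))" by (rule lborel_pair.AE_integrable_snd[OF f2])
 show "integrable lborel (%t. \<integral>x. f (t, x) \<partial>lborel)" by (rule lborel_pair.integrable_fst'[OF f1])
 show "integrable lborel (%x. \<integral>t. f (t, x) \<partial>lborel)" by (rule lborel_pair.integrable_snd[OF f2])
 show "(LBINT t. (LBINT x. f (t, x))) = integral\<^sup>L lborel f"
 using lborel_pair.integral_fst'[OF f1] by (simp add: lborel_prod)
 show "(LBINT x. (LBINT t. f (t, x))) = integral\<^sup>L lborel f"
 using lborel_pair.integral_snd[OF f2] by (simp add: lborel_prod case_prod_beta')
qed

lemma set_integral_lborel_pair:
 fixes f :: "real \<times> real => real"
 assumes f: "set_integrable lborel (A \<times> B) f"
 shows "set_integrable lborel A (%t. LBINT x:B. f (t, x))"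
 and "set_integrable lborel B (%x. LBINT t:A. f (t, x))"
 and "(LBINT t:A. LBINT x:B. f (t, x)) = (LBINT z:A \<times> B. f z)"
 and "(LBINT x:B. LBINT t:A. f (t, x)) = (LBINT z:A \<times> B. f z)"
 and "AE t in lborel. t \<in> A --> set_integrable lborel B (%x. f (t, x))"
proof -
 have i: "integrable lborel (%z. indicat_real (A \<times> B) z *\<^sub>R f z)"
 using f by (simp add: set_integrable_def)
 have e: "indicat_real (A \<times> B) (t, x) *\<^sub>R y = indicat_real A t *\<^sub>R (indicat_real B x *\<^sub>R y)" for t x and y :: real
 by (auto simp: indicator_def)
 have e': "indicat_real (A \<times> B) (t, x) *\<^sub>R y = indicat_real B x *\<^sub>R (indicat_real A t *\<^sub>R y)" for t x and y :: real
 by (auto simp: indicator_def)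
 note F = integrable_lborel_pair[OF i]
 show "set_integrable lborel A (%t. LBINT x:B. f (t, x))"
 using F(3) unfolding e set_integrable_def set_lebesgue_integral_def by simp
 show "set_integrable lborel B (%x. LBINT t:A. f (t, x))"
 using F(4) unfolding e' set_integrable_def set_lebesgue_integral_def by simp
 show "(LBINT t:A. LBINT x:B. f (t, x)) = (LBINT z:A \<times> B. f z)"
 using F(5) unfolding e set_lebesgue_integral_def by simp
 show "(LBINT x:B. LBINT t:A. f (t, x)) = (LBINT z:A \<times> B. f z)"
 using F(6) unfolding e' set_lebesgue_integral_def by simp
 show "AE t in lborel. t \<in> A --> set_integrable lborel B (%x. f (t, x))"
 using F(1)[unfolded e] by eventually_elim (auto simp: set_integrable_def)
qed

lemma AE_lborel_pair:
 assumes "AE z in (lborel :: (real \<times> real) measure). P z"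
 shows "AE t in lborel. AE x in lborel. P (t, x)"
proof -
 have "AE z in (lborel \<Otimes>\<^sub>M lborel :: (real \<times> real) measure). P z"
 using assms unfolding lborel_prod .
 then show ?thesis by (rule lborel_pair.AE_pair)
qed

lemma integrable_mult_bounded:
 fixes f g :: "'a => real"
 assumes "integrable M f" "g \<in> borel_measurable M" "AE x in M. \<bar>g x\<bar> <= B"
 shows "integrable M (%x. g x * f x)"
proof (rule L_integrable_bound)
 show "integrable M (%x. B * f x)" using assms by simp
 show "AE x in M. norm (g x * f x) <= norm (B * f x)"
 using assms(3)
 proof eventually_elim
 case (elim x)
 then show ?case using mult_right_mono[of "\<bar>g x\<bar>" "\<bar>B\<bar>" "\<bar>f x\<bar>"] by (simp add: abs_mult)
 qed
qed (use assms in auto)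

lemma measurable_fst_snd_borel[measurable]:
 "fst \<in> borel_measurable (borel :: ('a::second_countable_topology \<times> 'b::second_countable_topology) measure)"
 "snd \<in> borel_measurable (borel :: ('a::second_countable_topology \<times> 'b::second_countable_topology) measure)"
 by (auto intro!: borel_measurable_continuous_onI continuous_intros)

lemma borel_measurable_section:
 fixes F :: "real \<times> real => real"
 assumes "F \<in> borel_measurable borel"
 shows "(%x. F (s, x)) \<in> borel_measurable borel" "(%s. F (s, x)) \<in> borel_measurable borel"
 by (intro measurable_compose[OF _ assms] borel_measurable_continuous_onI continuous_intros)+

lemma set_integrable_of_integrable:
 fixes f :: "'a => real"
 shows "integrable M f ==> A \<in> sets M ==> set_integrable M A f"
 unfolding set_integrable_def by (rule integrable_mult_indicator)

lemma borel_measurable_set_integral_snd: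
 fixes F :: "real \<times> real => real"
 assumes "F \<in> borel_measurable borel" "B \<in> sets borel"
 shows "(%s. LBINT x:B. F (s, x)) \<in> borel_measurable borel"
proof -
 have [measurable]: "F \<in> borel_measurable (borel \<Otimes>\<^sub>M lborel)"
 using assms(1) by (simp add: borel_prod[symmetric] cong: measurable_cong_sets)
 show ?thesis
 unfolding set_lebesgue_integral_def using assms(2) by measurable
qed

section \<open>The velocity field and the weighted energy identity\<close>

text \<open>The velocity is stored as left boundary value plus spatial derivative. It is then
  defined everywhere, jointly measurable, absolutely continuous in \<open>x\<close> for almost every
  \<open>t\<close>, and dominated by an integrable function of \<open>t\<close> alone. For negative
  \<open>x\<close> the interval is empty and the value is \<open>u0 t\<close>.\<close>

definition vel :: "(real => real) => (real \<times> real => real) => real => real => real" where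
 "vel u0 d t x = u0 t + (LBINT y:{0..x}. d (t, y))"

lemma vel_measurable[measurable]:
 assumes [measurable]: "u0 \<in> borel_measurable borel" "d \<in> borel_measurable borel"
 shows "(%z. vel u0 d (fst z) (snd z)) \<in> borel_measurable borel"
proof -
 have [measurable]: "d \<in> borel_measurable (borel \<Otimes>\<^sub>M borel)" by (simp add: borel_prod)
 have "(%z. \<integral>y. (if 0 <= y \<and> y <= snd z then d (fst z, y) else 0) \<partial>lborel) \<in> borel_measurable (borel \<Otimes>\<^sub>M borel)"
 by measurable
 moreover have "(LBINT y:{0..x}. d (t, y)) = (LBINT y. (if 0 <= y \<and> y <= x then d (t, y) else 0))" for t x
 unfolding set_lebesgue_integral_def by (intro L_integral_cong) auto
 ultimately have "(%z. u0 (fst z) + (LBINT y:{0..snd z}. d (fst z, y))) \<in> borel_measurable (borel \<Otimes>\<^sub>M borel)"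
 by simp
 then show ?thesis by (simp add: vel_def borel_prod)
qed

lemma ac_on_vel:
 assumes "integrable lborel (%x. d (t, x))"
 shows "ac_on b (vel u0 d t) (%x. d (t, x))"
proof -
 have "set_integrable lborel {0..b} (%x. d (t, x))"
 using integrable_mult_indicator[OF _ assms, of "{0..b}"] by (simp add: set_integrable_def)
 then show ?thesis by (simp add: ac_on_def vel_def set_integral_at_point)
qed

lemma vel_0: "vel u0 d t 0 = u0 t"
 by (simp add: vel_def set_integral_at_point)

lemma vel_le:
 assumes "integrable lborel (%x. d (t, x))"
 shows "\<bar>vel u0 d t x\<bar> <= \<bar>u0 t\<bar> + (LBINT y. \<bar>d (t, y)\<bar>)"
proof -
 have "\<bar>LBINT y:{0..x}. d (t, y)\<bar> <= (LBINT y. \<bar>indicat_real {0..x} y *\<^sub>R d (t, y)\<bar>)"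
 unfolding set_lebesgue_integral_def by (rule integral_abs_bound)
 also have "\<dots> <= (LBINT y. \<bar>d (t, y)\<bar>)"
 using assms integrable_mult_indicator[OF _ assms, of "{0..x}"]
 by (intro integral_mono integrable_abs) (auto simp: indicator_def)
 finally show ?thesis by (simp add: vel_def)
qed

lemma vel_bound_integrable:
 fixes d :: "real \<times> real => real"
 assumes "integrable lborel u0" "integrable lborel d"
 shows "integrable lborel (%t. \<bar>u0 t\<bar> + (LBINT y. \<bar>d (t, y)\<bar>))"
 using assms(1) integrable_lborel_pair(3)[OF integrable_abs[OF assms(2)]] by simp

text \<open>The slicewise bound of \<open>vel_le\<close> depends on time only, so on a strip of
  finite width it is an integrable majorant.\<close>

lemma integrable_vel_box:
 assumes u0: "integrable lborel u0" and d: "integrable lborel d"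
 shows "set_integrable lborel (UNIV \<times> {a..b}) (%z. vel u0 d (fst z) (snd z))"
proof -
 have [measurable]: "u0 \<in> borel_measurable borel" "d \<in> borel_measurable borel"
 using u0 d by auto
 define n where "n t = \<bar>u0 t\<bar> + (LBINT y. \<bar>d (t, y)\<bar>)" for t
 have n: "integrable lborel n" unfolding n_def by (rule vel_bound_integrable[OF u0 d])
 have [measurable]: "n \<in> borel_measurable borel" using borel_measurable_integrable[OF n] by simp
 have ind: "integrable lborel (indicat_real {a..b})"
 by (intro integrable_real_indicator) (auto simp: emeasure_lborel_Icc_eq)
 have "integrable (lborel \<Otimes>\<^sub>M lborel) (%z. n (fst z) * indicat_real {a..b} (snd z))"
 proof (rule lborel_pair.Fubini_integrable)
 show "(%z. n (fst z) * indicat_real {a..b} (snd z)) \<in> borel_measurable (lborel \<Otimes>\<^sub>M lborel)"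
 unfolding lborel_prod measurable_lborel1 by measurable
 show "integrable lborel (%t. \<integral>x. norm (n (fst (t, x)) * indicat_real {a..b} (snd (t, x))) \<partial>lborel)"
 using n by (simp add: abs_mult)
 show "AE t in lborel. integrable lborel (%x. n (fst (t, x)) * indicat_real {a..b} (snd (t, x)))"
 using ind by simp
 qed
 then have ni: "integrable lborel (%z. n (fst z) * indicat_real {a..b} (snd z))"
 by (simp add: lborel_prod)
 have "AE t in lborel. AE x in lborel. \<bar>vel u0 d t x\<bar> <= n t"
 using integrable_lborel_pair(1)[OF d] by eventually_elim (auto simp: n_def intro: vel_le)
 moreover have "{z \<in> space (lborel \<Otimes>\<^sub>M lborel). \<bar>vel u0 d (fst z) (snd z)\<bar> <= n (fst z)} \<in> sets (lborel \<Otimes>\<^sub>M lborel)"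
 unfolding lborel_prod space_lborel sets_lborel
 by measurable
 ultimately have "AE z in lborel \<Otimes>\<^sub>M lborel. \<bar>vel u0 d (fst z) (snd z)\<bar> <= n (fst z)"
 using lborel_pair.AE_pair_measure[of "%z. \<bar>vel u0 d (fst z) (snd z)\<bar> <= n (fst z)"] by simp
 then have ae: "AE z in lborel. \<bar>vel u0 d (fst z) (snd z)\<bar> <= n (fst z)" unfolding lborel_prod .
 show ?thesis unfolding set_integrable_def
 proof (rule L_integrable_bound[OF ni])
 show "AE z in lborel. norm (indicat_real (UNIV \<times> {a..b}) z *\<^sub>R vel u0 d (fst z) (snd z))
 <= norm (n (fst z) * indicat_real {a..b} (snd z))"
 using ae by eventually_elim (auto simp: indicator_def)
 show "(%z. indicat_real (UNIV \<times> {a..b}) z *\<^sub>R vel u0 d (fst z) (snd z)) \<in> borel_measurable lborel"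
 unfolding indicator_times by measurable
 qed
qed

lemma bounded_of_lipschitz_derivative:
 fixes \<beta> \<beta>' :: "real => real"
 assumes der: "!!x. (\<beta> has_real_derivative \<beta>' x) (at x)"
 and lip: "!!x y. \<bar>\<beta>' y - \<beta>' x\<bar> <= L * \<bar>y - x\<bar>"
 shows "\<beta> \<in> borel_measurable borel" "\<beta>' \<in> borel_measurable borel"
 and "\<exists>B. \<forall>x. \<bar>x\<bar> <= R --> \<bar>\<beta> x\<bar> <= B \<and> \<bar>\<beta>' x\<bar> <= B"
proof -
 have "0 <= L" using lip[of 1 0] by auto
 have c1: "continuous_on UNIV \<beta>" using der by (auto intro!: continuous_at_imp_continuous_on DERIV_isCont)
 have "L-lipschitz_on UNIV \<beta>'" using lip \<open>0 <= L\<close> by (intro lipschitz_onI) (auto simp: dist_real_def abs_minus_commute)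
 then have c2: "continuous_on UNIV \<beta>'" by (rule lipschitz_on_continuous_on)
 show "\<beta> \<in> borel_measurable borel" "\<beta>' \<in> borel_measurable borel"
 using c1 c2 by (auto intro: borel_measurable_continuous_onI)
 have "compact (\<beta> ` {-R..R})" "compact (\<beta>' ` {-R..R})"
 by (auto intro!: compact_continuous_image continuous_on_subset[OF c1] continuous_on_subset[OF c2])
 then have "bounded (\<beta> ` {-R..R})" "bounded (\<beta>' ` {-R..R})" by (auto intro: compact_imp_bounded)
 then obtain A B where "\<forall>x\<in>{-R..R}. norm (\<beta> x) <= A" "\<forall>x\<in>{-R..R}. norm (\<beta>' x) <= B"
 unfolding bounded_iff by (metis imageI)
 then have "\<forall>x. \<bar>x\<bar> <= R --> \<bar>\<beta> x\<bar> <= max A B \<and> \<bar>\<beta>' x\<bar> <= max A B"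
 by (auto simp: abs_le_iff le_max_iff_disj)
 then show "\<exists>B. \<forall>x. \<bar>x\<bar> <= R --> \<bar>\<beta> x\<bar> <= B \<and> \<bar>\<beta>' x\<bar> <= B" by blast
qed

text \<open>Multiply the equation \<open>q = r - U * vx\<close> by
  \<open>(1 - x) * \<beta>' v\<close>. In time this is the chain rule for fixed \<open>x\<close>; in
  space the transport term is completed to the derivative of \<open>(1 - x) * \<beta> v * U\<close>,
  which leaves boundary values at 0 and \<open>b\<close>. The weight is chosen for the later limit
  of \<open>b\<close> to 1: it suppresses the end that mollified functions cannot reach.\<close>

lemma energy_identity:
 fixes v vx q r d :: "real \<times> real => real" and \<beta> \<beta>' u0 :: "real => real"
 assumes b: "0 < b" and t: "0 <= t"
 and meas[measurable]: "v \<in> borel_measurable borel" "vx \<in> borel_measurable borel" "q \<in> borel_measurable borel"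
 and vb: "!!z. \<bar>v z\<bar> <= V" and vxb: "!!z. \<bar>vx z\<bar> <= V'"
 and d: "integrable lborel d" and r: "integrable lborel r" and u0: "integrable lborel u0"
 and der: "!!x. (\<beta> has_real_derivative \<beta>' x) (at x)"
 and lip: "!!x y. \<bar>\<beta>' y - \<beta>' x\<bar> <= L * \<bar>y - x\<bar>"
 and time: "!!x. 0 <= x ==> x <= b ==> ac_on t (%s. v (s, x)) (%s. q (s, x))"
 and space: "!!s. 0 <= s ==> s <= t ==> ac_on b (%x. v (s, x)) (%x. vx (s, x))"
 and rel: "AE z in lborel. z \<in> {0..t} \<times> {0..b} --> q z = r z - vel u0 d (fst z) (snd z) * vx z"
 shows "(LBINT x:{0..b}. (1 - x) * (\<beta> (v (t, x)) - \<beta> (v (0, x)))) =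
 (LBINT s:{0..t}. (LBINT x:{0..b}. (1 - x) * \<beta>' (v (s, x)) * r (s, x)
 - \<beta> (v (s, x)) * vel u0 d s x + (1 - x) * \<beta> (v (s, x)) * d (s, x))
 - (1 - b) * \<beta> (v (s, b)) * vel u0 d s b + \<beta> (v (s, 0)) * u0 s)"
proof -
 have L: "0 <= L" using lip[of 1 0] by auto
 note \<beta>m[measurable] = bounded_of_lipschitz_derivative(1,2)[OF der lip]
 obtain B where B: "!!x. \<bar>x\<bar> <= V ==> \<bar>\<beta> x\<bar> <= B" "!!x. \<bar>x\<bar> <= V ==> \<bar>\<beta>' x\<bar> <= B"
 using bounded_of_lipschitz_derivative(3)[OF der lip, of V] by blast
 have [measurable]: "u0 \<in> borel_measurable borel" "d \<in> borel_measurable borel" "r \<in> borel_measurable borel"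
 using u0 d r by auto
 have B0: "0 <= B" using B(1)[of "v (0,0)"] vb[of "(0,0)"] by linarith
 let ?U = "vel u0 d"
 have sub3: "x - (y - z) = x - y + z" for x y z :: real by simp
 \<comment> \<open>Pointwise form of the integration by parts: \<open>a\<close> stands for
   \<open>1 - x\<close>, so that its derivative is -1 and the last bracket is the
   \<open>x\<close>-derivative of \<open>a * B' * U'\<close>.\<close>
 have ring_eq: "a * b' * (r' - U' * v') = a * b' * r' - B' * U' + a * B' * d' - (U' * (a * (b' * v') - B') + a * B' * d')"
 for a b' r' U' v' B' d' :: real by algebra
 define Uf where "Uf z = ?U (fst z) (snd z)" for z
 have [measurable]: "Uf \<in> borel_measurable borel" unfolding Uf_def by measurable
 have [measurable]: "(%z. \<beta>' (v z)) \<in> borel_measurable borel" "(%z. \<beta> (v z)) \<in> borel_measurable borel"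
 by measurable
 have m1: "(%z. (1 - snd z) * \<beta>' (v z) * q z) \<in> borel_measurable borel"
 by measurable
 have "(%z. (1 - snd z) * \<beta>' (v z) * r z - \<beta> (v z) * Uf z + (1 - snd z) * \<beta> (v z) * d z) \<in> borel_measurable borel"
 by measurable
 then have m2: "(%z. (1 - snd z) * \<beta>' (v z) * r z - \<beta> (v z) * ?U (fst z) (snd z)
 + (1 - snd z) * \<beta> (v z) * d z) \<in> borel_measurable borel"
 unfolding Uf_def .
 have "(%z. Uf z * ((1 - snd z) * (\<beta>' (v z) * vx z) - \<beta> (v z)) + (1 - snd z) * \<beta> (v z) * d z) \<in> borel_measurable borel"
 by measurable
 then have m3: "(%z. ?U (fst z) (snd z) * ((1 - snd z) * (\<beta>' (v z) * vx z) - \<beta> (v z))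
 + (1 - snd z) * \<beta> (v z) * d z) \<in> borel_measurable borel"
 unfolding Uf_def .
 have cont1: "continuous_on {0..b} (%x. 1 - x)" by (intro continuous_intros)
 \<comment> \<open>Joint integrability is read off from the right-hand side of \<open>rel\<close>,
   because the hypothesis \<open>time\<close> controls \<open>q\<close> only along lines of fixed
   \<open>x\<close>.\<close>
 have Qi: "set_integrable lborel ({0..t} \<times> {0..b}) (%z. (1 - snd z) * \<beta>' (v z) * q z)"
 proof -
 have 1: "set_integrable lborel ({0..t} \<times> {0..b}) (%z. (1 - snd z) * \<beta>' (v z) * (r z - ?U (fst z) (snd z) * vx z))"
 proof -
 have "set_integrable lborel ({0..t} \<times> {0..b}) r"
 by (rule set_integrable_of_integrable[OF r]) (simp add: borel_Times)
 moreover have "set_integrable lborel ({0..t} \<times> {0..b}) (%z. ?U (fst z) (snd z))"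
 by (rule set_integrable_subset[OF integrable_vel_box[OF u0 d, of 0 b]]) (auto simp: borel_Times)
 then have "integrable lborel (%z. vx z * (indicat_real ({0..t} \<times> {0..b}) z *\<^sub>R ?U (fst z) (snd z)))"
 unfolding set_integrable_def by (rule integrable_mult_bounded[where B=V']) (use vxb in auto)
 then have "set_integrable lborel ({0..t} \<times> {0..b}) (%z. ?U (fst z) (snd z) * vx z)"
 by (simp add: set_integrable_def mult_ac)
 ultimately have "set_integrable lborel ({0..t} \<times> {0..b}) (%z. r z - ?U (fst z) (snd z) * vx z)"
 by (rule set_integral_diff)
 then have i: "integrable lborel (%z. indicat_real ({0..t} \<times> {0..b}) z *\<^sub>R (r z - ?U (fst z) (snd z) * vx z))"
 by (simp add: set_integrable_def)
 have "integrable lborel (%z. (indicat_real ({0..t} \<times> {0..b}) z * (1 - snd z) * \<beta>' (v z)) *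
 (indicat_real ({0..t} \<times> {0..b}) z *\<^sub>R (r z - ?U (fst z) (snd z) * vx z)))"
 proof (rule integrable_mult_bounded[OF i])
 show "AE z in lborel. \<bar>indicat_real ({0..t} \<times> {0..b}) z * (1 - snd z) * \<beta>' (v z)\<bar> <= (1 + b) * B"
 using B(2)[OF vb] b B0
 by (intro AE_I2) (auto simp: abs_mult indicator_def intro!: mult_mono)
 show "(%z. indicat_real ({0..t} \<times> {0..b}) z * (1 - snd z) * \<beta>' (v z)) \<in> borel_measurable lborel"
 unfolding indicator_times by measurable
 qed
 then show ?thesis unfolding set_integrable_def
 by (rule L_integrable_cong[THEN iffD1, rotated 2]) (auto simp: indicator_def)
 qed
 show ?thesis
 proof (rule set_integrable_cong_AE[THEN iffD1, OF _ _ _ _ 1])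
 show "{0..t} \<times> {0..b} \<in> sets (lborel :: (real \<times> real) measure)" by (simp add: borel_Times)
 show "AE z\<in>{0..t} \<times> {0..b} in lborel. (1 - snd z) * \<beta>' (v z) * (r z - ?U (fst z) (snd z) * vx z) = (1 - snd z) * \<beta>' (v z) * q z"
 using rel by eventually_elim auto
 have "(%z. (1 - snd z) * \<beta>' (v z) * (r z - Uf z * vx z)) \<in> borel_measurable lborel" by measurable
 then show "(%z. (1 - snd z) * \<beta>' (v z) * (r z - ?U (fst z) (snd z) * vx z)) \<in> borel_measurable lborel"
 unfolding Uf_def .
 show "(%z. (1 - snd z) * \<beta>' (v z) * q z) \<in> borel_measurable lborel"
 using m1 by simp
 qed
 qed
 have "(LBINT x:{0..b}. (1 - x) * (\<beta> (v (t, x)) - \<beta> (v (0, x))))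
 = (LBINT x:{0..b}. LBINT s:{0..t}. (1 - x) * \<beta>' (v (s, x)) * q (s, x))"
 proof (rule set_lebesgue_integral_cong, simp, intro allI impI)
 fix x assume x: "x \<in> {0..b}"
 have "ac_on t (%s. \<beta> (v (s, x))) (%s. \<beta>' (v (s, x)) * q (s, x))"
 using x by (intro ac_on_compose[OF time L der lip, where R=V]) (auto intro: vb)
 then have "\<beta> (v (t, x)) - \<beta> (v (0, x)) = (LBINT s:{0..t}. \<beta>' (v (s, x)) * q (s, x))"
 using t by (simp add: ac_on_def)
 then show "(1 - x) * (\<beta> (v (t, x)) - \<beta> (v (0, x))) = (LBINT s:{0..t}. (1 - x) * \<beta>' (v (s, x)) * q (s, x))"
 by (simp add: mult.assoc)
 qed
 also have "\<dots> = (LBINT s:{0..t}. LBINT x:{0..b}. (1 - x) * \<beta>' (v (s, x)) * q (s, x))"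
 using set_integral_lborel_pair(3,4)[OF Qi] by simp
 also have "\<dots> = (LBINT s:{0..t}. (LBINT x:{0..b}. (1 - x) * \<beta>' (v (s, x)) * r (s, x)
 - \<beta> (v (s, x)) * ?U s x + (1 - x) * \<beta> (v (s, x)) * d (s, x))
 - (1 - b) * \<beta> (v (s, b)) * ?U s b + \<beta> (v (s, 0)) * u0 s)"
 proof (rule set_lebesgue_integral_cong_AE)
 have "AE s in lborel. s \<in> {0..t} --> set_integrable lborel {0..b} (%x. (1 - x) * \<beta>' (v (s, x)) * q (s, x))"
 using set_integral_lborel_pair(5)[OF Qi] by simp
 moreover note AE_lborel_pair[OF rel] integrable_lborel_pair(1)[OF d] integrable_lborel_pair(1)[OF r]
 ultimately show "AE s\<in>{0..t} in lborel. (LBINT x:{0..b}. (1 - x) * \<beta>' (v (s, x)) * q (s, x)) =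
 (LBINT x:{0..b}. (1 - x) * \<beta>' (v (s, x)) * r (s, x)
 - \<beta> (v (s, x)) * ?U s x + (1 - x) * \<beta> (v (s, x)) * d (s, x))
 - (1 - b) * \<beta> (v (s, b)) * ?U s b + \<beta> (v (s, 0)) * u0 s"
 proof eventually_elim
 case (elim s)
 show ?case
 proof
 assume s: "s \<in> {0..t}"
 have acU: "ac_on b (?U s) (%x. d (s, x))" using elim by (intro ac_on_vel)
 have acv: "ac_on b (%x. v (s, x)) (%x. vx (s, x))" using s by (intro space) auto
 have ac\<beta>: "ac_on b (%x. \<beta> (v (s, x))) (%x. \<beta>' (v (s, x)) * vx (s, x))"
 by (intro ac_on_compose[OF acv L der lip, where R=V]) (auto intro: vb)
 have ac1: "ac_on b (%x. 1 - x) (%x. -1)"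
 using ac_on_add[OF ac_on_const[of b 1] ac_on_cmult[OF ac_on_ident[of b], of "-1"]] by simp
 define D where "D x = (1 - x) * (\<beta>' (v (s, x)) * vx (s, x)) - \<beta> (v (s, x))" for x
 have acZ: "ac_on b (%x. (1 - x) * \<beta> (v (s, x))) D"
 by (rule ac_on_cong[OF ac_on_mult[OF ac1 ac\<beta>]]) (auto simp: D_def)
 note acZU = ac_on_mult[OF acZ acU]
 have A: "set_integrable lborel {0..b} (%x. ?U s x * D x + (1 - x) * \<beta> (v (s, x)) * d (s, x))"
 "(1 - b) * \<beta> (v (s, b)) * ?U s b - \<beta> (v (s, 0)) * u0 s
 = (LBINT x:{0..b}. ?U s x * D x + (1 - x) * \<beta> (v (s, x)) * d (s, x))"
 using acZU b by (auto simp: ac_on_def vel_0)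
 have cU: "continuous_on {0..b} (?U s)" by (rule ac_on_continuous[OF acU])
 have c\<beta>: "continuous_on {0..b} (%x. \<beta> (v (s, x)))" by (rule ac_on_continuous[OF ac\<beta>])
 have ds: "set_integrable lborel {0..b} (%x. d (s, x))" and rs: "set_integrable lborel {0..b} (%x. r (s, x))"
 using elim integrable_mult_indicator[of "{0..b}" lborel "%x. d (s, x)"]
 integrable_mult_indicator[of "{0..b}" lborel "%x. r (s, x)"] by (auto simp: set_integrable_def)
 have r1: "set_integrable lborel {0..b} (%x. \<beta>' (v (s, x)) * r (s, x))"
 by (rule set_integrable_mult_bounded[OF rs, where B=B]) (auto intro: B vb)
 have R: "set_integrable lborel {0..b} (%x. (1 - x) * \<beta>' (v (s, x)) * r (s, x)
 - \<beta> (v (s, x)) * ?U s x + (1 - x) * \<beta> (v (s, x)) * d (s, x))"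
 using set_integrable_mult_continuous[OF r1 cont1]
 borel_integrable_atLeastAtMost'[OF continuous_on_mult[OF c\<beta> cU]]
 set_integrable_mult_continuous[OF ds continuous_on_mult[OF cont1 c\<beta>]]
 by (intro set_integral_add(1) set_integral_diff(1)) (auto simp: mult.assoc)
 define Rf where "Rf x = (1 - x) * \<beta>' (v (s, x)) * r (s, x)
 - \<beta> (v (s, x)) * ?U s x + (1 - x) * \<beta> (v (s, x)) * d (s, x)" for x
 define Af where "Af x = ?U s x * D x + (1 - x) * \<beta> (v (s, x)) * d (s, x)" for x
 have Rf: "set_integrable lborel {0..b} Rf" using R by (simp add: Rf_def[abs_def])
 have Af: "set_integrable lborel {0..b} Af"
 "(1 - b) * \<beta> (v (s, b)) * ?U s b - \<beta> (v (s, 0)) * u0 s = (LBINT x:{0..b}. Af x)"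
 using A by (simp_all only: Af_def[abs_def])
 have e1: "(LBINT x:{0..b}. (1 - x) * \<beta>' (v (s, x)) * q (s, x)) = (LBINT x:{0..b}. Rf x - Af x)"
 proof (rule set_lebesgue_integral_cong_AE)
 show "AE x\<in>{0..b} in lborel. (1 - x) * \<beta>' (v (s, x)) * q (s, x) = Rf x - Af x"
 using elim(2)
 proof eventually_elim
 case (elim x)
 show ?case
 proof
 assume "x \<in> {0..b}"
 with elim s have "q (s, x) = r (s, x) - ?U s x * vx (s, x)" by auto
 then show "(1 - x) * \<beta>' (v (s, x)) * q (s, x) = Rf x - Af x"
 by (simp only: Rf_def Af_def D_def ring_eq)
 qed
 qed
 have "Rf \<in> borel_measurable borel" "Af \<in> borel_measurable borel"
 using borel_measurable_section(1)[OF m2, of s] borel_measurable_section(1)[OF m3, of s]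
 by (simp_all only: Rf_def[abs_def] Af_def[abs_def] D_def fst_conv snd_conv)
 then show "(%x. Rf x - Af x) \<in> borel_measurable lborel"
 by simp
 show "(%x. (1 - x) * \<beta>' (v (s, x)) * q (s, x)) \<in> borel_measurable lborel"
 using borel_measurable_section(1)[OF m1, of s] by simp
 qed simp
 have e2: "(LBINT x:{0..b}. Rf x - Af x) = (LBINT x:{0..b}. Rf x) - (LBINT x:{0..b}. Af x)"
 by (rule set_integral_diff(2)[OF Rf Af(1)])
 have e3: "(LBINT x:{0..b}. Rf x) - (LBINT x:{0..b}. Af x)
 = (LBINT x:{0..b}. Rf x) - (1 - b) * \<beta> (v (s, b)) * ?U s b + \<beta> (v (s, 0)) * u0 s"
 by (simp only: Af(2)[symmetric] sub3)
 show "(LBINT x:{0..b}. (1 - x) * \<beta>' (v (s, x)) * q (s, x)) =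
 (LBINT x:{0..b}. (1 - x) * \<beta>' (v (s, x)) * r (s, x)
 - \<beta> (v (s, x)) * ?U s x + (1 - x) * \<beta> (v (s, x)) * d (s, x))
 - (1 - b) * \<beta> (v (s, b)) * ?U s b + \<beta> (v (s, 0)) * u0 s"
 using trans[OF e1 trans[OF e2 e3]] by (simp only: Rf_def[abs_def])
 qed
 qed
 show "(%s. LBINT x:{0..b}. (1 - x) * \<beta>' (v (s, x)) * q (s, x)) \<in> borel_measurable lborel"
 using borel_measurable_set_integral_snd[OF m1, of "{0..b}"] by simp
 have [measurable]: "(%s. v (s, b)) \<in> borel_measurable borel" "(%s. v (s, 0)) \<in> borel_measurable borel"
 "(%s. ?U s b) \<in> borel_measurable borel"
 using borel_measurable_section(2)[of v] borel_measurable_section(2)[of "%z. ?U (fst z) (snd z)" b]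
 by simp_all
 have [measurable]: "(%s. LBINT x:{0..b}. (1 - x) * \<beta>' (v (s, x)) * r (s, x)
 - \<beta> (v (s, x)) * ?U s x + (1 - x) * \<beta> (v (s, x)) * d (s, x)) \<in> borel_measurable borel"
 using borel_measurable_set_integral_snd[OF m2, of "{0..b}"] by simp
 show "(%s. (LBINT x:{0..b}. (1 - x) * \<beta>' (v (s, x)) * r (s, x)
 - \<beta> (v (s, x)) * ?U s x + (1 - x) * \<beta> (v (s, x)) * d (s, x))
 - (1 - b) * \<beta> (v (s, b)) * ?U s b + \<beta> (v (s, 0)) * u0 s) \<in> borel_measurable lborel"
 unfolding measurable_lborel1
 by (intro borel_measurable_add borel_measurable_diff borel_measurable_times borel_measurable_const) measurable
 qed simp
 finally show ?thesis .
qed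

section \<open>The one-sided kernel\<close>

definition moll :: "real => real" where
 "moll s = max 0 (6 * s * (1 - s))"

definition moll' :: "real => real" where
 "moll' s = (if 0 <= s \<and> s <= 1 then 6 - 12 * s else 0)"

lemma moll_eq: "moll s = indicat_real {0..1} s * (6 * s - 6 * s^2)"
proof (cases "s \<in> {0..1}")
 case True
 then have "0 <= 6 * s * (1 - s)" by simp
 then show ?thesis using True by (simp add: moll_def power2_eq_square algebra_simps)
next
 case False
 then have "6 * s * (1 - s) <= 0" by (auto simp: mult_le_0_iff not_le)
 then show ?thesis using False by (simp add: moll_def)
qed

lemma moll_zero: "s <= 0 \<or> 1 <= s ==> moll s = 0"
 by (cases "s \<in> {0..1}") (auto simp: moll_eq power2_eq_square)

lemma moll_bounds: "0 <= moll s" "moll s <= 6" "\<bar>moll s\<bar> <= 6"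
proof -
 have "6 * s - 6 * s^2 <= 6" if "s <= 1" using that zero_le_power2[of s] by linarith
 then show "moll s <= 6" by (auto simp: moll_eq indicator_def)
 then show "0 <= moll s" "\<bar>moll s\<bar> <= 6" by (auto simp: moll_def)
qed

lemma moll'_bound: "\<bar>moll' s\<bar> <= 6"
 by (auto simp: moll'_def)

lemma moll_measurable[measurable]: "moll \<in> borel_measurable borel" "moll' \<in> borel_measurable borel"
 unfolding moll_def[abs_def] moll'_def[abs_def] by measurable

lemma moll_continuous: "continuous_on A moll"
 unfolding moll_def[abs_def] by (intro continuous_intros)

lemma moll_DERIV:
 assumes "s ~= 0" "s ~= 1"
 shows "(moll has_real_derivative moll' s) (at s)"
proof -
 consider "s < 0" | "0 < s" "s < 1" | "1 < s" using assms by linarith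
 then show ?thesis
 proof cases
 case 1
 have "((%_. 0) has_real_derivative moll' s) (at s)" using 1 by (auto simp: moll'_def)
 then show ?thesis
 by (rule has_field_derivative_transform_within_open[where S="{..<0}"]) (use 1 in \<open>auto simp: moll_zero\<close>)
 next
 case 2
 have "((%s. 6 * s - 6 * s^2) has_real_derivative moll' s) (at s)"
 using 2 by (auto simp: moll'_def intro!: derivative_eq_intros)
 then show ?thesis
 by (rule has_field_derivative_transform_within_open[where S="{0<..<1}"]) (use 2 in \<open>auto simp: moll_eq\<close>)
 next
 case 3
 have "((%_. 0) has_real_derivative moll' s) (at s)" using 3 by (auto simp: moll'_def)
 then show ?thesis
 by (rule has_field_derivative_transform_within_open[where S="{1<..}"]) (use 3 in \<open>auto simp: moll_zero\<close>)
 qed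
qed

text \<open>The affine argument serves integration in the kernel variable itself and, with slope
  \<open>- (1 / ep)\<close>, integration in the centre of the average. The two kinks of the kernel
  correspond to the two points excluded from the fundamental theorem.\<close>

lemma moll_affine_integral:
 assumes "a <= b" "c ~= 0"
 shows "(LBINT s:{a..b}. moll' (p + c * s)) = (moll (p + c * b) - moll (p + c * a)) / c"
proof -
 have hi: "((%s. moll' (p + c * s)) has_integral moll (p + c * b) / c - moll (p + c * a) / c) {a..b}"
 proof (rule fundamental_theorem_of_calculus_interior_strong[where S="{-p/c, (1-p)/c}"])
 fix s assume s: "s \<in> {a<..<b} - {-p/c, (1-p)/c}"
 then have "p + c * s ~= 0" "p + c * s ~= 1" using \<open>c ~= 0\<close> by (auto simp: field_simps)
 then have "((%s. moll (p + c * s)) has_real_derivative moll' (p + c * s) * c) (at s)"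
 by (intro DERIV_chain2[where f=moll] moll_DERIV) (auto intro!: derivative_eq_intros)
 from DERIV_cdivide[OF this, of c]
 show "((%s. moll (p + c * s) / c) has_vector_derivative moll' (p + c * s)) (at s)"
 using \<open>c ~= 0\<close> by (simp add: has_real_derivative_iff_has_vector_derivative)
 next
 show "continuous_on {a..b} (%s. moll (p + c * s) / c)"
 using \<open>c ~= 0\<close> by (intro continuous_intros continuous_on_compose2[OF moll_continuous[of UNIV]]) auto
 qed (use assms in auto)
 have "set_integrable lborel {a..b} (%s. moll' (p + c * s))"
 proof -
 have "set_integrable lborel {a..b} (%s. moll' (p + c * s) * 1)"
 by (intro set_integrable_mult_bounded[where B=6] borel_integrable_atLeastAtMost') (auto simp: moll'_bound)
 then show ?thesis by simp
 qed
 from set_borel_integral_eq_integral(2)[OF this] integral_unique[OF hi]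
 show ?thesis by (simp add: diff_divide_distrib)
qed

lemma moll_lipschitz: "\<bar>moll y - moll x\<bar> <= 6 * \<bar>y - x\<bar>"
proof -
 have *: "\<bar>moll y - moll x\<bar> <= 6 * (y - x)" if "x <= y" for x y
 proof -
 have i: "set_integrable lborel {x..y} (%s. moll' s)"
 proof -
 have "set_integrable lborel {x..y} (%s. moll' s * 1)"
 by (intro set_integrable_mult_bounded[where B=6] borel_integrable_atLeastAtMost') (auto simp: moll'_bound)
 then show ?thesis by simp
 qed
 have "moll y - moll x = (LBINT s:{x..y}. moll' s)"
 using moll_affine_integral[OF that, of 1 0] by simp
 also have "\<bar>\<dots>\<bar> <= (LBINT s:{x..y}. 6)"
 by (rule set_integral_abs_le[OF i]) (auto simp: moll'_bound intro!: borel_integrable_atLeastAtMost')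
 also have "\<dots> = 6 * (y - x)" using that by (simp add: set_integral_const)
 finally show ?thesis .
 qed
 show ?thesis using *[of x y] *[of y x] by (cases "x <= y") (auto simp: abs_minus_commute)
qed

lemma integrable_moll:
 "integrable lborel moll" "integrable lborel moll'" "integrable lborel (%s. moll' s * s)"
proof -
 have i: "integrable lborel (indicat_real {0..1::real})"
 by (intro integrable_real_indicator) auto
 show "integrable lborel moll"
 by (rule L_integrable_bound[OF integrable_mult_right[OF i, of 6]])
 (auto simp: moll_zero moll_bounds indicator_def intro!: AE_I2)
 show "integrable lborel moll'"
 by (rule L_integrable_bound[OF integrable_mult_right[OF i, of 6]])
 (auto simp: moll'_def indicator_def intro!: AE_I2)
 show "integrable lborel (%s. moll' s * s)"
 proof (rule L_integrable_bound[OF integrable_mult_right[OF i, of 6]])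
 have "\<bar>moll' s\<bar> * \<bar>s\<bar> <= 6 * 1" if "0 <= s" "s <= 1" for s
 using that by (intro mult_mono moll'_bound) auto
 then show "AE s in lborel. norm (moll' s * s) <= norm (6 * indicat_real {0..1} s)"
 by (intro AE_I2) (auto simp: abs_mult indicator_def moll'_def)
 qed simp
qed

lemma integral_moll: "integral\<^sup>L lborel moll = 1" "(LBINT s. moll' s * s) = -1"
proof -
 have "(LBINT s. indicat_real {0..1} s *\<^sub>R (6 * s - 6 * s^2)) = (3 * 1^2 - 2 * 1^3) - (3 * 0^2 - 2 * 0^3 :: real)"
 by (rule integral_FTC_atLeastAtMost[where F="%s. 3 * s^2 - 2 * s^3"])
 (auto intro!: derivative_eq_intros continuous_intros simp: has_real_derivative_iff_has_vector_derivative[symmetric])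
 then show "integral\<^sup>L lborel moll = 1" by (simp add: moll_eq[abs_def])
 have "(LBINT s. indicat_real {0..1} s *\<^sub>R (6 * s - 12 * s^2)) = (3 * 1^2 - 4 * 1^3) - (3 * 0^2 - 4 * 0^3 :: real)"
 by (rule integral_FTC_atLeastAtMost[where F="%s. 3 * s^2 - 4 * s^3"])
 (auto intro!: derivative_eq_intros continuous_intros simp: has_real_derivative_iff_has_vector_derivative[symmetric])
 moreover have "moll' s * s = indicat_real {0..1} s *\<^sub>R (6 * s - 12 * s^2)" for s
 by (auto simp: moll'_def power2_eq_square algebra_simps)
 ultimately show "(LBINT s. moll' s * s) = -1" by simp
qed

text \<open>Spatial test functions with derivative \<open>tt'\<close> off a finite set.\<close>

definition lip_test :: "(real => real) => (real => real) => bool" where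
 "lip_test tt tt' \<longleftrightarrow> tt \<in> borel_measurable borel \<and> tt' \<in> borel_measurable borel \<and>
 (\<exists>L. L-lipschitz_on {0..1} tt \<and> (\<forall>x. \<bar>tt' x\<bar> <= L) \<and> (\<forall>x. \<bar>tt x\<bar> <= L)) \<and>
 (\<exists>S. finite S \<and> (\<forall>x\<in>{0<..<1} - S. (tt has_real_derivative tt' x) (at x)))"

lemma lip_test_moll:
 assumes "0 < ep"
 shows "lip_test (%y. moll ((y - x) / ep) / ep) (%y. moll' ((y - x) / ep) / ep^2)"
 unfolding lip_test_def
proof (intro conjI)
 \<comment> \<open>\<open>6 / ep^2\<close> bounds the slope and the derivative,
   \<open>6 / ep\<close> the values; their sum is one constant for all three demands.\<close>
 show "\<exists>L. L-lipschitz_on {0..1} (%y. moll ((y - x) / ep) / ep) \<and> (\<forall>y. \<bar>moll' ((y - x) / ep) / ep^2\<bar> <= L)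
 \<and> (\<forall>y. \<bar>moll ((y - x) / ep) / ep\<bar> <= L)"
 proof (intro exI[of _ "6 / ep^2 + 6 / ep"] conjI allI lipschitz_onI)
 fix y z :: real
 have "\<bar>moll ((y - x) / ep) - moll ((z - x) / ep)\<bar> <= 6 * \<bar>(y - x) / ep - (z - x) / ep\<bar>"
 by (rule moll_lipschitz)
 also have "\<dots> = 6 * \<bar>y - z\<bar> / ep" using assms by (simp add: diff_divide_distrib[symmetric] abs_divide)
 finally have "\<bar>moll ((y - x) / ep) - moll ((z - x) / ep)\<bar> / ep <= 6 * \<bar>y - z\<bar> / ep / ep"
 using assms by (intro divide_right_mono) auto
 then have "\<bar>moll ((y - x) / ep) / ep - moll ((z - x) / ep) / ep\<bar> <= 6 * \<bar>y - z\<bar> / ep / ep"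
 using assms by (simp add: diff_divide_distrib[symmetric] abs_divide)
 also have "\<dots> = 6 / ep^2 * \<bar>y - z\<bar>" by (simp add: power2_eq_square)
 also have "\<dots> <= (6 / ep^2 + 6 / ep) * \<bar>y - z\<bar>" using assms by (intro mult_right_mono) auto
 finally show "dist (moll ((y - x) / ep) / ep) (moll ((z - x) / ep) / ep) <= (6 / ep^2 + 6 / ep) * dist y z"
 by (simp add: dist_real_def)
 next
 fix y
 have "\<bar>moll' ((y - x) / ep) / ep^2\<bar> <= 6 / ep^2"
 using assms moll'_bound[of "(y - x) / ep"] by (simp add: abs_divide divide_right_mono)
 then show "\<bar>moll' ((y - x) / ep) / ep^2\<bar> <= 6 / ep^2 + 6 / ep" using assms by (simp add: add_increasing2)
 have "\<bar>moll ((y - x) / ep) / ep\<bar> <= 6 / ep"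
 using assms moll_bounds(3)[of "(y - x) / ep"] by (simp add: abs_divide divide_right_mono)
 then show "\<bar>moll ((y - x) / ep) / ep\<bar> <= 6 / ep^2 + 6 / ep" using assms by (simp add: add_increasing)
 qed (use assms in auto)
 show "\<exists>S. finite S \<and> (\<forall>y\<in>{0<..<1} - S. ((%y. moll ((y - x) / ep) / ep) has_real_derivative moll' ((y - x) / ep) / ep^2) (at y))"
 proof (intro exI[of _ "{x, x + ep}"] conjI ballI)
 fix y assume y: "y \<in> {0<..<1} - {x, x + ep}"
 then have "(y - x) / ep ~= 0" "(y - x) / ep ~= 1" using assms by (auto simp: field_simps)
 then have "((%y. moll ((y - x) / ep)) has_real_derivative moll' ((y - x) / ep) * (1 / ep)) (at y)"
 using assms by (intro DERIV_chain2[where f=moll] moll_DERIV) (auto intro!: derivative_eq_intros)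
 from DERIV_cdivide[OF this, of ep]
 show "((%y. moll ((y - x) / ep) / ep) has_real_derivative moll' ((y - x) / ep) / ep^2) (at y)"
 by (simp add: power2_eq_square)
 qed simp
qed measurable

lemma emeasure_rectangle_finite: "emeasure lborel ({a..b} \<times> {c..d} :: (real \<times> real) set) < top"
proof -
 have "{a..b} \<times> {c..d} = cbox (a, c) (b, d)" by (simp add: cbox_Pair_eq)
 then show ?thesis using emeasure_lborel_cbox_finite[of "(a, c)" "(b, d)"] by simp
qed

section \<open>Mollification of a scalar balance law\<close>

text \<open>Testing with functions of \<open>x\<close> alone and integrating in time already makes
  every spatial average of \<open>w\<close> absolutely continuous in time. All functions live on the
  whole line or plane, \<open>w\<close> and \<open>h\<close> vanish off the spatial interval and the
  bounds hold everywhere, so that Lebesgue measure can be used without restriction.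
  \<open>g0\<close> and \<open>g1\<close> are the traces at the two ends; the outer normal accounts
  for their opposite signs.\<close>

locale balance_law =
 fixes T C :: real and w d h :: "real \<times> real => real" and u0 g0 g1 :: "real => real"
 assumes T: "0 < T"
 and w_measurable[measurable]: "w \<in> borel_measurable borel"
 and w_le: "!!z. \<bar>w z\<bar> <= C"
 and w_0: "!!t x. \<not> (0 < x \<and> x < 1 \<and> 0 <= t \<and> t <= T) ==> w (t, x) = 0"
 and d: "integrable lborel d"
 and h: "integrable lborel h" and h_0: "!!t x. \<not> (0 < x \<and> x < 1) ==> h (t, x) = 0"
 and u0: "integrable lborel u0"
 and g_measurable[measurable]: "g0 \<in> borel_measurable borel" "g1 \<in> borel_measurable borel"
 and g_le: "!!t. \<bar>g0 t\<bar> <= C" "!!t. \<bar>g1 t\<bar> <= C"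
 and balance: "!!tt tt' t. lip_test tt tt' ==> 0 <= t ==> t <= T ==>
 (LBINT x. w (t, x) * tt x) - (LBINT x. w (0, x) * tt x) =
 (LBINT s:{0..t}. (LBINT x. w (s, x) * vel u0 d s x * tt' x + h (s, x) * tt x)
 - g1 s * vel u0 d s 1 * tt 1 + g0 s * u0 s * tt 0)"
begin

lemma C0: "0 <= C" using w_le[of "(0,0)"] by linarith

lemma d_measurable[measurable]: "d \<in> borel_measurable borel" and h_measurable[measurable]: "h \<in> borel_measurable borel"
 and u0_measurable[measurable]: "u0 \<in> borel_measurable borel"
 using d h u0 by auto

lemma vel_measurable'[measurable]: "(%z. vel u0 d (fst z) (snd z)) \<in> borel_measurable borel"
 by measurable

lemma w_integrable: "integrable lborel w"
proof (rule L_integrable_bound)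
 show "integrable lborel (%z :: real \<times> real. C * indicat_real ({0..T} \<times> {0..1}) z)"
 by (intro integrable_mult_right integrable_real_indicator)
 (simp_all add: borel_Times emeasure_rectangle_finite)
 show "AE z in lborel. norm (w z) <= norm (C * indicat_real ({0..T} \<times> {0..1}) z)"
 proof (rule AE_I2)
 fix z :: "real \<times> real"
 show "norm (w z) <= norm (C * indicat_real ({0..T} \<times> {0..1}) z)"
 proof (cases z)
 case (Pair t x)
 then show ?thesis using w_le[of z] w_0[of x t] C0 by (cases "0 < x \<and> x < 1 \<and> 0 <= t \<and> t <= T") (auto simp: indicator_def)
 qed
 qed
qed simp

lemma w_integrable_section: "integrable lborel (%x. w (t, x))"
proof (rule L_integrable_bound)
 show "integrable lborel (%x. C * indicat_real {0..1::real} x)"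
 by (intro integrable_mult_right integrable_real_indicator) auto
 show "AE x in lborel. norm (w (t, x)) <= norm (C * indicat_real {0..1} x)"
 proof (rule AE_I2)
 fix x
 show "norm (w (t, x)) <= norm (C * indicat_real {0..1} x)"
 using w_le[of "(t, x)"] w_0[of x t] C0 by (auto simp: indicator_def)
 qed
qed (use borel_measurable_section(1)[OF w_measurable] in simp)

lemma w_vel_integrable: "integrable lborel (%z. w z * vel u0 d (fst z) (snd z))"
proof -
 have "integrable lborel (%z. w z * (indicat_real (UNIV \<times> {0..1}) z *\<^sub>R vel u0 d (fst z) (snd z)))"
 using integrable_vel_box[OF u0 d, of 0 1] unfolding set_integrable_def
 by (rule integrable_mult_bounded[where B=C]) (auto simp: w_le)
 also have "(%z. w z * (indicat_real (UNIV \<times> {0..1}) z *\<^sub>R vel u0 d (fst z) (snd z))) = (%z. w z * vel u0 d (fst z) (snd z))"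
 proof
 fix z :: "real \<times> real"
 show "w z * (indicat_real (UNIV \<times> {0..1}) z *\<^sub>R vel u0 d (fst z) (snd z)) = w z * vel u0 d (fst z) (snd z)"
 proof (cases z)
 case (Pair t x)
 then show ?thesis using w_0[of x t] by (cases "0 < x \<and> x < 1") (auto simp: indicator_def)
 qed
 qed
 finally show ?thesis .
qed

lemma balance_integrand_integrable:
 assumes "lip_test tt tt'"
 shows "integrable lborel (%z. w z * vel u0 d (fst z) (snd z) * tt' (snd z) + h z * tt (snd z))"
proof -
 obtain L where L: "!!x. \<bar>tt x\<bar> <= L" "!!x. \<bar>tt' x\<bar> <= L" and [measurable]: "tt \<in> borel_measurable borel" "tt' \<in> borel_measurable borel"
 using assms by (auto simp: lip_test_def)
 have "integrable lborel (%z. tt' (snd z) * (w z * vel u0 d (fst z) (snd z)))"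
 by (rule integrable_mult_bounded[OF w_vel_integrable, where B=L]) (auto simp: L)
 moreover have "integrable lborel (%z. tt (snd z) * h z)"
 by (rule integrable_mult_bounded[OF h, where B=L]) (auto simp: L)
 ultimately show ?thesis by (simp add: mult_ac)
qed

definition mv :: "real => real \<times> real => real" where
 "mv ep z = (LBINT s. w (z + (0, ep * s)) * moll s)"

text \<open>The \<open>x\<close>-derivative of \<open>mv ep\<close>, with the derivative falling on
  the kernel; the minus sign comes from differentiating with respect to the centre.\<close>

definition mvx :: "real => real \<times> real => real" where
 "mvx ep z = - (LBINT y. w (fst z, y) * (moll' ((y - snd z) / ep) / ep^2))"

text \<open>The time derivative of \<open>mv ep\<close>: the interior part of the balance law for
  the test function \<open>moll ((y - x) / ep) / ep\<close>.\<close>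

definition mq :: "real => real \<times> real => real" where
 "mq ep z = (LBINT y. w (fst z, y) * vel u0 d (fst z) y * (moll' ((y - snd z) / ep) / ep^2)
 + h (fst z, y) * (moll ((y - snd z) / ep) / ep))"

text \<open>The last two terms are the errors of mollification; the second one is the commutator, in which the
 increment of the velocity is written as an average of its derivative.\<close>

definition mr :: "real => real \<times> real => real" where
 "mr ep z = h z - w z * d z + (LBINT s. (h (z + (0, ep * s)) - h z) * moll s)
 + (LBINT p. moll' (fst p) * fst p * indicat_real {0<..1} (snd p) *
 (w (z + (0, ep * fst p)) * d (z + (0, ep * (fst p * snd p))) - w z * d z))"

lemma mv_eq:
 assumes "0 < ep"
 shows "mv ep (t, x) = (LBINT y. w (t, y) * (moll ((y - x) / ep) / ep))"
 using lborel_integral_real_affine[of ep "%y. w (t, y) * (moll ((y - x) / ep) / ep)" x] assms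
 by (simp add: mv_def)

lemma w_moll_integrable: "integrable lborel (%s. w (z + (0, ep * s)) * moll s)"
proof (rule integrable_mult_bounded[OF integrable_moll(1), where B=C])
 show "(%s. w (z + (0, ep * s))) \<in> borel_measurable lborel"
 proof -
 have "(%s. z + (0, ep * s)) \<in> borel_measurable borel"
 by (intro borel_measurable_continuous_onI continuous_intros)
 then show ?thesis using measurable_compose[OF _ w_measurable] by simp
 qed
qed (simp add: w_le)

lemma mv_le: "\<bar>mv ep z\<bar> <= C"
proof -
 have "\<bar>mv ep z\<bar> <= (LBINT s. \<bar>w (z + (0, ep * s)) * moll s\<bar>)"
 unfolding mv_def by (rule integral_abs_bound)
 also have "\<dots> <= (LBINT s. C * moll s)"
 using w_moll_integrable[of z ep] integrable_moll(1)
 by (intro integral_mono integrable_abs integrable_mult_right) (auto simp: abs_mult moll_bounds intro!: mult_right_mono w_le)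
 also have "\<dots> = C" by (simp add: integral_moll)
 finally show ?thesis .
qed

lemma mvx_le:
 assumes "0 < ep" shows "\<bar>mvx ep z\<bar> <= 6 * C / ep^2"
proof -
 have i: "integrable lborel (%x::real. 6 * C / ep^2 * indicat_real {0..1} x)"
 by (intro integrable_mult_right integrable_real_indicator) auto
 have "\<bar>mvx ep z\<bar> <= (LBINT y. \<bar>w (fst z, y) * (moll' ((y - snd z) / ep) / ep^2)\<bar>)"
 unfolding mvx_def abs_minus_cancel by (rule integral_abs_bound)
 also have "\<dots> <= (\<integral>y. 6 * C / ep^2 * indicat_real {0..1} y \<partial>(lborel :: real measure))"
 proof (rule integral_mono'[OF i])
 fix y :: real
 show "\<bar>w (fst z, y) * (moll' ((y - snd z) / ep) / ep^2)\<bar> <= 6 * C / ep^2 * indicat_real {0..1} y"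
 proof (cases "0 < y \<and> y < 1")
 case True
 have "\<bar>w (fst z, y)\<bar> * \<bar>moll' ((y - snd z) / ep)\<bar> <= C * 6"
 by (intro mult_mono w_le moll'_bound C0) auto
 then have "\<bar>w (fst z, y)\<bar> * \<bar>moll' ((y - snd z) / ep)\<bar> / ep^2 <= C * 6 / ep^2"
 by (intro divide_right_mono) auto
 then show ?thesis using True by (simp add: abs_mult mult.commute)
 qed (use w_0 C0 assms in \<open>auto simp: indicator_def\<close>)
 qed (use C0 in auto)
 also have "\<dots> = 6 * C / ep^2" by simp
 finally show ?thesis .
qed

lemma pair_integral_measurable:
 fixes F :: "'a::euclidean_space \<times> 'b::euclidean_space => real"
 assumes "F \<in> borel_measurable borel"
 shows "(%z. \<integral>s. F (z, s) \<partial>lborel) \<in> borel_measurable borel"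
proof -
 have [measurable]: "F \<in> borel_measurable (borel \<Otimes>\<^sub>M lborel)"
 using assms by (simp add: borel_prod[symmetric] cong: measurable_cong_sets)
 show ?thesis by measurable
qed

lemma mv_measurable[measurable]: "mv ep \<in> borel_measurable borel"
proof -
 have "(%p :: (real \<times> real) \<times> real. fst p + (0, ep * snd p)) \<in> borel_measurable borel"
 by (intro borel_measurable_continuous_onI continuous_intros)
 then have "(%p :: (real \<times> real) \<times> real. w (fst p + (0, ep * snd p)) * moll (snd p)) \<in> borel_measurable borel"
 by measurable
 from pair_integral_measurable[OF this] show ?thesis by (simp add: mv_def[abs_def])
qed

lemma mvx_measurable[measurable]: "mvx ep \<in> borel_measurable borel"
proof -
 have "(%p :: (real \<times> real) \<times> real. (fst (fst p), snd p)) \<in> borel_measurable borel"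
 by (intro borel_measurable_continuous_onI continuous_intros)
 then have "(%p :: (real \<times> real) \<times> real. w (fst (fst p), snd p) * (moll' ((snd p - snd (fst p)) / ep) / ep^2)) \<in> borel_measurable borel"
 by measurable
 from pair_integral_measurable[OF this] show ?thesis by (simp add: mvx_def[abs_def])
qed

lemma mq_measurable[measurable]: "mq ep \<in> borel_measurable borel"
proof -
 have [measurable]: "(%p :: (real \<times> real) \<times> real. (fst (fst p), snd p)) \<in> borel_measurable borel"
 by (intro borel_measurable_continuous_onI continuous_intros)
 have "(%p :: (real \<times> real) \<times> real. vel u0 d (fst (fst p)) (snd p)) \<in> borel_measurable borel"
 using measurable_compose[OF \<open>(%p. (fst (fst p), snd p)) \<in> _\<close> vel_measurable'] by simp
 then have "(%p :: (real \<times> real) \<times> real. w (fst (fst p), snd p) * vel u0 d (fst (fst p)) (snd p) * (moll' ((snd p - snd (fst p)) / ep) / ep^2)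
 + h (fst (fst p), snd p) * (moll ((snd p - snd (fst p)) / ep) / ep)) \<in> borel_measurable borel"
 by measurable
 from pair_integral_measurable[OF this] show ?thesis by (simp add: mq_def[abs_def])
qed

text \<open>For these \<open>x\<close>, the value 0 included, the shifted kernel vanishes at both
  ends of [0, 1], so no boundary flux enters and the balance law reduces to
  \<open>mq\<close>.\<close>

lemma mv_time:
 assumes "0 < ep" "0 <= x" "x <= 1 - ep" "0 <= t" "t <= T"
 shows "ac_on t (%s. mv ep (s, x)) (%s. mq ep (s, x))"
proof -
 let ?tt = "%y. moll ((y - x) / ep) / ep" and ?tt' = "%y. moll' ((y - x) / ep) / ep^2"
 note lt = lip_test_moll[OF assms(1), of x]
 have "1 <= (1 - x) / ep" "(0 - x) / ep <= 0" using assms by (auto simp: field_simps)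
 then have 0: "?tt 1 = 0" "?tt 0 = 0" by (simp_all add: moll_zero)
 have "integrable lborel (%s. mq ep (s, x))"
 using integrable_lborel_pair(3)[OF balance_integrand_integrable[OF lt]] by (simp add: mq_def)
 then have "set_integrable lborel {0..t} (%s. mq ep (s, x))"
 by (intro set_integrable_of_integrable) auto
 moreover have "mv ep (s, x) - mv ep (0, x) = (LBINT r:{0..s}. mq ep (r, x))" if "s \<in> {0..t}" for s
 using balance[OF lt, of s] that assms 0 by (simp add: mv_eq mq_def)
 ultimately show ?thesis by (simp add: ac_on_def)
qed

text \<open>Fubini in the centre and in the integration variable. The derivative falls on the
  kernel, so boundedness and measurability of \<open>w\<close> are enough.\<close>

lemma mv_space:
 assumes "0 < ep"
 shows "ac_on b (%x. mv ep (t, x)) (%x. mvx ep (t, x))"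
proof -
 have "mv ep (t, x) - mv ep (t, 0) = (LINT \<xi>:{0..x}|lborel. mvx ep (t, \<xi>))" if x: "0 <= x" for x
 proof -
 let ?f = "%z. - (w (t, snd z) * (moll' ((snd z - fst z) / ep) / ep^2))"
 have S: "set_integrable lborel ({0..x} \<times> UNIV) ?f"
 unfolding set_integrable_def
 proof (rule L_integrable_bound)
 show "integrable lborel (%z :: real \<times> real. C * 6 / ep^2 * indicat_real ({0..x} \<times> {0..1}) z)"
 by (intro integrable_mult_right integrable_real_indicator)
 (simp_all add: borel_Times emeasure_rectangle_finite)
 have wt: "(%z. w (t, snd z)) \<in> borel_measurable (borel :: (real \<times> real) measure)"
 using measurable_compose[OF _ borel_measurable_section(1)[OF w_measurable, of t], of snd] by simp
 then show "(%z. indicat_real ({0..x} \<times> UNIV) z *\<^sub>R ?f z) \<in> borel_measurable lborel"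
 unfolding indicator_times by measurable
 have "\<bar>w (t, y)\<bar> * \<bar>moll' s\<bar> <= C * 6" for y s
 by (intro mult_mono w_le moll'_bound C0) auto
 then have "\<bar>w (t, y)\<bar> * \<bar>moll' s\<bar> / ep^2 <= C * 6 / ep^2" for y s
 by (intro divide_right_mono) auto
 then have *: "\<bar>w (t, y)\<bar> * \<bar>moll' s\<bar> / ep^2 <= C * 6 / ep^2 * indicat_real {0..1} y" for y s
 using w_0[of y t] by (cases "0 < y \<and> y < 1") (auto simp: indicator_def C0)
 show "AE z in lborel. norm (indicat_real ({0..x} \<times> UNIV) z *\<^sub>R ?f z) <= norm (C * 6 / ep^2 * indicat_real ({0..x} \<times> {0..1}) z)"
 proof (rule AE_I2)
 fix z :: "real \<times> real"
 show "norm (indicat_real ({0..x} \<times> UNIV) z *\<^sub>R ?f z) <= norm (C * 6 / ep^2 * indicat_real ({0..x} \<times> {0..1}) z)"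
 using *[of "snd z" "(snd z - fst z) / ep"] C0
 by (cases "fst z \<in> {0..x}"; cases "snd z \<in> {0..1}") (auto simp: indicator_times abs_mult indicator_def)
 qed
 qed
 have inner: "(LINT \<xi>:{0..x}|lborel. ?f (\<xi>, y)) = w (t, y) * ((moll ((y - x) / ep) - moll (y / ep)) / ep)" for y
 proof -
 have "(LINT \<xi>:{0..x}|lborel. moll' ((y - \<xi>) / ep)) = - ep * (moll ((y - x) / ep) - moll (y / ep))"
 proof -
 have "y / ep + - (1 / ep) * \<xi> = (y - \<xi>) / ep" for \<xi> by (simp add: diff_divide_distrib)
 then show ?thesis using moll_affine_integral[OF x, of "- (1 / ep)" "y / ep"] assms by (simp add: mult.commute)
 qed
 moreover have "(LINT \<xi>:{0..x}|lborel. ?f (\<xi>, y)) = - w (t, y) / ep^2 * (LINT \<xi>:{0..x}|lborel. moll' ((y - \<xi>) / ep))"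
 proof -
 have "(%\<xi>. ?f (\<xi>, y)) = (%\<xi>. - w (t, y) / ep^2 * moll' ((y - \<xi>) / ep))"
 by (simp add: fun_eq_iff)
 then show ?thesis by (simp only: set_integral_mult_right)
 qed
 ultimately show ?thesis using assms by (simp add: power2_eq_square)
 qed
 have i: "integrable lborel (%y. w (t, y) * (moll ((y - x) / ep) / ep))" for x
 proof -
 have "integrable lborel (%y. (moll ((y - x) / ep) / ep) * w (t, y))"
 by (rule integrable_mult_bounded[OF w_integrable_section, where B="6/ep"])
 (use assms moll_bounds in \<open>auto simp: divide_right_mono\<close>)
 then show ?thesis by (simp add: mult.commute)
 qed
 have "(LINT \<xi>:{0..x}|lborel. mvx ep (t, \<xi>)) = (LINT \<xi>:{0..x}|lborel. LBINT y:UNIV. ?f (\<xi>, y))"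
 by (simp add: mvx_def set_lebesgue_integral_def)
 also have "\<dots> = (LBINT y:UNIV. LINT \<xi>:{0..x}|lborel. ?f (\<xi>, y))"
 using set_integral_lborel_pair(3,4)[OF S] by simp
 also have "\<dots> = (LBINT y. w (t, y) * (moll ((y - x) / ep) / ep) - w (t, y) * (moll ((y - 0) / ep) / ep))"
 unfolding inner by (simp add: set_lebesgue_integral_def diff_divide_distrib right_diff_distrib)
 also have "\<dots> = mv ep (t, x) - mv ep (t, 0)"
 unfolding mv_eq[OF assms] by (rule L_integral_diff[OF i i])
 finally show ?thesis ..
 qed
 moreover have "set_integrable lborel {0..b} (%x. mvx ep (t, x))"
 proof -
 have "set_integrable lborel {0..b} (%x. mvx ep (t, x) * 1)"
 by (intro set_integrable_mult_bounded[where B="6*C/ep^2"] borel_integrable_atLeastAtMost' borel_measurable_section mvx_le assms)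
 auto
 then show ?thesis by simp
 qed
 ultimately show ?thesis by (simp add: ac_on_def)
qed

end

section \<open>The commutator estimate\<close>

text \<open>The direction \<open>a\<close> permits averaging along the second coordinate of the
  plane as well as on the line; the latter gives convergence on each time slice separately.\<close>

lemma mollify_L1:
 fixes f :: "'a::euclidean_space => real" and a :: 'a and e :: "nat => real"
 assumes f: "integrable lborel f" and e: "e \<longlonglongrightarrow> 0"
 shows "integrable lborel (%z. \<integral>s. (f (z + (e n * s) *\<^sub>R a) - f z) * moll s \<partial>lborel)"
 and "AE z in lborel. integrable lborel (%s. (f (z + (e n * s) *\<^sub>R a) - f z) * moll s)"
 and "(%n. \<integral>z. \<bar>\<integral>s. (f (z + (e n * s) *\<^sub>R a) - f z) * moll s \<partial>lborel\<bar> \<partial>lborel) \<longlonglongrightarrow> 0"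
proof -
 define F where "F n z s = (f (z + (e n * s) *\<^sub>R a) - f z) * moll s" for n z s
 have [measurable]: "f \<in> borel_measurable borel" using f by auto
 have 1: "(%p. F n (fst p) (snd p)) \<in> borel_measurable borel" for n
 proof -
 have [measurable]: "(%p :: 'a \<times> real. fst p + (e n * snd p) *\<^sub>R a) \<in> borel_measurable borel"
 by (intro borel_measurable_continuous_onI continuous_intros)
 show ?thesis unfolding F_def by measurable
 qed
 have tr: "integrable lborel (%z. f (z + c))" for c by (rule integrable_lborel_translate(1)[OF f])
 have 2: "integrable lborel (%z. F n z s)" for n s
 unfolding F_def using tr f by auto
 have eq: "(LBINT z. \<bar>F n z s\<bar>) = (LBINT z. \<bar>f (z + (e n * s) *\<^sub>R a) - f z\<bar>) * moll s" for n s
 by (simp add: F_def abs_mult moll_bounds)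
 have 3: "(LBINT z. \<bar>F n z s\<bar>) <= 2 * (LBINT z. \<bar>f z\<bar>) * moll s" for n s
 proof -
 have "(LBINT z. \<bar>f (z + (e n * s) *\<^sub>R a) - f z\<bar>) <= (LBINT z. \<bar>f (z + (e n * s) *\<^sub>R a)\<bar> + \<bar>f z\<bar>)"
 using tr f by (intro integral_mono) auto
 also have "\<dots> = (LBINT z. \<bar>f (z + (e n * s) *\<^sub>R a)\<bar>) + (LBINT z. \<bar>f z\<bar>)"
 using tr f by (intro L_integral_add) auto
 also have "(LBINT z. \<bar>f (z + (e n * s) *\<^sub>R a)\<bar>) = (LBINT z. \<bar>f z\<bar>)"
 using integrable_lborel_translate(2)[of "%z. \<bar>f z\<bar>" "(e n * s) *\<^sub>R a"] f by simp
 finally show ?thesis unfolding eq by (intro mult_right_mono) (auto simp: moll_bounds)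
 qed
 have 4: "integrable lborel (%s. 2 * (LBINT z. \<bar>f z\<bar>) * moll s)"
 using integrable_moll(1) by simp
 have 5: "(%n. \<integral>z. \<bar>F n z s\<bar> \<partial>lborel) \<longlonglongrightarrow> 0" for s
 proof -
 have "(%n. (e n * s) *\<^sub>R a) \<longlonglongrightarrow> (0 * s) *\<^sub>R a" by (intro tendsto_intros e)
 then have "(%n. (e n * s) *\<^sub>R a) \<longlonglongrightarrow> 0" by simp
 from tendsto_mult_right[OF tendsto_translate_L1[OF f this], of "moll s"]
 show ?thesis unfolding eq by simp
 qed
 note R = tendsto_integral_of_averages[OF 1 2 3 4 5, unfolded F_def]
 show "integrable lborel (%z. \<integral>s. (f (z + (e n * s) *\<^sub>R a) - f z) * moll s \<partial>lborel)"
 "AE z in lborel. integrable lborel (%s. (f (z + (e n * s) *\<^sub>R a) - f z) * moll s)"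
 "(%n. \<integral>z. \<bar>\<integral>s. (f (z + (e n * s) *\<^sub>R a) - f z) * moll s \<partial>lborel\<bar> \<partial>lborel) \<longlonglongrightarrow> 0"
 by (rule R)+
qed

text \<open>Weight of the commutator: the difference quotient of the velocity times
  \<open>moll' s\<close> is the average of \<open>d\<close>, weighted by \<open>ker\<close>, over
  the intermediate points reached with \<open>s * \<tau>\<close>. Its mass is that of
  \<open>s * moll' s\<close>, namely -1, and produces the term \<open>- w * d\<close> of the
  limit.\<close>

definition ker :: "real \<times> real => real" where
 "ker p = moll' (fst p) * fst p * indicat_real {0<..1} (snd p)"

lemma ker_measurable[measurable]: "ker \<in> borel_measurable borel"
 unfolding ker_def[abs_def] by measurable

lemma ker_integrable: "integrable lborel ker"
proof (rule L_integrable_bound)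
 show "integrable lborel (%p :: real \<times> real. 6 * indicat_real ({0..1} \<times> {0..1}) p)"
 by (intro integrable_mult_right integrable_real_indicator) (simp_all add: borel_Times emeasure_rectangle_finite)
 have *: "\<bar>moll' s\<bar> * \<bar>s\<bar> <= 6 * 1" if "0 <= s" "s <= 1" for s
 using that by (intro mult_mono moll'_bound) auto
 show "AE p in lborel. norm (ker p) <= norm (6 * indicat_real ({0..1} \<times> {0..1}) p)"
 proof (rule AE_I2)
 fix p :: "real \<times> real"
 show "norm (ker p) <= norm (6 * indicat_real ({0..1} \<times> {0..1}) p)"
 proof (cases p)
 case (Pair a b)
 then show ?thesis using *[of a] by (cases "a \<in> {0..1}"; cases "b \<in> {0..1}")
 (auto simp: ker_def abs_mult indicator_times indicator_def moll'_def)
 qed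
 qed
qed simp

lemma ker_integral: "integral\<^sup>L lborel ker = -1"
proof -
 have 1: "measure lborel {0<..1::real} = 1" by (simp add: measure_def)
 have "integral\<^sup>L lborel ker = (LBINT s. (LBINT t. ker (s, t)))"
 using integrable_lborel_pair(5)[OF ker_integrable] by simp
 also have "\<dots> = (LBINT s. moll' s * s)"
 by (simp add: ker_def 1)
 finally show ?thesis by (simp add: integral_moll)
qed

context balance_law
begin

lemma mr_eq: "mr ep z = h z - w z * d z + (LBINT s. (h (z + (0, ep * s)) - h z) * moll s)
 + (LBINT p. ker p * (w (z + (0, ep * fst p)) * d (z + (0, ep * (fst p * snd p))) - w z * d z))"
 by (simp add: mr_def ker_def)

text \<open>The DiPerna-Lions argument. For a fixed \<open>p\<close>, change the shift of
  \<open>d\<close> first, where \<open>w\<close> enters only through its bound, and then the shift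
  of \<open>w\<close> against the fixed integrable \<open>d\<close>, where L1 convergence and
  boundedness of \<open>w\<close> suffice. The average over \<open>p\<close> is then covered by
  domination.\<close>

lemma commutator_L1:
 fixes e :: "nat => real"
 assumes e: "e \<longlonglongrightarrow> 0"
 shows "integrable lborel (%z. \<integral>p. ker p * (w (z + (0, e n * fst p)) * d (z + (0, e n * (fst p * snd p))) - w z * d z) \<partial>lborel)"
 and "AE z in lborel. integrable lborel (%p. ker p * (w (z + (0, e n * fst p)) * d (z + (0, e n * (fst p * snd p))) - w z * d z))"
 and "(%n. \<integral>z. \<bar>\<integral>p. ker p * (w (z + (0, e n * fst p)) * d (z + (0, e n * (fst p * snd p))) - w z * d z) \<partial>lborel\<bar> \<partial>lborel) \<longlonglongrightarrow> 0"
proof -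
 define G where "G n z p = w (z + (0, e n * fst p)) * d (z + (0, e n * (fst p * snd p))) - w z * d z"
 for n and z p :: "real \<times> real"
 define F where "F n z p = ker p * G n z p" for n z p
 have m: "(%p. G n (fst p) (snd p)) \<in> borel_measurable borel" for n
 proof -
 have [measurable]: "(%p :: (real \<times> real) \<times> (real \<times> real). fst p + (0, e n * fst (snd p))) \<in> borel_measurable borel"
 "(%p :: (real \<times> real) \<times> (real \<times> real). fst p + (0, e n * (fst (snd p) * snd (snd p)))) \<in> borel_measurable borel"
 by (intro borel_measurable_continuous_onI continuous_intros)+
 show ?thesis unfolding G_def by measurable
 qed
 have 1: "(%p. F n (fst p) (snd p)) \<in> borel_measurable borel" for n
 unfolding F_def using m[of n] by measurable
 have trw: "integrable lborel (%z. w (z + c))" and trd: "integrable lborel (%z. d (z + c))" for c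
 by (rule integrable_lborel_translate(1)[OF w_integrable], rule integrable_lborel_translate(1)[OF d])
 have wd: "integrable lborel (%z. w (z + c) * d (z + c'))" for c c'
 by (rule integrable_mult_bounded[OF trd, where B=C]) (use trw in \<open>auto simp: w_le\<close>)
 have wd0: "integrable lborel (%z. w z * d z)" using wd[of 0 0] by simp
 have Gi: "integrable lborel (%z. G n z p)" for n p
 unfolding G_def using wd wd0 by auto
 have 2: "integrable lborel (%z. F n z p)" for n p
 unfolding F_def using Gi by auto
 have eq: "(LBINT z. \<bar>F n z p\<bar>) = \<bar>ker p\<bar> * (LBINT z. \<bar>G n z p\<bar>)" for n p
 by (simp add: F_def abs_mult)
 have Cd: "\<bar>w z * y\<bar> <= C * \<bar>y\<bar>" for z y by (simp add: abs_mult mult_right_mono w_le)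
 have dnorm: "(LBINT z. \<bar>d (z + c)\<bar>) = (LBINT z. \<bar>d z\<bar>)" for c
 using integrable_lborel_translate(2)[of "%z. \<bar>d z\<bar>" c] d by simp
 have 3: "(LBINT z. \<bar>F n z p\<bar>) <= \<bar>ker p\<bar> * (2 * C * (LBINT z. \<bar>d z\<bar>))" for n p
 proof -
 let ?c = "(0, e n * (fst p * snd p))"
 have "(LBINT z. \<bar>G n z p\<bar>) <= (LBINT z. C * \<bar>d (z + ?c)\<bar> + C * \<bar>d z\<bar>)"
 proof (rule integral_mono)
 show "\<bar>G n z p\<bar> <= C * \<bar>d (z + ?c)\<bar> + C * \<bar>d z\<bar>" for z
 unfolding G_def using Cd[of "z + (0, e n * fst p)" "d (z + ?c)"] Cd[of z "d z"] by linarith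
 qed (use Gi trd d in auto)
 also have "\<dots> = C * (LBINT z. \<bar>d (z + ?c)\<bar>) + C * (LBINT z. \<bar>d z\<bar>)"
 using trd d by simp
 also have "\<dots> = 2 * C * (LBINT z. \<bar>d z\<bar>)" by (simp only: dnorm)
 finally show ?thesis unfolding eq by (intro mult_left_mono) auto
 qed
 have 4: "integrable lborel (%p. \<bar>ker p\<bar> * (2 * C * (LBINT z. \<bar>d z\<bar>)))"
 using ker_integrable by simp
 have 5: "(%n. \<integral>z. \<bar>F n z p\<bar> \<partial>lborel) \<longlonglongrightarrow> 0" for p
 proof -
 define a b where "a n = (0 :: real, e n * fst p)" and "b n = (0 :: real, e n * (fst p * snd p))" for n
 have "(%n. (0 :: real, e n * fst p)) \<longlonglongrightarrow> (0, 0 * fst p)"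
 "(%n. (0 :: real, e n * (fst p * snd p))) \<longlonglongrightarrow> (0, 0 * (fst p * snd p))"
 by (intro tendsto_intros e)+
 then have ab: "a \<longlonglongrightarrow> 0" "b \<longlonglongrightarrow> 0" by (simp_all add: a_def[abs_def] b_def[abs_def] zero_prod_def)
 have l1: "(%n. \<integral>z. \<bar>w (z + a n) - w z\<bar> * \<bar>d z\<bar> \<partial>lborel) \<longlonglongrightarrow> 0"
 proof (rule tendsto_integral_mult_of_L1[OF _ _ _ d])
 show "(%n. \<integral>z. \<bar>w (z + a n) - w z\<bar> \<partial>lborel) \<longlonglongrightarrow> 0"
 by (rule tendsto_translate_L1[OF w_integrable ab(1)])
 show "\<bar>w (z + a n) - w z\<bar> <= 2 * C" for n z using w_le[of "z + a n"] w_le[of z] by linarith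
 qed (use trw w_integrable in auto)
 have l2: "(%n. C * (LBINT z. \<bar>d (z + b n) - d z\<bar>)) \<longlonglongrightarrow> 0"
 using tendsto_mult_left[OF tendsto_translate_L1[OF d ab(2)], of C] by simp
 have l3: "(%n. \<bar>ker p\<bar> * (C * (LBINT z. \<bar>d (z + b n) - d z\<bar>) + (LBINT z. \<bar>w (z + a n) - w z\<bar> * \<bar>d z\<bar>))) \<longlonglongrightarrow> 0"
 using tendsto_mult_left[OF tendsto_add[OF l2 l1], of "\<bar>ker p\<bar>"] by simp
 have le: "(LBINT z. \<bar>F n z p\<bar>) <= \<bar>ker p\<bar> * (C * (LBINT z. \<bar>d (z + b n) - d z\<bar>) + (LBINT z. \<bar>w (z + a n) - w z\<bar> * \<bar>d z\<bar>))" for n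
 proof -
 have i1: "integrable lborel (%z. \<bar>w (z + a n) - w z\<bar> * \<bar>d z\<bar>)"
 proof (rule integrable_mult_bounded[where B="2*C"])
 show "integrable lborel (%z. \<bar>d z\<bar>)" using d by simp
 have "(%z. w (z + a n)) \<in> borel_measurable lborel" using trw by (rule borel_measurable_integrable)
 then show "(%z. \<bar>w (z + a n) - w z\<bar>) \<in> borel_measurable lborel" by simp
 have "\<bar>w (z + a n) - w z\<bar> <= 2 * C" for z using w_le[of "z + a n"] w_le[of z] by linarith
 then show "AE z in lborel. \<bar>\<bar>w (z + a n) - w z\<bar>\<bar> <= 2 * C" by simp
 qed
 have "(LBINT z. \<bar>G n z p\<bar>) <= (LBINT z. C * \<bar>d (z + b n) - d z\<bar> + \<bar>w (z + a n) - w z\<bar> * \<bar>d z\<bar>)"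
 proof (rule integral_mono)
 show "\<bar>G n z p\<bar> <= C * \<bar>d (z + b n) - d z\<bar> + \<bar>w (z + a n) - w z\<bar> * \<bar>d z\<bar>" for z
 proof -
 have "G n z p = w (z + a n) * (d (z + b n) - d z) + (w (z + a n) - w z) * d z"
 by (simp add: G_def a_def b_def algebra_simps)
 then show ?thesis
 using Cd[of "z + a n" "d (z + b n) - d z"] abs_mult[of "w (z + a n) - w z" "d z"] by linarith
 qed
 qed (use Gi trd d i1 in auto)
 also have "\<dots> = C * (LBINT z. \<bar>d (z + b n) - d z\<bar>) + (LBINT z. \<bar>w (z + a n) - w z\<bar> * \<bar>d z\<bar>)"
 using trd d i1 by simp
 finally show ?thesis unfolding eq by (intro mult_left_mono) auto
 qed
 show ?thesis
 by (rule Lim_null_comparison[OF always_eventually l3]) (use le in \<open>simp add: integral_nonneg_AE\<close>)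
 qed
 note R = tendsto_integral_of_averages[OF 1 2 3 4 5, unfolded F_def G_def]
 show "integrable lborel (%z. \<integral>p. ker p * (w (z + (0, e n * fst p)) * d (z + (0, e n * (fst p * snd p))) - w z * d z) \<partial>lborel)"
 "AE z in lborel. integrable lborel (%p. ker p * (w (z + (0, e n * fst p)) * d (z + (0, e n * (fst p * snd p))) - w z * d z))"
 "(%n. \<integral>z. \<bar>\<integral>p. ker p * (w (z + (0, e n * fst p)) * d (z + (0, e n * (fst p * snd p))) - w z * d z) \<partial>lborel\<bar> \<partial>lborel) \<longlonglongrightarrow> 0"
 by (rule R)+
qed

lemma h_mollify:
 assumes e: "e \<longlonglongrightarrow> 0"
 shows "integrable lborel (%z. \<integral>s. (h (z + (0, e n * s)) - h z) * moll s \<partial>lborel)"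
 and "AE z in lborel. integrable lborel (%s. (h (z + (0, e n * s)) - h z) * moll s)"
 and "(%n. \<integral>z. \<bar>\<integral>s. (h (z + (0, e n * s)) - h z) * moll s \<partial>lborel\<bar> \<partial>lborel) \<longlonglongrightarrow> 0"
 using mollify_L1[OF h e, where a="(0, 1)"] by simp_all

lemma wd_integrable: "integrable lborel (%z. h z - w z * d z)"
 using h integrable_mult_bounded[OF d, of w C] by (auto simp: w_le)

lemma mr_integrable: "integrable lborel (mr ep)"
 and mr_tendsto: "e \<longlonglongrightarrow> 0 ==> (%n. \<integral>z. \<bar>mr (e n) z - (h z - w z * d z)\<bar> \<partial>lborel) \<longlonglongrightarrow> 0"
proof -
 \<comment> \<open>The estimates are stated along null sequences. This one starts with
   \<open>ep\<close> and is 0 afterwards, so its index 0 gives integrability for a single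
   \<open>ep\<close>.\<close>
 have "(%n. if n = 0 then ep else 0) \<longlonglongrightarrow> 0"
 by (rule tendsto_eventually, rule eventually_sequentiallyI[of 1]) auto
 from h_mollify(1)[OF this, of 0] commutator_L1(1)[OF this, of 0] wd_integrable
 show "integrable lborel (mr ep)" by (simp add: mr_eq[abs_def])
 assume e: "e \<longlonglongrightarrow> 0"
 let ?A = "%n z. \<integral>s. (h (z + (0, e n * s)) - h z) * moll s \<partial>lborel"
 let ?B = "%n z. \<integral>p. ker p * (w (z + (0, e n * fst p)) * d (z + (0, e n * (fst p * snd p))) - w z * d z) \<partial>lborel"
 note A = h_mollify[OF e] and B = commutator_L1[OF e]
 have le: "(LBINT z. \<bar>mr (e n) z - (h z - w z * d z)\<bar>) <= (LBINT z. \<bar>?A n z\<bar>) + (LBINT z. \<bar>?B n z\<bar>)" for n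
 proof -
 have "(LBINT z. \<bar>mr (e n) z - (h z - w z * d z)\<bar>) = (LBINT z. \<bar>?A n z + ?B n z\<bar>)"
 by (simp add: mr_eq)
 also have "\<dots> <= (LBINT z. \<bar>?A n z\<bar> + \<bar>?B n z\<bar>)"
 using A(1)[of n] B(1)[of n] by (intro integral_mono) auto
 finally show ?thesis using A(1)[of n] B(1)[of n] by simp
 qed
 show "(%n. \<integral>z. \<bar>mr (e n) z - (h z - w z * d z)\<bar> \<partial>lborel) \<longlonglongrightarrow> 0"
 proof -
 have "(%n. (LBINT z. \<bar>?A n z\<bar>) + (LBINT z. \<bar>?B n z\<bar>)) \<longlonglongrightarrow> 0"
 using tendsto_add[OF A(3) B(3)] by (simp only: add_0_right)
 moreover have "norm (LBINT z. \<bar>mr (e n) z - (h z - w z * d z)\<bar>) <= (LBINT z. \<bar>?A n z\<bar>) + (LBINT z. \<bar>?B n z\<bar>)" for n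
 proof -
 have "0 <= (LBINT z. \<bar>mr (e n) z - (h z - w z * d z)\<bar>)" by (rule integral_nonneg_AE) simp
 then show ?thesis using le[of n] by (simp only: real_norm_def abs_of_nonneg)
 qed
 ultimately show ?thesis by (rule Lim_null_comparison[OF always_eventually[OF allI], rotated])
 qed
qed

text \<open>Because the kernel has mass 1, \<open>w\<close> can be subtracted under the integral,
  which makes the difference an average of translation errors.\<close>

lemma mv_tendsto:
 assumes e: "e \<longlonglongrightarrow> 0"
 shows "(%n. \<integral>z. \<bar>mv (e n) z - w z\<bar> \<partial>lborel) \<longlonglongrightarrow> 0" "integrable lborel (mv ep)"
 and "(%n. \<integral>x. \<bar>mv (e n) (t, x) - w (t, x)\<bar> \<partial>lborel) \<longlonglongrightarrow> 0" "integrable lborel (%x. mv ep (t, x))"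
proof -
 have eq: "mv ep z - w z = (LBINT s. (w (z + (0, ep * s)) - w z) * moll s)" for ep z
 using w_moll_integrable[of z ep] integrable_moll(1)
 by (simp add: mv_def left_diff_distrib integral_moll)
 show "(%n. \<integral>z. \<bar>mv (e n) z - w z\<bar> \<partial>lborel) \<longlonglongrightarrow> 0"
 using mollify_L1(3)[OF w_integrable e, where a="(0, 1)"] by (simp add: eq)
 have e': "(%n. if n = 0 then ep else 0) \<longlonglongrightarrow> 0"
 by (rule tendsto_eventually, rule eventually_sequentiallyI[of 1]) auto
 have "integrable lborel (%z. mv ep z - w z)"
 using mollify_L1(1)[OF w_integrable e', where a="(0, 1)" and n=0] by (simp add: eq)
 from L_integrable_add[OF this w_integrable] show "integrable lborel (mv ep)" by simp
 show "(%n. \<integral>x. \<bar>mv (e n) (t, x) - w (t, x)\<bar> \<partial>lborel) \<longlonglongrightarrow> 0"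
 using mollify_L1(3)[OF w_integrable_section[of t] e, where a=1] by (simp add: eq)
 have "integrable lborel (%x. mv ep (t, x) - w (t, x))"
 using mollify_L1(1)[OF w_integrable_section[of t] e', where a=1 and n=0] by (simp add: eq)
 from L_integrable_add[OF this w_integrable_section[of t]]
 show "integrable lborel (%x. mv ep (t, x))" by simp
qed

text \<open>The fundamental theorem between \<open>x\<close> and \<open>x + ep * s\<close>, rescaled
  to the unit interval; \<open>0 <= x\<close> is where \<open>vel\<close> is a genuine primitive of
  \<open>d\<close>.\<close>

lemma vel_increment:
 assumes "integrable lborel (%x. d (t, x))" "0 <= x" "0 < ep"
 shows "(vel u0 d t (x + ep * s) - vel u0 d t x) / ep * moll' s
 = (LBINT \<tau>. ker (s, \<tau>) * d (t, x + ep * (s * \<tau>)))"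
proof (cases "0 < s \<and> s <= 1")
 case True
 define c where "c = ep * s"
 have c: "0 < c" using True assms by (simp add: c_def)
 have "vel u0 d t (x + c) - vel u0 d t x = (LBINT y:{x<..x + c}. d (t, y))"
 using assms c by (intro ac_on_increment[OF ac_on_vel[OF assms(1), of "x + c"]]) auto
 also have "\<dots> = c * (LBINT \<tau>. indicat_real {x<..x + c} (x + c * \<tau>) * d (t, x + c * \<tau>))"
 using lborel_integral_real_affine[of c "%y. indicat_real {x<..x + c} y * d (t, y)" x] c
 by (simp add: set_lebesgue_integral_def)
 also have "(%\<tau>. indicat_real {x<..x + c} (x + c * \<tau>)) = indicat_real {0<..1}"
 using c mult_le_cancel_left_pos[OF c, of _ 1] by (auto simp: fun_eq_iff indicator_def zero_less_mult_iff)
 finally have "vel u0 d t (x + ep * s) - vel u0 d t x = (ep * s) * (LBINT \<tau>. indicat_real {0<..1} \<tau> * d (t, x + ep * s * \<tau>))"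
 by (simp only: c_def)
 moreover have "(LBINT \<tau>. ker (s, \<tau>) * d (t, x + ep * (s * \<tau>)))
 = moll' s * s * (LBINT \<tau>. indicat_real {0<..1} \<tau> * d (t, x + ep * s * \<tau>))"
 by (simp add: ker_def mult.assoc)
 ultimately show ?thesis using assms(3) by simp
next
 case False
 \<comment> \<open>At \<open>s = 0\<close> the value of \<open>moll'\<close> is 6, but the increment
   of the velocity vanishes; for the other \<open>s\<close> outside the unit interval
   \<open>moll'\<close> is 0 and with it both sides.\<close>
 then show ?thesis by (cases "s = 0") (auto simp: ker_def moll'_def)
qed

text \<open>The transport equation for the mollified function. After rescaling,
  \<open>mq + U * mvx\<close> contains the velocity only through
  \<open>U (x + ep * s) - U x\<close>, which \<open>vel_increment\<close> turns into an average of
  \<open>d\<close>. Subtracting \<open>w z * d z\<close> under the kernel of mass -1 splits off the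
  limit source \<open>h - w * d\<close>.\<close>

lemma mq_eq_mr:
 assumes "0 < ep"
 shows "AE z in lborel. z \<in> {0..t} \<times> {0..b} --> mq ep z = mr ep z - vel u0 d (fst z) (snd z) * mvx ep z"
proof -
 have e': "(%n. if n = 0 then ep else 0) \<longlonglongrightarrow> 0"
 by (rule tendsto_eventually, rule eventually_sequentiallyI[of 1]) auto
 have m: "AE z in (lborel :: (real \<times> real) measure). integrable lborel (%x. f (fst z, x))" if f: "integrable lborel f" for f :: "real \<times> real => real"
 proof -
 have "AE t in lborel. integrable lborel (%x. f (t, x))" by (rule integrable_lborel_pair(1)[OF f])
 then obtain N where N: "{t. \<not> integrable lborel (%x. f (t, x))} \<subseteq> N" "N \<in> null_sets lborel"
 by (auto elim!: AE_E simp: null_setsI)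
 have "N \<times> UNIV \<in> null_sets (lborel \<Otimes>\<^sub>M lborel :: (real \<times> real) measure)"
 using N(2) by (intro lborel.times_in_null_sets1) auto
 then show ?thesis unfolding lborel_prod
 by (rule AE_I') (use N(1) in auto)
 qed
 have 1: "AE z in lborel. integrable lborel (%s. (h (z + (0, ep * s)) - h z) * moll s)"
 using h_mollify(2)[OF e', of 0] by simp
 have 2: "AE z in lborel. integrable lborel (%p. ker p * (w (z + (0, ep * fst p)) * d (z + (0, ep * (fst p * snd p))) - w z * d z))"
 using commutator_L1(2)[OF e', of 0] by simp
 from 1 2 m[OF d] m[OF h] show ?thesis
 proof eventually_elim
 case (elim z)
 obtain r x where z: "z = (r, x)" by (cases z)
 let ?U = "vel u0 d r"
 show ?case
 proof
 assume "z \<in> {0..t} \<times> {0..b}"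
 then have x: "0 <= x" by (simp add: z)
 have dI: "integrable lborel (%x. d (r, x))" using elim(3) by (simp add: z)
 have zs: "z + (0, ep * s) = (r, x + ep * s)" for s by (simp add: z)
 have [measurable]: "?U \<in> borel_measurable borel" "(%y. w (r, y)) \<in> borel_measurable borel"
 using borel_measurable_section(1)[OF vel_measurable', of r] borel_measurable_section(1)[OF w_measurable, of r] by simp_all
 define N where "N = \<bar>u0 r\<bar> + (LBINT y. \<bar>d (r, y)\<bar>)"
 have N: "\<bar>?U y\<bar> <= N" for y unfolding N_def by (rule vel_le[OF dI])
 have wU: "\<bar>w (r, y) * ?U y' / ep\<bar> <= C * N / ep" for y y'
 using assms by (simp add: abs_mult divide_right_mono mult_mono w_le N C0)
 have i1: "integrable lborel (%s. w (r, x + ep * s) * ?U (x + ep * s) / ep * moll' s)"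
 by (rule integrable_mult_bounded[OF integrable_moll(2), where B="C * N / ep"]) (use wU in auto)
 have i2: "integrable lborel (%s. w (r, x + ep * s) * ?U x / ep * moll' s)"
 by (rule integrable_mult_bounded[OF integrable_moll(2), where B="C * N / ep"]) (use wU in auto)
 have i0: "integrable lborel (%s. (h (r, x + ep * s) - h z) * moll s)" using elim(1) by (simp add: zs)
 have i3: "integrable lborel (%s. h (r, x + ep * s) * moll s)"
 using L_integrable_add[OF i0 integrable_mult_right[OF integrable_moll(1), of "h z"]]
 by (simp add: algebra_simps)
 have I3: "(LBINT s. h (r, x + ep * s) * moll s) = (LBINT s. (h (r, x + ep * s) - h z) * moll s) + h z"
 proof -
 have "(LBINT s. (h (r, x + ep * s) - h z) * moll s) = (LBINT s. h (r, x + ep * s) * moll s - h z * moll s)"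
 by (simp add: left_diff_distrib)
 also have "\<dots> = (LBINT s. h (r, x + ep * s) * moll s) - (LBINT s. h z * moll s)"
 by (intro L_integral_diff i3 integrable_mult_right integrable_moll)
 finally show ?thesis by (simp add: integral_moll)
 qed
 have MQ: "mq ep z = (LBINT s. w (r, x + ep * s) * ?U (x + ep * s) / ep * moll' s) + (LBINT s. h (r, x + ep * s) * moll s)"
 proof -
 have "mq ep z = ep * (LBINT s. w (r, x + ep * s) * ?U (x + ep * s) * (moll' s / ep^2) + h (r, x + ep * s) * (moll s / ep))"
 using lborel_integral_real_affine[of ep "%y. w (r, y) * ?U y * (moll' ((y - x) / ep) / ep^2) + h (r, y) * (moll ((y - x) / ep) / ep)" x] assms
 by (simp add: mq_def z)
 also have "\<dots> = (LBINT s. ep * (w (r, x + ep * s) * ?U (x + ep * s) * (moll' s / ep^2) + h (r, x + ep * s) * (moll s / ep)))"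
 by (rule integral_mult_right_zero[symmetric])
 also have "\<dots> = (LBINT s. w (r, x + ep * s) * ?U (x + ep * s) / ep * moll' s + h (r, x + ep * s) * moll s)"
 using assms by (intro L_integral_cong) (auto simp: field_simps power2_eq_square)
 also have "\<dots> = (LBINT s. w (r, x + ep * s) * ?U (x + ep * s) / ep * moll' s) + (LBINT s. h (r, x + ep * s) * moll s)"
 by (rule L_integral_add[OF i1 i3])
 finally show ?thesis .
 qed
 have MV: "?U x * mvx ep z = - (LBINT s. w (r, x + ep * s) * ?U x / ep * moll' s)"
 proof -
 have "mvx ep z = - (ep * (LBINT s. w (r, x + ep * s) * (moll' s / ep^2)))"
 using lborel_integral_real_affine[of ep "%y. w (r, y) * (moll' ((y - x) / ep) / ep^2)" x] assms
 by (simp add: mvx_def z)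
 then have "?U x * mvx ep z = - (?U x * ep * (LBINT s. w (r, x + ep * s) * (moll' s / ep^2)))"
 by simp
 also have "?U x * ep * (LBINT s. w (r, x + ep * s) * (moll' s / ep^2)) = (LBINT s. ?U x * ep * (w (r, x + ep * s) * (moll' s / ep^2)))"
 by (rule integral_mult_right_zero[symmetric])
 also have "\<dots> = (LBINT s. w (r, x + ep * s) * ?U x / ep * moll' s)"
 using assms by (intro L_integral_cong) (auto simp: field_simps power2_eq_square)
 finally show ?thesis .
 qed
 define P where "P p = ker p * (w (z + (0, ep * fst p)) * d (z + (0, ep * (fst p * snd p))))" for p
 have kz: "integrable lborel (%p. ker p * (w z * d z))" using ker_integrable by simp
 have Pe: "P p = ker p * (w (z + (0, ep * fst p)) * d (z + (0, ep * (fst p * snd p))) - w z * d z) + ker p * (w z * d z)" for p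
 by (simp add: P_def algebra_simps)
 have Pi: "integrable lborel P" unfolding Pe[abs_def] by (rule L_integrable_add[OF elim(2) kz])
 have PI: "integral\<^sup>L lborel P = (LBINT p. ker p * (w (z + (0, ep * fst p)) * d (z + (0, ep * (fst p * snd p))) - w z * d z)) - w z * d z"
 unfolding Pe[abs_def] using L_integral_add[OF elim(2) kz] by (simp add: ker_integral)
 have "(LBINT s. w (r, x + ep * s) * ?U (x + ep * s) / ep * moll' s) - (LBINT s. w (r, x + ep * s) * ?U x / ep * moll' s)
 = (LBINT s. w (r, x + ep * s) * ?U (x + ep * s) / ep * moll' s - w (r, x + ep * s) * ?U x / ep * moll' s)"
 by (rule L_integral_diff[OF i1 i2, symmetric])
 also have "\<dots> = (LBINT s. (LBINT \<tau>. P (s, \<tau>)))"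
 proof (rule L_integral_cong[OF refl])
 fix s
 have "w (r, x + ep * s) * ?U (x + ep * s) / ep * moll' s - w (r, x + ep * s) * ?U x / ep * moll' s
 = w (r, x + ep * s) * ((?U (x + ep * s) - ?U x) / ep * moll' s)"
 by (simp add: diff_divide_distrib algebra_simps)
 also have "\<dots> = w (r, x + ep * s) * (LBINT \<tau>. ker (s, \<tau>) * d (r, x + ep * (s * \<tau>)))"
 by (simp only: vel_increment[OF dI x assms])
 also have "\<dots> = (LBINT \<tau>. w (r, x + ep * s) * (ker (s, \<tau>) * d (r, x + ep * (s * \<tau>))))"
 by (rule integral_mult_right_zero[symmetric])
 also have "\<dots> = (LBINT \<tau>. P (s, \<tau>))"
 by (intro L_integral_cong) (auto simp: P_def z)
 finally show "w (r, x + ep * s) * ?U (x + ep * s) / ep * moll' s - w (r, x + ep * s) * ?U x / ep * moll' s = (LBINT \<tau>. P (s, \<tau>))" .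
 qed
 also have "\<dots> = integral\<^sup>L lborel P" by (rule integrable_lborel_pair(5)[OF Pi])
 finally have "mq ep z + ?U x * mvx ep z = integral\<^sup>L lborel P + (LBINT s. h (r, x + ep * s) * moll s)"
 using MQ MV by linarith
 then have "mq ep z + ?U x * mvx ep z = mr ep z"
 unfolding PI I3 mr_eq zs by linarith
 then show "mq ep z = mr ep z - vel u0 d (fst z) (snd z) * mvx ep z" by (simp add: z)
 qed
 qed
qed

end

section \<open>Passing to the limit in the energy identity\<close>

text \<open>Compares integrals over growing domains with the one over the limit domain: on
  \<open>B - A\<close> only the limit function has to be estimated.\<close>

lemma set_integral_diff_le:
 fixes f g :: "'a => real"
 assumes f: "set_integrable M B f" and g: "set_integrable M B g"
 and A: "A \<in> sets M" "A \<subseteq> B" and B: "B \<in> sets M"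
 shows "\<bar>(LINT x:A|M. f x) - (LINT x:B|M. g x)\<bar> <= (LINT x:B|M. \<bar>f x - g x\<bar>) + (LINT x:B - A|M. \<bar>g x\<bar>)"
proof -
 have fA: "set_integrable M A f" and gA: "set_integrable M A g" and gB: "set_integrable M (B - A) g"
 using A B by (auto intro: set_integrable_subset[OF f] set_integrable_subset[OF g])
 have "B = A \<union> (B - A)" using A by auto
 then have "(LINT x:B|M. g x) = (LINT x:A|M. g x) + (LINT x:B - A|M. g x)"
 using set_integral_Un[OF _ gA gB] by auto
 then have "(LINT x:A|M. f x) - (LINT x:B|M. g x) = (LINT x:A|M. f x - g x) - (LINT x:B - A|M. g x)"
 using set_integral_diff(2)[OF fA gA] by simp
 moreover have "\<bar>LINT x:A|M. f x - g x\<bar> <= (LINT x:B|M. \<bar>f x - g x\<bar>)"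
 proof -
 have i: "integrable M (%x. indicat_real B x *\<^sub>R (f x - g x))"
 using set_integral_diff(1)[OF f g] by (simp add: set_integrable_def)
 have "integrable M (%x. indicat_real A x *\<^sub>R (f x - g x))"
 using set_integral_diff(1)[OF fA gA] by (simp add: set_integrable_def)
 then have "\<bar>\<integral>x. indicat_real A x *\<^sub>R (f x - g x) \<partial>M\<bar> <= (\<integral>x. \<bar>indicat_real B x *\<^sub>R (f x - g x)\<bar> \<partial>M)"
 using i A by (intro order_trans[OF integral_abs_bound] integral_mono integrable_abs) (auto simp: indicator_def)
 then show ?thesis by (simp add: set_lebesgue_integral_def abs_mult)
 qed
 moreover have "\<bar>LINT x:B - A|M. g x\<bar> <= (LINT x:B - A|M. \<bar>g x\<bar>)"
 unfolding set_lebesgue_integral_def by (rule order_trans[OF integral_abs_bound]) (simp add: abs_mult)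
 ultimately show ?thesis by linarith
qed

lemma set_integral_abs_le_integral:
 fixes f :: "'a => real"
 assumes "integrable M f" "A \<in> sets M"
 shows "(LINT x:A|M. \<bar>f x\<bar>) <= (\<integral>x. \<bar>f x\<bar> \<partial>M)"
 unfolding set_lebesgue_integral_def
 using assms integrable_mult_indicator[OF assms(2) integrable_abs[OF assms(1)]]
 by (intro integral_mono) (auto simp: indicator_def)

lemma lipschitz_of_bounded_derivative:
 fixes \<beta> \<beta>' :: "real => real"
 assumes der: "!!x. (\<beta> has_real_derivative \<beta>' x) (at x)" and B: "!!x. \<bar>x\<bar> <= V ==> \<bar>\<beta>' x\<bar> <= B"
 and "\<bar>x\<bar> <= V" "\<bar>y\<bar> <= V"
 shows "\<bar>\<beta> x - \<beta> y\<bar> <= B * \<bar>x - y\<bar>"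
proof -
 have "norm (\<beta> x - \<beta> y) <= B * norm (x - y)"
 proof (rule differentiable_bound[of "{-V..V}" \<beta> "%x h. \<beta>' x * h"])
 fix z assume "z \<in> {-V..V}"
 show "(\<beta> has_derivative (*) (\<beta>' z)) (at z within {-V..V})"
 using der[of z] by (auto simp: has_field_derivative_def intro: has_derivative_at_withinI)
 show "onorm ((*) (\<beta>' z)) <= B"
 using B[of z] \<open>z \<in> {-V..V}\<close> by (intro onorm_le) (auto simp: abs_mult intro!: mult_right_mono)
 qed (use assms in \<open>auto simp: abs_le_iff\<close>)
 then show ?thesis by simp
qed

text \<open>All terms of the energy identity except the left boundary value pass to the limit, so
  the identity itself forces that value to converge. The filter is arbitrary: one index will give
  the mollifications of the solution, two indices their differences, with limit 0. The bound
  \<open>V' i\<close> may blow up, as \<open>vx\<close> has disappeared from the identity.\<close>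

lemma energy_limit:
 fixes v vx q r :: "'i => real \<times> real => real" and v0 r0 d :: "real \<times> real => real"
 and \<beta> \<beta>' u0 :: "real => real" and b :: "'i => real"
 assumes t: "0 <= t" and b: "!!i. 0 < b i" "!!i. b i <= 1" "(b \<longlongrightarrow> 1) F"
 and meas[measurable]: "!!i. v i \<in> borel_measurable borel" "!!i. vx i \<in> borel_measurable borel" "!!i. q i \<in> borel_measurable borel"
 and vb: "!!i z. \<bar>v i z\<bar> <= V" and vxb: "!!i z. \<bar>vx i z\<bar> <= V' i"
 and d: "integrable lborel d" and r: "!!i. integrable lborel (r i)" and u0: "integrable lborel u0"
 and der: "!!x. (\<beta> has_real_derivative \<beta>' x) (at x)"
 and lip: "!!x y. \<bar>\<beta>' y - \<beta>' x\<bar> <= L * \<bar>y - x\<bar>"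
 and time: "!!i x. 0 <= x ==> x <= b i ==> ac_on t (%s. v i (s, x)) (%s. q i (s, x))"
 and space: "!!i s. ac_on (b i) (%x. v i (s, x)) (%x. vx i (s, x))"
 and rel: "!!i. AE z in lborel. z \<in> {0..t} \<times> {0..b i} --> q i z = r i z - vel u0 d (fst z) (snd z) * vx i z"
 and v0: "integrable lborel v0" "!!z. \<bar>v0 z\<bar> <= V" and vi: "!!i. integrable lborel (v i)"
 and lim_v: "((%i. \<integral>z. \<bar>v i z - v0 z\<bar> \<partial>lborel) \<longlongrightarrow> 0) F"
 and r0: "integrable lborel r0" and lim_r: "((%i. \<integral>z. \<bar>r i z - r0 z\<bar> \<partial>lborel) \<longlongrightarrow> 0) F"
 and sl: "!!i s. integrable lborel (%x. v i (s, x))" "!!s. integrable lborel (%x. v0 (s, x))"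
 and lim_sl: "!!s. ((%i. \<integral>x. \<bar>v i (s, x) - v0 (s, x)\<bar> \<partial>lborel) \<longlongrightarrow> 0) F"
 shows "((%i. LBINT s:{0..t}. \<beta> (v i (s, 0)) * u0 s) \<longlongrightarrow>
 (LBINT x:{0..1}. (1 - x) * (\<beta> (v0 (t, x)) - \<beta> (v0 (0, x))))
 - (LBINT z:{0..t} \<times> {0..1}. (1 - snd z) * \<beta>' (v0 z) * r0 z
 - \<beta> (v0 z) * vel u0 d (fst z) (snd z) + (1 - snd z) * \<beta> (v0 z) * d z)) F"
proof -
 have L: "0 <= L" using lip[of 1 0] by auto
 note \<beta>m[measurable] = bounded_of_lipschitz_derivative(1,2)[OF der lip]
 obtain B where B: "!!x. \<bar>x\<bar> <= V ==> \<bar>\<beta> x\<bar> <= B" "!!x. \<bar>x\<bar> <= V ==> \<bar>\<beta>' x\<bar> <= B"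
 using bounded_of_lipschitz_derivative(3)[OF der lip, of V] by blast
 have B0: "0 <= B" using B(1)[of "v0 (0,0)"] v0(2)[of "(0,0)"] by linarith
 have \<beta>lip: "\<bar>\<beta> x - \<beta> y\<bar> <= B * \<bar>x - y\<bar>" if "\<bar>x\<bar> <= V" "\<bar>y\<bar> <= V" for x y
 by (rule lipschitz_of_bounded_derivative[OF der B(2) that])
 have [measurable]: "u0 \<in> borel_measurable borel" "d \<in> borel_measurable borel" "v0 \<in> borel_measurable borel"
 using u0 d v0 by auto
 define U where "U z = vel u0 d (fst z) (snd z)" for z
 have [measurable]: "U \<in> borel_measurable borel" unfolding U_def by measurable
 let ?S = "{0..t} \<times> {0..1::real}"
 have S: "?S \<in> sets (lborel :: (real \<times> real) measure)" by (simp add: borel_Times)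
 have Sb: "{0..t} \<times> {0..b i} \<in> sets (lborel :: (real \<times> real) measure)" for i by (simp add: borel_Times)
 \<comment> \<open>Cutting the velocity off to the rectangle makes it integrable on the plane, so
   that it can play the role of the fixed factor \<open>G\<close> in
   \<open>tendsto_integral_mult_of_L1\<close>.\<close>
 define US where "US z = indicat_real ?S z * U z" for z
 have US: "integrable lborel US"
 proof -
 have "?S \<subseteq> UNIV \<times> {0..1}" by auto
 from set_integrable_subset[OF integrable_vel_box[OF u0 d, of 0 1] S this]
 show ?thesis by (simp add: US_def[abs_def] U_def set_integrable_def)
 qed
 define \<Phi> where "\<Phi> f g z = (1 - snd z) * \<beta>' (f z) * g z - \<beta> (f z) * U z + (1 - snd z) * \<beta> (f z) * d z"
 for f g and z :: "real \<times> real"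
 have \<Phi>i: "set_integrable lborel ?S (\<Phi> f g)"
 if f: "f \<in> borel_measurable borel" "!!z. \<bar>f z\<bar> <= V" and g: "integrable lborel g" for f g
 proof -
 note f(1)[measurable]
 have ind: "indicat_real ?S \<in> borel_measurable borel" using S by (intro borel_measurable_indicator) simp
 note ind[measurable]
 have b1: "\<bar>indicat_real ?S z * (1 - snd z)\<bar> <= 1" for z by (auto simp: indicator_def)
 have m1: "\<bar>x * y\<bar> <= B" if "\<bar>x\<bar> <= 1" "\<bar>y\<bar> <= B" for x y
 using mult_mono[OF that] B0 by (simp add: abs_mult)
 have "integrable lborel (%z. (indicat_real ?S z * (1 - snd z) * \<beta>' (f z)) * g z)"
 by (rule integrable_mult_bounded[OF g, where B=B]) (use m1[OF b1 B(2)[OF f(2)]] in auto)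
 moreover have "integrable lborel (%z. \<beta> (f z) * US z)"
 by (rule integrable_mult_bounded[OF US, where B=B]) (use B(1)[OF f(2)] in auto)
 moreover have "integrable lborel (%z. (indicat_real ?S z * (1 - snd z) * \<beta> (f z)) * d z)"
 by (rule integrable_mult_bounded[OF d, where B=B]) (use m1[OF b1 B(1)[OF f(2)]] in auto)
 ultimately have "integrable lborel (%z. (indicat_real ?S z * (1 - snd z) * \<beta>' (f z)) * g z - \<beta> (f z) * US z
 + (indicat_real ?S z * (1 - snd z) * \<beta> (f z)) * d z)"
 by (intro L_integrable_add L_integrable_diff)
 moreover have "(%z. (indicat_real ?S z * (1 - snd z) * \<beta>' (f z)) * g z - \<beta> (f z) * US z
 + (indicat_real ?S z * (1 - snd z) * \<beta> (f z)) * d z) = (%z. indicat_real ?S z *\<^sub>R \<Phi> f g z)"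
 by (simp add: fun_eq_iff \<Phi>_def US_def algebra_simps)
 ultimately show ?thesis by (simp add: set_integrable_def)
 qed
 have v0m: "v0 \<in> borel_measurable borel" using v0 by auto
 note P0 = \<Phi>i[OF v0m v0(2) r0] and Pi = \<Phi>i[OF meas(1) vb r]
 let ?n = "%s. \<bar>u0 s\<bar> + (LBINT y. \<bar>d (s, y)\<bar>)"
 have n: "integrable lborel ?n" by (rule vel_bound_integrable[OF u0 d])
 \<comment> \<open>The right boundary term; its weight bounds it by \<open>1 - b i\<close> times an
   integrable function of time.\<close>
 define E where "E i s = (1 - b i) * \<beta> (v i (s, b i)) * vel u0 d s (b i)" for i s
 have Em: "E i \<in> borel_measurable borel" for i
 using borel_measurable_section(2)[of "v i" "b i"] borel_measurable_section(2)[of U "b i"]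
 unfolding E_def[abs_def] by (simp add: U_def)
 have Eb: "AE s in lborel. \<bar>E i s\<bar> <= (1 - b i) * (B * ?n s)" for i
 using integrable_lborel_pair(1)[OF d]
 proof eventually_elim
 case (elim s)
 have "\<bar>\<beta> (v i (s, b i))\<bar> * \<bar>vel u0 d s (b i)\<bar> <= B * ?n s"
 by (intro mult_mono B(1) vb vel_le elim B0) auto
 then show ?case using b(2)[of i] by (simp add: E_def abs_mult mult.assoc mult_left_mono)
 qed
 have Ei: "integrable lborel (E i)" for i
 proof (rule L_integrable_bound)
 show "integrable lborel (%s. (1 - b i) * (B * ?n s))" using n by (intro integrable_mult_right)
 show "AE s in lborel. norm (E i s) <= norm ((1 - b i) * (B * ?n s))"
 using Eb[of i]
 proof eventually_elim
 case (elim s)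
 then show ?case using abs_ge_self[of "(1 - b i) * (B * ?n s)"] by (simp only: real_norm_def)
 qed
 qed (use Em in simp)
 have EI: "\<bar>LBINT s:{0..t}. E i s\<bar> <= (1 - b i) * (B * (LBINT s. ?n s))" for i
 proof -
 have "\<bar>LBINT s:{0..t}. E i s\<bar> <= (LBINT s. \<bar>indicat_real {0..t} s *\<^sub>R E i s\<bar>)"
 unfolding set_lebesgue_integral_def by (rule integral_abs_bound)
 also have "\<dots> <= (LBINT s. (1 - b i) * (B * ?n s))"
 proof (rule integral_mono_AE)
 show "integrable lborel (%s. \<bar>indicat_real {0..t} s *\<^sub>R E i s\<bar>)"
 using integrable_mult_indicator[OF _ Ei, of "{0..t}"] by (intro integrable_abs) simp
 show "integrable lborel (%s. (1 - b i) * (B * ?n s))" using n by (intro integrable_mult_right)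
 show "AE s in lborel. \<bar>indicat_real {0..t} s *\<^sub>R E i s\<bar> <= (1 - b i) * (B * ?n s)"
 using Eb[of i] by eventually_elim (auto simp: indicator_def)
 qed
 also have "\<dots> = (1 - b i) * (B * (LBINT s. ?n s))" by (simp only: integral_mult_right_zero)
 finally show ?thesis .
 qed
 have ti: "set_integrable lborel {0..t} (%s. \<beta> (v i (s, 0)) * u0 s)" for i
 proof (rule set_integrable_of_integrable)
 show "integrable lborel (%s. \<beta> (v i (s, 0)) * u0 s)"
 by (rule integrable_mult_bounded[OF u0, where B=B])
 (use borel_measurable_section(2)[of "v i" 0] B(1) vb in auto)
 qed simp
 have ident: "(LBINT s:{0..t}. \<beta> (v i (s, 0)) * u0 s) =
 (LBINT x:{0..b i}. (1 - x) * (\<beta> (v i (t, x)) - \<beta> (v i (0, x))))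
 - (LBINT z:{0..t} \<times> {0..b i}. \<Phi> (v i) (r i) z) + (LBINT s:{0..t}. E i s)" for i
 proof -
 have Pb: "set_integrable lborel ({0..t} \<times> {0..b i}) (\<Phi> (v i) (r i))"
 by (rule set_integrable_subset[OF Pi Sb]) (use b(2)[of i] in auto)
 have iA: "set_integrable lborel {0..t} (%s. LBINT x:{0..b i}. \<Phi> (v i) (r i) (s, x))"
 by (rule set_integral_lborel_pair(1)[OF Pb])
 have iE: "set_integrable lborel {0..t} (E i)" by (rule set_integrable_of_integrable[OF Ei]) simp
 have "(LBINT x:{0..b i}. (1 - x) * (\<beta> (v i (t, x)) - \<beta> (v i (0, x))))
 = (LBINT s:{0..t}. (LBINT x:{0..b i}. \<Phi> (v i) (r i) (s, x)) - E i s + \<beta> (v i (s, 0)) * u0 s)"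
 using energy_identity[OF b(1) t meas vb vxb d r u0 der lip time space rel, of i]
 by (simp add: \<Phi>_def E_def U_def)
 also have "\<dots> = (LBINT s:{0..t}. (LBINT x:{0..b i}. \<Phi> (v i) (r i) (s, x)) - E i s)
 + (LBINT s:{0..t}. \<beta> (v i (s, 0)) * u0 s)"
 by (rule set_integral_add(2)[OF set_integral_diff(1)[OF iA iE] ti])
 also have "(LBINT s:{0..t}. (LBINT x:{0..b i}. \<Phi> (v i) (r i) (s, x)) - E i s)
 = (LBINT s:{0..t}. LBINT x:{0..b i}. \<Phi> (v i) (r i) (s, x)) - (LBINT s:{0..t}. E i s)"
 by (rule set_integral_diff(2)[OF iA iE])
 also have "(LBINT s:{0..t}. LBINT x:{0..b i}. \<Phi> (v i) (r i) (s, x)) = (LBINT z:{0..t} \<times> {0..b i}. \<Phi> (v i) (r i) z)"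
 by (rule set_integral_lborel_pair(3)[OF Pb])
 finally show ?thesis by linarith
 qed
 have b0: "((%i. 1 - b i) \<longlongrightarrow> 0) F" using tendsto_diff[OF tendsto_const b(3), of 1] by simp
 have l3: "((%i. LBINT s:{0..t}. E i s) \<longlongrightarrow> 0) F"
 by (rule Lim_null_comparison[OF always_eventually, where g="%i. (1 - b i) * (B * (LBINT s. ?n s))"])
 (use EI tendsto_mult_right[OF b0, of "B * (LBINT s. ?n s)"] in simp_all)
 have l1: "((%i. LBINT x:{0..b i}. (1 - x) * (\<beta> (v i (t, x)) - \<beta> (v i (0, x)))) \<longlongrightarrow>
 (LBINT x:{0..1}. (1 - x) * (\<beta> (v0 (t, x)) - \<beta> (v0 (0, x))))) F"
 proof -
 define f where "f w0 x = (1 - x) * (\<beta> (w0 (t, x)) - \<beta> (w0 (0, x)))" for w0 :: "real \<times> real => real" and x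
 have fm: "f w0 \<in> borel_measurable borel" if "w0 \<in> borel_measurable borel" for w0
 unfolding f_def[abs_def] using borel_measurable_section(1)[OF that] by measurable
 have fb: "\<bar>f w0 x\<bar> <= 2 * B" if "!!z. \<bar>w0 z\<bar> <= V" "x \<in> {0..1}" for w0 x
 proof -
 have "\<bar>\<beta> (w0 (t, x)) - \<beta> (w0 (0, x))\<bar> <= 2 * B"
 using B(1)[OF that(1), of "(t, x)"] B(1)[OF that(1), of "(0, x)"] by linarith
 moreover have "\<bar>1 - x\<bar> <= 1" using that(2) by auto
 ultimately have "\<bar>1 - x\<bar> * \<bar>\<beta> (w0 (t, x)) - \<beta> (w0 (0, x))\<bar> <= 1 * (2 * B)"
 by (intro mult_mono) auto
 then show ?thesis by (simp add: f_def abs_mult)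
 qed
 have fi: "set_integrable lborel {0..1} (f w0)" if "w0 \<in> borel_measurable borel" "!!z. \<bar>w0 z\<bar> <= V" for w0
 proof -
 have "set_integrable lborel {0..1} (%x. f w0 x * 1)"
 by (rule set_integrable_mult_bounded[OF _ fm[OF that(1)] fb[OF that(2)]]) (auto intro!: borel_integrable_atLeastAtMost')
 then show ?thesis by simp
 qed
 note f0 = fi[OF v0m v0(2)] and fvi = fi[OF meas(1) vb]
 \<comment> \<open>The first two terms come from the Lipschitz bound of \<open>\<beta>\<close> on
   the common range, the last from the strip between \<open>b i\<close> and 1, where the integrand
   is at most \<open>2 * B\<close>.\<close>
 let ?b = "%i. B * (LBINT x. \<bar>v i (t, x) - v0 (t, x)\<bar>) + B * (LBINT x. \<bar>v i (0, x) - v0 (0, x)\<bar>) + 2 * B * (1 - b i)"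
 have bound: "\<bar>(LBINT x:{0..b i}. f (v i) x) - (LBINT x:{0..1}. f v0 x)\<bar> <= ?b i" for i
 proof -
 have i1: "integrable lborel (%x. \<bar>v i (s, x) - v0 (s, x)\<bar>)" for s using sl by auto
 have "(LBINT x:{0..1}. \<bar>f (v i) x - f v0 x\<bar>) \<le>
 (LBINT x:{0..1}. B * \<bar>v i (t, x) - v0 (t, x)\<bar> + B * \<bar>v i (0, x) - v0 (0, x)\<bar>)"
 proof (rule set_integral_mono)
 show "set_integrable lborel {0..1} (%x. \<bar>f (v i) x - f v0 x\<bar>)"
 by (intro set_integrable_abs set_integral_diff(1) fvi f0)
 show "set_integrable lborel {0..1} (%x. B * \<bar>v i (t, x) - v0 (t, x)\<bar> + B * \<bar>v i (0, x) - v0 (0, x)\<bar>)"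
 using i1 by (intro set_integrable_of_integrable) auto
 fix x :: real assume x: "x \<in> {0..1}"
 have "\<bar>f (v i) x - f v0 x\<bar> = (1 - x) * \<bar>(\<beta> (v i (t, x)) - \<beta> (v0 (t, x))) - (\<beta> (v i (0, x)) - \<beta> (v0 (0, x)))\<bar>"
 using x by (simp add: f_def right_diff_distrib[symmetric] abs_mult) (simp add: algebra_simps)
 also have "\<dots> <= 1 * \<bar>(\<beta> (v i (t, x)) - \<beta> (v0 (t, x))) - (\<beta> (v i (0, x)) - \<beta> (v0 (0, x)))\<bar>"
 using x by (intro mult_right_mono) auto
 also have "\<dots> <= B * \<bar>v i (t, x) - v0 (t, x)\<bar> + B * \<bar>v i (0, x) - v0 (0, x)\<bar>"
 unfolding mult_1 by (intro order_trans[OF abs_triangle_ineq4] add_mono \<beta>lip vb v0(2))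
 finally show "\<bar>f (v i) x - f v0 x\<bar> <= B * \<bar>v i (t, x) - v0 (t, x)\<bar> + B * \<bar>v i (0, x) - v0 (0, x)\<bar>" .
 qed
 also have "\<dots> <= (LBINT x. B * \<bar>v i (t, x) - v0 (t, x)\<bar> + B * \<bar>v i (0, x) - v0 (0, x)\<bar>)"
 using set_integral_abs_le_integral[of lborel "%x. B * \<bar>v i (t, x) - v0 (t, x)\<bar> + B * \<bar>v i (0, x) - v0 (0, x)\<bar>" "{0..1}"] i1 B0
 by simp
 also have "\<dots> = B * (LBINT x. \<bar>v i (t, x) - v0 (t, x)\<bar>) + B * (LBINT x. \<bar>v i (0, x) - v0 (0, x)\<bar>)"
 using i1 by simp
 finally have 1: "(LBINT x:{0..1}. \<bar>f (v i) x - f v0 x\<bar>) <= \<dots>" .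
 have e: "{0..1} - {0..b i} = {b i<..1}" using b(1)[of i] b(2)[of i] by auto
 have "(LBINT x:{0..1} - {0..b i}. \<bar>f v0 x\<bar>) <= (LBINT x:{b i<..1}. 2 * B)"
 unfolding e
 proof (rule set_integral_mono)
 show "set_integrable lborel {b i<..1} (%x. \<bar>f v0 x\<bar>)"
 using b(1)[of i] by (intro set_integrable_abs set_integrable_subset[OF f0]) auto
 show "set_integrable lborel {b i<..1} (%x. 2 * B)"
 unfolding set_integrable_def using b(2)[of i] by (intro integrable_scaleR_left integrable_real_indicator) auto
 show "\<bar>f v0 x\<bar> <= 2 * B" if "x \<in> {b i<..1}" for x using fb[OF v0(2), of x] that b(1)[of i] by auto
 qed
 also have "\<dots> = 2 * B * (1 - b i)" using b(2)[of i] by (simp add: set_integral_const)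
 finally have 2: "(LBINT x:{0..1} - {0..b i}. \<bar>f v0 x\<bar>) <= 2 * B * (1 - b i)" .
 have "\<bar>(LBINT x:{0..b i}. f (v i) x) - (LBINT x:{0..1}. f v0 x)\<bar>
 <= (LBINT x:{0..1}. \<bar>f (v i) x - f v0 x\<bar>) + (LBINT x:{0..1} - {0..b i}. \<bar>f v0 x\<bar>)"
 by (rule set_integral_diff_le[OF fvi f0]) (use b(2)[of i] in auto)
 then show ?thesis using 1 2 by linarith
 qed
 have "(?b \<longlongrightarrow> B * 0 + B * 0 + 2 * B * 0) F"
 by (intro tendsto_add tendsto_mult tendsto_const lim_sl b0)
 then have "(?b \<longlongrightarrow> 0) F" by simp
 then have "((%i. (LBINT x:{0..b i}. f (v i) x) - (LBINT x:{0..1}. f v0 x)) \<longlongrightarrow> 0) F"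
 by (rule Lim_null_comparison[OF always_eventually[OF allI], rotated]) (use bound in simp)
 then show ?thesis unfolding f_def by (rule LIM_zero_cancel)
 qed
 have l2: "((%i. LBINT z:{0..t} \<times> {0..b i}. \<Phi> (v i) (r i) z) \<longlongrightarrow> (LBINT z:?S. \<Phi> v0 r0 z)) F"
 proof -
 define D where "D i z = v i z - v0 z" for i z
 have Di: "integrable lborel (D i)" for i unfolding D_def using vi v0 by auto
 have Db: "\<bar>D i z\<bar> <= 2 * V" for i z using vb[of i z] v0(2)[of z] by (simp add: D_def)
 have DL: "((%i. \<integral>z. \<bar>D i z\<bar> \<partial>lborel) \<longlongrightarrow> 0) F" unfolding D_def by (rule lim_v)
 have DG: "((%i. \<integral>z. \<bar>D i z\<bar> * \<bar>G z\<bar> \<partial>lborel) \<longlongrightarrow> 0) F" if "integrable lborel G" for G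
 by (rule tendsto_integral_mult_of_L1[OF Di DL Db that])
 have DGi: "integrable lborel (%z. \<bar>D i z\<bar> * \<bar>G z\<bar>)" if "integrable lborel G" for G i
 by (rule integrable_mult_bounded[OF integrable_abs[OF that], where B="2*V"]) (use Di Db in auto)
 \<comment> \<open>The strip between \<open>b i\<close> and 1. Its indicators are bounded and tend
   to 0 in the mean, so the integral of the fixed function \<open>\<Phi> v0 r0\<close> over it is
   covered by the same truncation lemma.\<close>
 define Z where "Z i = ?S - {0..t} \<times> {0..b i}" for i
 have Zs: "Z i \<in> sets lborel" for i unfolding Z_def using S Sb by auto
 have Zi: "integrable lborel (indicat_real (Z i))" for i
 proof -
 have "emeasure lborel (Z i) <= emeasure lborel ?S" using S by (intro emeasure_mono) (auto simp: Z_def)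
 also have "\<dots> < top" by (rule emeasure_rectangle_finite)
 finally show ?thesis using Zs by (intro integrable_real_indicator) auto
 qed
 have "(LBINT z. \<bar>indicat_real (Z i) z\<bar>) = t * (1 - b i)" for i
 proof -
 have "(LBINT z. \<bar>indicat_real (Z i) z\<bar>) = (LBINT s. (LBINT x. indicat_real (Z i) (s, x)))"
 using integrable_lborel_pair(5)[OF Zi] by simp
 also have "\<dots> = (LBINT s. indicat_real {0..t} s * (1 - b i))"
 proof (rule L_integral_cong[OF refl])
 fix s
 have "(LBINT x. indicat_real (Z i) (s, x)) = (LBINT x. indicat_real {0..t} s * indicat_real {b i<..1} x)"
 using b(1)[of i] by (intro L_integral_cong[OF refl]) (auto simp: Z_def indicator_def)
 also have "\<dots> = indicat_real {0..t} s * measure lborel {b i<..1}" by simp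
 also have "measure lborel {b i<..1} = 1 - b i" using b(2)[of i] by (simp add: measure_def)
 finally show "(LBINT x. indicat_real (Z i) (s, x)) = indicat_real {0..t} s * (1 - b i)" .
 qed
 also have "\<dots> = t * (1 - b i)" using t by simp
 finally show ?thesis .
 qed
 then have ZL: "((%i. \<integral>z. \<bar>indicat_real (Z i) z\<bar> \<partial>lborel) \<longlongrightarrow> 0) F"
 using tendsto_mult_left[OF b0, of t] by simp
 define G0 where "G0 z = indicat_real ?S z * \<Phi> v0 r0 z" for z
 have G0: "integrable lborel G0" using P0 by (simp add: G0_def[abs_def] set_integrable_def)
 have ZG: "((%i. \<integral>z. \<bar>indicat_real (Z i) z\<bar> * \<bar>G0 z\<bar> \<partial>lborel) \<longlongrightarrow> 0) F"
 by (rule tendsto_integral_mult_of_L1[OF Zi ZL _ G0, where C=1]) (auto simp: indicator_def)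
 let ?R = "%i z. B * \<bar>r i z - r0 z\<bar> + L * (\<bar>D i z\<bar> * \<bar>r0 z\<bar>) + B * (\<bar>D i z\<bar> * \<bar>US z\<bar>) + B * (\<bar>D i z\<bar> * \<bar>d z\<bar>)"
 let ?b = "%i. B * (LBINT z. \<bar>r i z - r0 z\<bar>) + L * (LBINT z. \<bar>D i z\<bar> * \<bar>r0 z\<bar>) + B * (LBINT z. \<bar>D i z\<bar> * \<bar>US z\<bar>)
 + B * (LBINT z. \<bar>D i z\<bar> * \<bar>d z\<bar>) + (LBINT z. \<bar>indicat_real (Z i) z\<bar> * \<bar>G0 z\<bar>)"
 have bound: "\<bar>(LBINT z:{0..t} \<times> {0..b i}. \<Phi> (v i) (r i) z) - (LBINT z:?S. \<Phi> v0 r0 z)\<bar> <= ?b i" for i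
 proof -
 have Ri: "integrable lborel (%z. \<bar>r i z - r0 z\<bar>)" using r r0 by auto
 have Rint: "integrable lborel (?R i)"
 by (intro L_integrable_add integrable_mult_right Ri DGi r0 US d)
 have "(LBINT z:?S. \<bar>\<Phi> (v i) (r i) z - \<Phi> v0 r0 z\<bar>) <= (LBINT z:?S. ?R i z)"
 proof (rule set_integral_mono)
 show "set_integrable lborel ?S (%z. \<bar>\<Phi> (v i) (r i) z - \<Phi> v0 r0 z\<bar>)"
 by (intro set_integrable_abs set_integral_diff(1) Pi P0)
 show "set_integrable lborel ?S (?R i)" by (rule set_integrable_of_integrable[OF Rint S])
 fix z assume z: "z \<in> ?S"
 have x: "\<bar>1 - snd z\<bar> <= 1" using z by auto
 have US': "US z = U z" using z by (simp add: US_def)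
 \<comment> \<open>Telescoping: each summand carries exactly one difference, of \<open>r\<close>, of
   \<open>\<beta>'\<close> or of \<open>\<beta>\<close>. The last two are bounded by
   \<open>D\<close>, and \<open>DG\<close> handles their products with merely integrable
   factors.\<close>
 have e: "\<Phi> (v i) (r i) z - \<Phi> v0 r0 z = (1 - snd z) * (\<beta>' (v i z) * (r i z - r0 z)) + (1 - snd z) * ((\<beta>' (v i z) - \<beta>' (v0 z)) * r0 z)
 - (\<beta> (v i z) - \<beta> (v0 z)) * U z + (1 - snd z) * ((\<beta> (v i z) - \<beta> (v0 z)) * d z)"
 unfolding \<Phi>_def by algebra
 have tri: "\<bar>p1 + p2 - p3 + p4\<bar> <= \<bar>p1\<bar> + \<bar>p2\<bar> + \<bar>p3\<bar> + \<bar>p4\<bar>" for p1 p2 p3 p4 :: real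
 by linarith
 have x': "\<bar>(1 - snd z) * y\<bar> <= \<bar>y\<bar>" for y
 using mult_right_mono[OF x, of "\<bar>y\<bar>"] by (simp add: abs_mult)
 have a1: "\<bar>\<beta>' (v i z) * (r i z - r0 z)\<bar> <= B * \<bar>r i z - r0 z\<bar>"
 unfolding abs_mult by (intro mult_right_mono B(2) vb) auto
 have a2: "\<bar>(\<beta>' (v i z) - \<beta>' (v0 z)) * r0 z\<bar> <= L * (\<bar>D i z\<bar> * \<bar>r0 z\<bar>)"
 using mult_right_mono[OF lip[of "v i z" "v0 z"], of "\<bar>r0 z\<bar>"] by (simp add: abs_mult D_def mult.assoc)
 have \<beta>D: "\<bar>\<beta> (v i z) - \<beta> (v0 z)\<bar> <= B * \<bar>D i z\<bar>" unfolding D_def by (rule \<beta>lip[OF vb v0(2)])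
 have a3: "\<bar>(\<beta> (v i z) - \<beta> (v0 z)) * y\<bar> <= B * (\<bar>D i z\<bar> * \<bar>y\<bar>)" for y
 using mult_right_mono[OF \<beta>D, of "\<bar>y\<bar>"] by (simp add: abs_mult mult.assoc)
 show "\<bar>\<Phi> (v i) (r i) z - \<Phi> v0 r0 z\<bar> <= ?R i z"
 unfolding e US'
 by (rule order_trans[OF tri]) (intro add_mono order_trans[OF x' a1] order_trans[OF x' a2] a3 order_trans[OF x' a3])
 qed
 also have "\<dots> = (LBINT z:?S. \<bar>?R i z\<bar>)"
 using B0 L by (intro set_lebesgue_integral_cong S) auto
 also have "\<dots> <= (LBINT z. \<bar>?R i z\<bar>)" by (rule set_integral_abs_le_integral[OF Rint S])
 also have "\<dots> = (LBINT z. ?R i z)" using B0 L by (intro L_integral_cong) auto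
 also have "\<dots> = B * (LBINT z. \<bar>r i z - r0 z\<bar>) + L * (LBINT z. \<bar>D i z\<bar> * \<bar>r0 z\<bar>) + B * (LBINT z. \<bar>D i z\<bar> * \<bar>US z\<bar>)
 + B * (LBINT z. \<bar>D i z\<bar> * \<bar>d z\<bar>)"
 by (simp only: L_integral_add L_integrable_add integrable_mult_right Ri DGi r0 US d integral_mult_right_zero)
 finally have 1: "(LBINT z:?S. \<bar>\<Phi> (v i) (r i) z - \<Phi> v0 r0 z\<bar>) <= \<dots>" .
 have 2: "(LBINT z:?S - {0..t} \<times> {0..b i}. \<bar>\<Phi> v0 r0 z\<bar>) = (LBINT z. \<bar>indicat_real (Z i) z\<bar> * \<bar>G0 z\<bar>)"
 unfolding set_lebesgue_integral_def Z_def[symmetric]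
 by (intro L_integral_cong[OF refl]) (auto simp: Z_def G0_def indicator_def)
 have "\<bar>(LBINT z:{0..t} \<times> {0..b i}. \<Phi> (v i) (r i) z) - (LBINT z:?S. \<Phi> v0 r0 z)\<bar>
 <= (LBINT z:?S. \<bar>\<Phi> (v i) (r i) z - \<Phi> v0 r0 z\<bar>) + (LBINT z:?S - {0..t} \<times> {0..b i}. \<bar>\<Phi> v0 r0 z\<bar>)"
 by (rule set_integral_diff_le[OF Pi P0 Sb _ S]) (use b(2)[of i] in auto)
 then show ?thesis using 1 2 by linarith
 qed
 have "(?b \<longlongrightarrow> B * 0 + L * 0 + B * 0 + B * 0 + 0) F"
 by (intro tendsto_add tendsto_mult tendsto_const lim_r DG r0 US d ZG)
 then have "(?b \<longlongrightarrow> 0) F" by simp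
 then have "((%i. (LBINT z:{0..t} \<times> {0..b i}. \<Phi> (v i) (r i) z) - (LBINT z:?S. \<Phi> v0 r0 z)) \<longlongrightarrow> 0) F"
 by (rule Lim_null_comparison[OF always_eventually[OF allI], rotated]) (use bound in simp)
 then show ?thesis by (rule LIM_zero_cancel)
 qed
 have "((%i. LBINT s:{0..t}. \<beta> (v i (s, 0)) * u0 s) \<longlongrightarrow>
 (LBINT x:{0..1}. (1 - x) * (\<beta> (v0 (t, x)) - \<beta> (v0 (0, x)))) - (LBINT z:?S. \<Phi> v0 r0 z) + 0) F"
 unfolding ident by (intro tendsto_add tendsto_diff l1 l2 l3)
 then show ?thesis by (simp add: \<Phi>_def U_def)
qed

text \<open>Half-lines intersected with [0, T] are initial intervals, the only sets of times about
  which the balance law speaks directly.\<close>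

lemma tendsto_set_integral_of_initial:
 fixes g :: "'i => real => real"
 assumes g[measurable]: "!!i. g i \<in> borel_measurable borel" and H: "integrable lborel H"
 and dom: "!!i s. \<bar>g i s\<bar> <= H s" and T: "0 <= T"
 and lim: "!!a. 0 <= a ==> a <= T ==> ((%i. LBINT s:{0..a}. g i s) \<longlongrightarrow> 0) F"
 and A: "A \<in> sets borel"
 shows "((%i. LBINT s:{0..T} \<inter> A. g i s) \<longlongrightarrow> 0) F"
proof -
 define g' where "g' i s = indicat_real {0..T} s * g i s" for i s
 have e: "(LBINT s:B. g' i s) = (LBINT s:{0..T} \<inter> B. g i s)" for B i
 unfolding set_lebesgue_integral_def g'_def by (intro L_integral_cong) (auto simp: indicator_def)
 have "((%i. LBINT s:A. g' i s) \<longlongrightarrow> 0) F"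
 proof (rule tendsto_set_integral_of_half_lines[OF _ H])
 show "g' i \<in> borel_measurable borel" for i unfolding g'_def[abs_def] by measurable
 show "\<bar>g' i s\<bar> <= H s" for i s using dom[of i s] abs_ge_zero[of "g i s"] by (auto simp: g'_def indicator_def)
 have "(LBINT s. g' i s) = (LBINT s:{0..T}. g i s)" for i
 using e[of UNIV i] by (simp add: set_lebesgue_integral_def)
 then show "((%i. \<integral>s. g' i s \<partial>lborel) \<longlongrightarrow> 0) F" using lim[of T] T by simp
 fix a
 show "((%i. LBINT s:{..a}. g' i s) \<longlongrightarrow> 0) F"
 proof (cases "0 <= a")
 case True
 have "{0..T} \<inter> {..a} = {0..min T a}" by auto
 then show ?thesis unfolding e using lim[of "min T a"] T True by simp
 next
 case False
 then have "{0..T} \<inter> {..a} = {}" by auto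
 then show ?thesis unfolding e by (simp add: set_lebesgue_integral_def)
 qed
 qed (rule A)
 then show ?thesis unfolding e .
qed

lemma tendsto_L1_pair:
 fixes f :: "nat => 'a => real"
 assumes f: "!!n. integrable M (f n)" "integrable M f0" and lim: "(%n. \<integral>z. \<bar>f n z - f0 z\<bar> \<partial>M) \<longlonglongrightarrow> 0"
 shows "((%p. \<integral>z. \<bar>f (fst p) z - f (snd p) z\<bar> \<partial>M) \<longlongrightarrow> 0) (sequentially \<times>\<^sub>F sequentially)"
proof -
 let ?g = "%p. (\<integral>z. \<bar>f (fst p) z - f0 z\<bar> \<partial>M) + (\<integral>z. \<bar>f (snd p) z - f0 z\<bar> \<partial>M)"
 have "(?g \<longlongrightarrow> 0 + 0) (sequentially \<times>\<^sub>F sequentially)"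
 by (intro tendsto_add filterlim_compose[OF lim] filterlim_fst filterlim_snd)
 then have g: "(?g \<longlongrightarrow> 0) (sequentially \<times>\<^sub>F sequentially)" by simp
 have "(\<integral>z. \<bar>f (fst p) z - f (snd p) z\<bar> \<partial>M) <= ?g p" for p
 proof -
 have "(\<integral>z. \<bar>f (fst p) z - f (snd p) z\<bar> \<partial>M) <= (\<integral>z. \<bar>f (fst p) z - f0 z\<bar> + \<bar>f (snd p) z - f0 z\<bar> \<partial>M)"
 using f by (intro integral_mono) auto
 also have "\<dots> = ?g p" using f by (intro L_integral_add) auto
 finally show ?thesis .
 qed
 then have "norm (\<integral>z. \<bar>f (fst p) z - f (snd p) z\<bar> \<partial>M) <= ?g p" for p
 by (simp add: integral_nonneg_AE)
 then show ?thesis by (intro Lim_null_comparison[OF always_eventually g]) blast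
qed

section \<open>Strong convergence of the mollified boundary values\<close>

text \<open>The offset 2 gives \<open>eps n < 1\<close> for every index, so that
  \<open>1 - eps n\<close> is always a positive right end for the energy identity.\<close>

definition eps :: "nat => real" where "eps n = 1 / (real n + 2)"

lemma eps: "0 < eps n" "eps n < 1" "eps \<longlonglongrightarrow> 0"
proof -
 show "0 < eps n" "eps n < 1" by (auto simp: eps_def)
 show "eps \<longlonglongrightarrow> 0" unfolding eps_def[abs_def] by real_asymp
qed

text \<open>The smoothstep polynomial, which is 1 minus the primitive of \<open>moll\<close>.
  Testing with \<open>cutoff (x / ep)\<close> therefore weights the flux near 0 with the very kernel
  that defines the mollified boundary value.\<close>

definition cutoff :: "real => real" where
 "cutoff z = (let y = max 0 (min 1 z) in 1 - 3 * y^2 + 2 * y^3)"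

lemma cutoff_values: "z <= 0 ==> cutoff z = 1" "1 <= z ==> cutoff z = 0"
 by (auto simp: cutoff_def max_def min_def)

lemma cutoff_measurable[measurable]: "cutoff \<in> borel_measurable borel"
 unfolding cutoff_def[abs_def] Let_def by measurable

lemma cutoff_bound: "\<bar>cutoff z\<bar> <= 6"
proof -
 define y where "y = max 0 (min 1 z)"
 have y: "0 <= y" "y <= 1" by (auto simp: y_def)
 have "y^2 <= 1" "y^3 <= 1" using y by (auto intro: power_le_one)
 moreover have "0 <= y^2" "0 <= y^3" using y by auto
 ultimately show ?thesis unfolding cutoff_def Let_def y_def[symmetric] by linarith
qed

lemma cutoff_lipschitz: "\<bar>cutoff x - cutoff y\<bar> <= 12 * \<bar>x - y\<bar>"
proof -
 let ?c = "%z::real. max 0 (min 1 z)"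
 have "\<bar>(1 - 3 * (?c x)^2 + 2 * (?c x)^3) - (1 - 3 * (?c y)^2 + 2 * (?c y)^3)\<bar> <= 12 * \<bar>?c x - ?c y\<bar>"
 proof (rule lipschitz_of_bounded_derivative[where V=1])
 show "((%z::real. 1 - 3 * z^2 + 2 * z^3) has_real_derivative - 6 * z + 6 * z^2) (at z)" for z
 by (auto intro!: derivative_eq_intros simp: power2_eq_square)
 show "\<bar>- 6 * z + 6 * z^2\<bar> <= 12" if "\<bar>z\<bar> <= 1" for z :: real
 proof -
 have "z^2 <= 1" using that by (simp add: abs_square_le_1)
 then show ?thesis using that zero_le_power2[of z] by linarith
 qed
 qed auto
 also have "\<dots> <= 12 * \<bar>x - y\<bar>" by (auto simp: max_def min_def)
 finally show ?thesis by (simp add: cutoff_def Let_def)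
qed

lemma cutoff_DERIV:
 assumes "0 < z" "z ~= 1"
 shows "(cutoff has_real_derivative - moll z) (at z)"
proof (cases "z < 1")
 case True
 have "((%z::real. 1 - 3 * z^2 + 2 * z^3) has_real_derivative - moll z) (at z)"
 using assms True by (auto intro!: derivative_eq_intros simp: moll_eq power2_eq_square algebra_simps)
 then show ?thesis
 by (rule has_field_derivative_transform_within_open[where S="{0<..<1}"])
 (use assms True in \<open>auto simp: cutoff_def max_def min_def\<close>)
next
 case False
 then have "((%_. 0) has_real_derivative - moll z) (at z)" by (simp add: moll_zero)
 then show ?thesis
 by (rule has_field_derivative_transform_within_open[where S="{1<..}"])
 (use assms False in \<open>auto simp: cutoff_values\<close>)
qed

lemma lip_test_cutoff:
 assumes "0 < ep"
 shows "lip_test (%x. cutoff (x / ep)) (%x. - moll (x / ep) / ep)"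
 unfolding lip_test_def
proof (intro conjI)
 show "\<exists>L. L-lipschitz_on {0..1} (%x. cutoff (x / ep)) \<and> (\<forall>x. \<bar>- moll (x / ep) / ep\<bar> <= L) \<and> (\<forall>x. \<bar>cutoff (x / ep)\<bar> <= L)"
 proof (intro exI[of _ "12 / ep + 6"] conjI allI lipschitz_onI)
 fix x y :: real
 have "\<bar>cutoff (x / ep) - cutoff (y / ep)\<bar> <= 12 * \<bar>x / ep - y / ep\<bar>" by (rule cutoff_lipschitz)
 also have "\<dots> = 12 / ep * \<bar>x - y\<bar>" using assms by (simp add: diff_divide_distrib[symmetric] abs_divide)
 also have "\<dots> <= (12 / ep + 6) * \<bar>x - y\<bar>" by (intro mult_right_mono) auto
 finally show "dist (cutoff (x / ep)) (cutoff (y / ep)) <= (12 / ep + 6) * dist x y" by (simp add: dist_real_def)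
 next
 fix x
 have "\<bar>- moll (x / ep) / ep\<bar> <= 6 / ep"
 using assms moll_bounds(3)[of "x / ep"] by (simp add: abs_divide divide_right_mono)
 also have "\<dots> <= 12 / ep + 6" using assms by (simp add: field_simps)
 finally show "\<bar>- moll (x / ep) / ep\<bar> <= 12 / ep + 6" .
 have "0 <= 12 / ep" using assms by simp
 then show "\<bar>cutoff (x / ep)\<bar> <= 12 / ep + 6" using cutoff_bound[of "x / ep"] by linarith
 qed (use assms in auto)
 show "\<exists>S. finite S \<and> (\<forall>x\<in>{0<..<1} - S. ((%x. cutoff (x / ep)) has_real_derivative - moll (x / ep) / ep) (at x))"
 proof (intro exI[of _ "{ep}"] conjI ballI)
 fix x assume "x \<in> {0<..<1} - {ep}"
 then have "0 < x / ep" "x / ep ~= 1" using assms by auto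
 then have "((%x. cutoff (x / ep)) has_real_derivative - moll (x / ep) * (1 / ep)) (at x)"
 using assms by (intro DERIV_chain2[where f=cutoff] cutoff_DERIV) (auto intro!: derivative_eq_intros)
 then show "((%x. cutoff (x / ep)) has_real_derivative - moll (x / ep) / ep) (at x)" by simp
 qed simp
qed measurable

lemma tendsto_integral_boundary_strip:
 fixes f :: "real \<times> real => real"
 assumes f: "integrable lborel f"
 shows "(%n. \<integral>z. indicat_real {0<..eps n} (snd z) * \<bar>f z\<bar> \<partial>lborel) \<longlonglongrightarrow> 0"
proof -
 have [measurable]: "f \<in> borel_measurable borel" using f by auto
 have "(%n. \<integral>z. indicat_real {0<..eps n} (snd z) * \<bar>f z\<bar> \<partial>lborel) \<longlonglongrightarrow> (\<integral>z. 0 \<partial>(lborel :: (real \<times> real) measure))"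
 proof (rule integral_dominated_convergence[where w="%z. \<bar>f z\<bar>"])
 show "AE z in lborel. (%n. indicat_real {0<..eps n} (snd z) * \<bar>f z\<bar>) \<longlonglongrightarrow> 0"
 proof (rule AE_I2)
 fix z :: "real \<times> real"
 have "\<forall>\<^sub>F n in sequentially. indicat_real {0<..eps n} (snd z) = 0"
 proof (cases "0 < snd z")
 case True
 then have "\<forall>\<^sub>F n in sequentially. eps n < snd z" by (intro order_tendstoD(2)[OF eps(3)])
 then show ?thesis by eventually_elim auto
 qed auto
 then show "(%n. indicat_real {0<..eps n} (snd z) * \<bar>f z\<bar>) \<longlonglongrightarrow> 0"
 by (intro tendsto_eventually) (auto elim: eventually_mono)
 qed
 show "integrable lborel (%z. \<bar>f z\<bar>)" using f by simp
 show "(%z. indicat_real {0<..eps n} (snd z) * \<bar>f z\<bar>) \<in> borel_measurable lborel" for n by measurable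
 qed (auto simp: indicator_def)
 then show ?thesis by simp
qed

context balance_law
begin

text \<open>The mollified equation is linear, so a difference of two mollifications solves it with a
  source tending to 0 in the mean. With the square for \<open>\<beta>\<close> and limit functions 0,
  everything on the right of \<open>energy_limit\<close> vanishes. Both mollifications must be
  available, so the interval ends at 1 minus the larger \<open>eps\<close>.\<close>

lemma trace_energy_pair:
 assumes t: "0 <= t" "t <= T"
 shows "((%p. LBINT s:{0..t}. (mv (eps (fst p)) (s, 0) - mv (eps (snd p)) (s, 0))^2 * u0 s) \<longlongrightarrow> 0)
 (sequentially \<times>\<^sub>F sequentially)"
proof -
 let ?F = "sequentially \<times>\<^sub>F sequentially :: (nat \<times> nat) filter"
 let ?v = "%p z. mv (eps (fst p)) z - mv (eps (snd p)) z"
 let ?vx = "%p z. mvx (eps (fst p)) z - mvx (eps (snd p)) z"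
 let ?q = "%p z. mq (eps (fst p)) z - mq (eps (snd p)) z"
 let ?r = "%p z. mr (eps (fst p)) z - mr (eps (snd p)) z"
 let ?b = "%p. 1 - max (eps (fst p)) (eps (snd p))"
 have acd: "ac_on b (%t. f t - g t) (%t. f' t - g' t)" if "ac_on b f f'" "ac_on b g g'" for b f g f' g'
 using ac_on_add[OF that(1) ac_on_cmult[OF that(2), of "-1"]] by simp
 have "((%p. LBINT s:{0..t}. (%x. x^2) (?v p (s, 0)) * u0 s) \<longlongrightarrow>
 (LBINT x:{0..1}. (1 - x) * ((%x. x^2) ((%_. 0 :: real) (t, x)) - (%x. x^2) ((%_. 0 :: real) (0, x))))
 - (LBINT z:{0..t} \<times> {0..1}. (1 - snd z) * (%x. 2 * x) ((%_. 0 :: real) z) * (%_. 0 :: real) z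
 - (%x. x^2) ((%_. 0 :: real) z) * vel u0 d (fst z) (snd z) + (1 - snd z) * (%x. x^2) ((%_. 0 :: real) z) * d z)) ?F"
 proof (rule energy_limit[where v="?v" and vx="?vx" and q="?q" and r="?r" and b="?b" and V="2*C" and L=2
 and V'="%p. 6 * C / (eps (fst p))^2 + 6 * C / (eps (snd p))^2", OF t(1)])
 have "((%p. 1 - max (eps (fst p)) (eps (snd p))) \<longlongrightarrow> 1 - max 0 0) ?F"
 by (intro tendsto_diff tendsto_const tendsto_max filterlim_compose[OF eps(3)] filterlim_fst filterlim_snd)
 then show "(?b \<longlongrightarrow> 1) ?F" by simp
 show "0 < ?b p" "?b p <= 1" for p using eps(1,2)[of "fst p"] eps(1,2)[of "snd p"] by auto
 show "\<bar>?v p z\<bar> <= 2 * C" for p z using mv_le[of "eps (fst p)" z] mv_le[of "eps (snd p)" z] by linarith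
 show "\<bar>?vx p z\<bar> <= 6 * C / (eps (fst p))^2 + 6 * C / (eps (snd p))^2" for p z
 using mvx_le[OF eps(1), of "fst p" z] mvx_le[OF eps(1), of "snd p" z] by linarith
 show "integrable lborel (?r p)" for p using mr_integrable by auto
 show "((%x. x^2) has_real_derivative 2 * x) (at x)" for x :: real by (auto intro!: derivative_eq_intros)
 show "\<bar>2 * y - 2 * x\<bar> <= 2 * \<bar>y - x\<bar>" for x y :: real by (auto simp: abs_if)
 show "ac_on t (%s. ?v p (s, x)) (%s. ?q p (s, x))" if "0 <= x" "x <= ?b p" for p x
 using that t by (intro acd mv_time eps) auto
 show "ac_on (?b p) (%x. ?v p (s, x)) (%x. ?vx p (s, x))" for p s
 by (intro acd mv_space eps)
 show "AE z in lborel. z \<in> {0..t} \<times> {0..?b p} --> ?q p z = ?r p z - vel u0 d (fst z) (snd z) * ?vx p z" for p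
 using mq_eq_mr[OF eps(1), of t "?b p" "fst p"] mq_eq_mr[OF eps(1), of t "?b p" "snd p"]
 by eventually_elim (auto simp: algebra_simps)
 show "integrable lborel (?v p)" for p using mv_tendsto(2)[OF eps(3)] by auto
 show "((%p. \<integral>z. \<bar>?v p z - 0\<bar> \<partial>lborel) \<longlongrightarrow> 0) ?F"
 using tendsto_L1_pair[OF mv_tendsto(2)[OF eps(3)] w_integrable mv_tendsto(1)[OF eps(3)]] by simp
 show "((%p. \<integral>z. \<bar>?r p z - 0\<bar> \<partial>lborel) \<longlongrightarrow> 0) ?F"
 using tendsto_L1_pair[OF mr_integrable wd_integrable mr_tendsto[OF eps(3)]] by simp
 show "integrable lborel (%x. ?v p (s, x))" for p s using mv_tendsto(4)[OF eps(3)] by auto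
 show "((%p. \<integral>x. \<bar>?v p (s, x) - 0\<bar> \<partial>lborel) \<longlongrightarrow> 0) ?F" for s
 using tendsto_L1_pair[OF mv_tendsto(4)[OF eps(3)] w_integrable_section mv_tendsto(3)[OF eps(3)]] by simp
 qed (use d u0 C0 in auto)
 then show ?thesis by (simp add: set_lebesgue_integral_def)
qed

abbreviation mtr :: "nat => real => real" where "mtr n s \<equiv> mv (eps n) (s, 0)"

lemma mtr_measurable[measurable]: "mtr n \<in> borel_measurable borel"
 by (rule borel_measurable_section(2)[OF mv_measurable])

lemma bounded_u0_integrable:
 assumes "f \<in> borel_measurable borel" "!!s. \<bar>f s\<bar> <= B" "A \<in> sets borel"
 shows "set_integrable lborel A (%s. f s * u0 s)"
 by (rule set_integrable_of_integrable[OF integrable_mult_bounded[OF u0, where B=B]]) (use assms in auto)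

lemma bounded_abs_u0_integrable:
 assumes "f \<in> borel_measurable borel" "!!s. \<bar>f s\<bar> <= B" "A \<in> sets borel"
 shows "set_integrable lborel A (%s. f s * \<bar>u0 s\<bar>)"
 by (rule set_integrable_of_integrable[OF integrable_mult_bounded[OF integrable_abs[OF u0], where B=B]]) (use assms in auto)

lemma mtr_diff_le: "\<bar>mtr n s - mtr m s\<bar> <= 2 * C" "\<bar>mtr n s - g0 s\<bar> <= 2 * C"
 using mv_le[of "eps n" "(s, 0)"] mv_le[of "eps m" "(s, 0)"] g_le(1)[of s] by linarith+

text \<open>Since \<open>u0\<close> may change sign, small signed integrals say nothing by
  themselves. Known for all Borel sets of times, they can be restricted to \<open>0 < u0\<close> and
  to its complement, which yields the weight \<open>\<bar>u0\<bar>\<close>. The step from squares to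
  moduli is Young's inequality.\<close>

lemma trace_cauchy:
 "((%p. LBINT s:{0..T}. \<bar>mtr (fst p) s - mtr (snd p) s\<bar> * \<bar>u0 s\<bar>) \<longlongrightarrow> 0) (sequentially \<times>\<^sub>F sequentially)"
proof -
 let ?F = "sequentially \<times>\<^sub>F sequentially :: (nat \<times> nat) filter"
 let ?D = "%p s. mtr (fst p) s - mtr (snd p) s"
 have D2: "\<bar>(?D p s)^2\<bar> <= 4 * C^2" for p s
 using power_mono[OF mtr_diff_le(1)[of "fst p" s "snd p"] abs_ge_zero, of 2] by (simp add: power_mult_distrib)
 have lim: "((%p. LBINT s:{0..T} \<inter> A. (?D p s)^2 * u0 s) \<longlongrightarrow> 0) ?F" if "A \<in> sets borel" for A
 proof (rule tendsto_set_integral_of_initial[OF _ _ _ _ trace_energy_pair that])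
 show "integrable lborel (%s. 4 * C^2 * \<bar>u0 s\<bar>)" using u0 by simp
 show "\<bar>(?D p s)^2 * u0 s\<bar> <= 4 * C^2 * \<bar>u0 s\<bar>" for p s
 unfolding abs_mult by (intro mult_right_mono D2) auto
 show "(%s. (?D p s)^2 * u0 s) \<in> borel_measurable borel" for p by measurable
 qed (use T in auto)
 let ?P = "{s. 0 < u0 s}" and ?N = "{s. \<not> 0 < u0 s}"
 have PN: "?P \<in> sets borel" "?N \<in> sets borel" by measurable
 have sq: "(LBINT s:{0..T}. (?D p s)^2 * \<bar>u0 s\<bar>)
 = (LBINT s:{0..T} \<inter> ?P. (?D p s)^2 * u0 s) - (LBINT s:{0..T} \<inter> ?N. (?D p s)^2 * u0 s)" for p
 proof -
 have m: "(%s. (?D p s)^2) \<in> borel_measurable borel" by measurable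
 have i: "set_integrable lborel ({0..T} \<inter> A) (%s. (?D p s)^2 * u0 s)" if "A \<in> sets borel" for A
 by (rule bounded_u0_integrable[OF m D2]) (use that in auto)
 have "(LBINT s:{0..T}. (?D p s)^2 * \<bar>u0 s\<bar>)
 = (LBINT s. indicat_real ({0..T} \<inter> ?P) s *\<^sub>R ((?D p s)^2 * u0 s) - indicat_real ({0..T} \<inter> ?N) s *\<^sub>R ((?D p s)^2 * u0 s))"
 unfolding set_lebesgue_integral_def by (intro L_integral_cong) (auto simp: indicator_def)
 then show ?thesis using i[OF PN(1)] i[OF PN(2)] unfolding set_lebesgue_integral_def set_integrable_def
 by (simp only: L_integral_diff)
 qed
 have sqlim: "((%p. LBINT s:{0..T}. (?D p s)^2 * \<bar>u0 s\<bar>) \<longlongrightarrow> 0) ?F"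
 using tendsto_diff[OF lim[OF PN(1)] lim[OF PN(2)]] unfolding sq by simp
 define I where "I = (LBINT s:{0..T}. \<bar>u0 s\<bar>)"
 have I0: "0 <= I" unfolding I_def set_lebesgue_integral_def by (intro integral_nonneg_AE) auto
 have iu: "set_integrable lborel {0..T} (%s. \<bar>u0 s\<bar>)" using u0 by (intro set_integrable_of_integrable) auto
 show ?thesis
 proof (rule tendstoI)
 fix e :: real assume e: "0 < e"
 \<comment> \<open>Makes the part of Young's bound that is free of the squares smaller than
   \<open>e / 2\<close>; adding 1 covers the case \<open>I = 0\<close>.\<close>
 define et where "et = e / (2 * (I + 1))"
 have et: "0 < et" "et * I < e / 2"
 proof -
 show "0 < et" using e I0 by (simp add: et_def)
 have "et * I < et * (I + 1)" using \<open>0 < et\<close> by simp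
 also have "\<dots> = e / 2" using I0 by (simp add: et_def field_simps)
 finally show "et * I < e / 2" .
 qed
 have "\<forall>\<^sub>F p in ?F. (LBINT s:{0..T}. (?D p s)^2 * \<bar>u0 s\<bar>) < et * (e / 2)"
 using e et by (intro order_tendstoD(2)[OF sqlim]) auto
 then show "\<forall>\<^sub>F p in ?F. dist (LBINT s:{0..T}. \<bar>?D p s\<bar> * \<bar>u0 s\<bar>) 0 < e"
 proof eventually_elim
 case (elim p)
 have m: "(%s. (?D p s)^2) \<in> borel_measurable borel" "(%s. \<bar>?D p s\<bar>) \<in> borel_measurable borel" by measurable
 have i1: "set_integrable lborel {0..T} (%s. (?D p s)^2 * \<bar>u0 s\<bar>)"
 by (rule bounded_abs_u0_integrable[OF m(1) D2]) simp
 have i2: "set_integrable lborel {0..T} (%s. \<bar>?D p s\<bar> * \<bar>u0 s\<bar>)"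
 by (rule bounded_abs_u0_integrable[OF m(2), where B="2*C"]) (use mtr_diff_le in auto)
 have "(LBINT s:{0..T}. \<bar>?D p s\<bar> * \<bar>u0 s\<bar>) <= (LBINT s:{0..T}. et * \<bar>u0 s\<bar> + 1 / et * ((?D p s)^2 * \<bar>u0 s\<bar>))"
 proof (rule set_integral_mono[OF i2])
 show "set_integrable lborel {0..T} (%s. et * \<bar>u0 s\<bar> + 1 / et * ((?D p s)^2 * \<bar>u0 s\<bar>))"
 by (intro set_integral_add(1) set_integrable_mult_right iu i1)
 fix s
 have "\<bar>?D p s\<bar> <= et + (?D p s)^2 / et"
 proof -
 have "2 * et * \<bar>?D p s\<bar> <= et^2 + (?D p s)^2"
 using zero_le_power2[of "et - \<bar>?D p s\<bar>"] by (simp add: power2_diff)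
 then have "et * \<bar>?D p s\<bar> <= et^2 + (?D p s)^2"
 using et(1) mult_nonneg_nonneg[of et "\<bar>?D p s\<bar>"] by linarith
 then show ?thesis using et(1) by (simp add: field_simps power2_eq_square)
 qed
 then have "\<bar>?D p s\<bar> * \<bar>u0 s\<bar> <= (et + (?D p s)^2 / et) * \<bar>u0 s\<bar>" by (intro mult_right_mono) auto
 then show "\<bar>?D p s\<bar> * \<bar>u0 s\<bar> <= et * \<bar>u0 s\<bar> + 1 / et * ((?D p s)^2 * \<bar>u0 s\<bar>)"
 by (simp add: distrib_right)
 qed
 also have "\<dots> = et * I + 1 / et * (LBINT s:{0..T}. (?D p s)^2 * \<bar>u0 s\<bar>)"
 unfolding I_def
 by (simp only: set_integral_add(2)[OF set_integrable_mult_right[OF iu] set_integrable_mult_right[OF i1]] set_integral_mult_right)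
 also have "\<dots> < e / 2 + 1 / et * (et * (e / 2))"
 using et elim by (intro add_strict_mono mult_strict_left_mono) auto
 also have "\<dots> = e" using et(1) by simp
 finally have "(LBINT s:{0..T}. \<bar>?D p s\<bar> * \<bar>u0 s\<bar>) < e" .
 moreover have "0 <= (LBINT s:{0..T}. \<bar>?D p s\<bar> * \<bar>u0 s\<bar>)"
 unfolding set_lebesgue_integral_def by (intro integral_nonneg_AE) auto
 ultimately show ?case by (simp add: dist_real_def)
 qed
 qed
qed

lemma section_d_h_integrable:
 "AE s in lborel. integrable lborel (%x. d (s, x)) \<and> integrable lborel (%x. h (s, x))"
 using integrable_lborel_pair(1)[OF d] integrable_lborel_pair(1)[OF h] by eventually_elim auto

text \<open>Test with the cutoff supported near 0: the tested solution is of order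
  \<open>eps n\<close>, while the flux is the kernel average of \<open>w * U\<close>, in which
  \<open>U\<close> may be replaced by its boundary value \<open>u0\<close> at the cost of the mass
  of \<open>d\<close> on the strip.\<close>

lemma trace_weak_initial:
 assumes t: "0 <= t" "t <= T"
 shows "(%n. LBINT s:{0..t}. (mtr n s - g0 s) * u0 s) \<longlonglongrightarrow> 0"
proof -
 define J where "J n s = (LBINT x. w (s, x) * vel u0 d s x * (- moll (x / eps n) / eps n) + h (s, x) * cutoff (x / eps n)) + g0 s * u0 s" for n s
 \<comment> \<open>The two errors: 6 bounds the cutoff in front of the source, and \<open>C\<close>
   bounds \<open>w\<close> in front of the variation of the velocity over the strip.\<close>
 define K where "K n s = 6 * (LBINT x. indicat_real {0<..eps n} x * \<bar>h (s, x)\<bar>) + C * (LBINT x. indicat_real {0<..eps n} x * \<bar>d (s, x)\<bar>)" for n s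
 have Ki: "integrable lborel (K n)" and KI: "(LBINT s. K n s) = 6 * (LBINT z. indicat_real {0<..eps n} (snd z) * \<bar>h z\<bar>)
 + C * (LBINT z. indicat_real {0<..eps n} (snd z) * \<bar>d z\<bar>)" for n
 proof -
 have i: "integrable lborel (%z. indicat_real {0<..eps n} (snd z) * \<bar>f z\<bar>)" if "integrable lborel f" for f :: "real \<times> real => real"
 by (rule integrable_mult_bounded[OF integrable_abs[OF that], where B=1]) (auto simp: indicator_def)
 note H = integrable_lborel_pair(3,5)[OF i[OF h]] and D = integrable_lborel_pair(3,5)[OF i[OF d]]
 show "integrable lborel (K n)" using H(1) D(1) by (simp add: K_def[abs_def])
 show "(LBINT s. K n s) = 6 * (LBINT z. indicat_real {0<..eps n} (snd z) * \<bar>h z\<bar>)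
 + C * (LBINT z. indicat_real {0<..eps n} (snd z) * \<bar>d z\<bar>)"
 using H D by (simp add: K_def)
 qed
 have Klim: "(%n. \<integral>s. K n s \<partial>lborel) \<longlonglongrightarrow> 0"
 unfolding KI using tendsto_add[OF tendsto_mult_left[OF tendsto_integral_boundary_strip[OF h], of 6]
 tendsto_mult_left[OF tendsto_integral_boundary_strip[OF d], of C]] by simp
 have Ji: "set_integrable lborel {0..t} (J n)" for n
 unfolding J_def[abs_def]
 proof (rule set_integral_add(1))
 show "set_integrable lborel {0..t} (%s. \<integral>x. w (s, x) * vel u0 d s x * (- moll (x / eps n) / eps n) + h (s, x) * cutoff (x / eps n) \<partial>lborel)"
 using integrable_lborel_pair(3)[OF balance_integrand_integrable[OF lip_test_cutoff[OF eps(1)]], of n]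
 by (intro set_integrable_of_integrable) auto
 show "set_integrable lborel {0..t} (%s. g0 s * u0 s)"
 by (rule bounded_u0_integrable[OF _ g_le(1)]) auto
 qed
 \<comment> \<open>Two time slices, each at most \<open>6 * C\<close> on a strip of width
   \<open>eps n\<close>.\<close>
 have Jint: "\<bar>LBINT s:{0..t}. J n s\<bar> <= 12 * C * eps n" for n
 proof -
 have "cutoff (1 / eps n) = 0" "cutoff (0 / eps n) = 1"
 using eps(1,2)[of n] by (auto simp: cutoff_values)
 then have "(LBINT s:{0..t}. J n s) = (LBINT x. w (t, x) * cutoff (x / eps n)) - (LBINT x. w (0, x) * cutoff (x / eps n))"
 using balance[OF lip_test_cutoff[OF eps(1)] t, of n] by (simp add: J_def)
 moreover have "\<bar>\<integral>x. w (s, x) * cutoff (x / eps n) \<partial>lborel\<bar> <= 6 * C * eps n" for s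
 proof -
 have "\<bar>\<integral>x. w (s, x) * cutoff (x / eps n) \<partial>lborel\<bar> <= (LBINT x. \<bar>w (s, x) * cutoff (x / eps n)\<bar>)"
 by (rule integral_abs_bound)
 also have "\<dots> <= (LBINT x. 6 * C * indicat_real {0..eps n} x)"
 proof (rule integral_mono')
 show "integrable lborel (%x::real. 6 * C * indicat_real {0..eps n} x)"
 using eps(1)[of n] by (intro integrable_mult_right integrable_real_indicator) (auto simp: emeasure_lborel_Icc_eq)
 fix x
 show "\<bar>w (s, x) * cutoff (x / eps n)\<bar> <= 6 * C * indicat_real {0..eps n} x"
 proof (cases "0 <= x \<and> x <= eps n")
 case True
 have "\<bar>w (s, x)\<bar> * \<bar>cutoff (x / eps n)\<bar> <= C * 6" by (intro mult_mono w_le cutoff_bound C0) auto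
 then show ?thesis using True by (simp add: abs_mult mult.commute)
 next
 case False
 then have "w (s, x) = 0 \<or> cutoff (x / eps n) = 0"
 using w_0[of x s] eps(1)[of n] by (auto intro!: cutoff_values(2))
 then show ?thesis using C0 by auto
 qed
 qed (use C0 in auto)
 also have "\<dots> = 6 * C * eps n" using eps(1)[of n] by simp
 finally show ?thesis .
 qed
 from this[of t] this[of 0] show ?thesis using calculation by linarith
 qed
 have ae: "AE s in lborel. \<bar>(mtr n s - g0 s) * u0 s + J n s\<bar> <= K n s" for n
 using section_d_h_integrable
 proof eventually_elim
 case (elim s)
 then have dI: "integrable lborel (%x. d (s, x))" and hI: "integrable lborel (%x. h (s, x))" by auto
 let ?e = "eps n" and ?U = "vel u0 d s"
 have e: "0 < ?e" by (rule eps)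
 define N where "N = \<bar>u0 s\<bar> + (LBINT y. \<bar>d (s, y)\<bar>)"
 have N: "\<bar>?U y\<bar> <= N" for y unfolding N_def by (rule vel_le[OF dI])
 have [measurable]: "?U \<in> borel_measurable borel" "(%y. w (s, y)) \<in> borel_measurable borel"
 using borel_measurable_section(1)[OF vel_measurable', of s] borel_measurable_section(1)[OF w_measurable, of s] by simp_all
 have wU: "\<bar>w (s, y) * ?U y'\<bar> <= C * N" for y y'
 by (simp add: abs_mult mult_mono w_le N C0)
 have i1: "integrable lborel (%\<sigma>. w (s, ?e * \<sigma>) * ?U (?e * \<sigma>) * moll \<sigma>)"
 by (rule integrable_mult_bounded[OF integrable_moll(1), where B="C * N"]) (use wU in auto)
 have i2: "integrable lborel (%\<sigma>. w (s, ?e * \<sigma>) * u0 s * moll \<sigma>)"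
 by (rule integrable_mult_bounded[OF integrable_moll(1), where B="C * N"])
 (use wU[of _ 0] in \<open>auto simp: vel_0\<close>)
 have i3: "integrable lborel (%x. h (s, x) * cutoff (x / ?e))"
 using integrable_mult_bounded[OF hI, of "%x. cutoff (x / ?e)" 6] by (auto simp: cutoff_bound mult.commute)
 have i4: "integrable lborel (%x. w (s, x) * ?U x * (- moll (x / ?e) / ?e))"
 proof -
 have "integrable lborel (%x. moll (0 + 1 / ?e * x))"
 using e by (intro lborel_integrable_real_affine integrable_moll) auto
 then have "integrable lborel (%x. (- 1 / ?e) * ((w (s, x) * ?U x) * moll (0 + 1 / ?e * x)))"
 by (intro integrable_mult_right integrable_mult_bounded[where B="C * N"]) (use wU in auto)
 then show ?thesis by (simp add: mult_ac)
 qed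
 have a4: "(LBINT x. w (s, x) * ?U x * (- moll (x / ?e) / ?e)) = - (LBINT \<sigma>. w (s, ?e * \<sigma>) * ?U (?e * \<sigma>) * moll \<sigma>)"
 proof -
 have "(LBINT x. w (s, x) * ?U x * (- moll (x / ?e) / ?e)) = ?e * (LBINT \<sigma>. w (s, ?e * \<sigma>) * ?U (?e * \<sigma>) * (- moll \<sigma> / ?e))"
 using lborel_integral_real_affine[of ?e "%x. w (s, x) * ?U x * (- moll (x / ?e) / ?e)" 0] e by simp
 also have "\<dots> = (LBINT \<sigma>. ?e * (w (s, ?e * \<sigma>) * ?U (?e * \<sigma>) * (- moll \<sigma> / ?e)))"
 by (rule integral_mult_right_zero[symmetric])
 also have "\<dots> = (LBINT \<sigma>. - (w (s, ?e * \<sigma>) * ?U (?e * \<sigma>) * moll \<sigma>))"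
 using e by (intro L_integral_cong) auto
 finally show ?thesis by simp
 qed
 have m: "mtr n s * u0 s = (LBINT \<sigma>. w (s, ?e * \<sigma>) * u0 s * moll \<sigma>)"
 proof -
 have "mtr n s * u0 s = (LBINT \<sigma>. w (s, ?e * \<sigma>) * moll \<sigma> * u0 s)"
 unfolding mv_def integral_mult_left_zero by simp
 then show ?thesis by (simp add: mult_ac)
 qed
 have eq: "(mtr n s - g0 s) * u0 s + J n s = (LBINT \<sigma>. w (s, ?e * \<sigma>) * u0 s * moll \<sigma> - w (s, ?e * \<sigma>) * ?U (?e * \<sigma>) * moll \<sigma>)
 + (LBINT x. h (s, x) * cutoff (x / ?e))"
 unfolding L_integral_diff[OF i2 i1] J_def L_integral_add[OF i4 i3] a4
 using m by (simp add: left_diff_distrib)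
 define D where "D = (LBINT x. indicat_real {0<..?e} x * \<bar>d (s, x)\<bar>)"
 have U: "\<bar>?U (?e * \<sigma>) - u0 s\<bar> <= D" if "0 <= \<sigma>" "\<sigma> <= 1" for \<sigma>
 proof -
 have "?U (?e * \<sigma>) - ?U 0 = (LBINT y:{0<..?e * \<sigma>}. d (s, y))"
 using e that by (intro ac_on_increment[OF ac_on_vel[OF dI, of "?e * \<sigma>"]]) auto
 also have "\<bar>\<dots>\<bar> <= (LBINT y. \<bar>indicat_real {0<..?e * \<sigma>} y *\<^sub>R d (s, y)\<bar>)"
 unfolding set_lebesgue_integral_def by (rule integral_abs_bound)
 also have "\<dots> <= D" unfolding D_def
 proof (rule integral_mono)
 show "integrable lborel (%y. \<bar>indicat_real {0<..?e * \<sigma>} y *\<^sub>R d (s, y)\<bar>)"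
 using integrable_mult_indicator[OF _ dI, of "{0<..?e * \<sigma>}"] by (intro integrable_abs) simp
 show "integrable lborel (%x. indicat_real {0<..?e} x * \<bar>d (s, x)\<bar>)"
 using integrable_mult_indicator[OF _ integrable_abs[OF dI], of "{0<..?e}"] by simp
 have "?e * \<sigma> <= ?e" using e that by (simp add: mult_le_cancel_left1)
 then show "\<bar>indicat_real {0<..?e * \<sigma>} y *\<^sub>R d (s, y)\<bar> <= indicat_real {0<..?e} y * \<bar>d (s, y)\<bar>" for y
 by (auto simp: indicator_def)
 qed
 finally show ?thesis by (simp add: vel_0)
 qed
 have "\<bar>\<integral>\<sigma>. w (s, ?e * \<sigma>) * u0 s * moll \<sigma> - w (s, ?e * \<sigma>) * ?U (?e * \<sigma>) * moll \<sigma> \<partial>lborel\<bar> <= (LBINT \<sigma>. C * D * moll \<sigma>)"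
 proof (rule order_trans[OF integral_abs_bound integral_mono])
 show "integrable lborel (%\<sigma>. \<bar>w (s, ?e * \<sigma>) * u0 s * moll \<sigma> - w (s, ?e * \<sigma>) * ?U (?e * \<sigma>) * moll \<sigma>\<bar>)"
 using i1 i2 by auto
 show "integrable lborel (%\<sigma>. C * D * moll \<sigma>)" using integrable_moll by simp
 fix \<sigma>
 show "\<bar>w (s, ?e * \<sigma>) * u0 s * moll \<sigma> - w (s, ?e * \<sigma>) * ?U (?e * \<sigma>) * moll \<sigma>\<bar> <= C * D * moll \<sigma>"
 proof (cases "0 <= \<sigma> \<and> \<sigma> <= 1")
 case True
 have "w (s, ?e * \<sigma>) * u0 s * moll \<sigma> - w (s, ?e * \<sigma>) * ?U (?e * \<sigma>) * moll \<sigma> = - (w (s, ?e * \<sigma>) * (?U (?e * \<sigma>) - u0 s) * moll \<sigma>)"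
 by (simp add: algebra_simps)
 then have "\<bar>w (s, ?e * \<sigma>) * u0 s * moll \<sigma> - w (s, ?e * \<sigma>) * ?U (?e * \<sigma>) * moll \<sigma>\<bar> = \<bar>w (s, ?e * \<sigma>)\<bar> * \<bar>?U (?e * \<sigma>) - u0 s\<bar> * moll \<sigma>"
 by (simp add: abs_mult moll_bounds)
 also have "\<dots> <= C * D * moll \<sigma>"
 using True by (intro mult_right_mono mult_mono w_le U C0 moll_bounds) auto
 finally show ?thesis .
 qed (auto simp: moll_zero)
 qed
 also have "\<dots> = C * D" by (simp add: integral_moll)
 finally have 1: "\<bar>\<integral>\<sigma>. w (s, ?e * \<sigma>) * u0 s * moll \<sigma> - w (s, ?e * \<sigma>) * ?U (?e * \<sigma>) * moll \<sigma> \<partial>lborel\<bar> <= C * D" .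
 have "\<bar>\<integral>x. h (s, x) * cutoff (x / ?e) \<partial>lborel\<bar> <= (LBINT x. 6 * (indicat_real {0<..?e} x * \<bar>h (s, x)\<bar>))"
 proof (rule order_trans[OF integral_abs_bound integral_mono])
 show "integrable lborel (%x. \<bar>h (s, x) * cutoff (x / ?e)\<bar>)" using i3 by auto
 show "integrable lborel (%x. 6 * (indicat_real {0<..?e} x * \<bar>h (s, x)\<bar>))"
 using integrable_mult_indicator[OF _ integrable_abs[OF hI], of "{0<..?e}"] by simp
 fix x
 show "\<bar>h (s, x) * cutoff (x / ?e)\<bar> <= 6 * (indicat_real {0<..?e} x * \<bar>h (s, x)\<bar>)"
 proof (cases "0 < x \<and> x <= ?e")
 case True
 then show ?thesis using mult_left_mono[OF cutoff_bound[of "x / ?e"] abs_ge_zero[of "h (s, x)"]]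
 by (simp add: abs_mult mult.commute)
 next
 case False
 then have "h (s, x) = 0 \<or> cutoff (x / ?e) = 0"
 using h_0[of x s] e by (auto intro!: cutoff_values(2))
 then show ?thesis by auto
 qed
 qed
 also have "\<dots> = 6 * (LBINT x. indicat_real {0<..?e} x * \<bar>h (s, x)\<bar>)" by simp
 finally show ?case unfolding eq K_def D_def[symmetric] using 1 by linarith
 qed
 have "\<bar>LBINT s:{0..t}. (mtr n s - g0 s) * u0 s\<bar> <= 12 * C * eps n + (LBINT s. K n s)" for n
 proof -
 have i: "set_integrable lborel {0..t} (%s. (mtr n s - g0 s) * u0 s)"
 by (rule bounded_u0_integrable[OF _ mtr_diff_le(2)]) auto
 have "\<bar>LBINT s:{0..t}. (mtr n s - g0 s) * u0 s + J n s\<bar> <= (LBINT s. K n s)"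
 unfolding set_lebesgue_integral_def
 proof (rule order_trans[OF integral_abs_bound integral_mono_AE])
 show "integrable lborel (%s. \<bar>indicat_real {0..t} s *\<^sub>R ((mtr n s - g0 s) * u0 s + J n s)\<bar>)"
 using set_integral_add(1)[OF i Ji] unfolding set_integrable_def by (rule integrable_abs)
 show "AE s in lborel. \<bar>indicat_real {0..t} s *\<^sub>R ((mtr n s - g0 s) * u0 s + J n s)\<bar> <= K n s"
 using ae[of n]
 proof eventually_elim
 case (elim s)
 then show ?case using order_trans[OF abs_ge_zero elim] by (auto simp: indicator_def)
 qed
 qed (rule Ki)
 then show ?thesis using Jint[of n] set_integral_add(2)[OF i Ji[of n]] by linarith
 qed
 then have "norm (LBINT s:{0..t}. (mtr n s - g0 s) * u0 s) <= 12 * C * eps n + (LBINT s. K n s)" for n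
 by simp
 moreover have "(%n. 12 * C * eps n + (LBINT s. K n s)) \<longlonglongrightarrow> 0"
 using tendsto_add[OF tendsto_mult_left[OF eps(3), of "12 * C"] Klim] by simp
 ultimately show ?thesis by (rule Lim_null_comparison[OF always_eventually[OF allI]])
qed

lemma trace_weak:
 assumes "A \<in> sets borel"
 shows "(%n. LBINT s:{0..T} \<inter> A. (mtr n s - g0 s) * u0 s) \<longlonglongrightarrow> 0"
proof (rule tendsto_set_integral_of_initial[OF _ _ _ _ trace_weak_initial assms])
 show "integrable lborel (%s. 2 * C * \<bar>u0 s\<bar>)" using u0 by simp
 show "\<bar>(mtr n s - g0 s) * u0 s\<bar> <= 2 * C * \<bar>u0 s\<bar>" for n s
 unfolding abs_mult by (intro mult_right_mono mtr_diff_le) auto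
qed (use T in auto)

text \<open>For fixed \<open>n\<close> the weighted modulus is the signed integrand on a set
  \<open>A\<close> and its negative off \<open>A\<close>. On these two fixed sets
  \<open>mtr n\<close> is exchanged for a later \<open>mtr m\<close> by the Cauchy property, and the
  weak convergence of \<open>mtr m\<close> finishes. This identifies the limit with the given trace
  directly.\<close>

lemma trace_strong: "(%n. LBINT s:{0..T}. \<bar>mtr n s - g0 s\<bar> * \<bar>u0 s\<bar>) \<longlonglongrightarrow> 0"
proof (rule tendstoI)
 fix e :: real assume e: "0 < e"
 have "\<forall>\<^sub>F p in sequentially \<times>\<^sub>F sequentially. (LBINT s:{0..T}. \<bar>mtr (fst p) s - mtr (snd p) s\<bar> * \<bar>u0 s\<bar>) < e / 3"
 using e by (intro order_tendstoD(2)[OF trace_cauchy]) auto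
 then obtain N where N: "!!n m. N <= n ==> N <= m ==> (LBINT s:{0..T}. \<bar>mtr n s - mtr m s\<bar> * \<bar>u0 s\<bar>) < e / 3"
 by (fastforce simp: eventually_prod_sequentially)
 have "dist (LBINT s:{0..T}. \<bar>mtr n s - g0 s\<bar> * \<bar>u0 s\<bar>) 0 < e" if n: "N <= n" for n
 proof -
 define A where "A = {s. 0 < (mtr n s - g0 s) * u0 s}"
 have A: "A \<in> sets borel" "- A \<in> sets borel" unfolding A_def by (auto intro!: borel_comp)
 have "\<forall>\<^sub>F m in sequentially. \<bar>LBINT s:{0..T} \<inter> A. (mtr m s - g0 s) * u0 s\<bar> < e / 3"
 "\<forall>\<^sub>F m in sequentially. \<bar>LBINT s:{0..T} \<inter> - A. (mtr m s - g0 s) * u0 s\<bar> < e / 3"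
 using e tendstoD[OF trace_weak[OF A(1)], of "e/3"] tendstoD[OF trace_weak[OF A(2)], of "e/3"] by (auto simp: dist_real_def)
 then have "\<forall>\<^sub>F m in sequentially. N <= m \<and> \<bar>LBINT s:{0..T} \<inter> A. (mtr m s - g0 s) * u0 s\<bar> < e / 3
 \<and> \<bar>LBINT s:{0..T} \<inter> - A. (mtr m s - g0 s) * u0 s\<bar> < e / 3"
 using eventually_ge_at_top[of N] by eventually_elim auto
 then obtain m where m: "N <= m" "\<bar>LBINT s:{0..T} \<inter> A. (mtr m s - g0 s) * u0 s\<bar> < e / 3"
 "\<bar>LBINT s:{0..T} \<inter> - A. (mtr m s - g0 s) * u0 s\<bar> < e / 3"
 by (auto simp: eventually_sequentially)
 have i0: "set_integrable lborel B (%s. (mtr m s - g0 s) * u0 s)" if "B \<in> sets borel" for B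
 by (rule bounded_u0_integrable[OF _ mtr_diff_le(2)]) (use that in auto)
 have i1: "set_integrable lborel B (%s. \<bar>mtr n s - mtr m s\<bar> * \<bar>u0 s\<bar>)" if "B \<in> sets borel" for B
 by (rule bounded_abs_u0_integrable[where B="2*C"]) (use that mtr_diff_le in auto)
 have i2: "set_integrable lborel B (%s. \<bar>mtr n s - g0 s\<bar> * \<bar>u0 s\<bar>)" if "B \<in> sets borel" for B
 by (rule bounded_abs_u0_integrable[where B="2*C"]) (use that mtr_diff_le in auto)
 have split: "(LBINT s:{0..T}. f s) = (LBINT s:{0..T} \<inter> A. f s) + (LBINT s:{0..T} \<inter> - A. f s)"
 if "!!B. B \<in> sets borel ==> set_integrable lborel B f" for f :: "real => real"
 proof -
 have "{0..T} = ({0..T} \<inter> A) \<union> ({0..T} \<inter> - A)" by auto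
 then show ?thesis using set_integral_Un[of "{0..T} \<inter> A" "{0..T} \<inter> - A" lborel f] that A by auto
 qed
 have a: "(LBINT s:{0..T} \<inter> A. \<bar>mtr n s - g0 s\<bar> * \<bar>u0 s\<bar>)
 <= (LBINT s:{0..T} \<inter> A. \<bar>mtr n s - mtr m s\<bar> * \<bar>u0 s\<bar>) + (LBINT s:{0..T} \<inter> A. (mtr m s - g0 s) * u0 s)"
 proof -
 have "(LBINT s:{0..T} \<inter> A. \<bar>mtr n s - g0 s\<bar> * \<bar>u0 s\<bar>)
 <= (LBINT s:{0..T} \<inter> A. \<bar>mtr n s - mtr m s\<bar> * \<bar>u0 s\<bar> + (mtr m s - g0 s) * u0 s)"
 proof (rule set_integral_mono)
 fix s assume "s \<in> {0..T} \<inter> A"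
 then have "\<bar>mtr n s - g0 s\<bar> * \<bar>u0 s\<bar> = (mtr n s - mtr m s) * u0 s + (mtr m s - g0 s) * u0 s"
 by (simp add: A_def abs_mult[symmetric] algebra_simps)
 moreover have "(mtr n s - mtr m s) * u0 s <= \<bar>mtr n s - mtr m s\<bar> * \<bar>u0 s\<bar>" by (simp add: abs_mult[symmetric])
 ultimately show "\<bar>mtr n s - g0 s\<bar> * \<bar>u0 s\<bar> <= \<bar>mtr n s - mtr m s\<bar> * \<bar>u0 s\<bar> + (mtr m s - g0 s) * u0 s" by linarith
 qed (use i0 i1 i2 A in \<open>auto intro!: set_integral_add(1)\<close>)
 also have "\<dots> = (LBINT s:{0..T} \<inter> A. \<bar>mtr n s - mtr m s\<bar> * \<bar>u0 s\<bar>) + (LBINT s:{0..T} \<inter> A. (mtr m s - g0 s) * u0 s)"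
 using A by (intro set_integral_add(2) i1 i0) auto
 finally show ?thesis .
 qed
 have b: "(LBINT s:{0..T} \<inter> - A. \<bar>mtr n s - g0 s\<bar> * \<bar>u0 s\<bar>)
 <= (LBINT s:{0..T} \<inter> - A. \<bar>mtr n s - mtr m s\<bar> * \<bar>u0 s\<bar>) - (LBINT s:{0..T} \<inter> - A. (mtr m s - g0 s) * u0 s)"
 proof -
 have "(LBINT s:{0..T} \<inter> - A. \<bar>mtr n s - g0 s\<bar> * \<bar>u0 s\<bar>)
 <= (LBINT s:{0..T} \<inter> - A. \<bar>mtr n s - mtr m s\<bar> * \<bar>u0 s\<bar> - (mtr m s - g0 s) * u0 s)"
 proof (rule set_integral_mono)
 fix s assume "s \<in> {0..T} \<inter> - A"
 then have "\<bar>mtr n s - g0 s\<bar> * \<bar>u0 s\<bar> = - ((mtr n s - mtr m s) * u0 s) - (mtr m s - g0 s) * u0 s"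
 by (simp add: A_def abs_mult[symmetric] algebra_simps)
 moreover have "- ((mtr n s - mtr m s) * u0 s) <= \<bar>mtr n s - mtr m s\<bar> * \<bar>u0 s\<bar>" by (simp add: abs_mult[symmetric])
 ultimately show "\<bar>mtr n s - g0 s\<bar> * \<bar>u0 s\<bar> <= \<bar>mtr n s - mtr m s\<bar> * \<bar>u0 s\<bar> - (mtr m s - g0 s) * u0 s" by linarith
 qed (use i0 i1 i2 A in \<open>auto intro!: set_integral_diff(1)\<close>)
 also have "\<dots> = (LBINT s:{0..T} \<inter> - A. \<bar>mtr n s - mtr m s\<bar> * \<bar>u0 s\<bar>) - (LBINT s:{0..T} \<inter> - A. (mtr m s - g0 s) * u0 s)"
 using A by (intro set_integral_diff(2) i1 i0) auto
 finally show ?thesis .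
 qed
 have "0 <= (LBINT s:{0..T}. \<bar>mtr n s - g0 s\<bar> * \<bar>u0 s\<bar>)"
 unfolding set_lebesgue_integral_def by (intro integral_nonneg_AE) auto
 moreover have "(LBINT s:{0..T}. \<bar>mtr n s - g0 s\<bar> * \<bar>u0 s\<bar>) < e"
 proof -
 define p1 p2 q1 q2 r1 r2 where "p1 = (LBINT s:{0..T} \<inter> A. \<bar>mtr n s - g0 s\<bar> * \<bar>u0 s\<bar>)"
 and "p2 = (LBINT s:{0..T} \<inter> - A. \<bar>mtr n s - g0 s\<bar> * \<bar>u0 s\<bar>)"
 and "q1 = (LBINT s:{0..T} \<inter> A. \<bar>mtr n s - mtr m s\<bar> * \<bar>u0 s\<bar>)"
 and "q2 = (LBINT s:{0..T} \<inter> - A. \<bar>mtr n s - mtr m s\<bar> * \<bar>u0 s\<bar>)"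
 and "r1 = (LBINT s:{0..T} \<inter> A. (mtr m s - g0 s) * u0 s)"
 and "r2 = (LBINT s:{0..T} \<inter> - A. (mtr m s - g0 s) * u0 s)"
 note defs = p1_def p2_def q1_def q2_def r1_def r2_def
 have "p1 <= q1 + r1" "p2 <= q2 - r2" "\<bar>r1\<bar> < e / 3" "\<bar>r2\<bar> < e / 3"
 unfolding defs by (rule a b m(2,3))+
 moreover have "(LBINT s:{0..T}. \<bar>mtr n s - mtr m s\<bar> * \<bar>u0 s\<bar>) = q1 + q2"
 unfolding defs by (rule split[OF i1])
 moreover note N[OF n m(1)]
 moreover have "(LBINT s:{0..T}. \<bar>mtr n s - g0 s\<bar> * \<bar>u0 s\<bar>) = p1 + p2"
 unfolding defs by (rule split[OF i2])
 ultimately show ?thesis by linarith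
 qed
 ultimately show ?thesis by (simp add: dist_real_def)
 qed
 then show "\<forall>\<^sub>F n in sequentially. dist (LBINT s:{0..T}. \<bar>mtr n s - g0 s\<bar> * \<bar>u0 s\<bar>) 0 < e"
 by (intro eventually_sequentiallyI[of N])
qed

text \<open>Renormalization localized at the left end by the weight \<open>1 - x\<close>; the reflected law gives the
 complementary weight \<open>x\<close>.\<close>

lemma renormalized_left:
 assumes t: "0 <= t" "t <= T"
 and der: "!!x. (\<beta> has_real_derivative \<beta>' x) (at x)"
 and lip: "!!x y. \<bar>\<beta>' y - \<beta>' x\<bar> <= L * \<bar>y - x\<bar>"
 shows "(LBINT s:{0..t}. \<beta> (g0 s) * u0 s) =
 (LBINT x:{0..1}. (1 - x) * (\<beta> (w (t, x)) - \<beta> (w (0, x))))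
 - (LBINT z:{0..t} \<times> {0..1}. (1 - snd z) * \<beta>' (w z) * (h z - w z * d z)
 - \<beta> (w z) * vel u0 d (fst z) (snd z) + (1 - snd z) * \<beta> (w z) * d z)"
proof -
 have L: "0 <= L" using lip[of 1 0] by auto
 have 1: "(%n. LBINT s:{0..t}. \<beta> (mtr n s) * u0 s) \<longlonglongrightarrow>
 (LBINT x:{0..1}. (1 - x) * (\<beta> (w (t, x)) - \<beta> (w (0, x))))
 - (LBINT z:{0..t} \<times> {0..1}. (1 - snd z) * \<beta>' (w z) * (h z - w z * d z)
 - \<beta> (w z) * vel u0 d (fst z) (snd z) + (1 - snd z) * \<beta> (w z) * d z)"
 proof (rule energy_limit[where v="%n. mv (eps n)" and vx="%n. mvx (eps n)" and q="%n. mq (eps n)" and r="%n. mr (eps n)"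
 and b="%n. 1 - eps n" and V=C and L=L and V'="%n. 6 * C / (eps n)^2", OF t(1)])
 show "(%n. 1 - eps n) \<longlonglongrightarrow> 1" using tendsto_diff[OF tendsto_const eps(3), of 1] by simp
 show "0 < 1 - eps n" "1 - eps n <= 1" for n using eps(1,2)[of n] by auto
 show "ac_on t (%s. mv (eps n) (s, x)) (%s. mq (eps n) (s, x))" if "0 <= x" "x <= 1 - eps n" for n x
 using that t by (intro mv_time eps) auto
 qed (fact mv_measurable mvx_measurable mq_measurable mv_le mvx_le[OF eps(1)] d mr_integrable u0 der lip mv_space[OF eps(1)]
 mq_eq_mr[OF eps(1)] w_integrable w_le mv_tendsto[OF eps(3)] wd_integrable mr_tendsto[OF eps(3)] w_integrable_section)+
 obtain B where B: "!!x. \<bar>x\<bar> <= C ==> \<bar>\<beta> x\<bar> <= B" "!!x. \<bar>x\<bar> <= C ==> \<bar>\<beta>' x\<bar> <= B"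
 using bounded_of_lipschitz_derivative(3)[OF der lip, of C] by blast
 note bounded_of_lipschitz_derivative(1)[OF der lip, measurable]
 \<comment> \<open>Strong convergence is used here: on the common range \<open>\<beta>\<close> is
   Lipschitz, so convergence in the mean survives composition, which weak convergence does
   not.\<close>
 have 2: "(%n. LBINT s:{0..t}. \<beta> (mtr n s) * u0 s) \<longlonglongrightarrow> (LBINT s:{0..t}. \<beta> (g0 s) * u0 s)"
 proof (rule LIM_zero_cancel, rule Lim_null_comparison[OF always_eventually[OF allI]])
 have "(%n. B * (LBINT s:{0..T}. \<bar>mtr n s - g0 s\<bar> * \<bar>u0 s\<bar>)) \<longlonglongrightarrow> B * 0"
 by (intro tendsto_mult_left trace_strong)
 then show "(%n. B * (LBINT s:{0..T}. \<bar>mtr n s - g0 s\<bar> * \<bar>u0 s\<bar>)) \<longlonglongrightarrow> 0" by simp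
 fix n
 have i1: "set_integrable lborel {0..t} (%s. \<beta> (mtr n s) * u0 s)"
 by (rule bounded_u0_integrable[where B=B]) (use B(1)[OF mv_le] in auto)
 have i2: "set_integrable lborel {0..t} (%s. \<beta> (g0 s) * u0 s)"
 by (rule bounded_u0_integrable[where B=B]) (use B(1)[OF g_le(1)] in auto)
 have i3: "set_integrable lborel A (%s. \<bar>mtr n s - g0 s\<bar> * \<bar>u0 s\<bar>)" if "A \<in> sets borel" for A
 by (rule bounded_abs_u0_integrable[where B="2*C"]) (use that mtr_diff_le in auto)
 have "\<bar>(LBINT s:{0..t}. \<beta> (mtr n s) * u0 s) - (LBINT s:{0..t}. \<beta> (g0 s) * u0 s)\<bar>
 = \<bar>LBINT s:{0..t}. \<beta> (mtr n s) * u0 s - \<beta> (g0 s) * u0 s\<bar>"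
 by (simp only: set_integral_diff(2)[OF i1 i2])
 also have "\<dots> <= (LBINT s:{0..t}. B * (\<bar>mtr n s - g0 s\<bar> * \<bar>u0 s\<bar>))"
 proof (rule set_integral_abs_le)
 fix s
 have "\<bar>\<beta> (mtr n s) - \<beta> (g0 s)\<bar> <= B * \<bar>mtr n s - g0 s\<bar>"
 by (rule lipschitz_of_bounded_derivative[OF der B(2) mv_le g_le(1)])
 from mult_right_mono[OF this, of "\<bar>u0 s\<bar>"]
 show "\<bar>\<beta> (mtr n s) * u0 s - \<beta> (g0 s) * u0 s\<bar> <= B * (\<bar>mtr n s - g0 s\<bar> * \<bar>u0 s\<bar>)"
 by (simp add: left_diff_distrib[symmetric] abs_mult mult.assoc)
 qed (use i1 i2 i3[of "{0..t}"] in \<open>auto intro!: set_integral_diff(1) set_integrable_mult_right\<close>)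
 also have "\<dots> = B * (LBINT s:{0..t}. \<bar>mtr n s - g0 s\<bar> * \<bar>u0 s\<bar>)" by (rule set_integral_mult_right)
 also have "\<dots> <= B * (LBINT s:{0..T}. \<bar>mtr n s - g0 s\<bar> * \<bar>u0 s\<bar>)"
 proof (rule mult_left_mono)
 show "0 <= B" using B(1)[OF mv_le, of "eps n" "(0, 0)"] by (rule order_trans[OF abs_ge_zero])
 show "(LBINT s:{0..t}. \<bar>mtr n s - g0 s\<bar> * \<bar>u0 s\<bar>) <= (LBINT s:{0..T}. \<bar>mtr n s - g0 s\<bar> * \<bar>u0 s\<bar>)"
 unfolding set_lebesgue_integral_def
 using i3[of "{0..t}"] i3[of "{0..T}"] t unfolding set_integrable_def
 by (intro integral_mono) (auto simp: indicator_def)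
 qed
 finally show "norm ((LBINT s:{0..t}. \<beta> (mtr n s) * u0 s) - (LBINT s:{0..t}. \<beta> (g0 s) * u0 s))
 <= B * (LBINT s:{0..T}. \<bar>mtr n s - g0 s\<bar> * \<bar>u0 s\<bar>)" by simp
 qed
 show ?thesis by (rule LIMSEQ_unique[OF 2 1])
qed

end

section \<open>Reflection, renormalization and the positive part\<close>

lemma integral_reflect:
 fixes f :: "real => real"
 shows "(LBINT x. f (1 - x)) = integral\<^sup>L lborel f"
 and "integrable lborel (%x. f (1 - x)) \<longleftrightarrow> integrable lborel f"
 using lborel_integral_real_affine[of "-1" f 1] lborel_integrable_real_affine_iff[of "-1" f 1] by simp_all

lemma set_integral_reflect:
 fixes f :: "real => real"
 shows "(LBINT x:{0..1}. f (1 - x)) = (LBINT x:{0..1}. f x)"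
proof -
 have "(LBINT x:{0..1}. f (1 - x)) = (LBINT x. (%x. indicat_real {0..1} x *\<^sub>R f x) (1 - x))"
 unfolding set_lebesgue_integral_def by (intro L_integral_cong) (auto simp: indicator_def)
 also have "\<dots> = (LBINT x. indicat_real {0..1} x *\<^sub>R f x)" by (rule integral_reflect(1))
 finally show ?thesis by (simp only: set_lebesgue_integral_def)
qed

lemma lip_test_reflect:
 assumes "lip_test tt tt'"
 shows "lip_test (%x. tt (1 - x)) (%x. - tt' (1 - x))"
proof -
 obtain L S where L: "L-lipschitz_on {0..1} tt" "!!x. \<bar>tt' x\<bar> <= L" "!!x. \<bar>tt x\<bar> <= L"
 and S: "finite S" "!!x. x \<in> {0<..<1} - S ==> (tt has_real_derivative tt' x) (at x)"
 and [measurable]: "tt \<in> borel_measurable borel" "tt' \<in> borel_measurable borel"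
 using assms unfolding lip_test_def by blast
 show ?thesis unfolding lip_test_def
 proof (intro conjI exI[of _ L] allI)
 show "L-lipschitz_on {0..1} (%x. tt (1 - x))"
 proof (rule lipschitz_onI)
 fix x y :: real assume "x \<in> {0..1}" "y \<in> {0..1}"
 then have "dist (tt (1 - x)) (tt (1 - y)) <= L * dist (1 - x) (1 - y)" by (intro lipschitz_onD[OF L(1)]) auto
 then show "dist (tt (1 - x)) (tt (1 - y)) <= L * dist x y" by (simp add: dist_real_def abs_minus_commute)
 qed (rule lipschitz_on_nonneg[OF L(1)])
 show "\<exists>S. finite S \<and> (\<forall>x\<in>{0<..<1} - S. ((%x. tt (1 - x)) has_real_derivative - tt' (1 - x)) (at x))"
 proof (intro exI[of _ "(%x. 1 - x) ` S"] conjI ballI)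
 fix x assume x: "x \<in> {0<..<1} - (%x. 1 - x) ` S"
 then have "1 - x \<in> {0<..<1} - S" by (auto intro: rev_image_eqI[of "1 - x"])
 from S(2)[OF this] have "((%x. tt (1 - x)) has_real_derivative tt' (1 - x) * (-1)) (at x)"
 by (intro DERIV_chain2[where f=tt]) (auto intro!: derivative_eq_intros)
 then show "((%x. tt (1 - x)) has_real_derivative - tt' (1 - x)) (at x)" by simp
 qed (use S in simp)
 qed (use L in auto)
qed

text \<open>A \<open>C\<^sup>1\<close> approximation of the positive part from below.\<close>

definition pp :: "real => real => real" where
 "pp et s = (if s <= 0 then 0 else if s <= et then s^2 / (2 * et) else s - et / 2)"

definition pp' :: "real => real => real" where
 "pp' et s = max 0 (min 1 (s / et))"

lemma pp_DERIV:
 assumes et: "0 < et"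
 shows "(pp et has_real_derivative pp' et s) (at s)"
proof -
 have a: "((%s. if s <= et then s^2 / (2 * et) else s - et / 2) has_real_derivative (if s <= et then s / et else 1)) (at s)" for s
 proof -
 have "((%s. if s \<in> {..et} then s^2 / (2 * et) else s - et / 2) has_vector_derivative (if s \<in> {..et} then s / et else 1)) (at s within UNIV)"
 using et
 by (intro has_vector_derivative_If_within_closures[where T="{et..}" and S="{..et}"])
 (auto simp: has_real_derivative_iff_has_vector_derivative[symmetric] power2_eq_square field_simps intro!: derivative_eq_intros)
 then show ?thesis by (simp add: has_real_derivative_iff_has_vector_derivative)
 qed
 have "((%s. if s \<in> {..0} then 0 else if s <= et then s^2 / (2 * et) else s - et / 2) has_vector_derivative
 (if s \<in> {..0} then 0 else if s <= et then s / et else 1)) (at s within UNIV)"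
 using et has_field_derivative_at_within[OF a[of s], of "{0..}"]
 by (intro has_vector_derivative_If_within_closures[where T="{0..}" and S="{..0}"])
 (auto simp: has_real_derivative_iff_has_vector_derivative[symmetric])
 moreover have "(if s \<in> {..0} then 0 else if s <= et then s / et else 1) = pp' et s"
 using et by (auto simp: pp'_def max_def min_def field_simps)
 ultimately show ?thesis
 by (simp add: has_real_derivative_iff_has_vector_derivative pp_def[abs_def])
qed

lemma pp'_lipschitz:
 assumes et: "0 < et"
 shows "\<bar>pp' et y - pp' et x\<bar> <= 1 / et * \<bar>y - x\<bar>"
proof -
 have "\<bar>pp' et y - pp' et x\<bar> <= \<bar>y / et - x / et\<bar>" by (auto simp: pp'_def max_def min_def)
 also have "\<dots> = 1 / et * \<bar>y - x\<bar>" using et by (simp add: diff_divide_distrib[symmetric] abs_divide)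
 finally show ?thesis .
qed

text \<open>In the middle range both \<open>pp et s\<close> and \<open>s * pp' et s\<close> are
  multiples of \<open>s^2 / et\<close>, which lies between 0 and \<open>s\<close>; outside it the
  two regimes of the definition can be compared directly.\<close>

lemma pp_bounds:
 assumes et: "0 < et"
 shows "0 <= pp' et s" "s <= 0 ==> pp' et s = 0"
 and "\<bar>pp et s - s * pp' et s\<bar> <= et" "\<bar>pp et s - max 0 s\<bar> <= et"
proof -
 show "0 <= pp' et s" by (simp add: pp'_def)
 show "s <= 0 ==> pp' et s = 0" using et by (auto simp: pp'_def max_def min_def field_simps)
 consider "s <= 0" | "0 < s" "s <= et" | "et < s" by linarith
 then have "\<bar>pp et s - s * pp' et s\<bar> <= et \<and> \<bar>pp et s - max 0 s\<bar> <= et"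
 proof cases
 case 1
 then show ?thesis using et \<open>s <= 0 ==> pp' et s = 0\<close> by (simp add: pp_def)
 next
 case 2
 have "s / et <= 1" using 2 et by simp
 then have p': "pp' et s = s / et" using 2 et by (simp add: pp'_def)
 define q where "q = s^2 / et"
 have "s^2 <= s * et" unfolding power2_eq_square using 2 by (intro mult_left_mono) auto
 then have "q <= s" using et by (simp add: q_def field_simps)
 moreover have "0 <= q" using et by (simp add: q_def)
 moreover have "pp et s = q / 2" "s * pp' et s = q" using 2 et by (auto simp: pp_def p' q_def power2_eq_square)
 ultimately show ?thesis using 2 et by auto
 next
 case 3
 then have "pp' et s = 1" using et by (simp add: pp'_def)
 then show ?thesis using 3 et by (simp add: pp_def)
 qed
 then show "\<bar>pp et s - s * pp' et s\<bar> <= et" "\<bar>pp et s - max 0 s\<bar> <= et" by auto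
qed

lemma AE_integrable_section:
 fixes f :: "real \<times> real => real"
 assumes f: "integrable lborel f"
 shows "AE z in lborel. integrable lborel (%x. f (fst (z :: real \<times> real), x))"
proof -
 have "AE t in lborel. integrable lborel (%x. f (t, x))" by (rule integrable_lborel_pair(1)[OF f])
 then obtain N where N: "{t. \<not> integrable lborel (%x. f (t, x))} \<subseteq> N" "N \<in> null_sets lborel"
 by (auto elim!: AE_E simp: null_setsI)
 have "N \<times> UNIV \<in> null_sets (lborel \<Otimes>\<^sub>M lborel :: (real \<times> real) measure)"
 using N(2) by (intro lborel.times_in_null_sets1) auto
 then show ?thesis unfolding lborel_prod
 by (rule AE_I') (use N(1) in auto)
qed

definition flip :: "real \<times> real => real \<times> real" where "flip z = (fst z, 1 - snd z)"

lemma flip_measurable[measurable]: "flip \<in> borel_measurable borel"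
 unfolding flip_def[abs_def] by (intro borel_measurable_continuous_onI continuous_intros)

lemma integral_flip:
 fixes f :: "real \<times> real => real"
 assumes f: "integrable lborel f"
 shows "integrable lborel (%z. f (flip z))" and "(LBINT z. f (flip z)) = integral\<^sup>L lborel f"
proof -
 have m[measurable]: "f \<in> borel_measurable borel" using f by auto
 have "(%z. f (flip z)) \<in> borel_measurable lborel" by measurable
 have "integrable (lborel \<Otimes>\<^sub>M lborel) (%z. f (flip z))"
 proof (rule lborel_pair.Fubini_integrable)
 have "(%z. f (flip z)) \<in> borel_measurable lborel" by measurable
 then show "(%z. f (flip z)) \<in> borel_measurable (lborel \<Otimes>\<^sub>M lborel)" unfolding lborel_prod .
 have "(LBINT x. norm (f (flip (t, x)))) = (LBINT x. \<bar>f (t, x)\<bar>)" for t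
 using integral_reflect(1)[of "%x. \<bar>f (t, x)\<bar>"] by (simp add: flip_def)
 then show "integrable lborel (%t. \<integral>x. norm (f (flip (t, x))) \<partial>lborel)"
 using integrable_lborel_pair(3)[OF integrable_abs[OF f]] by simp
 show "AE t in lborel. integrable lborel (%x. f (flip (t, x)))"
 using integrable_lborel_pair(1)[OF f]
 proof eventually_elim
 case (elim t)
 then show ?case using integral_reflect(2)[of "%x. f (t, x)"] by (simp add: flip_def)
 qed
 qed
 then show i: "integrable lborel (%z. f (flip z))" by (simp add: lborel_prod)
 have "(LBINT z. f (flip z)) = (LBINT t. (LBINT x. f (t, 1 - x)))"
 using integrable_lborel_pair(5)[OF i] by (simp add: flip_def)
 also have "\<dots> = (LBINT t. (LBINT x. f (t, x)))" by (simp only: integral_reflect(1)[of "%x. f (_, x)"])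
 also have "\<dots> = integral\<^sup>L lborel f" by (rule integrable_lborel_pair(5)[OF f])
 finally show "(LBINT z. f (flip z)) = integral\<^sup>L lborel f" .
qed

context balance_law
begin

text \<open>Reflection turns the velocity into \<open>- U (1 - x)\<close>. Its derivative is the
  reflected \<open>d\<close> without a sign change, and its left boundary value is minus the old
  right one.\<close>

definition rd :: "real \<times> real => real" where "rd z = d (flip z)"
definition ru0 :: "real => real" where "ru0 t = - vel u0 d t 1"

lemma vel_reflect:
 assumes "integrable lborel (%x. d (t, x))" "0 <= x" "x <= 1"
 shows "vel ru0 rd t x = - vel u0 d t (1 - x)"
proof -
 have "vel u0 d t 1 - vel u0 d t (1 - x) = (LBINT y:{1 - x<..1}. d (t, y))"
 using assms by (intro ac_on_increment[OF ac_on_vel[OF assms(1), of 1]]) auto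
 also have "\<dots> = (LBINT y. (%y. indicat_real {1 - x<..1} y *\<^sub>R d (t, y)) (1 - y))"
 unfolding set_lebesgue_integral_def by (rule integral_reflect(1)[symmetric])
 also have "\<dots> = (LBINT y:{0..<x}. d (t, 1 - y))"
 unfolding set_lebesgue_integral_def by (intro L_integral_cong) (auto simp: indicator_def)
 also have "\<dots> = (LBINT y:{0..x}. d (t, 1 - y))"
 proof (rule set_integral_null_delta)
 show "integrable lborel (%y. d (t, 1 - y))" using assms(1) integral_reflect(2)[of "%y. d (t, y)"] by simp
 have "sym_diff {0..<x} {0..x} \<subseteq> {x}" by auto
 then show "sym_diff {0..<x} {0..x} \<in> null_sets lborel"
 by (intro finite_imp_null_set_lborel finite_subset[OF _ finite.insertI[OF finite.emptyI]])
 qed auto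
 finally show ?thesis using assms(1) by (simp add: vel_def[of ru0] ru0_def rd_def flip_def)
qed

lemma vel_1_integrable: "integrable lborel (%s. vel u0 d s 1)"
proof (rule L_integrable_bound[OF vel_bound_integrable[OF u0 d]])
 show "(%s. vel u0 d s 1) \<in> borel_measurable lborel"
 using borel_measurable_section(2)[OF vel_measurable', of 1] by simp
 show "AE s in lborel. norm (vel u0 d s 1) <= norm (\<bar>u0 s\<bar> + (LBINT y. \<bar>d (s, y)\<bar>))"
 using integrable_lborel_pair(1)[OF d]
 proof eventually_elim
 case (elim s)
 from vel_le[OF this, of u0 1] show ?case by (simp add: order_trans[OF _ abs_ge_self])
 qed
qed

text \<open>The velocity and the derivative of the test function both change sign, so the interior
  flux is preserved; the ends, and with them the traces, are exchanged.\<close>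

lemma balance_law_flip: "balance_law T C (%z. w (flip z)) rd (%z. h (flip z)) ru0 g1 g0"
proof
 show "0 < T" by (rule T)
 show "(%z. w (flip z)) \<in> borel_measurable borel" by measurable
 show "\<bar>w (flip z)\<bar> <= C" for z by (rule w_le)
 show "w (flip (t, x)) = 0" if "\<not> (0 < x \<and> x < 1 \<and> 0 <= t \<and> t <= T)" for t x
 unfolding flip_def using that by (auto intro!: w_0)
 show rd: "integrable lborel rd" unfolding rd_def[abs_def] by (rule integral_flip(1)[OF d])
 show "integrable lborel (%z. h (flip z))" by (rule integral_flip(1)[OF h])
 show "h (flip (t, x)) = 0" if "\<not> (0 < x \<and> x < 1)" for t x
 unfolding flip_def using that by (auto intro!: h_0)
 show ru0: "integrable lborel ru0" unfolding ru0_def[abs_def] using vel_1_integrable by simp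
 show "g1 \<in> borel_measurable borel" "g0 \<in> borel_measurable borel" by measurable
 show "\<bar>g1 t\<bar> <= C" "\<bar>g0 t\<bar> <= C" for t by (rule g_le)+
 have [measurable]: "rd \<in> borel_measurable borel" "ru0 \<in> borel_measurable borel" using rd ru0 by auto
 fix tt tt' t assume lt: "lip_test tt tt'" and t: "0 <= t" "t <= T"
 note lr = lip_test_reflect[OF lt]
 have [measurable]: "tt \<in> borel_measurable borel" "tt' \<in> borel_measurable borel" using lt by (auto simp: lip_test_def)
 have L: "(LBINT x. w (flip (s, x)) * tt x) = (LBINT x. w (s, x) * tt (1 - x))" for s
 using integral_reflect(1)[of "%x. w (s, x) * tt (1 - x)"] by (simp add: flip_def)
 let ?J = "%s. (LBINT x. w (s, x) * vel u0 d s x * (- tt' (1 - x)) + h (s, x) * tt (1 - x))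
 - g1 s * vel u0 d s 1 * tt (1 - 1) + g0 s * u0 s * tt (1 - 0)"
 let ?K = "%s. (LBINT x. w (flip (s, x)) * vel ru0 rd s x * tt' x + h (flip (s, x)) * tt x)
 - g0 s * vel ru0 rd s 1 * tt 1 + g1 s * ru0 s * tt 0"
 have "(LBINT s:{0..t}. ?J s) = (LBINT s:{0..t}. ?K s)"
 proof (rule set_lebesgue_integral_cong_AE)
 have [measurable]: "(%s. vel u0 d s 1) \<in> borel_measurable borel" "(%s. vel ru0 rd s 1) \<in> borel_measurable borel"
 using borel_measurable_section(2)[OF vel_measurable', of 1] borel_measurable_section(2)[OF vel_measurable[of ru0 rd], of 1] by simp_all
 have [measurable]: "(%s. \<integral>x. w (s, x) * vel u0 d s x * (- tt' (1 - x)) + h (s, x) * tt (1 - x) \<partial>lborel) \<in> borel_measurable borel"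
 using integrable_lborel_pair(3)[OF balance_integrand_integrable[OF lr]] by (auto dest: borel_measurable_integrable)
 have vr: "(%z. vel ru0 rd (fst z) (snd z)) \<in> borel_measurable borel" by measurable
 have "(%z. w (flip z) * vel ru0 rd (fst z) (snd z) * tt' (snd z) + h (flip z) * tt (snd z)) \<in> borel_measurable borel"
 using vr by measurable
 from pair_integral_measurable[OF this]
 have [measurable]: "(%s. \<integral>x. w (flip (s, x)) * vel ru0 rd s x * tt' x + h (flip (s, x)) * tt x \<partial>lborel) \<in> borel_measurable borel"
 by simp
 show "?J \<in> borel_measurable lborel" "?K \<in> borel_measurable lborel"
 unfolding measurable_lborel1
 by (intro borel_measurable_add borel_measurable_diff borel_measurable_times borel_measurable_const; measurable)+
 show "AE s\<in>{0..t} in lborel. ?J s = ?K s"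
 using integrable_lborel_pair(1)[OF d]
 proof eventually_elim
 case (elim s)
 have "(LBINT x. w (s, x) * vel u0 d s x * (- tt' (1 - x)) + h (s, x) * tt (1 - x))
 = (LBINT x. w (s, 1 - x) * vel u0 d s (1 - x) * (- tt' x) + h (s, 1 - x) * tt x)"
 using integral_reflect(1)[of "%x. w (s, x) * vel u0 d s x * (- tt' (1 - x)) + h (s, x) * tt (1 - x)"] by simp
 also have "\<dots> = (LBINT x. w (flip (s, x)) * vel ru0 rd s x * tt' x + h (flip (s, x)) * tt x)"
 proof (rule L_integral_cong[OF refl])
 fix x
 show "w (s, 1 - x) * vel u0 d s (1 - x) * (- tt' x) + h (s, 1 - x) * tt x
 = w (flip (s, x)) * vel ru0 rd s x * tt' x + h (flip (s, x)) * tt x"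
 proof (cases "0 <= x \<and> x <= 1")
 case True
 then show ?thesis using vel_reflect[OF elim] by (simp add: flip_def)
 qed (use w_0 in \<open>auto simp: flip_def\<close>)
 qed
 finally show ?case
 using vel_reflect[OF elim, of 1] by (simp add: vel_0 ru0_def)
 qed
 qed simp
 then show "(LBINT x. w (flip (t, x)) * tt x) - (LBINT x. w (flip (0, x)) * tt x) = (LBINT s:{0..t}. ?K s)"
 unfolding L using balance[OF lr t] by simp
qed

text \<open>Add the identity with weight \<open>1 - x\<close> and the reflected one, which has
  weight \<open>x\<close>. The terms \<open>\<beta> w * U\<close> that stem from differentiating the
  weights have opposite signs and cancel; both boundary fluxes remain.\<close>

lemma renormalized:
 assumes t: "0 <= t" "t <= T"
 and der: "!!x. (\<beta> has_real_derivative \<beta>' x) (at x)"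
 and lip: "!!x y. \<bar>\<beta>' y - \<beta>' x\<bar> <= L * \<bar>y - x\<bar>"
 shows "(LBINT x:{0..1}. \<beta> (w (t, x))) = (LBINT x:{0..1}. \<beta> (w (0, x)))
 + (LBINT s:{0..t}. \<beta> (g0 s) * u0 s) - (LBINT s:{0..t}. \<beta> (g1 s) * vel u0 d s 1)
 + (LBINT z:{0..t} \<times> {0..1}. \<beta>' (w z) * (h z - w z * d z) + \<beta> (w z) * d z)"
proof -
 interpret R: balance_law T C "%z. w (flip z)" rd "%z. h (flip z)" ru0 g1 g0 by (rule balance_law_flip)
 obtain B where B: "!!x. \<bar>x\<bar> <= C ==> \<bar>\<beta> x\<bar> <= B" "!!x. \<bar>x\<bar> <= C ==> \<bar>\<beta>' x\<bar> <= B"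
 using bounded_of_lipschitz_derivative(3)[OF der lip, of C] by blast
 note [measurable] = bounded_of_lipschitz_derivative(1,2)[OF der lip]
 let ?S = "{0..t} \<times> {0..1::real}"
 have S: "?S \<in> sets (lborel :: (real \<times> real) measure)" by (simp add: borel_Times)
 note f1 = renormalized_left[OF t der lip] and f2 = R.renormalized_left[OF t der lip]
 have bi: "set_integrable lborel {0..1} (%x. a x * \<beta> (w (s, x)))" if "continuous_on {0..1} a" for a s
 proof (rule set_integrable_mult_continuous[OF _ that])
 have m: "(%x. \<beta> (w (s, x))) \<in> borel_measurable borel"
 using borel_measurable_section(1)[OF w_measurable, of s] by measurable
 have "set_integrable lborel {0..1} (%x. \<beta> (w (s, x)) * 1)"
 by (rule set_integrable_mult_bounded[OF _ m, where B=B]) (auto intro!: borel_integrable_atLeastAtMost' B w_le)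
 then show "set_integrable lborel {0..1} (%x. \<beta> (w (s, x)))" by simp
 qed
 have x1: "(LBINT x:{0..1}. (1 - x) * (\<beta> (w (t, x)) - \<beta> (w (0, x)))) + (LBINT x:{0..1}. (1 - x) * (\<beta> (w (flip (t, x))) - \<beta> (w (flip (0, x)))))
 = (LBINT x:{0..1}. \<beta> (w (t, x))) - (LBINT x:{0..1}. \<beta> (w (0, x)))"
 proof -
 have i: "set_integrable lborel {0..1} (%x. \<beta> (w (s, x)))" "set_integrable lborel {0..1} (%x. x * \<beta> (w (s, x)))"
 "set_integrable lborel {0..1} (%x. (1 - x) * \<beta> (w (s, x)))" for s
 using bi[of "%_. 1" s] bi[of "%x. x" s] bi[of "%x. 1 - x" s] continuous_on_diff[OF continuous_on_const continuous_on_id, of "{0..1}" "1::real"]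
 by auto
 have a: "(LBINT x:{0..1}. (1 - x) * (\<beta> (w (flip (t, x))) - \<beta> (w (flip (0, x)))))
 = (LBINT x:{0..1}. x * (\<beta> (w (t, x)) - \<beta> (w (0, x))))"
 using set_integral_reflect[of "%x. x * (\<beta> (w (t, x)) - \<beta> (w (0, x)))"] by (simp add: flip_def)
 have b: "(LBINT x:{0..1}. x * (\<beta> (w (t, x)) - \<beta> (w (0, x)))) = (LBINT x:{0..1}. x * \<beta> (w (t, x))) - (LBINT x:{0..1}. x * \<beta> (w (0, x)))"
 using set_integral_diff(2)[OF i(2) i(2), of t 0] by (simp add: right_diff_distrib)
 have c: "(LBINT x:{0..1}. (1 - x) * (\<beta> (w (t, x)) - \<beta> (w (0, x)))) = (LBINT x:{0..1}. (1 - x) * \<beta> (w (t, x))) - (LBINT x:{0..1}. (1 - x) * \<beta> (w (0, x)))"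
 using set_integral_diff(2)[OF i(3) i(3), of t 0] by (simp add: right_diff_distrib)
 have e: "(LBINT x:{0..1}. x * \<beta> (w (s, x))) + (LBINT x:{0..1}. (1 - x) * \<beta> (w (s, x))) = (LBINT x:{0..1}. \<beta> (w (s, x)))" for s
 using set_integral_add(2)[OF i(2) i(3), of s s] by (simp add: left_diff_distrib)
 show ?thesis unfolding a b c using e[of t] e[of 0] by linarith
 qed
 define p1 where "p1 z = (1 - snd z) * \<beta>' (w z) * (h z - w z * d z) - \<beta> (w z) * vel u0 d (fst z) (snd z) + (1 - snd z) * \<beta> (w z) * d z" for z
 \<comment> \<open>The integrand of the reflected identity, carried back by
   \<open>flip\<close>.\<close>
 define p2 where "p2 z = snd z * \<beta>' (w z) * (h z - w z * d z) + \<beta> (w z) * vel u0 d (fst z) (snd z) + snd z * \<beta> (w z) * d z" for z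
 have si: "set_integrable lborel ?S (%z. a z * b z * f z)"
 if "integrable lborel f" "a \<in> borel_measurable borel" "b \<in> borel_measurable borel" "!!z. z \<in> ?S ==> \<bar>a z\<bar> <= 1" "!!z. \<bar>b z\<bar> <= B" for a b f
 proof -
 have ind: "indicat_real ?S \<in> borel_measurable borel" using S by (intro borel_measurable_indicator) simp
 have "integrable lborel (%z. (indicat_real ?S z * a z * b z) * f z)"
 proof (rule integrable_mult_bounded[OF that(1), where B=B])
 show "(%z. indicat_real ?S z * a z * b z) \<in> borel_measurable lborel" using that(2,3) ind by simp
 show "AE z in lborel. \<bar>indicat_real ?S z * a z * b z\<bar> <= B"
 proof (rule AE_I2)
 fix z
 show "\<bar>indicat_real ?S z * a z * b z\<bar> <= B"
 using that(4)[of z] that(5)[of z] order_trans[OF abs_ge_zero that(5)[of z]] mult_mono[of "\<bar>a z\<bar>" 1 "\<bar>b z\<bar>" B]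
 by (auto simp: indicator_def abs_mult)
 qed
 qed
 then show ?thesis by (simp add: set_integrable_def mult.assoc)
 qed
 have m: "(%z. \<beta> (w z)) \<in> borel_measurable borel" "(%z. \<beta>' (w z)) \<in> borel_measurable borel" by measurable
 have uU: "set_integrable lborel ?S (%z. \<beta> (w z) * vel u0 d (fst z) (snd z))"
 proof -
 have sub: "?S \<subseteq> UNIV \<times> {0..1}" by auto
 have "integrable lborel (%z. \<beta> (w z) * (indicat_real ?S z *\<^sub>R vel u0 d (fst z) (snd z)))"
 using set_integrable_subset[OF integrable_vel_box[OF u0 d, of 0 1] S sub] unfolding set_integrable_def
 by (rule integrable_mult_bounded[where B=B]) (use m B w_le in auto)
 then show ?thesis by (simp add: set_integrable_def mult.left_commute)
 qed
 have s1: "\<bar>1 - snd z\<bar> <= 1" "\<bar>snd z\<bar> <= 1" if "z \<in> ?S" for z using that by auto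
 have Bw: "\<bar>\<beta> (w z)\<bar> <= B" "\<bar>\<beta>' (w z)\<bar> <= B" for z by (rule B[OF w_le])+
 have i1: "set_integrable lborel ?S p1" unfolding p1_def[abs_def]
 by (intro set_integral_add(1) set_integral_diff(1) si uU wd_integrable d m Bw s1) measurable
 have i2: "set_integrable lborel ?S p2" unfolding p2_def[abs_def]
 by (intro set_integral_add(1) si uU wd_integrable d m Bw s1) measurable
 have q2: "(LBINT z:?S. (1 - snd z) * \<beta>' (w (flip z)) * (h (flip z) - w (flip z) * rd z)
 - \<beta> (w (flip z)) * vel ru0 rd (fst z) (snd z) + (1 - snd z) * \<beta> (w (flip z)) * rd z) = (LBINT z:?S. p2 z)"
 proof -
 have i2': "integrable lborel (%z. indicat_real ?S z *\<^sub>R p2 z)" using i2 by (simp add: set_integrable_def)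
 have iS: "indicat_real ?S (flip z) = indicat_real ?S z" for z by (cases z) (auto simp: flip_def indicator_def)
 have "(LBINT z:?S. p2 z) = (LBINT z. indicat_real ?S z *\<^sub>R p2 (flip z))"
 using integral_flip(2)[OF i2'] by (simp add: set_lebesgue_integral_def iS)
 also have "\<dots> = (LBINT z. indicat_real ?S z *\<^sub>R ((1 - snd z) * \<beta>' (w (flip z)) * (h (flip z) - w (flip z) * rd z)
 - \<beta> (w (flip z)) * vel ru0 rd (fst z) (snd z) + (1 - snd z) * \<beta> (w (flip z)) * rd z))"
 proof (rule integral_cong_AE)
 show "(%z. indicat_real ?S z *\<^sub>R p2 (flip z)) \<in> borel_measurable lborel"
 using borel_measurable_integrable[OF integral_flip(1)[OF i2']] by (simp add: iS)
 note R.vel_measurable'[measurable] R.d_measurable[measurable]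
 have ind[measurable]: "indicat_real ?S \<in> borel_measurable borel" using S by (intro borel_measurable_indicator) simp
 show "(%z. indicat_real ?S z *\<^sub>R ((1 - snd z) * \<beta>' (w (flip z)) * (h (flip z) - w (flip z) * rd z)
 - \<beta> (w (flip z)) * vel ru0 rd (fst z) (snd z) + (1 - snd z) * \<beta> (w (flip z)) * rd z)) \<in> borel_measurable lborel"
 by measurable
 show "AE z in lborel. indicat_real ?S z *\<^sub>R p2 (flip z) = indicat_real ?S z *\<^sub>R ((1 - snd z) * \<beta>' (w (flip z)) * (h (flip z) - w (flip z) * rd z)
 - \<beta> (w (flip z)) * vel ru0 rd (fst z) (snd z) + (1 - snd z) * \<beta> (w (flip z)) * rd z)"
 using AE_integrable_section[OF d]
 proof eventually_elim
 case (elim z)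
 show ?case
 proof (cases "z \<in> ?S")
 case True
 then have "vel ru0 rd (fst z) (snd z) = - vel u0 d (fst z) (1 - snd z)"
 by (intro vel_reflect[OF elim]) auto
 then show ?thesis by (simp add: p2_def flip_def rd_def)
 qed simp
 qed
 qed
 finally show ?thesis by (simp add: set_lebesgue_integral_def)
 qed
 have x2: "(LBINT z:?S. p1 z) + (LBINT z:?S. p2 z) = (LBINT z:?S. \<beta>' (w z) * (h z - w z * d z) + \<beta> (w z) * d z)"
 proof -
 have "p1 z + p2 z = \<beta>' (w z) * (h z - w z * d z) + \<beta> (w z) * d z" for z
 unfolding p1_def p2_def by algebra
 then show ?thesis using set_integral_add(2)[OF i1 i2] by simp
 qed
 have x3: "(LBINT s:{0..t}. \<beta> (g1 s) * ru0 s) = - (LBINT s:{0..t}. \<beta> (g1 s) * vel u0 d s 1)"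
 unfolding ru0_def by (simp add: set_lebesgue_integral_def)
 show ?thesis using f1 f2 x1 x2 unfolding q2 x3 p1_def[symmetric] by linarith
qed

text \<open>With \<open>\<beta> = pp et\<close> the source is
  \<open>\<beta>' w * h + (\<beta> w - w * \<beta>' w) * d\<close>. The first part is nonpositive
  because \<open>\<beta>'\<close> vanishes for \<open>w <= 0\<close>; the second is at most
  \<open>et * \<bar>d\<bar>\<close>, as the positive part is homogeneous of degree 1 and the
  divergence drops out in the limit.\<close>

lemma positive_part_balance:
 assumes t: "0 <= t" "t <= T"
 and neg: "AE z in lborel. z \<in> {0..T} \<times> {0..1} --> 0 < w z --> h z <= 0"
 shows "(LBINT x. max 0 (w (t, x))) <= (LBINT x. max 0 (w (0, x)))
 + (LBINT s:{0..t}. max 0 (g0 s) * u0 s) - (LBINT s:{0..t}. max 0 (g1 s) * vel u0 d s 1)"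
proof -
 let ?S = "{0..t} \<times> {0..1::real}"
 have S: "?S \<in> sets (lborel :: (real \<times> real) measure)" by (simp add: borel_Times)
 let ?U1 = "%s. vel u0 d s 1"
 have L: "(LBINT x. max 0 (w (s, x))) = (LBINT x:{0..1}. max 0 (w (s, x)))" for s
 unfolding set_lebesgue_integral_def
 proof (rule L_integral_cong[OF refl])
 fix x show "max 0 (w (s, x)) = indicat_real {0..1} x *\<^sub>R max 0 (w (s, x))"
 using w_0[of x s] by (cases "x \<in> {0..1}") auto
 qed
 \<comment> \<open>Collects the factors of \<open>et\<close>: 1 for each of the two time slices over
   the unit interval, and one norm for each boundary term and for the divergence.\<close>
 define M where "M = 2 + (LBINT s. \<bar>u0 s\<bar>) + (LBINT s. \<bar>?U1 s\<bar>) + (LBINT z. \<bar>d z\<bar>)"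
 define A where "A s = (LBINT x:{0..1}. max 0 (w (s, x)))" for s
 define P where "P = (LBINT s:{0..t}. max 0 (g0 s) * u0 s)"
 define Q where "Q = (LBINT s:{0..t}. max 0 (g1 s) * ?U1 s)"
 have approx: "A t <= A 0 + P - Q + et * M" if et: "0 < et" for et
 proof -
 note ren = renormalized[OF t pp_DERIV[OF et] pp'_lipschitz[OF et]]
 note [measurable] = bounded_of_lipschitz_derivative(1,2)[OF pp_DERIV[OF et] pp'_lipschitz[OF et]]
 obtain B where B: "!!x. \<bar>x\<bar> <= C ==> \<bar>pp et x\<bar> <= B" "!!x. \<bar>x\<bar> <= C ==> \<bar>pp' et x\<bar> <= B"
 using bounded_of_lipschitz_derivative(3)[OF pp_DERIV[OF et] pp'_lipschitz[OF et], of C] by blast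
 have maxb: "\<bar>max 0 x\<bar> <= C" if "\<bar>x\<bar> <= C" for x :: real using that by auto
 have a: "\<bar>(LBINT x:{0..1}. pp et (w (s, x))) - A s\<bar> <= et" for s
 proof -
 have m: "(%x. pp et (w (s, x))) \<in> borel_measurable borel" "(%x. max 0 (w (s, x))) \<in> borel_measurable borel"
 using borel_measurable_section(1)[OF w_measurable, of s] by measurable
 have "set_integrable lborel {0..1} (%x. pp et (w (s, x)) * 1)"
 by (rule set_integrable_mult_bounded[OF _ m(1), where B=B]) (auto intro!: borel_integrable_atLeastAtMost' B w_le)
 moreover have "set_integrable lborel {0..1} (%x. max 0 (w (s, x)) * 1)"
 by (rule set_integrable_mult_bounded[OF _ m(2) maxb[OF w_le]]) (auto intro!: borel_integrable_atLeastAtMost')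
 ultimately have i: "set_integrable lborel {0..1} (%x. pp et (w (s, x)))" "set_integrable lborel {0..1} (%x. max 0 (w (s, x)))" by simp_all
 have "\<bar>LBINT x:{0..1}. pp et (w (s, x)) - max 0 (w (s, x))\<bar> <= (LBINT x:{0..1::real}. et)"
 by (rule set_integral_abs_le[OF set_integral_diff(1)[OF i]]) (auto intro!: borel_integrable_atLeastAtMost' pp_bounds[OF et])
 then show ?thesis using set_integral_diff(2)[OF i] by (simp add: A_def set_integral_const)
 qed
 have b: "\<bar>(LBINT s:{0..t}. pp et (g s) * f s) - (LBINT s:{0..t}. max 0 (g s) * f s)\<bar> <= et * (LBINT s. \<bar>f s\<bar>)"
 if g: "g \<in> borel_measurable borel" "!!s. \<bar>g s\<bar> <= C" and f: "integrable lborel f" for f g :: "real => real"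
 proof -
 note g(1)[measurable]
 have i: "set_integrable lborel {0..t} (%s. pp et (g s) * f s)" "set_integrable lborel {0..t} (%s. max 0 (g s) * f s)"
 using integrable_mult_bounded[OF f, of "%s. pp et (g s)" B] integrable_mult_bounded[OF f, of "%s. max 0 (g s)" C]
 B(1)[OF g(2)] maxb[OF g(2)] by (auto intro!: set_integrable_of_integrable)
 have "\<bar>LBINT s:{0..t}. pp et (g s) * f s - max 0 (g s) * f s\<bar> <= (LBINT s:{0..t}. et * \<bar>f s\<bar>)"
 proof (rule set_integral_abs_le[OF set_integral_diff(1)[OF i]])
 show "set_integrable lborel {0..t} (%s. et * \<bar>f s\<bar>)" using f by (intro set_integrable_of_integrable) auto
 show "\<bar>pp et (g s) * f s - max 0 (g s) * f s\<bar> <= et * \<bar>f s\<bar>" for s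
 using mult_right_mono[OF pp_bounds(4)[OF et, of "g s"], of "\<bar>f s\<bar>"] by (simp add: left_diff_distrib[symmetric] abs_mult)
 qed
 also have "\<dots> = et * (LBINT s:{0..t}. \<bar>f s\<bar>)" by (rule set_integral_mult_right)
 also have "\<dots> <= et * (LBINT s. \<bar>f s\<bar>)"
 using et by (intro mult_left_mono set_integral_abs_le_integral[OF f]) auto
 finally show ?thesis using set_integral_diff(2)[OF i] by simp
 qed
 have hd: "integrable lborel (%z. pp' et (w z) * (h z - w z * d z) + pp et (w z) * d z)"
 using integrable_mult_bounded[OF wd_integrable, of "%z. pp' et (w z)" B] integrable_mult_bounded[OF d, of "%z. pp et (w z)" B]
 B[OF w_le] by auto
 have c: "(LBINT z:?S. pp' et (w z) * (h z - w z * d z) + pp et (w z) * d z) <= et * (LBINT z. \<bar>d z\<bar>)"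
 proof -
 have "(LBINT z:?S. pp' et (w z) * (h z - w z * d z) + pp et (w z) * d z) <= (LBINT z. et * \<bar>d z\<bar>)"
 unfolding set_lebesgue_integral_def
 proof (rule integral_mono_AE)
 show "integrable lborel (%z. indicat_real ?S z *\<^sub>R (pp' et (w z) * (h z - w z * d z) + pp et (w z) * d z))"
 by (rule integrable_mult_indicator[OF S hd])
 show "integrable lborel (%z. et * \<bar>d z\<bar>)" using d by simp
 show "AE z in lborel. indicat_real ?S z *\<^sub>R (pp' et (w z) * (h z - w z * d z) + pp et (w z) * d z) <= et * \<bar>d z\<bar>"
 using neg
 proof eventually_elim
 case (elim z)
 have e: "pp' et (w z) * (h z - w z * d z) + pp et (w z) * d z = pp' et (w z) * h z + (pp et (w z) - w z * pp' et (w z)) * d z"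
 by (simp add: algebra_simps)
 have "(pp et (w z) - w z * pp' et (w z)) * d z <= \<bar>pp et (w z) - w z * pp' et (w z)\<bar> * \<bar>d z\<bar>"
 unfolding abs_mult[symmetric] by (rule abs_ge_self)
 also have "\<dots> <= et * \<bar>d z\<bar>" by (intro mult_right_mono pp_bounds[OF et]) auto
 finally have 1: "(pp et (w z) - w z * pp' et (w z)) * d z <= et * \<bar>d z\<bar>" .
 have 2: "pp' et (w z) * h z <= 0" if "z \<in> ?S"
 proof (cases "0 < w z")
 case True
 have "z \<in> {0..T} \<times> {0..1}" using that t by auto
 then have "h z <= 0" using elim True by auto
 then show ?thesis using pp_bounds(1)[OF et, of "w z"] by (simp add: mult_nonneg_nonpos)
 next
 case False
 then show ?thesis using pp_bounds(2)[OF et, of "w z"] by simp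
 qed
 show ?case
 proof (cases "z \<in> ?S")
 case True
 then show ?thesis unfolding e using 1 2[OF True] by simp
 qed (use et in auto)
 qed
 qed
 then show ?thesis by simp
 qed
 have b0: "\<bar>(LBINT s:{0..t}. pp et (g0 s) * u0 s) - P\<bar> <= et * (LBINT s. \<bar>u0 s\<bar>)"
 unfolding P_def by (rule b) (use u0 g_le in auto)
 have b1: "\<bar>(LBINT s:{0..t}. pp et (g1 s) * ?U1 s) - Q\<bar> <= et * (LBINT s. \<bar>?U1 s\<bar>)"
 unfolding Q_def by (rule b) (use vel_1_integrable g_le in auto)
 define y1 y2 y3 y4 y5 where "y1 = (LBINT x:{0..1}. pp et (w (t, x)))" and "y2 = (LBINT x:{0..1}. pp et (w (0, x)))"
 and "y3 = (LBINT s:{0..t}. pp et (g0 s) * u0 s)" and "y4 = (LBINT s:{0..t}. pp et (g1 s) * ?U1 s)"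
 and "y5 = (LBINT z:?S. pp' et (w z) * (h z - w z * d z) + pp et (w z) * d z)"
 define k1 k2 k3 where "k1 = et * (LBINT s. \<bar>u0 s\<bar>)" and "k2 = et * (LBINT s. \<bar>?U1 s\<bar>)" and "k3 = et * (LBINT z. \<bar>d z\<bar>)"
 have "et * M = 2 * et + k1 + k2 + k3" by (simp add: M_def k1_def k2_def k3_def algebra_simps)
 moreover have "y1 = y2 + y3 - y4 + y5" using ren by (simp only: y1_def y2_def y3_def y4_def y5_def)
 moreover have "\<bar>y1 - A t\<bar> <= et" "\<bar>y2 - A 0\<bar> <= et" unfolding y1_def y2_def by (rule a)+
 moreover have "\<bar>y3 - P\<bar> <= k1" "\<bar>y4 - Q\<bar> <= k2" "y5 <= k3"
 unfolding y3_def y4_def y5_def k1_def k2_def k3_def by (fact b0, fact b1, fact c)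
 ultimately show ?thesis by linarith
 qed
 have "((%et. A 0 + P - Q + et * M) \<longlongrightarrow> A 0 + P - Q + 0 * M) (at_right 0)"
 by (intro tendsto_intros)
 moreover have "\<forall>\<^sub>F et in at_right 0. A t <= A 0 + P - Q + et * M"
 using approx by (auto simp: eventually_at_right_field intro!: exI[of _ 1])
 ultimately have "A t <= A 0 + P - Q + 0 * M"
 by (intro tendsto_lowerbound[where F="at_right (0::real)"]) auto
 then show ?thesis unfolding L A_def P_def Q_def by simp
qed

text \<open>Averages of nonpositive slices are nonpositive, so where \<open>0 < g0 s\<close> the
  distance from \<open>mtr n s\<close> to \<open>g0 s\<close> is at least
  \<open>\<bar>g0 s\<bar>\<close>. Strong convergence then leaves no mass of
  \<open>\<bar>g0\<bar> * \<bar>u0\<bar>\<close> there.\<close>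

lemma trace_nonpos:
 assumes zero: "!!s. 0 <= s ==> s <= T ==> (LBINT x. max 0 (w (s, x))) = 0"
 shows "AE s in lborel. s \<in> {0..T} --> u0 s ~= 0 --> g0 s <= 0"
proof -
 have m_le: "mtr n s <= 0" if s: "0 <= s" "s <= T" for n s
 proof -
 have i: "integrable lborel (%x. max 0 (w (s, x)))"
 by (rule L_integrable_bound[OF w_integrable_section[of s]])
 (use borel_measurable_section(1)[OF w_measurable, of s] in \<open>auto intro!: AE_I2\<close>)
 then have ae: "AE x in lborel. w (s, x) <= 0"
 using integral_nonneg_eq_0_iff_AE[OF i] zero[OF s] by (auto elim: eventually_mono)
 have "mtr n s = (LBINT y. w (s, y) * (moll ((y - 0) / eps n) / eps n))" by (rule mv_eq[OF eps(1)])
 also have "\<dots> <= 0"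
 proof -
 have "AE y in lborel. 0 <= - (w (s, y) * (moll ((y - 0) / eps n) / eps n))"
 using ae
 proof eventually_elim
 case (elim y)
 have "0 <= moll ((y - 0) / eps n) / eps n" using eps(1)[of n] by (intro divide_nonneg_nonneg moll_bounds) auto
 from mult_nonpos_nonneg[OF elim this] show ?case by simp
 qed
 from integral_nonneg_AE[OF this] show ?thesis by simp
 qed
 finally show ?thesis .
 qed
 define A where "A = {0..T} \<inter> {s. 0 < g0 s}"
 have A: "A \<in> sets lborel" unfolding A_def by measurable
 have i1: "set_integrable lborel A (%s. \<bar>g0 s\<bar> * \<bar>u0 s\<bar>)" and i2: "set_integrable lborel {0..T} (%s. \<bar>mtr n s - g0 s\<bar> * \<bar>u0 s\<bar>)" for n
 proof -
 show "set_integrable lborel A (%s. \<bar>g0 s\<bar> * \<bar>u0 s\<bar>)"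
 by (rule bounded_abs_u0_integrable[where B=C]) (use A g_le in auto)
 show "set_integrable lborel {0..T} (%s. \<bar>mtr n s - g0 s\<bar> * \<bar>u0 s\<bar>)" for n
 by (rule bounded_abs_u0_integrable[where B="2*C"]) (use mtr_diff_le in auto)
 qed
 have le: "(LBINT s:A. \<bar>g0 s\<bar> * \<bar>u0 s\<bar>) <= (LBINT s:{0..T}. \<bar>mtr n s - g0 s\<bar> * \<bar>u0 s\<bar>)" for n
 unfolding set_lebesgue_integral_def
 proof (rule integral_mono)
 fix s
 have "\<bar>g0 s\<bar> * \<bar>u0 s\<bar> <= \<bar>mtr n s - g0 s\<bar> * \<bar>u0 s\<bar>" if "s \<in> A"
 using that m_le[of s n] by (intro mult_right_mono) (auto simp: A_def)
 then show "indicat_real A s *\<^sub>R (\<bar>g0 s\<bar> * \<bar>u0 s\<bar>) <= indicat_real {0..T} s *\<^sub>R (\<bar>mtr n s - g0 s\<bar> * \<bar>u0 s\<bar>)"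
 by (auto simp: indicator_def A_def)
 qed (use i1 i2 in \<open>auto simp: set_integrable_def\<close>)
 have "(LBINT s:A. \<bar>g0 s\<bar> * \<bar>u0 s\<bar>) <= 0"
 by (rule tendsto_lowerbound[OF trace_strong]) (use le in auto)
 moreover have nn: "0 <= indicat_real A s *\<^sub>R (\<bar>g0 s\<bar> * \<bar>u0 s\<bar>)" for s by (auto simp: indicator_def)
 ultimately have "(LBINT s. indicat_real A s *\<^sub>R (\<bar>g0 s\<bar> * \<bar>u0 s\<bar>)) = 0"
 unfolding set_lebesgue_integral_def using L_integral_nonneg[of lborel "%s. indicat_real A s *\<^sub>R (\<bar>g0 s\<bar> * \<bar>u0 s\<bar>)", OF nn]
 by (intro antisym)
 then have "AE s in lborel. indicat_real A s *\<^sub>R (\<bar>g0 s\<bar> * \<bar>u0 s\<bar>) = 0"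
 using integral_nonneg_eq_0_iff_AE[OF i1[unfolded set_integrable_def]] nn by auto
 then show ?thesis by eventually_elim (auto simp: A_def indicator_def split: if_splits)
qed

lemma traces_nonpos:
 assumes zero: "!!s. 0 <= s ==> s <= T ==> (LBINT x. max 0 (w (s, x))) = 0"
 shows "AE s in lborel. s \<in> {0..T} --> (u0 s ~= 0 --> g0 s <= 0) \<and> (vel u0 d s 1 ~= 0 --> g1 s <= 0)"
proof -
 interpret R: balance_law T C "%z. w (flip z)" rd "%z. h (flip z)" ru0 g1 g0 by (rule balance_law_flip)
 have "(LBINT x. max 0 (w (flip (s, x)))) = 0" if "0 <= s" "s <= T" for s
 using zero[OF that] integral_reflect(1)[of "%x. max 0 (w (s, x))"] by (simp add: flip_def)
 then have "AE s in lborel. s \<in> {0..T} --> ru0 s ~= 0 --> g1 s <= 0" by (intro R.trace_nonpos) auto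
 moreover have "AE s in lborel. s \<in> {0..T} --> u0 s ~= 0 --> g0 s <= 0" by (intro trace_nonpos zero)
 ultimately show ?thesis by eventually_elim (auto simp: ru0_def)
qed

end

section \<open>Affine changes of the unknown\<close>

definition zext :: "real => (real => real) => real => real" where
 "zext T f t = indicat_real {0..T} t * f t"

lemma zext_simps: "0 <= t ==> t <= T ==> zext T f t = f t" "\<not> (0 <= t \<and> t <= T) ==> zext T f t = 0"
 by (auto simp: zext_def)

lemma zext_measurable: "ac_on T a a' ==> zext T a \<in> borel_measurable borel"
 using borel_measurable_continuous_on_indicator[OF _ ac_on_continuous[of T a a']] by (simp add: zext_def[abs_def])

lemma zext_integrable: "ac_on T a a' ==> integrable lborel (zext T a')"
 by (simp add: ac_on_def set_integrable_def zext_def[abs_def])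

lemma integrable_fst_box:
 fixes q :: "real => real"
 assumes "integrable lborel q"
 shows "integrable lborel (%z :: real \<times> real. q (fst z) * indicat_real {0<..<1} (snd z))"
proof -
 have "set_integrable lborel (UNIV \<times> {0..1}) (%z :: real \<times> real. q (fst z))"
 using integrable_vel_box[OF assms, of "%_. 0" 0 1] by (simp add: vel_def)
 then have "integrable lborel (%z :: real \<times> real. indicat_real {0<..<1} (snd z) * (indicat_real (UNIV \<times> {0..1}) z *\<^sub>R q (fst z)))"
 unfolding set_integrable_def by (rule integrable_mult_bounded[where B=1]) auto
 moreover have "(%z :: real \<times> real. indicat_real {0<..<1} (snd z) * (indicat_real (UNIV \<times> {0..1}) z *\<^sub>R q (fst z)))
 = (%z. q (fst z) * indicat_real {0<..<1} (snd z))"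
 by (rule ext) (auto simp: indicator_def mem_Times_iff)
 ultimately show ?thesis by simp
qed

lemma integral_open_unit:
 fixes q :: "real => real"
 assumes "set_integrable lborel {0..1} q"
 shows "integrable lborel (%x. indicat_real {0<..<1} x * q x)"
 and "(LBINT x. indicat_real {0<..<1} x * q x) = (LBINT x:{0..1}. q x)"
proof -
 have "set_integrable lborel {0<..<1} q" by (rule set_integrable_subset[OF assms]) auto
 then show i: "integrable lborel (%x. indicat_real {0<..<1} x * q x)" by (simp add: set_integrable_def)
 show "(LBINT x. indicat_real {0<..<1} x * q x) = (LBINT x:{0..1}. q x)"
 unfolding set_lebesgue_integral_def
 proof (rule integral_cong_AE)
 show "AE x in lborel. indicat_real {0<..<1} x * q x = indicat_real {0..1} x *\<^sub>R q x"
 using AE_lborel_singleton[of "0::real"] AE_lborel_singleton[of "1::real"]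
 by eventually_elim (auto simp: indicator_def)
 qed (use i assms in \<open>auto simp: set_integrable_def\<close>)
qed

lemma lip_test_ac_on:
 assumes "lip_test tt tt'"
 shows "ac_on 1 tt tt'"
proof -
 obtain L S where L: "L-lipschitz_on {0..1} tt" "!!x. \<bar>tt' x\<bar> <= L" and S: "finite S"
 "!!x. x \<in> {0<..<1} - S ==> (tt has_real_derivative tt' x) (at x)" and m: "tt' \<in> borel_measurable borel"
 using assms unfolding lip_test_def by blast
 have i: "set_integrable lborel {0..t} tt'" if "t <= 1" for t
 proof -
 have "set_integrable lborel {0..t} (%x. tt' x * 1)"
 by (rule set_integrable_mult_bounded[OF _ m L(2)]) (auto intro!: borel_integrable_atLeastAtMost')
 then show ?thesis by simp
 qed
 have "tt t - tt 0 = (LBINT s:{0..t}. tt' s)" if t: "t \<in> {0..1}" for t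
 proof -
 have "(tt' has_integral (tt t - tt 0)) {0..t}"
 proof (rule fundamental_theorem_of_calculus_interior_strong[OF S(1)])
 show "0 <= t" using t by simp
 fix x assume "x \<in> {0<..<t} - S"
 then have "x \<in> {0<..<1} - S" using t by auto
 from S(2)[OF this] show "(tt has_vector_derivative tt' x) (at x)" by (simp add: has_real_derivative_iff_has_vector_derivative)
 next
 show "continuous_on {0..t} tt"
 by (rule continuous_on_subset[OF lipschitz_on_continuous_on[OF L(1)]]) (use t in auto)
 qed
 moreover have "(tt' has_integral (LBINT s:{0..t}. tt' s)) {0..t}"
 using set_borel_integral_eq_integral[OF i] t by (simp add: has_integral_integral)
 ultimately show ?thesis by (rule has_integral_unique)
 qed
 then show ?thesis using i[of 1] by (simp add: ac_on_def)
qed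

context balance_law
begin

text \<open>This is the law for the excess over a spatially constant bound. The factor
  \<open>a\<close> is treated by the product rule in time; the constant has flux
  \<open>b * U\<close>, whose divergence \<open>b * d\<close> moves into the source when
  \<open>U * tt\<close> is integrated by parts. The indicator of the open interval keeps the zero
  extension that the locale demands.\<close>

lemma balance_law_affine:
 assumes a: "ac_on T a a'" and b: "ac_on T b b'"
 and aB: "!!t. 0 <= t ==> t <= T ==> \<bar>a t\<bar> <= A" and bB: "!!t. 0 <= t ==> t <= T ==> \<bar>b t\<bar> <= B"
 shows "balance_law T (A * C + B) (%z. zext T a (fst z) * w z - zext T b (fst z) * indicat_real {0<..<1} (snd z)) d
 (%z. zext T a (fst z) * h z + zext T a' (fst z) * w z
 - (zext T b' (fst z) + zext T b (fst z) * d z) * indicat_real {0<..<1} (snd z)) u0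
 (%t. zext T a t * g0 t - zext T b t) (%t. zext T a t * g1 t - zext T b t)"
proof -
 note [measurable] = zext_measurable[OF a] zext_measurable[OF b]
 have A0: "0 <= A" and B0: "0 <= B" using aB[of 0] bB[of 0] T by auto
 have za: "\<bar>zext T a t\<bar> <= A" and zb: "\<bar>zext T b t\<bar> <= B" for t
 using aB[of t] bB[of t] A0 B0 by (auto simp: zext_def indicator_def)
 have zi: "integrable lborel (zext T a')" "integrable lborel (zext T b')" using zext_integrable[OF a] zext_integrable[OF b] by auto
 have [measurable]: "zext T a' \<in> borel_measurable borel" "zext T b' \<in> borel_measurable borel" using zi by auto
 define W where "W = (%z. zext T a (fst z) * w z - zext T b (fst z) * indicat_real {0<..<1} (snd z))"
 define H where "H = (%z. zext T a (fst z) * h z + zext T a' (fst z) * w z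
 - (zext T b' (fst z) + zext T b (fst z) * d z) * indicat_real {0<..<1} (snd z))"
 have [measurable]: "W \<in> borel_measurable borel" unfolding W_def by measurable
 have Hm[measurable]: "H \<in> borel_measurable borel" unfolding H_def by measurable
 have le: "\<bar>zext T a t * x - zext T b t * y\<bar> <= A * C + B" if "\<bar>x\<bar> <= C" "\<bar>y\<bar> <= 1" for t x y
 proof -
 have "\<bar>zext T a t * x\<bar> <= A * C" unfolding abs_mult using za[of t] that A0 by (intro mult_mono) auto
 moreover have "\<bar>zext T b t * y\<bar> <= B * 1" unfolding abs_mult using zb[of t] that B0 by (intro mult_mono) auto
 ultimately show ?thesis by linarith
 qed
 have Hi: "integrable lborel H"
 proof -
 have 1: "integrable lborel (%z. zext T a (fst z) * h z)"
 by (rule integrable_mult_bounded[OF h, where B=A]) (use za in auto)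
 have "integrable lborel (%z. w z * (zext T a' (fst z) * indicat_real {0<..<1} (snd z)))"
 by (rule integrable_mult_bounded[OF integrable_fst_box[OF zi(1)], where B=C]) (use w_le in auto)
 moreover have "w z * (zext T a' (fst z) * indicat_real {0<..<1} (snd z)) = zext T a' (fst z) * w z" for z
 using w_0[of "snd z" "fst z"] by (cases "snd z \<in> {0<..<1}") auto
 ultimately have 2: "integrable lborel (%z. zext T a' (fst z) * w z)" by simp
 have 3: "integrable lborel (%z. (zext T b (fst z) * indicat_real {0<..<1} (snd z)) * d z)"
 by (rule integrable_mult_bounded[OF d, where B=B]) (use zb B0 in \<open>auto simp: indicator_def\<close>)
 have eq: "H = (%z. zext T a (fst z) * h z + zext T a' (fst z) * w z
 - (zext T b' (fst z) * indicat_real {0<..<1} (snd z) + (zext T b (fst z) * indicat_real {0<..<1} (snd z)) * d z))"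
 by (rule ext) (simp add: H_def algebra_simps)
 show ?thesis unfolding eq
 by (rule L_integrable_diff[OF L_integrable_add[OF 1 2]
 L_integrable_add[OF integrable_fst_box[OF zi(2)] 3]])
 qed
 have "balance_law T (A * C + B) W d H u0 (%t. zext T a t * g0 t - zext T b t) (%t. zext T a t * g1 t - zext T b t)"
 proof unfold_locales
 show "0 < T" by (rule T)
 show "W \<in> borel_measurable borel" by measurable
 show "\<bar>W z\<bar> <= A * C + B" for z unfolding W_def by (rule le[OF w_le]) auto
 show "W (t, x) = 0" if "\<not> (0 < x \<and> x < 1 \<and> 0 <= t \<and> t <= T)" for t x
 using that w_0[OF that] by (auto simp: W_def zext_def indicator_def)
 show "integrable lborel d" "integrable lborel H" "integrable lborel u0" by (rule d Hi u0)+
 show "H (t, x) = 0" if "\<not> (0 < x \<and> x < 1)" for t x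
 using that h_0[OF that] w_0[of x t] by (auto simp: H_def)
 show "(%t. zext T a t * g0 t - zext T b t) \<in> borel_measurable borel" "(%t. zext T a t * g1 t - zext T b t) \<in> borel_measurable borel"
 by measurable
 show "\<bar>zext T a t * g0 t - zext T b t\<bar> <= A * C + B" "\<bar>zext T a t * g1 t - zext T b t\<bar> <= A * C + B" for t
 using le[OF g_le(1), of 1 t] le[OF g_le(2), of 1 t] by auto
 next
 fix tt tt' t assume tt: "lip_test tt tt'" and t: "0 <= t" "t <= T"
 obtain LL where ttb: "!!x. \<bar>tt x\<bar> <= LL" and [measurable]: "tt \<in> borel_measurable borel" "tt' \<in> borel_measurable borel"
 using tt unfolding lip_test_def by blast
 define L where "L s = (LBINT x. w (s, x) * tt x)" for s
 define P where "P s = (LBINT x. w (s, x) * vel u0 d s x * tt' x + h (s, x) * tt x)" for s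
 define \<Phi> where "\<Phi> s = P s - g1 s * vel u0 d s 1 * tt 1 + g0 s * u0 s * tt 0" for s
 define I where "I = (LBINT x. indicat_real {0<..<1} x * tt x)"
 have \<Phi>i: "integrable lborel \<Phi>"
 proof -
 have "integrable lborel P" using integrable_lborel_pair(3)[OF balance_integrand_integrable[OF tt]] by (simp add: P_def[abs_def])
 moreover have "integrable lborel (%s. g1 s * vel u0 d s 1)"
 by (rule integrable_mult_bounded[OF vel_1_integrable, where B=C]) (use g_le in auto)
 moreover have "integrable lborel (%s. g0 s * u0 s)"
 by (rule integrable_mult_bounded[OF u0, where B=C]) (use g_le in auto)
 ultimately show ?thesis unfolding \<Phi>_def[abs_def] by (intro L_integrable_add L_integrable_diff integrable_mult_left)
 qed
 have acL: "ac_on T L \<Phi>"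
 unfolding ac_on_def
 proof (intro conjI ballI)
 show "set_integrable lborel {0..T} \<Phi>" by (rule set_integrable_of_integrable[OF \<Phi>i]) simp
 show "L s - L 0 = (LBINT r:{0..s}. \<Phi> r)" if "s \<in> {0..T}" for s
 using balance[OF tt, of s] that by (simp add: L_def P_def \<Phi>_def)
 qed
 \<comment> \<open>\<open>L\<close> is the tested solution and \<open>I\<close> the integral of the
   test function, so \<open>- I * b\<close> is the tested constant.\<close>
 have ac: "ac_on T (%s. a s * L s + (- I) * b s) (%s. L s * a' s + a s * \<Phi> s + (- I) * b' s)"
 by (intro ac_on_add ac_on_mult a acL ac_on_cmult b)
 have wI: "integrable lborel (%x. w (s, x) * tt x)" for s
 using integrable_mult_bounded[OF w_integrable_section[of s], of tt LL] ttb by (simp add: mult.commute)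
 have ttI: "integrable lborel (%x. indicat_real {0<..<1} x * tt x)"
 using integrable_mult_bounded[of lborel "indicat_real {0<..<1}" tt LL] ttb by (simp add: mult.commute)
 have lhs: "(LBINT x. W (s, x) * tt x) = a s * L s + (- I) * b s" if s: "0 <= s" "s <= T" for s
 proof -
 have "W (s, x) * tt x = a s * (w (s, x) * tt x) - b s * (indicat_real {0<..<1} x * tt x)" for x
 using s by (simp add: W_def zext_simps algebra_simps)
 then have "(LBINT x. W (s, x) * tt x) = (LBINT x. a s * (w (s, x) * tt x) - b s * (indicat_real {0<..<1} x * tt x))" by simp
 also have "\<dots> = a s * L s - b s * I" using wI ttI by (simp add: L_def I_def)
 finally show ?thesis by (simp add: algebra_simps)
 qed
 define Q where "Q s = (LBINT x. W (s, x) * vel u0 d s x * tt' x + H (s, x) * tt x)" for s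
 have Qm: "Q \<in> borel_measurable borel"
 proof -
 have "(%z. W z * vel u0 d (fst z) (snd z) * tt' (snd z) + H z * tt (snd z)) \<in> borel_measurable borel" by measurable
 from pair_integral_measurable[OF this] show ?thesis by (simp add: Q_def[abs_def])
 qed
 have [measurable]: "(%s. vel u0 d s 1) \<in> borel_measurable borel"
 using borel_measurable_section(2)[OF vel_measurable', of 1] by simp
 have "AE s in lborel. s \<in> {0..T} --> Q s - (zext T a s * g1 s - zext T b s) * vel u0 d s 1 * tt 1 + (zext T a s * g0 s - zext T b s) * u0 s * tt 0
 = L s * a' s + a s * \<Phi> s + (- I) * b' s"
 using integrable_lborel_pair(1)[OF balance_integrand_integrable[OF tt]] integrable_lborel_pair(1)[OF d]
 proof eventually_elim
 case (elim s)
 show ?case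
 proof
 assume s: "s \<in> {0..T}"
 have z: "zext T f s = f s" for f using s by (simp add: zext_simps)
 have ac1: "ac_on 1 (%x. vel u0 d s x * tt x) (%x. tt x * d (s, x) + vel u0 d s x * tt' x)"
 by (rule ac_on_mult[OF ac_on_vel[OF elim(2)] lip_test_ac_on[OF tt]])
 define q where "q x = tt x * d (s, x) + vel u0 d s x * tt' x" for x
 have "set_integrable lborel {0..1} q" using ac1 by (simp add: ac_on_def q_def[abs_def])
 note q = integral_open_unit[OF this]
 have q1: "(LBINT x:{0..1}. q x) = vel u0 d s 1 * tt 1 - u0 s * tt 0"
 using ac1 by (simp add: ac_on_def q_def vel_0)
 have i1: "integrable lborel (%x. w (s, x) * vel u0 d s x * tt' x + h (s, x) * tt x)" using elim(1) by simp
 have "W (s, x) * vel u0 d s x * tt' x + H (s, x) * tt x =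
 (a s * (w (s, x) * vel u0 d s x * tt' x + h (s, x) * tt x) + a' s * (w (s, x) * tt x))
 - (b' s * (indicat_real {0<..<1} x * tt x) + b s * (indicat_real {0<..<1} x * q x))" for x
 by (simp add: W_def H_def z q_def algebra_simps)
 then have "Q s = (LBINT x. (a s * (w (s, x) * vel u0 d s x * tt' x + h (s, x) * tt x) + a' s * (w (s, x) * tt x))
 - (b' s * (indicat_real {0<..<1} x * tt x) + b s * (indicat_real {0<..<1} x * q x)))"
 by (simp add: Q_def)
 also have "\<dots> = (LBINT x. a s * (w (s, x) * vel u0 d s x * tt' x + h (s, x) * tt x) + a' s * (w (s, x) * tt x))
 - (LBINT x. b' s * (indicat_real {0<..<1} x * tt x) + b s * (indicat_real {0<..<1} x * q x))"
 by (intro L_integral_diff L_integrable_add integrable_mult_right i1 wI ttI q(1))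
 also have "(LBINT x. a s * (w (s, x) * vel u0 d s x * tt' x + h (s, x) * tt x) + a' s * (w (s, x) * tt x))
 = (LBINT x. a s * (w (s, x) * vel u0 d s x * tt' x + h (s, x) * tt x)) + (LBINT x. a' s * (w (s, x) * tt x))"
 by (intro L_integral_add integrable_mult_right i1 wI)
 also have "(LBINT x. b' s * (indicat_real {0<..<1} x * tt x) + b s * (indicat_real {0<..<1} x * q x))
 = (LBINT x. b' s * (indicat_real {0<..<1} x * tt x)) + (LBINT x. b s * (indicat_real {0<..<1} x * q x))"
 by (intro L_integral_add integrable_mult_right ttI q(1))
 finally have "Q s = a s * P s + a' s * L s - (b' s * I + b s * (vel u0 d s 1 * tt 1 - u0 s * tt 0))"
 unfolding integral_mult_right_zero q(2) q1 by (simp add: P_def L_def I_def)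
 then show "Q s - (zext T a s * g1 s - zext T b s) * vel u0 d s 1 * tt 1 + (zext T a s * g0 s - zext T b s) * u0 s * tt 0
 = L s * a' s + a s * \<Phi> s + (- I) * b' s"
 by (simp add: z \<Phi>_def algebra_simps)
 qed
 qed
 note AE = this
 have "(LBINT x. W (t, x) * tt x) - (LBINT x. W (0, x) * tt x) = (LBINT s:{0..t}. L s * a' s + a s * \<Phi> s + (- I) * b' s)"
 using ac t T by (simp add: lhs ac_on_def)
 also have "\<dots> = (LBINT s:{0..t}. Q s - (zext T a s * g1 s - zext T b s) * vel u0 d s 1 * tt 1 + (zext T a s * g0 s - zext T b s) * u0 s * tt 0)"
 unfolding set_lebesgue_integral_def
 proof (rule integral_cong_AE)
 have "set_integrable lborel {0..t} (%s. L s * a' s + a s * \<Phi> s + (- I) * b' s)"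
 using ac_on_subinterval[OF ac t] by (simp add: ac_on_def)
 then show "(%s. indicat_real {0..t} s *\<^sub>R (L s * a' s + a s * \<Phi> s + (- I) * b' s)) \<in> borel_measurable lborel"
 by (simp add: set_integrable_def)
 show "(%s. indicat_real {0..t} s *\<^sub>R (Q s - (zext T a s * g1 s - zext T b s) * vel u0 d s 1 * tt 1 + (zext T a s * g0 s - zext T b s) * u0 s * tt 0)) \<in> borel_measurable lborel"
 using Qm by measurable
 show "AE s in lborel. indicat_real {0..t} s *\<^sub>R (L s * a' s + a s * \<Phi> s + (- I) * b' s)
 = indicat_real {0..t} s *\<^sub>R (Q s - (zext T a s * g1 s - zext T b s) * vel u0 d s 1 * tt 1 + (zext T a s * g0 s - zext T b s) * u0 s * tt 0)"
 using AE by eventually_elim (use t in \<open>auto simp: indicator_def\<close>)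
 qed
 finally show "(LBINT x. W (t, x) * tt x) - (LBINT x. W (0, x) * tt x) =
 (LBINT s:{0..t}. (LBINT x. W (s, x) * vel u0 d s x * tt' x + H (s, x) * tt x)
 - (zext T a s * g1 s - zext T b s) * vel u0 d s 1 * tt 1 + (zext T a s * g0 s - zext T b s) * u0 s * tt 0)"
 by (simp only: Q_def)
 qed
 then show ?thesis by (simp only: W_def H_def)
qed

end

section \<open>Smooth test functions and the continuous W11 representative\<close>

lemma tendsto_poly_mult_exp:
 fixes p :: "real poly"
 shows "((%y. poly p y * exp (- y)) \<longlongrightarrow> 0) at_top"
proof -
 have "((%y. \<Sum>i\<le>degree p. coeff p i * (y ^ i / exp y)) \<longlongrightarrow> (\<Sum>i\<le>degree p. coeff p i * 0)) at_top"
 by (intro tendsto_intros tendsto_power_div_exp_0)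
 then show ?thesis by (simp add: poly_altdef sum_distrib_right exp_minus divide_inverse mult.assoc)
qed

text \<open>Polynomials in \<open>1 / x\<close> times \<open>exp (- 1 / x)\<close>, extended by 0.
  Differentiation keeps this shape, with polynomial \<open>X^2 * (p - p')\<close>, which settles all
  orders of differentiability at 0 at once.\<close>

definition flat :: "real poly => real => real" where
 "flat p x = (if 0 < x then poly p (inverse x) * exp (- inverse x) else 0)"

lemma flat_DERIV: "(flat p has_real_derivative flat ([:0, 0, 1:] * (p - pderiv p)) x) (at x)"
proof -
 let ?q = "[:0, 0, 1:] * (p - pderiv p)"
 consider "x < 0" | "x = 0" | "0 < x" by linarith
 then show ?thesis
 proof cases
 case 1
 have "((%_. 0) has_real_derivative flat ?q x) (at x)" using 1 by (simp add: flat_def)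
 then show ?thesis
 by (rule has_field_derivative_transform_within_open[where S="{..<0}"]) (use 1 in \<open>auto simp: flat_def\<close>)
 next
 case 2
 have "((%h. (flat p (0 + h) - flat p 0) / h) \<longlongrightarrow> 0) (at 0)"
 proof (rule filterlim_split_at)
 show "((%h. (flat p (0 + h) - flat p 0) / h) \<longlongrightarrow> 0) (at_left 0)"
 by (rule tendsto_eventually) (auto simp: flat_def eventually_at_filter)
 have "((%h. poly (pCons 0 p) (inverse h) * exp (- inverse h)) \<longlongrightarrow> 0) (at_right 0)"
 by (rule filterlim_compose[OF tendsto_poly_mult_exp filterlim_inverse_at_top_right])
 then show "((%h. (flat p (0 + h) - flat p 0) / h) \<longlongrightarrow> 0) (at_right 0)"
 by (rule filterlim_cong[THEN iffD1, OF refl refl, rotated])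
 (auto simp: flat_def eventually_at_filter field_simps)
 qed
 then show ?thesis using 2 by (simp add: DERIV_def flat_def)
 next
 case 3
 have "((%x. poly p (inverse x) * exp (- inverse x)) has_real_derivative flat ?q x) (at x)"
 using 3 by (auto intro!: derivative_eq_intros DERIV_chain'[OF _ poly_DERIV] simp: flat_def algebra_simps power2_eq_square)
 then show ?thesis
 by (rule has_field_derivative_transform_within_open[where S="{0<..}"]) (use 3 in \<open>auto simp: flat_def\<close>)
 qed
qed

text \<open>A class closed under differentiation, as the iterated \<open>deriv\<close> in
  \<open>test_function\<close> calls for. Affine arguments provide translates and the reflected
  factor in \<open>bump\<close>.\<close>

inductive smooth_expr :: "(real => real) => bool" where
 flat: "smooth_expr (%x. flat p (\<alpha> * x + \<beta>))"
| const: "smooth_expr (%_. c)"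
| add: "smooth_expr f ==> smooth_expr g ==> smooth_expr (%x. f x + g x)"
| mult: "smooth_expr f ==> smooth_expr g ==> smooth_expr (%x. f x * g x)"

lemma smooth_expr_DERIV:
 assumes "smooth_expr f"
 shows "\<exists>f'. smooth_expr f' \<and> (\<forall>x. (f has_real_derivative f' x) (at x))"
 using assms
proof induction
 case (flat p \<alpha> \<beta>)
 let ?q = "[:0, 0, 1:] * (p - pderiv p)"
 have "((%x. flat p (\<alpha> * x + \<beta>)) has_real_derivative flat ?q (\<alpha> * x + \<beta>) * \<alpha>) (at x)" for x
 by (rule DERIV_chain2[OF flat_DERIV]) (auto intro!: derivative_eq_intros)
 moreover have "smooth_expr (%x. flat ?q (\<alpha> * x + \<beta>) * \<alpha>)" by (intro smooth_expr.intros)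
 ultimately show ?case by blast
next
 case (const c)
 then show ?case by (intro exI[of _ "%_. 0"]) (auto intro: smooth_expr.intros)
next
 case (add f g)
 then obtain f' g' where "smooth_expr f'" "smooth_expr g'" "!!x. (f has_real_derivative f' x) (at x)" "!!x. (g has_real_derivative g' x) (at x)" by blast
 then show ?case by (intro exI[of _ "%x. f' x + g' x"]) (auto intro: smooth_expr.intros DERIV_add)
next
 case (mult f g)
 then obtain f' g' where "smooth_expr f'" "smooth_expr g'" "!!x. (f has_real_derivative f' x) (at x)" "!!x. (g has_real_derivative g' x) (at x)" by blast
 with mult show ?case by (intro exI[of _ "%x. f' x * g x + g' x * f x"]) (auto intro!: smooth_expr.intros DERIV_mult)
qed

lemma smooth_expr_deriv_funpow: "smooth_expr f ==> smooth_expr ((deriv ^^ k) f)"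
proof (induction k)
 case (Suc k)
 obtain f' where f': "smooth_expr f'" "!!x. ((deriv ^^ k) f has_real_derivative f' x) (at x)"
 using smooth_expr_DERIV[OF Suc.IH[OF Suc.prems]] by blast
 then have "deriv ((deriv ^^ k) f) = f'" by (intro ext DERIV_imp_deriv)
 then show ?case using f' by simp
qed simp

text \<open>Only the derivative is asked to lie in the closed class, since the function itself will
  be a primitive of a combination of bumps.\<close>

lemma test_functionI:
 assumes der: "!!x. (\<phi> has_real_derivative \<psi> x) (at x)" and \<psi>: "smooth_expr \<psi>"
 and supp: "!!x. x \<notin> {a..b} ==> \<phi> x = 0" and ab: "0 < a" "b < 1"
 shows "test_function \<phi>"
 unfolding test_function_def
proof (intro conjI allI)
 fix k
 have "\<exists>D. \<forall>x. ((deriv ^^ k) \<phi> has_real_derivative D x) (at x)"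
 proof (cases k)
 case 0
 then show ?thesis using der by auto
 next
 case (Suc m)
 have "deriv \<phi> = \<psi>" using der by (intro ext DERIV_imp_deriv)
 then have "(deriv ^^ k) \<phi> = (deriv ^^ m) \<psi>" by (simp add: Suc funpow_swap1)
 then show ?thesis using smooth_expr_DERIV[OF smooth_expr_deriv_funpow[OF \<psi>, of m]] by auto
 qed
 then show "(deriv ^^ k) \<phi> differentiable_on UNIV"
 by (auto simp: differentiable_on_def real_differentiable_def)
next
 have "{x. \<phi> x ~= 0} \<subseteq> {a..b}" using supp by blast
 then have "closure {x. \<phi> x ~= 0} \<subseteq> {a..b}" by (rule closure_minimal) simp
 then show "closure {x. \<phi> x ~= 0} \<subseteq> {0<..<1}" "compact (closure {x. \<phi> x ~= 0})"
 using ab by (auto simp: compact_eq_bounded_closed intro: bounded_subset[OF bounded_closed_interval])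
qed

lemma AE_imp_ex_between:
 fixes a b :: real
 assumes "AE s in lborel. P s" "a < b"
 shows "\<exists>s. a < s \<and> s < b \<and> P s"
proof (rule ccontr)
 assume "\<not> ?thesis"
 then have "AE s in lborel. s \<notin> {a<..<b}" using assms(1) by (auto elim!: eventually_mono)
 then have "{a<..<b} \<in> null_sets lborel" by (subst (asm) AE_iff_null_sets[symmetric]) auto
 then show False using assms(2) by (auto simp: null_sets_def)
qed

lemma set_integrable_closed_interval:
 fixes q :: "real => real"
 assumes "set_integrable lborel {a<..<b} q"
 shows "set_integrable lborel {a..b} q"
proof (cases "a <= b")
 case True
 have "set_integrable lborel {c} q" for c
 proof -
 have "integrable lborel (%x. indicat_real {c} x *\<^sub>R q c)" by simp
 moreover have eq: "(%x. indicat_real {c} x *\<^sub>R q c) = (%x. indicat_real {c} x *\<^sub>R q x)" by (auto simp: indicator_def)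
 ultimately show ?thesis unfolding set_integrable_def by (simp only: eq)
 qed
 then have "set_integrable lborel ({a<..<b} \<union> ({a} \<union> {b})) q"
 by (intro set_integrable_Un assms) auto
 moreover have "{a<..<b} \<union> ({a} \<union> {b}) = {a..b}" using True by auto
 ultimately show ?thesis by simp
qed (simp add: set_integrable_def)

text \<open>Rewrites the side condition that arises when integrals over \<open>Omega\<close> are
  unfolded to restrictions of Lebesgue measure.\<close>

lemma Omega_int [simp]: "{0<..<1} \<inter> space lborel \<in> sets (lborel :: real measure)" by simp

lemma integral_Omega_component:
 fixes g :: "real => real^'n" and k :: "real => real"
 assumes g: "integrable Omega g" and k: "continuous_on UNIV k"
 shows "set_integrable lborel {0..1} (%x. g x $ j)"
 and "(\<integral>x. k x *\<^sub>R g x \<partial>Omega) $ j = (LBINT x:{0..1}. k x * g x $ j)"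
proof -
 have "integrable Omega (%x. g x $ j)" by (rule integrable_bounded_linear[OF bounded_linear_vec_nth g])
 then have "set_integrable lborel {0<..<1} (%x. g x $ j)"
 by (simp add: Omega_def integrable_restrict_space set_integrable_def)
 then show si: "set_integrable lborel {0..1} (%x. g x $ j)" by (rule set_integrable_closed_interval)
 obtain B where B: "!!x. x \<in> {0..1} ==> \<bar>k x\<bar> <= B"
 using compact_imp_bounded[OF compact_continuous_image[OF continuous_on_subset[OF k subset_UNIV] compact_Icc[of 0 1]]]
 unfolding bounded_iff by (metis image_eqI real_norm_def)
 have [measurable]: "k \<in> borel_measurable Omega"
 unfolding Omega_def by (intro measurable_restrict_space1) (simp add: borel_measurable_continuous_onI[OF k])
 have [measurable]: "g \<in> borel_measurable Omega" using g by auto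
 have i: "integrable Omega (%x. k x *\<^sub>R g x)"
 proof (rule L_integrable_bound)
 show "integrable Omega (%x. B *\<^sub>R g x)" using g by simp
 show "AE x in Omega. norm (k x *\<^sub>R g x) <= norm (B *\<^sub>R g x)"
 proof (rule AE_I2)
 fix x assume "x \<in> space Omega"
 then have "\<bar>k x\<bar> <= \<bar>B\<bar>" using B[of x] by (auto simp: Omega_def space_restrict_space)
 then show "norm (k x *\<^sub>R g x) <= norm (B *\<^sub>R g x)" by (simp add: mult_right_mono)
 qed
 qed measurable
 have "(\<integral>x. k x *\<^sub>R g x \<partial>Omega) $ j = (\<integral>x. (k x *\<^sub>R g x) $ j \<partial>Omega)"
 by (rule integral_bounded_linear[OF bounded_linear_vec_nth i, symmetric])
 also have "\<dots> = (LBINT x. indicat_real {0<..<1} x * (k x * g x $ j))"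
 by (simp add: Omega_def integral_restrict_space)
 also have "\<dots> = (LBINT x:{0..1}. k x * g x $ j)"
 by (rule integral_open_unit(2)[OF set_integrable_mult_continuous[OF si continuous_on_subset[OF k subset_UNIV]]])
 finally show "(\<integral>x. k x *\<^sub>R g x \<partial>Omega) $ j = (LBINT x:{0..1}. k x * g x $ j)" .
qed

lemma ac_on_C1:
 assumes der: "!!x. (\<phi> has_real_derivative \<psi> x) (at x)" and c: "continuous_on UNIV \<psi>"
 shows "ac_on b \<phi> \<psi>"
proof -
 have i: "set_integrable lborel {0..t} \<psi>" for t
 by (rule borel_integrable_atLeastAtMost') (rule continuous_on_subset[OF c subset_UNIV])
 have "\<phi> t - \<phi> 0 = (LBINT s:{0..t}. \<psi> s)" if "t \<in> {0..b}" for t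
 proof -
 have "(\<psi> has_integral (\<phi> t - \<phi> 0)) {0..t}"
 by (rule fundamental_theorem_of_calculus)
 (use that der in \<open>auto simp: has_real_derivative_iff_has_vector_derivative[symmetric] intro: has_field_derivative_at_within\<close>)
 moreover have "(\<psi> has_integral (LBINT s:{0..t}. \<psi> s)) {0..t}"
 using set_borel_integral_eq_integral[OF i] by (simp add: has_integral_integral)
 ultimately show ?thesis by (rule has_integral_unique)
 qed
 then show ?thesis using i by (simp add: ac_on_def)
qed

text \<open>Positive exactly on the interval from 0 to \<open>ep\<close>. It is left unnormalized;
  its positive integral is carried along and cancelled when two points are compared.\<close>

definition bump :: "real => real => real" where
 "bump ep x = flat 1 (1 * x + 0) * flat 1 ((- 1) * x + ep)"

lemma bump_smooth: "smooth_expr (%x. bump ep (x - a))"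
proof -
 have "(%x. bump ep (x - a)) = (%x. flat 1 (1 * x + (- a)) * flat 1 ((- 1) * x + (a + ep)))"
 by (rule ext) (simp add: bump_def algebra_simps)
 then show ?thesis by (simp only:) (intro smooth_expr.intros)
qed

lemma bump_facts:
 shows "0 <= bump ep x" "x \<notin> {0<..<ep} ==> bump ep x = 0" "x \<in> {0<..<ep} ==> 0 < bump ep x"
 by (auto simp: bump_def flat_def)

lemma smooth_expr_continuous: "smooth_expr f ==> continuous_on UNIV f"
 using smooth_expr_DERIV[of f] by (meson DERIV_isCont continuous_at_imp_continuous_on)

lemma bump_continuous: "continuous_on UNIV (%x. bump ep (x - a))"
 by (rule smooth_expr_continuous[OF bump_smooth])

lemma bump_integral:
 assumes ep: "0 < ep"
 shows "integrable lborel (bump ep)" "0 < integral\<^sup>L lborel (bump ep)"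
 and "0 <= a ==> a + ep <= b ==> (LBINT x:{0..b}. bump ep (x - a)) = integral\<^sup>L lborel (bump ep)"
proof -
 have c: "continuous_on A (bump ep)" for A
 using bump_continuous[of ep 0] by (auto intro: continuous_on_subset)
 have "set_integrable lborel {0..ep} (bump ep)" by (rule borel_integrable_atLeastAtMost'[OF c])
 moreover have "(%x. indicat_real {0..ep} x *\<^sub>R bump ep x) = bump ep"
 proof
 fix x show "indicat_real {0..ep} x *\<^sub>R bump ep x = bump ep x" using bump_facts(2)[of x ep] by (cases "x \<in> {0<..<ep}") auto
 qed
 ultimately show i: "integrable lborel (bump ep)" by (simp only: set_integrable_def)
 have "integral\<^sup>L lborel (bump ep) ~= 0"
 proof
 assume "integral\<^sup>L lborel (bump ep) = 0"
 then have "AE x in lborel. bump ep x = 0" using integral_nonneg_eq_0_iff_AE[OF i] bump_facts(1)[of ep] by auto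
 from AE_imp_ex_between[OF this ep] show False using bump_facts(3)[of _ ep] by force
 qed
 moreover have "0 <= integral\<^sup>L lborel (bump ep)" using bump_facts(1)[of ep] by (intro L_integral_nonneg)
 ultimately show "0 < integral\<^sup>L lborel (bump ep)" by simp
 show "(LBINT x:{0..b}. bump ep (x - a)) = integral\<^sup>L lborel (bump ep)" if "0 <= a" "a + ep <= b"
 proof -
 have "(%x. indicat_real {0..b} x *\<^sub>R bump ep (x - a)) = (%x. bump ep (x + (- a)))"
 proof
 fix x show "indicat_real {0..b} x *\<^sub>R bump ep (x - a) = bump ep (x + (- a))"
 using bump_facts(2)[of "x - a" ep] that by (cases "x - a \<in> {0<..<ep}") auto
 qed
 then show ?thesis unfolding set_lebesgue_integral_def using integrable_lborel_translate(2)[OF i, of "- a"] by (simp only:)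
 qed
qed

text \<open>The lower limit -1 lies to the left of the support, so that 0 is an interior point when
  the fundamental theorem is applied.\<close>

definition step :: "real => real => real" where "step ep x = integral {- 1..x} (bump ep)"

lemma step_facts:
 assumes "0 < ep"
 shows "(step ep has_real_derivative bump ep x) (at x)" "x <= 0 ==> step ep x = 0" "ep <= x ==> step ep x = step ep ep"
proof -
 have c: "continuous_on A (bump ep)" for A
 using bump_continuous[of ep 0] by (auto intro: continuous_on_subset)
 show z: "step ep x = 0" if "x <= 0" for x
 proof -
 have "integral {- 1..x} (bump ep) = integral {- 1..x} (%_. 0)"
 by (rule Henstock_Kurzweil_Integration.integral_cong) (use that bump_facts(2) in auto)
 then show ?thesis by (simp add: step_def)
 qed
 show "(step ep has_real_derivative bump ep x) (at x)"
 proof (cases "x < 0")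
 case True
 have "((%_. 0) has_real_derivative bump ep x) (at x)" using True bump_facts(2)[of x ep] by simp
 then show ?thesis
 by (rule has_field_derivative_transform_within_open[where S="{..<0}"]) (use True z in auto)
 next
 case False
 have "((%x. integral {- 1..x} (bump ep)) has_real_derivative bump ep x) (at x within {- 1..x + 1})"
 by (rule integral_has_real_derivative[OF c]) (use False in auto)
 then have "((%x. integral {- 1..x} (bump ep)) has_real_derivative bump ep x) (at x)"
 using False by (subst (asm) at_within_interior) auto
 then show ?thesis by (simp add: step_def[abs_def])
 qed
 show "step ep x = step ep ep" if "ep <= x"
 proof -
 have "integral {- 1..ep} (bump ep) + integral {ep..x} (bump ep) = integral {- 1..x} (bump ep)"
 by (rule Henstock_Kurzweil_Integration.integral_combine) (use that assms in \<open>auto intro!: integrable_continuous_interval c\<close>)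
 moreover have "integral {ep..x} (bump ep) = integral {ep..x} (%_. 0)"
 by (rule Henstock_Kurzweil_Integration.integral_cong) (use bump_facts(2) in auto)
 ultimately show ?thesis by (simp add: step_def)
 qed
qed

text \<open>The test function is the difference of two translates of a smooth step; its derivative
 compares the averages of a function near two points.\<close>

lemma W11_representation:
 fixes g g' :: "real => real^'n"
 assumes W: "W11 g g'"
 shows "set_integrable lborel {0..1} (%y. g' y $ j)"
 and "0 <= x ==> x <= 1 ==> g x $ j = g 0 $ j + (LBINT y:{0..x}. g' y $ j)"
proof -
 have gi: "integrable Omega g" "integrable Omega g'" and gc: "continuous_on {0..1} g"
 and test: "!!\<phi>. test_function \<phi> ==> (\<integral>x. deriv \<phi> x *\<^sub>R g x \<partial>Omega) = - (\<integral>x. \<phi> x *\<^sub>R g' x \<partial>Omega)"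
 using W by (auto simp: W11_def)
 show si: "set_integrable lborel {0..1} (%y. g' y $ j)" by (rule integral_Omega_component(1)[OF gi(2) continuous_on_const])
 define V where "V x = (LBINT y:{0..x}. g' y $ j)" for x
 have acV: "ac_on 1 V (%y. g' y $ j)" unfolding V_def[abs_def] by (rule ac_on_integral[OF si])
 have Vc: "continuous_on {0..1} V" by (rule ac_on_continuous[OF acV])
 define \<Psi> where "\<Psi> x = g x $ j - V x" for x
 have \<Psi>c: "continuous_on {0..1} \<Psi>" unfolding \<Psi>_def[abs_def]
 by (intro continuous_on_diff Vc continuous_on_component gc)
 have le: "\<bar>\<Psi> a - \<Psi> b\<bar> <= 2 * \<delta>" if ab: "0 < a" "a < b" "b < 1" and \<delta>: "0 < \<delta>" for a b \<delta>
 proof -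
 have "\<exists>e>0. \<forall>x. 0 <= x \<and> x <= 1 \<and> \<bar>x - p\<bar> < e --> \<bar>\<Psi> x - \<Psi> p\<bar> <= \<delta>" if "0 < p" "p < 1" for p
 proof -
 have p: "p \<in> {0..1}" using that by simp
 obtain e where e: "0 < e" "!!x. x \<in> {0..1} ==> dist x p < e ==> dist (\<Psi> x) (\<Psi> p) < \<delta>"
 using \<Psi>c[unfolded continuous_on_iff, THEN bspec, OF p] \<delta> by blast
 show ?thesis by (rule exI[of _ e]) (use e in \<open>auto simp: dist_real_def less_imp_le\<close>)
 qed
 from this[of a] this[of b] obtain ea eb where e: "0 < ea" "0 < eb" "!!x. 0 <= x ==> x <= 1 ==> \<bar>x - a\<bar> < ea ==> \<bar>\<Psi> x - \<Psi> a\<bar> <= \<delta>"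
 "!!x. 0 <= x ==> x <= 1 ==> \<bar>x - b\<bar> < eb ==> \<bar>\<Psi> x - \<Psi> b\<bar> <= \<delta>"
 using ab by auto
 \<comment> \<open>The first two bounds are continuity radii of \<open>\<Psi>\<close> at
   \<open>a\<close> and \<open>b\<close>; the third keeps the supports of both translates inside the
   open unit interval.\<close>
 define ep where "ep = min (min ea eb) ((1 - b) / 2)"
 have ep: "0 < ep" "ep <= ea" "ep <= eb" "ep <= (1 - b) / 2"
 proof -
 show "0 < ep" using e(1,2) ab by (simp add: ep_def)
 show "ep <= ea" "ep <= eb" by (simp_all add: ep_def)
 show "ep <= (1 - b) / 2" unfolding ep_def by (rule min.cobounded2)
 qed
 have b1: "b + ep < 1" using ep(4) ab by (simp add: field_simps)
 define \<psi> where "\<psi> x = bump ep (x - a) + (- 1) * bump ep (x - b)" for x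
 define \<phi> where "\<phi> x = step ep (x - a) - step ep (x - b)" for x
 have der: "(\<phi> has_real_derivative \<psi> x) (at x)" for x
 proof -
 have "((%x. step ep (x - p)) has_real_derivative bump ep (x - p) * 1) (at x)" for p
 by (rule DERIV_chain2[where f="step ep" and g="%x. x - p"], rule step_facts(1)[OF ep(1)])
 (auto intro!: derivative_eq_intros)
 then show ?thesis unfolding \<phi>_def[abs_def] \<psi>_def by (auto intro!: derivative_eq_intros)
 qed
 have \<psi>s: "smooth_expr \<psi>" unfolding \<psi>_def[abs_def] by (intro smooth_expr.intros bump_smooth)
 note \<psi>c = smooth_expr_continuous[OF \<psi>s]
 have supp: "\<phi> x = 0" if "x \<notin> {a..b + ep}" for x
 using that ab ep(1) step_facts(2)[OF ep(1), of "x - a"] step_facts(2)[OF ep(1), of "x - b"]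
 step_facts(3)[OF ep(1), of "x - a"] step_facts(3)[OF ep(1), of "x - b"] by (auto simp: \<phi>_def not_le)
 have "test_function \<phi>" by (rule test_functionI[where a=a and b="b + ep", OF der \<psi>s supp]) (use ab b1 in auto)
 moreover have "deriv \<phi> = \<psi>" using der by (intro ext DERIV_imp_deriv)
 ultimately have ibp: "(\<integral>x. \<psi> x *\<^sub>R g x \<partial>Omega) = - (\<integral>x. \<phi> x *\<^sub>R g' x \<partial>Omega)" using test[of \<phi>] by simp
 have \<phi>c: "continuous_on UNIV \<phi>" by (rule continuous_at_imp_continuous_on) (use der in \<open>blast intro: DERIV_isCont\<close>)
 have e1: "(LBINT x:{0..1}. \<psi> x * g x $ j) = - (LBINT x:{0..1}. \<phi> x * g' x $ j)"
 using arg_cong[OF ibp, of "%v. v $ j"]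
 by (simp add: integral_Omega_component(2)[OF gi(1) \<psi>c] integral_Omega_component(2)[OF gi(2) \<phi>c])
 have cI: "set_integrable lborel {0..1} (%x. f x * k x)" if "continuous_on UNIV f" "continuous_on {0..1} k" for f k :: "real => real"
 by (intro borel_integrable_atLeastAtMost' continuous_on_mult continuous_on_subset[OF that(1) subset_UNIV] that(2))
 \<comment> \<open>\<open>\<phi>\<close> vanishes at both ends, so the primitive \<open>V\<close>
   satisfies the same weak identity as \<open>g\<close>, and the difference \<open>\<Psi>\<close> is
   orthogonal to \<open>\<psi>\<close>.\<close>
 have e2: "(LBINT x:{0..1}. \<psi> x * V x + \<phi> x * g' x $ j) = 0"
 proof -
 have z: "\<phi> 0 = 0" "\<phi> 1 = 0" by (rule supp, use ab b1 in simp)+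
 have "ac_on 1 (%x. \<phi> x * V x) (%x. V x * \<psi> x + \<phi> x * g' x $ j)"
 by (rule ac_on_mult[OF ac_on_C1[OF der \<psi>c] acV])
 then have "\<phi> 1 * V 1 - \<phi> 0 * V 0 = (LBINT x:{0..1}. V x * \<psi> x + \<phi> x * g' x $ j)" unfolding ac_on_def by simp
 then show ?thesis unfolding z by (simp add: mult.commute)
 qed
 have e3: "(LBINT x:{0..1}. \<psi> x * V x + \<phi> x * g' x $ j) = (LBINT x:{0..1}. \<psi> x * V x) + (LBINT x:{0..1}. \<phi> x * g' x $ j)"
 by (rule set_integral_add(2)[OF cI[OF \<psi>c Vc] set_integrable_mult_continuous[OF si continuous_on_subset[OF \<phi>c subset_UNIV]]])
 have "(LBINT x:{0..1}. \<psi> x * g x $ j) = (LBINT x:{0..1}. \<psi> x * V x)" using e1 e2 e3 by linarith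
 then have "(LBINT x:{0..1}. \<psi> x * \<Psi> x) = 0"
 using cI[OF \<psi>c Vc] cI[OF \<psi>c continuous_on_component[OF gc]]
 by (simp add: \<Psi>_def right_diff_distrib set_integral_diff(2))
 moreover have "(LBINT x:{0..1}. \<psi> x * \<Psi> x) = (LBINT x:{0..1}. bump ep (x - a) * \<Psi> x) - (LBINT x:{0..1}. bump ep (x - b) * \<Psi> x)"
 by (simp add: \<psi>_def left_diff_distrib set_integral_diff(2) cI bump_continuous \<Psi>c)
 ultimately have eq: "(LBINT x:{0..1}. bump ep (x - a) * \<Psi> x) = (LBINT x:{0..1}. bump ep (x - b) * \<Psi> x)" by simp
 let ?N = "integral\<^sup>L lborel (bump ep)"
 have near: "\<bar>(LBINT x:{0..1}. bump ep (x - p) * \<Psi> x) - ?N * \<Psi> p\<bar> <= ?N * \<delta>"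
 if p: "0 < p" "p + ep < 1" and cl: "!!x. 0 <= x ==> x <= 1 ==> \<bar>x - p\<bar> < ep ==> \<bar>\<Psi> x - \<Psi> p\<bar> <= \<delta>" for p
 proof -
 have N: "(LBINT x:{0..1}. bump ep (x - p)) = ?N" by (rule bump_integral(3)[OF ep(1)]) (use p in auto)
 have "(LBINT x:{0..1}. bump ep (x - p) * \<Psi> x) - ?N * \<Psi> p = (LBINT x:{0..1}. bump ep (x - p) * \<Psi> x) - (LBINT x:{0..1}. bump ep (x - p) * \<Psi> p)"
 by (simp add: N)
 also have "\<dots> = (LBINT x:{0..1}. bump ep (x - p) * \<Psi> x - bump ep (x - p) * \<Psi> p)"
 by (rule set_integral_diff(2)[symmetric]) (intro cI bump_continuous \<Psi>c continuous_on_const)+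
 finally have "\<bar>(LBINT x:{0..1}. bump ep (x - p) * \<Psi> x) - ?N * \<Psi> p\<bar> = \<bar>LBINT x:{0..1}. bump ep (x - p) * \<Psi> x - bump ep (x - p) * \<Psi> p\<bar>" by simp
 also have "\<dots> <= (LBINT x:{0..1}. bump ep (x - p) * \<delta>)"
 proof (rule set_integral_abs_le)
 show "set_integrable lborel {0..1} (%x. bump ep (x - p) * \<Psi> x - bump ep (x - p) * \<Psi> p)"
 by (intro set_integral_diff(1) cI bump_continuous \<Psi>c continuous_on_const)
 show "set_integrable lborel {0..1} (%x. bump ep (x - p) * \<delta>)" by (intro cI bump_continuous continuous_on_const)
 show "\<bar>bump ep (x - p) * \<Psi> x - bump ep (x - p) * \<Psi> p\<bar> <= bump ep (x - p) * \<delta>" if x: "x \<in> {0..1}" for x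
 proof (cases "x - p \<in> {0<..<ep}")
 case True
 have "\<bar>bump ep (x - p) * \<Psi> x - bump ep (x - p) * \<Psi> p\<bar> = bump ep (x - p) * \<bar>\<Psi> x - \<Psi> p\<bar>"
 using bump_facts(1)[of ep "x - p"] by (simp add: right_diff_distrib[symmetric] abs_mult)
 also have "\<dots> <= bump ep (x - p) * \<delta>" by (intro mult_left_mono cl bump_facts) (use x True in auto)
 finally show ?thesis .
 qed (simp add: bump_facts(2))
 qed
 finally show ?thesis by (simp add: N)
 qed
 have "\<bar>(LBINT x:{0..1}. bump ep (x - a) * \<Psi> x) - ?N * \<Psi> a\<bar> <= ?N * \<delta>"
 by (rule near) (use e ep ab b1 in auto)
 moreover have "\<bar>(LBINT x:{0..1}. bump ep (x - a) * \<Psi> x) - ?N * \<Psi> b\<bar> <= ?N * \<delta>"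
 unfolding eq by (rule near) (use e ep ab b1 in auto)
 ultimately have "\<bar>?N * \<Psi> a - ?N * \<Psi> b\<bar> <= ?N * \<delta> + ?N * \<delta>" by (auto simp only: abs_le_iff)
 then have "?N * \<bar>\<Psi> a - \<Psi> b\<bar> <= ?N * (2 * \<delta>)"
 using bump_integral(2)[OF ep(1)] by (simp add: right_diff_distrib[symmetric] abs_mult)
 then show ?thesis using bump_integral(2)[OF ep(1)] by simp
 qed
 have lt: "\<Psi> a = \<Psi> b" if ab: "0 < a" "a < b" "b < 1" for a b
 proof (rule ccontr)
 assume "\<Psi> a ~= \<Psi> b"
 then have "0 < \<bar>\<Psi> a - \<Psi> b\<bar> / 4" by simp
 from le[OF ab this] this show False by (simp add: field_simps)
 qed
 have half: "\<Psi> y = \<Psi> (1 / 2)" if "y \<in> {0<..<1}" for y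
 proof -
 consider "y < 1 / 2" | "y = 1 / 2" | "1 / 2 < y" by linarith
 then show ?thesis
 proof cases
 case 1
 show ?thesis by (rule lt) (use 1 that in auto)
 next
 case 3
 show ?thesis by (rule lt[symmetric]) (use 3 that in auto)
 next
 case 2
 show ?thesis unfolding 2 ..
 qed
 qed
 have all: "\<Psi> y = \<Psi> (1 / 2)" if "y \<in> {0..1}" for y
 proof -
 have cl: "closure {0<..<1::real} = {0..1}" by simp
 show ?thesis by (rule continuous_constant_on_closure[of "{0<..<1}", OF \<Psi>c[folded cl] half that[folded cl]])
 qed
 have "V 0 - V 0 = V 0"
 using acV[unfolded ac_on_def, THEN conjunct2, THEN bspec, of 0] unfolding V_def by simp
 then have V0: "V 0 = 0" by simp
 show "g x $ j = g 0 $ j + (LBINT y:{0..x}. g' y $ j)" if "0 <= x" "x <= 1"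
 using all[of x] all[of 0] that V0 by (auto simp: \<Psi>_def V_def[symmetric])
qed

section \<open>Essential suprema and the domain measures in coordinates\<close>

text \<open>\<open>real_of_ereal\<close> sends infinite values to 0, so the essential supremum must
  first be shown finite. On a null space it is minus infinity but the claim is vacuous, hence the
  case distinction.\<close>

lemma ereal_real_of_Linf_norm:
 assumes m: "g \<in> borel_measurable M" and b: "AE x in M. \<bar>g x\<bar> <= B"
 shows "AE x in M. \<bar>g x\<bar> <= Linf_norm M g"
proof (cases "emeasure M (space M) = 0")
 case True
 then show ?thesis by (intro AE_I[of _ _ "space M"]) auto
next
 case False
 have m': "(%x. ereal \<bar>g x\<bar>) \<in> borel_measurable M" using m by measurable
 have u: "esssup M (%x. ereal \<bar>g x\<bar>) <= ereal B" by (rule esssup_I[OF m']) (use b in auto)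
 have "esssup M (%x. 0::ereal) <= esssup M (%x. ereal \<bar>g x\<bar>)" by (rule esssup_mono) auto
 then have l: "0 <= esssup M (%x. ereal \<bar>g x\<bar>)" using esssup_const[OF False, of "0::ereal"] by simp
 have "ereal (Linf_norm M g) = esssup M (%x. ereal \<bar>g x\<bar>)"
 unfolding Linf_norm_def by (rule ereal_real') (use u l in auto)
 then have "AE x in M. ereal \<bar>g x\<bar> <= ereal (Linf_norm M g)" using esssup_AE[where M=M and f="%x. ereal \<bar>g x\<bar>"] by (simp only:)
 then show ?thesis by simp
qed

lemma Linf_norm_le:
 assumes m: "g \<in> borel_measurable M" and b: "AE x in M. \<bar>g x\<bar> <= B" and ne: "emeasure M (space M) ~= 0"
 shows "Linf_norm M g <= B" "0 <= Linf_norm M g"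
proof -
 have m': "(%x. ereal \<bar>g x\<bar>) \<in> borel_measurable M" using m by measurable
 have u: "esssup M (%x. ereal \<bar>g x\<bar>) <= ereal B" by (rule esssup_I[OF m']) (use b in auto)
 have "esssup M (%x. 0::ereal) <= esssup M (%x. ereal \<bar>g x\<bar>)" by (rule esssup_mono) auto
 then have l: "0 <= esssup M (%x. ereal \<bar>g x\<bar>)" using esssup_const[OF ne, of "0::ereal"] by simp
 show "0 <= Linf_norm M g" unfolding Linf_norm_def using l by (simp add: real_of_ereal_pos)
 show "Linf_norm M g <= B" unfolding Linf_norm_def using u l by (cases "esssup M (%x. ereal \<bar>g x\<bar>)") auto
qed

lemma Omega_nonnull: "emeasure Omega (space Omega) ~= 0"
 by (simp add: Omega_def space_restrict_space emeasure_restrict_space)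

lemma AE_Omega: "(AE x in Omega. P x) \<longleftrightarrow> (AE x in lborel. x \<in> {0<..<1} --> P x)"
 unfolding Omega_def by (rule AE_restrict_space_iff) simp

text \<open>A sublevel set consists of those \<open>s\<close> for which the section of one fixed
  planar set is null, and the measure of a section depends measurably on \<open>s\<close>.\<close>

lemma measurable_Linf_norm:
 fixes g :: "real \<times> real => real"
 assumes g[measurable]: "g \<in> borel_measurable borel"
 shows "(%s. Linf_norm Omega (%x. g (s, x))) \<in> borel_measurable borel"
proof -
 have "(%s. esssup Omega (%x. ereal \<bar>g (s, x)\<bar>)) \<in> borel_measurable borel"
 proof (rule borel_measurableI_le)
 fix c :: ereal
 define Q where "Q = {z :: real \<times> real. snd z \<in> {0<..<1} \<and> \<not> ereal \<bar>g z\<bar> <= c}"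
 have Q: "Q \<in> sets (borel \<Otimes>\<^sub>M borel)" unfolding borel_prod Q_def by measurable
 have sec: "(%x. ereal \<bar>g (s, x)\<bar>) \<in> borel_measurable Omega" for s
 unfolding Omega_def using borel_measurable_section(1)[OF g, of s] by (intro measurable_restrict_space1) measurable
 have "esssup Omega (%x. ereal \<bar>g (s, x)\<bar>) <= c \<longleftrightarrow> emeasure lborel (Pair s -` Q) = 0" for s
 proof -
 have "esssup Omega (%x. ereal \<bar>g (s, x)\<bar>) <= c \<longleftrightarrow> (AE x in Omega. ereal \<bar>g (s, x)\<bar> <= c)"
 using esssup_I[OF sec[of s]] esssup_AE[where M=Omega and f="%x. ereal \<bar>g (s, x)\<bar>"]
 by (auto elim!: eventually_mono intro: order_trans)
 also have "\<dots> \<longleftrightarrow> (AE x in lborel. x \<notin> Pair s -` Q)" unfolding AE_Omega by (auto simp: Q_def)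
 also have "\<dots> \<longleftrightarrow> Pair s -` Q \<in> null_sets lborel"
 by (rule AE_iff_null_sets[symmetric]) (use sets_Pair1[OF Q, of s] in simp)
 finally show ?thesis using sets_Pair1[OF Q, of s] by (simp add: null_sets_def)
 qed
 moreover have "(%s. emeasure lborel (Pair s -` Q)) \<in> borel_measurable (borel :: real measure)"
 by (rule lborel.measurable_emeasure_Pair) (use Q in \<open>simp cong: sets_pair_measure_cong\<close>)
 ultimately show "{s \<in> space borel. esssup Omega (%x. ereal \<bar>g (s, x)\<bar>) <= c} \<in> sets borel" by simp
 qed
 then show ?thesis unfolding Linf_norm_def by measurable
qed

lemma vec_nth_measurable[measurable]: "(%x :: real^'n. x $ j) \<in> borel_measurable borel"
 by (rule borel_measurable_continuous_onI) (intro continuous_intros)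

abbreviation box :: "real => (real \<times> real) set" where
 "box T \<equiv> {0<..<T} \<times> {0<..<1}"

lemma box_sets: "box T \<in> sets borel" by (simp add: borel_Times)

text \<open>A single restriction of planar Lebesgue measure replaces the product of two
  restrictions; statements on the cylinder become statements with an indicator.\<close>

lemma QT_eq: "QT T = restrict_space lborel (box T)"
 unfolding QT_def Omega_def
proof (rule pair_measure_eqI)
 let ?A = "{0<..<T}" and ?B = "{0<..<1::real}"
 have sf: "sigma_finite_measure (restrict_space lborel X)" if "X \<in> sets lborel" for X :: "real set"
 by (rule sigma_finite_measure_restrict_space[OF lborel.sigma_finite_measure_axioms that])
 show "sigma_finite_measure (restrict_space lborel ?A)" "sigma_finite_measure (restrict_space lborel ?B)" by (auto intro: sf)
 show "sets (restrict_space lborel ?A \<Otimes>\<^sub>M restrict_space lborel ?B) = sets (restrict_space lborel (?A \<times> ?B))"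
 proof (intro antisym subsetI)
 fix X assume X: "X \<in> sets (restrict_space lborel ?A \<Otimes>\<^sub>M restrict_space lborel ?B)"
 have "(%z. (fst z, snd z)) \<in> measurable (restrict_space lborel (?A \<times> ?B)) (restrict_space lborel ?A \<Otimes>\<^sub>M restrict_space lborel ?B)"
 by (intro measurable_Pair measurable_restrict_space2) (auto simp: space_restrict_space intro!: measurable_restrict_space1)
 from measurable_sets[OF this X] sets.sets_into_space[OF X] show "X \<in> sets (restrict_space lborel (?A \<times> ?B))"
 by (auto simp: vimage_def space_restrict_space space_pair_measure) (metis (no_types, lifting) Collect_mem_eq Int_absorb2 Int_commute)
 next
 fix X assume X: "X \<in> sets (restrict_space lborel (?A \<times> ?B))"
 then obtain Y where Y: "Y \<in> sets borel" "X = (?A \<times> ?B) \<inter> Y" by (auto simp: sets_restrict_space)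
 have "(%z. (fst z, snd z)) \<in> measurable (restrict_space lborel ?A \<Otimes>\<^sub>M restrict_space lborel ?B) (borel \<Otimes>\<^sub>M borel)"
 by (intro measurable_Pair measurable_compose[OF measurable_fst] measurable_compose[OF measurable_snd] measurable_restrict_space1) auto
 then have "(%z. z) \<in> borel_measurable (restrict_space lborel ?A \<Otimes>\<^sub>M restrict_space lborel ?B)" by (simp add: borel_prod)
 from measurable_sets[OF this Y(1)] show "X \<in> sets (restrict_space lborel ?A \<Otimes>\<^sub>M restrict_space lborel ?B)"
 by (simp add: Y(2) space_pair_measure space_restrict_space Int_commute)
 qed
next
 fix A B assume AB: "A \<in> sets (restrict_space lborel {0<..<T})" "B \<in> sets (restrict_space lborel {0<..<1::real})"
 then have s: "A \<in> sets lborel" "B \<in> sets lborel" "A \<subseteq> {0<..<T}" "B \<subseteq> {0<..<1}"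
 by (auto simp: sets_restrict_space)
 have "emeasure lborel A * emeasure lborel B = emeasure lborel (A \<times> B)"
 using lborel.emeasure_pair_measure_Times[OF s(1), of B] s(2) by (simp add: lborel_prod)
 then show "emeasure (restrict_space lborel {0<..<T}) A * emeasure (restrict_space lborel {0<..<1}) B = emeasure (restrict_space lborel (box T)) (A \<times> B)"
 using s by (subst (1 2 3) emeasure_restrict_space) (auto simp: borel_Times)
qed

lemma borel_measurable_QT_iff:
 fixes f :: "real \<times> real => real"
 shows "f \<in> borel_measurable (QT T) \<longleftrightarrow> (%z. indicat_real (box T) z * f z) \<in> borel_measurable borel"
 unfolding QT_eq using box_sets[of T] by (subst borel_measurable_restrict_space_iff) auto

lemma integrable_QT_iff:
 fixes f :: "real \<times> real => real"
 shows "integrable (QT T) f \<longleftrightarrow> integrable lborel (%z. indicat_real (box T) z * f z)"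
 unfolding QT_eq using box_sets[of T] by (subst integrable_restrict_space) auto

lemma AE_QT: "(AE z in QT T. P z) \<longleftrightarrow> (AE z in lborel. z \<in> box T --> P z)"
 unfolding QT_eq by (rule AE_restrict_space_iff) (use box_sets[of T] in simp)

lemma integrable_QT_component:
 fixes f :: "real \<times> real => real^'n"
 shows "integrable (QT T) f ==> integrable lborel (%z. indicat_real (box T) z * f z $ j)"
 using integrable_bounded_linear[OF bounded_linear_vec_nth[of j], of "QT T" f] by (simp add: integrable_QT_iff)

lemma AE_timeT: "(AE t in timeT T. P t) \<longleftrightarrow> (AE t in lborel. t \<in> {0..T} --> P t)"
 unfolding timeT_def by (rule AE_restrict_space_iff) simp

lemma pair_sigma_finite_GammaT: "pair_sigma_finite (timeT T) (count_space {0, 1::real})"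
 unfolding pair_sigma_finite_def timeT_def
 by (auto intro!: sigma_finite_measure_restrict_space[OF lborel.sigma_finite_measure_axioms] sigma_finite_measure_count_space_finite)

lemma measurable_GammaT_section:
 assumes "f \<in> measurable (GammaT T) N" "\<omega> = 0 \<or> \<omega> = 1"
 shows "(%t. f (t, \<omega>)) \<in> measurable (timeT T) N"
 by (rule measurable_compose[OF _ assms(1)]) (use assms(2) in \<open>auto simp: GammaT_def intro!: measurable_Pair\<close>)

lemma measurable_GammaT:
 assumes "(%t. f (t, 0)) \<in> measurable (timeT T) N" "(%t. f (t, 1)) \<in> measurable (timeT T) N"
 shows "f \<in> measurable (GammaT T) N"
proof -
 have "(%(x, y). f (y, x)) \<in> measurable (count_space {0, 1} \<Otimes>\<^sub>M timeT T) N"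
 by (rule measurable_pair_measure_countable1) (use assms in auto)
 then show ?thesis unfolding GammaT_def by (subst measurable_pair_swap_iff) simp
qed

lemma AE_GammaT: "(AE z in GammaT T. P z) \<longleftrightarrow> (AE t in lborel. t \<in> {0..T} --> P (t, 0) \<and> P (t, 1))"
proof -
 interpret pair_sigma_finite "timeT T" "count_space {0, 1::real}" by (rule pair_sigma_finite_GammaT)
 have "(AE z in GammaT T. P z) \<longleftrightarrow> (AE t in timeT T. P (t, 0) \<and> P (t, 1))"
 proof
 assume "AE z in GammaT T. P z"
 then have "AE t in timeT T. AE \<omega> in count_space {0, 1}. P (t, \<omega>)" unfolding GammaT_def by (rule AE_pair)
 then show "AE t in timeT T. P (t, 0) \<and> P (t, 1)" by (simp add: AE_count_space)
 next
 assume "AE t in timeT T. P (t, 0) \<and> P (t, 1)"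
 then obtain N where N: "{t \<in> space (timeT T). \<not> (P (t, 0) \<and> P (t, 1))} \<subseteq> N" "emeasure (timeT T) N = 0" "N \<in> sets (timeT T)" by (rule AE_E)
 show "AE z in GammaT T. P z"
 proof (rule AE_I)
 show "{z \<in> space (GammaT T). \<not> P z} \<subseteq> N \<times> {0, 1}" using N(1) by (auto simp: GammaT_def space_pair_measure)
 show "emeasure (GammaT T) (N \<times> {0, 1}) = 0" using N(2,3)
 by (simp add: GammaT_def M2.emeasure_pair_measure_Times)
 show "N \<times> {0, 1} \<in> sets (GammaT T)" using N(3) by (simp add: GammaT_def)
 qed
 qed
 then show ?thesis unfolding AE_timeT .
qed

lemma borel_measurable_timeT_iff:
 fixes f :: "real => real"
 shows "f \<in> borel_measurable (timeT T) \<longleftrightarrow> zext T f \<in> borel_measurable borel"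
 unfolding timeT_def zext_def[abs_def] by (subst borel_measurable_restrict_space_iff) auto

text \<open>\<open>F0\<close> and \<open>F1\<close> agree with \<open>f\<close> only almost
  everywhere, so the representatives of trace and velocity chosen for the scalar law may stand in
  for the given ones.\<close>

lemma integral_GammaT:
 fixes f :: "real \<times> real => real"
 assumes m: "f \<in> borel_measurable (GammaT T)"
 and F: "integrable lborel F0" "integrable lborel F1"
 and ae: "AE t in lborel. t \<in> {0..T} --> f (t, 0) = F0 t \<and> f (t, 1) = F1 t"
 shows "integrable (GammaT T) f" "(\<integral>z. f z \<partial>GammaT T) = (LBINT t:{0..T}. F0 t + F1 t)"
proof -
 interpret pair_sigma_finite "timeT T" "count_space {0, 1::real}" by (rule pair_sigma_finite_GammaT)
 have ms: "(%t. f (t, 0)) \<in> borel_measurable (timeT T)" "(%t. f (t, 1)) \<in> borel_measurable (timeT T)"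
 by (rule measurable_GammaT_section[OF m], simp)+
 have Fi: "integrable (timeT T) F0" "integrable (timeT T) F1"
 using set_integrable_of_integrable[OF F(1), of "{0..T}"] set_integrable_of_integrable[OF F(2), of "{0..T}"]
 by (simp_all add: timeT_def integrable_restrict_space set_integrable_def)
 have ae': "AE t in timeT T. F0 t = f (t, 0)" "AE t in timeT T. F1 t = f (t, 1)"
 unfolding AE_timeT using ae by (eventually_elim, simp)+
 have fi: "integrable (timeT T) (%t. f (t, 0))" "integrable (timeT T) (%t. f (t, 1))"
 using integrable_cong_AE_imp[OF Fi(1) ms(1)] integrable_cong_AE_imp[OF Fi(2) ms(2)] ae' by (auto elim!: eventually_mono)
 show i: "integrable (GammaT T) f" unfolding GammaT_def
 proof (rule Fubini_integrable)
 show "f \<in> borel_measurable (timeT T \<Otimes>\<^sub>M count_space {0, 1})" using m by (simp add: GammaT_def)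
 show "integrable (timeT T) (%x. \<integral>y. norm (f (x, y)) \<partial>count_space {0, 1})"
 using fi by (simp add: lebesgue_integral_count_space_finite)
 qed (simp add: integrable_count_space)
 have "(\<integral>z. f z \<partial>GammaT T) = (\<integral>t. \<integral>\<omega>. f (t, \<omega>) \<partial>count_space {0, 1} \<partial>timeT T)"
 using i unfolding GammaT_def by (rule integral_fst'[symmetric])
 also have "\<dots> = (\<integral>t. f (t, 0) + f (t, 1) \<partial>timeT T)" by (simp add: lebesgue_integral_count_space_finite)
 also have "\<dots> = (\<integral>t. F0 t + F1 t \<partial>timeT T)"
 using ae' fi Fi by (intro integral_cong_AE) auto
 also have "\<dots> = (LBINT t:{0..T}. F0 t + F1 t)"
 by (simp add: timeT_def integral_restrict_space set_lebesgue_integral_def)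
 finally show "(\<integral>z. f z \<partial>GammaT T) = (LBINT t:{0..T}. F0 t + F1 t)" .
qed

lemma Linf_norm_le_vec: "Linf_norm M (%x. g x $ j) <= Linf_norm_vec M g"
 unfolding Linf_norm_vec_def by (rule Max_ge) auto

lemma AE_le_Linf_norm_vec:
 assumes "g \<in> Linf (%_. M)"
 shows "AE x in M. \<bar>g x $ j\<bar> <= Linf_norm_vec M g"
proof -
 from assms obtain C where m: "(%x. g x $ j) \<in> borel_measurable M" and b: "AE x in M. \<bar>g x $ j\<bar> <= C" by (auto simp: Linf_def)
 from ereal_real_of_Linf_norm[OF m b] show ?thesis by eventually_elim (use Linf_norm_le_vec[of M g j] in linarith)
qed

lemma L1_Linf_integrable:
 assumes "L1_Linf T f"
 shows "integrable lborel (%z. indicat_real (box T) z * f z $ j)"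
proof -
 define F where "F z = indicat_real (box T) z * f z $ j" for z
 define N where "N t = Linf_norm_vec Omega (%x. f (t, x))" for t
 have fm: "f \<in> borel_measurable (QT T)" and fL: "AE t in timeT T. (%x. f (t, x)) \<in> Linf (%_. Omega)" and Ni: "integrable (timeT T) N"
 using assms by (auto simp: L1_Linf_def N_def[abs_def])
 have Fm: "F \<in> borel_measurable borel" unfolding F_def[abs_def] borel_measurable_QT_iff[symmetric] using fm by measurable
 have ae: "AE t in lborel. AE x in lborel. norm (F (t, x)) <= norm (zext T N t * indicat_real {0<..<1} x)"
 using fL unfolding AE_timeT
 proof eventually_elim
 case (elim t)
 show ?case
 proof (cases "t \<in> {0<..<T}")
 case True
 with elim have "AE x in Omega. \<bar>f (t, x) $ j\<bar> <= N t" unfolding N_def by (intro AE_le_Linf_norm_vec) auto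
 then show ?thesis unfolding AE_Omega by eventually_elim (use True in \<open>auto simp: F_def zext_def indicator_def\<close>)
 qed (auto simp: F_def)
 qed
 have zN: "integrable lborel (zext T N)" using Ni by (simp add: timeT_def integrable_restrict_space zext_def[abs_def])
 have "integrable lborel F"
 proof (rule L_integrable_bound[OF integrable_fst_box[OF zN]])
 show "F \<in> borel_measurable lborel" using Fm by simp
 have [measurable]: "zext T N \<in> borel_measurable borel" using zN by auto
 have "{z \<in> space (lborel \<Otimes>\<^sub>M lborel). norm (F z) <= norm (zext T N (fst z) * indicat_real {0<..<1} (snd z))} \<in> sets (lborel \<Otimes>\<^sub>M lborel)"
 using Fm unfolding lborel_prod by measurable
 from lborel_pair.AE_pair_measure[OF this] ae
 show "AE z in lborel. norm (F z) <= norm (zext T N (fst z) * indicat_real {0<..<1} (snd z))" unfolding lborel_prod by simp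
 qed
 then show ?thesis by (simp add: F_def[abs_def])
qed

lemma diag_mult_nth: "(diag v *v x) $ i = v $ i * x $ i"
 by (simp add: diag_def matrix_vector_mult_def if_distrib[of "%a. a * _"] cong: if_cong)

text \<open>Turns an almost everywhere bound into one that holds everywhere, as
  \<open>balance_law\<close> demands, and changes only values that violate the bound.\<close>

definition clamp :: "real => real => real" where "clamp C y = max (- C) (min C y)"

lemma clamp_facts: "0 <= C ==> \<bar>clamp C y\<bar> <= C" "\<bar>y\<bar> <= C ==> clamp C y = y"
 by (auto simp: clamp_def)

lemma clamp_measurable[measurable]: "clamp C \<in> borel_measurable borel"
 unfolding clamp_def[abs_def] by measurable

text \<open>The integrability of \<open>u0\<close> is the trace inequality: a boundary value is at
  most the mean of the modulus over the unit interval plus the total variation in \<open>x\<close>,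
  and both are integrable in time.\<close>

lemma W11_velocity:
 fixes u ux :: "real \<times> real => real^'n" and j :: 'n
 assumes T: "0 < T" and u: "L1_W11 T u ux"
 defines "d \<equiv> (%z. indicat_real (box T) z * ux z $ j)" and "u0 \<equiv> zext T (%t. u (t, 0) $ j)"
 shows "integrable lborel d" "integrable lborel u0"
 and "AE t in lborel. t \<in> {0..T} --> (\<forall>x\<in>{0..1}. u (t, x) $ j = vel u0 d t x)"
proof -
 have ui: "integrable (QT T) u" "integrable (QT T) ux" and um: "u \<in> borel_measurable (GammaT T)"
 and W: "AE t in timeT T. W11 (%x. u (t, x)) (%x. ux (t, x))" using u by (auto simp: L1_W11_def)
 show d: "integrable lborel d" unfolding d_def by (rule integrable_QT_component[OF ui(2)])
 have dm: "d \<in> borel_measurable borel" using d by auto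
 show rep: "AE t in lborel. t \<in> {0..T} --> (\<forall>x\<in>{0..1}. u (t, x) $ j = vel u0 d t x)"
 using W[unfolded AE_timeT] AE_lborel_singleton[of "0::real"] AE_lborel_singleton[of T]
 proof eventually_elim
 case (elim t)
 show ?case
 proof (intro impI ballI)
 fix x :: real assume t: "t \<in> {0..T}" and x: "x \<in> {0..1}"
 then have tT: "t \<in> {0<..<T}" using elim by auto
 have W: "W11 (%x. u (t, x)) (%x. ux (t, x))" using elim t by simp
 have "(LBINT y:{0..x}. ux (t, y) $ j) = (LBINT y:{0..x}. d (t, y))"
 unfolding set_lebesgue_integral_def
 proof (rule integral_cong_AE)
 have "set_integrable lborel {0..x} (%y. ux (t, y) $ j)"
 by (rule set_integrable_subset[OF W11_representation(1)[OF W]]) (use x in auto)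
 then show "(%y. indicat_real {0..x} y *\<^sub>R ux (t, y) $ j) \<in> borel_measurable lborel" by (simp add: set_integrable_def)
 show "(%y. indicat_real {0..x} y *\<^sub>R d (t, y)) \<in> borel_measurable lborel"
 using borel_measurable_section(1)[OF dm, of t] by measurable
 show "AE y in lborel. indicat_real {0..x} y *\<^sub>R ux (t, y) $ j = indicat_real {0..x} y *\<^sub>R d (t, y)"
 using AE_lborel_singleton[of "0::real"] AE_lborel_singleton[of "1::real"]
 by eventually_elim (use x tT in \<open>auto simp: d_def indicator_def\<close>)
 qed
 then show "u (t, x) $ j = vel u0 d t x"
 using W11_representation(2)[OF W, of x j] x t by (simp add: vel_def u0_def zext_simps)
 qed
 qed
 have u0m: "u0 \<in> borel_measurable borel"
 unfolding u0_def borel_measurable_timeT_iff[symmetric] using measurable_GammaT_section[OF um, of 0] by measurable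
 define U where "U z = indicat_real (box T) z * u z $ j" for z
 have U: "integrable lborel U" unfolding U_def[abs_def] by (rule integrable_QT_component[OF ui(1)])
 show "integrable lborel u0"
 proof (rule L_integrable_bound)
 show "integrable lborel (%t. (LBINT x. \<bar>U (t, x)\<bar>) + (LBINT x. \<bar>d (t, x)\<bar>))"
 by (intro L_integrable_add integrable_lborel_pair(3)[of "%z. \<bar>U z\<bar>"] integrable_lborel_pair(3)[of "%z. \<bar>d z\<bar>"] integrable_abs U d)
 show "u0 \<in> borel_measurable lborel" using u0m by simp
 show "AE t in lborel. norm (u0 t) <= norm ((LBINT x. \<bar>U (t, x)\<bar>) + (LBINT x. \<bar>d (t, x)\<bar>))"
 using rep integrable_lborel_pair(1)[OF U] integrable_lborel_pair(1)[OF d] AE_lborel_singleton[of "0::real"] AE_lborel_singleton[of T]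
 proof eventually_elim
 case (elim t)
 let ?D = "\<integral>x. \<bar>d (t, x)\<bar> \<partial>lborel"
 have nn: "0 <= (LBINT x. \<bar>U (t, x)\<bar>)" "0 <= ?D" by (auto intro: L_integral_nonneg)
 have "\<bar>u0 t\<bar> <= (LBINT x. \<bar>U (t, x)\<bar>) + ?D"
 proof (cases "t \<in> {0..T}")
 case True
 then have tT: "t \<in> {0<..<T}" using elim by auto
 have m1: "measure lborel {0<..<1::real} = 1" by (simp add: measure_def)
 have "\<bar>u0 t\<bar> = (LBINT x. indicat_real {0<..<1::real} x * \<bar>u0 t\<bar>)" by (simp add: m1)
 also have "\<dots> <= (LBINT x. \<bar>U (t, x)\<bar> + indicat_real {0<..<1} x * ?D)"
 proof (rule integral_mono)
 fix x
 show "indicat_real {0<..<1} x * \<bar>u0 t\<bar> <= \<bar>U (t, x)\<bar> + indicat_real {0<..<1} x * ?D"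
 proof (cases "x \<in> {0<..<1}")
 case x: True
 then have "U (t, x) = u0 t + (LBINT y:{0..x}. d (t, y))" using elim(1) True tT by (auto simp: U_def vel_def)
 moreover have "\<bar>LBINT y:{0..x}. d (t, y)\<bar> <= ?D"
 using set_integral_abs_le_integral[OF elim(3), of "{0..x}"] set_integral_abs_le[OF set_integrable_of_integrable[OF elim(3)] set_integrable_of_integrable[OF integrable_abs[OF elim(3)]], of "{0..x}"]
 by force
 ultimately show ?thesis using x by simp
 qed simp
 qed (use elim in auto)
 also have "\<dots> = (LBINT x. \<bar>U (t, x)\<bar>) + ?D" using elim by (subst L_integral_add) (auto simp: m1)
 finally show ?thesis .
 qed (use nn in \<open>simp add: u0_def zext_simps\<close>)
 then show ?case using nn by simp
 qed
 qed
qed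

text \<open>The part of the slice at \<open>t\<close> that exceeds \<open>B\<close> has an integral
  of at most the L1 distance to almost every other slice, and this distance tends to 0. Thus a bound
  valid almost everywhere in the cylinder reaches every single time.\<close>

lemma C_Lp_bounded:
 fixes \<rho> :: "real \<times> real => real^'n"
 assumes T: "0 < T" and C: "C_Lp T 1 \<rho>" and b: "AE z in QT T. \<bar>\<rho> z $ j\<bar> <= B" and t: "t \<in> {0..T}"
 shows "AE x in Omega. \<bar>\<rho> (t, x) $ j\<bar> <= B"
proof -
 have m: "(%x. \<rho> (s, x)) \<in> borel_measurable Omega" and i: "integrable Omega (%x. norm (\<rho> (s, x)))" if "s \<in> {0..T}" for s
 using C that by (auto simp: C_Lp_def)
 have lim: "((%s. \<integral>x. norm (\<rho> (s, x) - \<rho> (t, x)) \<partial>Omega) \<longlongrightarrow> 0) (at t within {0..T})"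
 using C t by (auto simp: C_Lp_def)
 define P where "P = (\<integral>x. max 0 (\<bar>\<rho> (t, x) $ j\<bar> - B) \<partial>Omega)"
 have Pi: "integrable Omega (%x. max 0 (\<bar>\<rho> (t, x) $ j\<bar> - B))"
 proof (rule L_integrable_bound)
 have "finite_measure Omega"
 by (rule finite_measureI) (simp add: Omega_def space_restrict_space emeasure_restrict_space)
 then show "integrable Omega (%x. norm (\<rho> (t, x)) + \<bar>B\<bar>)" using i[OF t] by (simp add: finite_measure.integrable_const)
 show "(%x. max 0 (\<bar>\<rho> (t, x) $ j\<bar> - B)) \<in> borel_measurable Omega" using m[OF t] by measurable
 show "AE x in Omega. norm (max 0 (\<bar>\<rho> (t, x) $ j\<bar> - B)) <= norm (norm (\<rho> (t, x)) + \<bar>B\<bar>)"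
 using component_le_norm_cart[of "\<rho> (t, _)" j] by (intro AE_I2) (smt (verit) component_le_norm_cart norm_ge_zero real_norm_def)
 qed
 have "AE s in lborel. AE x in lborel. (s, x) \<in> box T --> \<bar>\<rho> (s, x) $ j\<bar> <= B"
 using AE_lborel_pair[OF b[unfolded AE_QT]] .
 then have le: "AE s in lborel. s \<in> {0<..<T} --> P <= (\<integral>x. norm (\<rho> (s, x) - \<rho> (t, x)) \<partial>Omega)"
 proof eventually_elim
 case (elim s)
 show ?case
 proof
 assume s: "s \<in> {0<..<T}"
 then have s': "s \<in> {0..T}" by auto
 have ae: "AE x in Omega. \<bar>\<rho> (s, x) $ j\<bar> <= B" unfolding AE_Omega using elim by eventually_elim (use s in auto)
 show "P <= (\<integral>x. norm (\<rho> (s, x) - \<rho> (t, x)) \<partial>Omega)" unfolding P_def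
 proof (rule integral_mono_AE[OF Pi])
 show "integrable Omega (%x. norm (\<rho> (s, x) - \<rho> (t, x)))"
 proof (rule L_integrable_bound)
 show "integrable Omega (%x. norm (\<rho> (s, x)) + norm (\<rho> (t, x)))" using i[OF t] i[OF s'] by simp
 show "(%x. norm (\<rho> (s, x) - \<rho> (t, x))) \<in> borel_measurable Omega" using m[OF t] m[OF s'] by measurable
 show "AE x in Omega. norm (norm (\<rho> (s, x) - \<rho> (t, x))) <= norm (norm (\<rho> (s, x)) + norm (\<rho> (t, x)))"
 by (intro AE_I2) (simp add: norm_triangle_ineq4)
 qed
 show "AE x in Omega. max 0 (\<bar>\<rho> (t, x) $ j\<bar> - B) <= norm (\<rho> (s, x) - \<rho> (t, x))"
 using ae
 proof eventually_elim
 case (elim x)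
 have "\<bar>(\<rho> (s, x) - \<rho> (t, x)) $ j\<bar> <= norm (\<rho> (s, x) - \<rho> (t, x))" by (rule component_le_norm_cart)
 then have "\<bar>\<rho> (t, x) $ j\<bar> - B <= norm (\<rho> (s, x) - \<rho> (t, x))" using elim unfolding vector_minus_component by linarith
 then show ?case by (intro max.boundedI) auto
 qed
 qed
 qed
 qed
 have "P <= 0"
 proof (rule ccontr)
 assume "\<not> P <= 0"
 then have "eventually (%s. (\<integral>x. norm (\<rho> (s, x) - \<rho> (t, x)) \<partial>Omega) < P) (at t within {0..T})"
 by (intro order_tendstoD(2)[OF lim]) simp
 then obtain e where e: "0 < e" "!!s. s \<in> {0..T} ==> s ~= t ==> dist s t < e ==> (\<integral>x. norm (\<rho> (s, x) - \<rho> (t, x)) \<partial>Omega) < P"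
 by (auto simp: eventually_at)
 \<comment> \<open>A one-sided neighbourhood is enough: to the right of \<open>t\<close>, or to the
   left when \<open>t\<close> is the final time.\<close>
 obtain a b where ab: "a < b" "!!s. a < s ==> s < b ==> s \<in> {0<..<T} \<and> s ~= t \<and> dist s t < e"
 proof (cases "t < T")
 case True
 show ?thesis by (rule that[of t "min T (t + e)"]) (use True e t in \<open>auto simp: dist_real_def\<close>)
 next
 case False
 show ?thesis by (rule that[of "max 0 (t - e)" t]) (use False T e t in \<open>auto simp: dist_real_def\<close>)
 qed
 from AE_imp_ex_between[OF le ab(1)] obtain s where "a < s" "s < b" "s \<in> {0<..<T} --> P <= (\<integral>x. norm (\<rho> (s, x) - \<rho> (t, x)) \<partial>Omega)" by blast
 with ab(2)[of s] e(2)[of s] show False by auto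
 qed
 moreover have "0 <= P" unfolding P_def by (intro L_integral_nonneg) simp
 ultimately have "P = 0" by simp
 then have "AE x in Omega. max 0 (\<bar>\<rho> (t, x) $ j\<bar> - B) = 0"
 using integral_nonneg_eq_0_iff_AE[OF Pi] by (simp add: P_def)
 then show ?thesis by eventually_elim (auto simp: max_def split: if_splits)
qed

lemma vpos_vneg_nth: "vpos v $ j = max (v $ j) 0" "vneg v $ j = max (- (v $ j)) 0"
 by (simp_all add: vpos_def vneg_def sup_vec_def sup_real_def)

lemma nuu_nth: "nuu u (t, 0) $ j = - (u (t, 0) $ j)" "nuu u (t, 1) $ j = u (t, 1) $ j"
 by (simp_all add: nuu_def nu_def)

lemma nuu_measurable:
 fixes u :: "real \<times> real => real^'n"
 assumes "u \<in> borel_measurable (GammaT T)"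
 shows "(%z. nuu u z $ j) \<in> borel_measurable (GammaT T)"
proof -
 have "(%z. nu (snd z)) \<in> borel_measurable (GammaT T)"
 by (rule measurable_GammaT) (simp_all add: nu_def)
 with assms show ?thesis by (simp add: nuu_def)
qed

text \<open>A measure with a density sees exactly the points where the density is positive, so each
  family reduces to a condition on the sign of \<open>u\<close>; at the end 0 the normal reverses
  that sign.\<close>

lemma AE_mu:
 fixes u :: "real \<times> real => real^'n"
 assumes um: "u \<in> borel_measurable (GammaT T)"
 shows "(AE z in mu_abs T u j. P z) \<longleftrightarrow>
 (AE t in lborel. t \<in> {0..T} --> (u (t, 0) $ j ~= 0 --> P (t, 0)) \<and> (u (t, 1) $ j ~= 0 --> P (t, 1)))"
 and "(AE z in mu_neg T u j. P z) \<longleftrightarrow>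
 (AE t in lborel. t \<in> {0..T} --> (0 < u (t, 0) $ j --> P (t, 0)) \<and> (u (t, 1) $ j < 0 --> P (t, 1)))"
 and "(AE z in mu_pos T u j. P z) \<longleftrightarrow>
 (AE t in lborel. t \<in> {0..T} --> (u (t, 0) $ j < 0 --> P (t, 0)) \<and> (0 < u (t, 1) $ j --> P (t, 1)))"
proof -
 note m[measurable] = nuu_measurable[OF um]
 have max_pos: "0 < max a (0::real) \<longleftrightarrow> 0 < a" and abs_pos: "0 < max a 0 + max (- a) (0::real) \<longleftrightarrow> a ~= 0" for a
 by (auto simp: max_def)
 have 1: "(%z. ennreal ((vpos (nuu u z) + vneg (nuu u z)) $ j)) \<in> borel_measurable (GammaT T)"
 "(%z. ennreal (vpos (nuu u z) $ j)) \<in> borel_measurable (GammaT T)" "(%z. ennreal (vneg (nuu u z) $ j)) \<in> borel_measurable (GammaT T)"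
 unfolding vector_add_component vpos_vneg_nth by measurable
 show "(AE z in mu_abs T u j. P z) \<longleftrightarrow>
 (AE t in lborel. t \<in> {0..T} --> (u (t, 0) $ j ~= 0 --> P (t, 0)) \<and> (u (t, 1) $ j ~= 0 --> P (t, 1)))"
 unfolding mu_abs_def unfolding AE_density[OF 1(1)] unfolding AE_GammaT ennreal_less_zero_iff vector_add_component vpos_vneg_nth
 unfolding abs_pos nuu_nth by (simp only: neg_equal_0_iff_equal)
 show "(AE z in mu_neg T u j. P z) \<longleftrightarrow>
 (AE t in lborel. t \<in> {0..T} --> (0 < u (t, 0) $ j --> P (t, 0)) \<and> (u (t, 1) $ j < 0 --> P (t, 1)))"
 unfolding mu_neg_def unfolding AE_density[OF 1(3)] unfolding AE_GammaT ennreal_less_zero_iff vpos_vneg_nth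
 unfolding max_pos nuu_nth by (simp only: minus_minus neg_0_less_iff_less)
 show "(AE z in mu_pos T u j. P z) \<longleftrightarrow>
 (AE t in lborel. t \<in> {0..T} --> (u (t, 0) $ j < 0 --> P (t, 0)) \<and> (0 < u (t, 1) $ j --> P (t, 1)))"
 unfolding mu_pos_def unfolding AE_density[OF 1(2)] unfolding AE_GammaT ennreal_less_zero_iff vpos_vneg_nth
 unfolding max_pos nuu_nth by (simp only: neg_0_less_iff_less)
qed

lemma measurable_mu:
 "borel_measurable (mu_abs T u j) = borel_measurable (GammaT T)"
 "borel_measurable (mu_neg T u j) = borel_measurable (GammaT T)"
 "borel_measurable (mu_pos T u j) = borel_measurable (GammaT T)"
 unfolding mu_abs_def mu_neg_def mu_pos_def by (rule measurable_cong_sets; simp)+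

section \<open>From the weak solution to a scalar balance law\<close>

lemma C01_axis:
 assumes tt: "lip_test tt tt'"
 shows "C01 T (%z. tt (snd z) *\<^sub>R axis j (1::real))"
proof -
 obtain L where L: "L-lipschitz_on {0..1} tt" using tt unfolding lip_test_def by blast
 have "L-lipschitz_on ({0..T} \<times> {0..1}) (%z. tt (snd z) *\<^sub>R axis j (1::real))"
 proof (rule lipschitz_onI)
 fix y z :: "real \<times> real" assume yz: "y \<in> {0..T} \<times> {0..1}" "z \<in> {0..T} \<times> {0..1}"
 have "dist (tt (snd y) *\<^sub>R axis j (1::real)) (tt (snd z) *\<^sub>R axis j 1) = dist (tt (snd y)) (tt (snd z))"
 by (simp add: dist_norm scaleR_left_diff_distrib[symmetric] norm_axis_1)
 also have "\<dots> <= L * dist (snd y) (snd z)" using yz by (intro lipschitz_onD[OF L]) auto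
 also have "\<dots> <= L * dist y z" by (intro mult_left_mono dist_snd_le lipschitz_on_nonneg[OF L])
 finally show "dist (tt (snd y) *\<^sub>R axis j (1::real)) (tt (snd z) *\<^sub>R axis j 1) <= L * dist y z" .
 qed (rule lipschitz_on_nonneg[OF L])
 then show ?thesis unfolding C01_def by blast
qed

text \<open>The law itself is the trace formula on [0, t] for a test function of \<open>x\<close> in
  the \<open>j\<close>-th coordinate. The work lies in choosing representatives that are measurable
  in the plane, bounded everywhere and correct on every time slice.\<close>

lemma component_balance:
 fixes u ux c f \<rho> \<gamma> :: "real \<times> real => real^'n" and j :: 'n
 assumes T: "0 < T" and u: "L1_W11 T u ux" and c: "integrable (QT T) c" and f: "L1_Linf T f"
 and sol: "weak_solution T u c f \<rho>" and cont: "C_Lp T 1 \<rho>" and tr: "is_trace T u c f \<rho> \<gamma>"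
 obtains C w d h u0 g0 g1 where "balance_law T C w d h u0 g0 g1"
 and "!!t. t \<in> {0..T} ==> AE x in lborel. x \<in> {0<..<1} --> w (t, x) = \<rho> (t, x) $ j"
 and "!!z. z \<in> box T ==> d z = ux z $ j"
 and "!!z. z \<in> box T ==> h z = f z $ j - c z $ j * w z"
 and "AE t in lborel. t \<in> {0..T} --> u0 t = u (t, 0) $ j \<and> vel u0 d t 1 = u (t, 1) $ j"
 and "AE t in lborel. t \<in> {0..T} --> (u (t, 0) $ j ~= 0 --> g0 t = \<gamma> (t, 0) $ j) \<and> (u (t, 1) $ j ~= 0 --> g1 t = \<gamma> (t, 1) $ j)"
proof -
 note box_sets[measurable]
 have um: "u \<in> borel_measurable (GammaT T)" and uQ: "integrable (QT T) u" using u by (auto simp: L1_W11_def)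
 have fm: "f \<in> borel_measurable (QT T)" using f by (auto simp: L1_Linf_def)
 obtain C1 where \<rho>m: "!!i. (%z. \<rho> z $ i) \<in> borel_measurable (QT T)" and C1: "AE z in QT T. \<bar>\<rho> z $ j\<bar> <= C1"
 using sol unfolding weak_solution_def Linf_def by blast
 obtain C2 where \<gamma>m: "!!i. (%z. \<gamma> z $ i) \<in> borel_measurable (GammaT T)" and C2: "AE z in mu_abs T u j. \<bar>\<gamma> z $ j\<bar> <= C2"
 using tr unfolding is_trace_def Linf_def measurable_mu by blast
 define C where "C = max 0 (max C1 C2)"
 have C: "0 <= C" "C1 <= C" "C2 <= C" by (auto simp: C_def)
 define d where "d = (%z. indicat_real (box T) z * ux z $ j)"
 define u0 where "u0 = zext T (%t. u (t, 0) $ j)"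
 note v = W11_velocity[OF T u, of j, folded d_def u0_def]
 define S where "S t x = indicat_real {0<..<1} x * \<rho> (t, x) $ j" for t x
 have Sm: "S t \<in> borel_measurable borel" if "t \<in> {0..T}" for t
 proof -
 have "(%x. \<rho> (t, x)) \<in> borel_measurable Omega" using cont that by (auto simp: C_Lp_def)
 then have "(%x. \<rho> (t, x) $ j) \<in> borel_measurable Omega" by measurable
 then show ?thesis unfolding Omega_def S_def[abs_def] by (subst (asm) borel_measurable_restrict_space_iff) auto
 qed
 \<comment> \<open>The space-time class is known to be measurable on the open box only, while the
   slices at 0 and \<open>T\<close> matter too. These two are added by hand; the clamp below then
   makes the bound hold everywhere.\<close>
 define R where "R z = indicat_real (box T) z * \<rho> z $ j + indicat_real {0} (fst z) * S 0 (snd z) + indicat_real {T} (fst z) * S T (snd z)" for z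
 define w where "w z = clamp C (R z)" for z
 have R_eq: "R (t, x) = S t x" if "t \<in> {0..T}" for t x
 using that T by (auto simp: R_def S_def indicator_def)
 have R_0: "R (t, x) = 0" if "\<not> (0 < x \<and> x < 1 \<and> 0 <= t \<and> t <= T)" for t x
 using that T by (auto simp: R_def S_def indicator_def)
 have [measurable]: "(%z. indicat_real (box T) z * \<rho> z $ j) \<in> borel_measurable borel" using \<rho>m[of j] by (simp add: borel_measurable_QT_iff)
 have [measurable]: "S 0 \<in> borel_measurable borel" "S T \<in> borel_measurable borel" using Sm T by auto
 have [measurable]: "R \<in> borel_measurable borel" unfolding R_def[abs_def] by measurable
 have wm[measurable]: "w \<in> borel_measurable borel" unfolding w_def[abs_def] by measurable
 have wC: "\<bar>w z\<bar> <= C" for z unfolding w_def by (rule clamp_facts(1)[OF C(1)])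
 have w0: "w (t, x) = 0" if "\<not> (0 < x \<and> x < 1 \<and> 0 <= t \<and> t <= T)" for t x
 unfolding w_def R_0[OF that] using C(1) by (intro clamp_facts) simp
 have w_eq: "AE x in lborel. x \<in> {0<..<1} --> w (t, x) = \<rho> (t, x) $ j" if t: "t \<in> {0..T}" for t
 using C_Lp_bounded[OF T cont C1 t] unfolding AE_Omega
 proof eventually_elim
 case (elim x)
 then show ?case using C R_eq[OF t, of x] by (auto simp: w_def S_def intro!: clamp_facts)
 qed
 have w_QT: "AE z in lborel. z \<in> box T --> w z = \<rho> z $ j"
 using C1 unfolding AE_QT
 proof eventually_elim
 case (elim z)
 show ?case
 proof
 assume z: "z \<in> box T"
 then have "R z = \<rho> z $ j" using R_eq[of "fst z" "snd z"] by (auto simp: S_def)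
 then show "w z = \<rho> z $ j" using elim z C unfolding w_def by (intro trans[OF arg_cong[of _ _ "clamp C"] clamp_facts(2)]) auto
 qed
 qed
 define cj where "cj z = indicat_real (box T) z * c z $ j" for z
 define fj where "fj z = indicat_real (box T) z * f z $ j" for z
 define uj where "uj z = indicat_real (box T) z * u z $ j" for z
 have ji: "integrable lborel cj" "integrable lborel fj" "integrable lborel uj"
 unfolding cj_def[abs_def] fj_def[abs_def] uj_def[abs_def] by (rule integrable_QT_component[OF c] L1_Linf_integrable[OF f] integrable_QT_component[OF uQ])+
 have jm[measurable]: "cj \<in> borel_measurable borel" "fj \<in> borel_measurable borel" "uj \<in> borel_measurable borel" using ji by auto
 define h where "h z = fj z - w z * cj z" for z
 have hi: "integrable lborel h" unfolding h_def[abs_def]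
 by (intro L_integrable_diff ji integrable_mult_bounded[OF ji(1), where B=C]) (use wC in auto)
 define g0 where "g0 t = clamp C (zext T (%t. \<gamma> (t, 0) $ j) t)" for t
 define g1 where "g1 t = clamp C (zext T (%t. \<gamma> (t, 1) $ j) t)" for t
 have [measurable]: "zext T (%t. \<gamma> (t, 0) $ j) \<in> borel_measurable borel" "zext T (%t. \<gamma> (t, 1) $ j) \<in> borel_measurable borel"
 unfolding borel_measurable_timeT_iff[symmetric] by (rule measurable_GammaT_section[OF \<gamma>m], simp)+
 have gm[measurable]: "g0 \<in> borel_measurable borel" "g1 \<in> borel_measurable borel" unfolding g0_def[abs_def] g1_def[abs_def] by measurable
 have gC: "\<bar>g0 t\<bar> <= C" "\<bar>g1 t\<bar> <= C" for t unfolding g0_def g1_def by (rule clamp_facts(1)[OF C(1)])+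
 have u_bd: "AE t in lborel. t \<in> {0..T} --> u0 t = u (t, 0) $ j \<and> vel u0 d t 1 = u (t, 1) $ j"
 using v(3) by eventually_elim (auto simp: u0_def zext_simps)
 have g_bd: "AE t in lborel. t \<in> {0..T} --> (u (t, 0) $ j ~= 0 --> g0 t = \<gamma> (t, 0) $ j) \<and> (u (t, 1) $ j ~= 0 --> g1 t = \<gamma> (t, 1) $ j)"
 using C2 unfolding AE_mu[OF um]
 by eventually_elim (use C in \<open>auto simp: g0_def g1_def zext_simps intro!: clamp_facts\<close>)
 have U1i: "integrable lborel (%s. vel u0 d s 1)"
 proof (rule L_integrable_bound[OF vel_bound_integrable[OF v(2,1)]])
 have [measurable]: "u0 \<in> borel_measurable borel" "d \<in> borel_measurable borel" using v by auto
 show "(%s. vel u0 d s 1) \<in> borel_measurable lborel"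
 using borel_measurable_section(2)[OF vel_measurable[of u0 d], of 1] by simp
 show "AE s in lborel. norm (vel u0 d s 1) <= norm (\<bar>u0 s\<bar> + (LBINT y. \<bar>d (s, y)\<bar>))"
 using integrable_lborel_pair(1)[OF v(1)]
 proof eventually_elim
 case (elim s)
 have "0 <= (LBINT y. \<bar>d (s, y)\<bar>)" by (intro L_integral_nonneg) simp
 then show ?case using vel_le[of d s u0 1, OF elim] by simp
 qed
 qed
 have bal: "(LBINT x. w (t, x) * tt x) - (LBINT x. w (0, x) * tt x) =
 (LBINT s:{0..t}. (LBINT x. w (s, x) * vel u0 d s x * tt' x + h (s, x) * tt x)
 - g1 s * vel u0 d s 1 * tt 1 + g0 s * u0 s * tt 0)"
 if tt: "lip_test tt tt'" and t: "0 <= t" "t <= T" for tt tt' t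
 proof -
 obtain L F where ttm[measurable]: "tt \<in> borel_measurable borel" "tt' \<in> borel_measurable borel"
 and L: "!!x. \<bar>tt' x\<bar> <= L" "!!x. \<bar>tt x\<bar> <= L" and F: "finite F"
 "!!x. x \<in> {0<..<1} - F ==> (tt has_real_derivative tt' x) (at x)"
 using tt unfolding lip_test_def by blast
 define \<phi> where "\<phi> = (%z :: real \<times> real. tt (snd z) *\<^sub>R axis j (1::real))"
 define D where "D x = vector_derivative (%y. tt y *\<^sub>R axis j (1::real)) (at x)" for x
 have D_eq: "D x = tt' x *\<^sub>R axis j 1" if "x \<in> {0<..<1} - F" for x
 proof -
 have "((%y. tt y *\<^sub>R axis j (1::real)) has_vector_derivative tt x *\<^sub>R 0 + tt' x *\<^sub>R axis j 1) (at x)"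
 by (rule has_vector_derivative_scaleR[OF F(2)[OF that] has_vector_derivative_const])
 then have "((%y. tt y *\<^sub>R axis j (1::real)) has_vector_derivative tt' x *\<^sub>R axis j 1) (at x)" by simp
 then show ?thesis unfolding D_def by (rule vector_derivative_at)
 qed
 \<comment> \<open>On the finite set \<open>F\<close> the value of \<open>vector_derivative\<close>
   is unspecified and may have any components. Hence the integrand is first written as a sum over
   all \<open>i\<close> and reduced to component \<open>j\<close> only almost everywhere;
   measurability survives a change on a finite set.\<close>
 define E where "E x = (if x \<in> {0<..<1} then D x else 0)" for x
 have Em: "E \<in> borel_measurable borel"
 proof (rule measurable_discrete_difference[where f="%x. if x \<in> {0<..<1} then tt' x *\<^sub>R axis j 1 else 0" and X=F])
 show "(%x. if x \<in> {0<..<1} then tt' x *\<^sub>R axis j (1::real) else 0) \<in> borel_measurable borel" by measurable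
 show "countable F" by (rule countable_finite[OF F(1)])
 show "(if x \<in> {0<..<1} then tt' x *\<^sub>R axis j 1 else 0) = E x" if "x \<notin> F" for x using D_eq[of x] that by (simp add: E_def)
 qed auto
 have wi: "weak_integrand u c f \<rho> \<phi> z = (\<Sum>i\<in>UNIV. \<rho> z $ i * (u z $ i * E (snd z) $ i - c z $ i * (tt (snd z) * axis j 1 $ i))) + f z $ j * tt (snd z)"
 if "z \<in> box T" for z
 proof -
 have "d_t \<phi> z = 0" by (simp add: d_t_def \<phi>_def)
 moreover have "d_x \<phi> z = E (snd z)" using that by (auto simp: d_x_def \<phi>_def E_def D_def)
 moreover have "f z \<bullet> \<phi> z = f z $ j * tt (snd z)" by (simp add: \<phi>_def inner_axis)
 ultimately show ?thesis by (simp add: weak_integrand_def inner_vec_def[of "\<rho> z"] diag_mult_nth) (simp add: \<phi>_def)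
 qed
 define K where "K z = w z * (uj z * tt' (snd z)) + h z * tt (snd z)" for z
 have Ki: "integrable lborel K" unfolding K_def[abs_def]
 proof (rule L_integrable_add)
 show "integrable lborel (%z. w z * (uj z * tt' (snd z)))"
 proof (rule integrable_mult_bounded[where B=C])
 show "integrable lborel (%z. uj z * tt' (snd z))"
 using integrable_mult_bounded[OF ji(3), of "%z. tt' (snd z)" L] L(1) by (simp add: mult.commute)
 qed (use wC in auto)
 show "integrable lborel (%z. h z * tt (snd z))"
 using integrable_mult_bounded[OF hi, of "%z. tt (snd z)" L] L(2) by (simp add: mult.commute)
 qed
 have I1: "(LINT z:{0..t} \<times> {0<..<1}|QT T. weak_integrand u c f \<rho> \<phi> z) = (LBINT s:{0..t}. \<integral>x. w (s, x) * vel u0 d s x * tt' x + h (s, x) * tt x \<partial>lborel)"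
 proof -
 define W where "W z = indicat_real ({0..t} \<times> {0<..<1}) z * ((\<Sum>i\<in>UNIV. \<rho> z $ i * (u z $ i * E (snd z) $ i - c z $ i * (tt (snd z) * axis j 1 $ i))) + f z $ j * tt (snd z))" for z
 have Wm: "W \<in> borel_measurable (QT T)"
 proof -
 have [measurable]: "u \<in> borel_measurable (QT T)" "c \<in> borel_measurable (QT T)" "f \<in> borel_measurable (QT T)" using uQ c fm by auto
 have sn: "snd \<in> borel_measurable (QT T)" unfolding QT_eq by (intro measurable_restrict_space1) simp
 have [measurable]: "(%z. tt (snd z)) \<in> borel_measurable (QT T)" "(%z. E (snd z)) \<in> borel_measurable (QT T)"
 using measurable_compose[OF sn ttm(1)] measurable_compose[OF sn Em] by auto
 have [measurable]: "indicat_real ({0..t} \<times> {0<..<1}) \<in> borel_measurable (QT T)"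
 unfolding QT_eq by (intro measurable_restrict_space1 borel_measurable_indicator) (simp add: borel_Times)
 note \<rho>m[measurable]
 show ?thesis unfolding W_def[abs_def] by measurable
 qed
 have "(LINT z:{0..t} \<times> {0<..<1}|QT T. weak_integrand u c f \<rho> \<phi> z) = (\<integral>z. W z \<partial>QT T)"
 unfolding set_lebesgue_integral_def
 by (rule L_integral_cong[OF refl]) (auto simp: W_def wi QT_eq space_restrict_space)
 also have "\<dots> = (LBINT z. indicat_real (box T) z * W z)"
 unfolding QT_eq using box_sets[of T] by (subst integral_restrict_space) auto
 also have "\<dots> = (LBINT z. indicat_real ({0..t} \<times> UNIV) z *\<^sub>R K z)"
 proof (rule integral_cong_AE)
 show "(%z. indicat_real (box T) z * W z) \<in> borel_measurable lborel" using Wm by (simp add: borel_measurable_QT_iff)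
 show "(%z. indicat_real ({0..t} \<times> UNIV) z *\<^sub>R K z) \<in> borel_measurable lborel"
 by (intro borel_measurable_scaleR borel_measurable_indicator borel_measurable_integrable[OF Ki]) (simp add: borel_Times)
 have nF: "AE x in lborel. x \<notin> F" by (rule AE_not_in) (use F(1) in \<open>auto intro: finite_imp_null_set_lborel\<close>)
 have F2: "AE z in lborel :: (real \<times> real) measure. snd z \<notin> F \<and> fst z ~= 0 \<and> fst z ~= T"
 proof -
 have "{z \<in> space (lborel \<Otimes>\<^sub>M lborel). snd z \<notin> F \<and> fst z ~= 0 \<and> fst z ~= T} \<in> sets (lborel \<Otimes>\<^sub>M lborel :: (real \<times> real) measure)"
 proof -
 have [measurable]: "F \<in> sets borel" using finite_imp_closed[OF F(1)] by (rule borel_closed)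
 show ?thesis unfolding lborel_prod by measurable
 qed
 moreover have "AE t in lborel. AE x in lborel. snd (t, x) \<notin> F \<and> fst (t, x) ~= 0 \<and> fst (t, x) ~= T"
 using AE_lborel_singleton[of "0::real"] AE_lborel_singleton[of T]
 by eventually_elim (use nF in auto)
 ultimately show ?thesis using lborel_pair.AE_pair_measure[of "%z. snd z \<notin> F \<and> fst z ~= 0 \<and> fst z ~= T"] unfolding lborel_prod by blast
 qed
 show "AE z in lborel. indicat_real (box T) z * W z = indicat_real ({0..t} \<times> UNIV) z *\<^sub>R K z"
 using w_QT F2
 proof eventually_elim
 case (elim z)
 show ?case
 proof (cases "z \<in> box T")
 case True
 then have Ez: "E (snd z) = tt' (snd z) *\<^sub>R axis j 1" using D_eq[of "snd z"] elim by (auto simp: E_def)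
 have sum1: "(\<Sum>i\<in>UNIV. \<rho> z $ i * (u z $ i * E (snd z) $ i - c z $ i * (tt (snd z) * axis j 1 $ i)))
 = \<rho> z $ j * (u z $ j * tt' (snd z) - c z $ j * tt (snd z))"
 proof -
 have "\<rho> z $ i * (u z $ i * E (snd z) $ i - c z $ i * (tt (snd z) * axis j 1 $ i))
 = (if i = j then \<rho> z $ j * (u z $ j * tt' (snd z) - c z $ j * tt (snd z)) else 0)" for i
 by (simp add: Ez axis_def)
 then show ?thesis by simp
 qed
 have "indicat_real ({0..t} \<times> {0<..<1}) z = indicat_real ({0..t} \<times> UNIV) z" using True by (auto simp: indicator_def)
 moreover have "W z = indicat_real ({0..t} \<times> {0<..<1}) z * (\<rho> z $ j * (u z $ j * tt' (snd z) - c z $ j * tt (snd z)) + f z $ j * tt (snd z))"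
 unfolding W_def sum1 ..
 ultimately show ?thesis using True elim by (simp add: K_def h_def uj_def fj_def cj_def algebra_simps)
 next
 case False
 then have "w (fst z, snd z) = 0" using elim by (intro w0) (auto simp: mem_Times_iff)
 then show ?thesis using False by (simp add: K_def h_def uj_def fj_def cj_def)
 qed
 qed
 qed
 also have "\<dots> = (LBINT s:{0..t}. LBINT x:UNIV. K (s, x))"
 proof -
 have "set_integrable lborel ({0..t} \<times> UNIV) K" by (rule set_integrable_of_integrable[OF Ki]) (simp add: borel_Times)
 from set_integral_lborel_pair(3)[OF this] show ?thesis by (simp add: set_lebesgue_integral_def)
 qed
 also have "\<dots> = (LBINT s:{0..t}. \<integral>x. w (s, x) * vel u0 d s x * tt' x + h (s, x) * tt x \<partial>lborel)"
 unfolding set_lebesgue_integral_def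
 proof (rule integral_cong_AE)
 have [measurable]: "u0 \<in> borel_measurable borel" "d \<in> borel_measurable borel" "h \<in> borel_measurable borel" using v hi by auto
 have Km: "K \<in> borel_measurable borel" using Ki by auto
 have K2m: "(%z. w z * vel u0 d (fst z) (snd z) * tt' (snd z) + h z * tt (snd z)) \<in> borel_measurable borel" by measurable
 show "(%s. indicat_real {0..t} s *\<^sub>R (LBINT x. indicat_real UNIV x *\<^sub>R K (s, x))) \<in> borel_measurable lborel"
 using borel_measurable_set_integral_snd[OF Km, of UNIV] unfolding set_lebesgue_integral_def by simp
 show "(%s. indicat_real {0..t} s *\<^sub>R (LBINT x. w (s, x) * vel u0 d s x * tt' x + h (s, x) * tt x)) \<in> borel_measurable lborel"
 using borel_measurable_set_integral_snd[OF K2m, of UNIV] unfolding set_lebesgue_integral_def by simp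
 show "AE s in lborel. indicat_real {0..t} s *\<^sub>R (LBINT x. indicat_real UNIV x *\<^sub>R K (s, x))
 = indicat_real {0..t} s *\<^sub>R (LBINT x. w (s, x) * vel u0 d s x * tt' x + h (s, x) * tt x)"
 using v(3) AE_lborel_singleton[of "0::real"] AE_lborel_singleton[of T]
 proof eventually_elim
 case (elim s)
 show ?case
 proof (cases "s \<in> {0..t}")
 case True
 have "K (s, x) = w (s, x) * vel u0 d s x * tt' x + h (s, x) * tt x" for x
 proof (cases "x \<in> {0<..<1}")
 case x: True
 then have "uj (s, x) = vel u0 d s x" using elim True t by (auto simp: uj_def)
 then show ?thesis by (simp add: K_def)
 next
 case False
 then have "w (s, x) = 0" by (intro w0) auto
 then show ?thesis by (simp add: K_def)
 qed
 then show ?thesis by simp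
 qed simp
 qed
 qed
 finally show ?thesis .
 qed
 have "integrable lborel (%s. g1 s * vel u0 d s 1)" by (rule integrable_mult_bounded[OF U1i, where B=C]) (use gC in auto)
 then have gi1: "integrable lborel (%s. g1 s * vel u0 d s 1 * tt 1)" by simp
 have "integrable lborel (%s. g0 s * u0 s)" by (rule integrable_mult_bounded[OF v(2), where B=C]) (use gC in auto)
 then have gi0: "integrable lborel (%s. g0 s * u0 s * tt 0)" by simp
 have I2: "(LINT z:{0..t} \<times> {0, 1}|GammaT T. \<gamma> z \<bullet> (diag (nuu u z) *v \<phi> z)) = (LBINT s:{0..t}. g1 s * vel u0 d s 1 * tt 1 - g0 s * u0 s * tt 0)"
 proof -
 have eq: "indicat_real ({0..t} \<times> {0, 1}) z *\<^sub>R (\<gamma> z \<bullet> (diag (nuu u z) *v \<phi> z)) = indicat_real ({0..t} \<times> {0, 1}) z * (\<gamma> z $ j * (nuu u z $ j * tt (snd z)))" for z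
 proof -
 have "diag (nuu u z) *v \<phi> z = (nuu u z $ j * tt (snd z)) *\<^sub>R axis j 1"
 by (auto simp: vec_eq_iff diag_mult_nth \<phi>_def axis_def)
 then show ?thesis by (simp add: inner_axis)
 qed
 let ?G = "%z. indicat_real ({0..t} \<times> {0, 1}) z * (\<gamma> z $ j * (nuu u z $ j * tt (snd z)))"
 let ?F0 = "%s. - (indicat_real {0..t} s * (g0 s * u0 s * tt 0))" and ?F1 = "%s. indicat_real {0..t} s * (g1 s * vel u0 d s 1 * tt 1)"
 have Gm: "?G \<in> borel_measurable (GammaT T)"
 proof (rule measurable_GammaT)
 have *: "(%s. \<gamma> (s, 0) $ j) \<in> borel_measurable (timeT T)" "(%s. \<gamma> (s, 1) $ j) \<in> borel_measurable (timeT T)"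
 "(%s. nuu u (s, 0) $ j) \<in> borel_measurable (timeT T)" "(%s. nuu u (s, 1) $ j) \<in> borel_measurable (timeT T)"
 by (rule measurable_GammaT_section[OF \<gamma>m] measurable_GammaT_section[OF nuu_measurable[OF um]]; simp)+
 have i: "indicat_real {0..t} \<in> borel_measurable (timeT T)" unfolding timeT_def by (intro measurable_restrict_space1) simp
 have ii: "indicat_real ({0..t} \<times> {0, 1}) (s, 0) = indicat_real {0..t} s" "indicat_real ({0..t} \<times> {0, 1}) (s, 1) = indicat_real {0..t} s" for s
 by (auto simp: indicator_def)
 show "(%s. ?G (s, 0)) \<in> borel_measurable (timeT T)" "(%s. ?G (s, 1)) \<in> borel_measurable (timeT T)"
 unfolding ii snd_conv by (intro borel_measurable_times i * measurable_const; simp)+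
 qed
 have F0: "integrable lborel ?F0"
 proof -
 have "integrable lborel (%s. indicat_real {0..t} s * (g0 s * u0 s * tt 0))"
 by (rule integrable_mult_bounded[OF gi0, where B=1]) auto
 then show ?thesis by simp
 qed
 have F1: "integrable lborel ?F1"
 by (rule integrable_mult_bounded[OF gi1, where B=1]) auto
 have ae: "AE s in lborel. s \<in> {0..T} --> ?G (s, 0) = ?F0 s \<and> ?G (s, 1) = ?F1 s"
 using u_bd g_bd
 proof eventually_elim
 case (elim s)
 show ?case
 proof
 assume s: "s \<in> {0..T}"
 have "g0 s * u0 s = \<gamma> (s, 0) $ j * u (s, 0) $ j" using elim s by (cases "u (s, 0) $ j = 0") auto
 moreover have "g1 s * vel u0 d s 1 = \<gamma> (s, 1) $ j * u (s, 1) $ j" using elim s by (cases "u (s, 1) $ j = 0") auto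
 ultimately show "?G (s, 0) = ?F0 s \<and> ?G (s, 1) = ?F1 s" by (auto simp: nuu_nth indicator_def algebra_simps)
 qed
 qed
 have "(LINT z:{0..t} \<times> {0, 1}|GammaT T. \<gamma> z \<bullet> (diag (nuu u z) *v \<phi> z)) = (\<integral>z. ?G z \<partial>GammaT T)"
 unfolding set_lebesgue_integral_def eq ..
 also have "\<dots> = (LBINT s:{0..T}. ?F0 s + ?F1 s)" by (rule integral_GammaT(2)[OF Gm F0 F1 ae])
 also have "\<dots> = (LBINT s:{0..t}. g1 s * vel u0 d s 1 * tt 1 - g0 s * u0 s * tt 0)"
 unfolding set_lebesgue_integral_def using t by (intro L_integral_cong) (auto simp: indicator_def)
 finally show ?thesis .
 qed
 have I3: "(\<integral>x. \<rho> (s, x) \<bullet> \<phi> (s, x) \<partial>Omega) = (LBINT x. w (s, x) * tt x)" if s: "s \<in> {0..T}" for s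
 proof -
 have "(\<integral>x. \<rho> (s, x) \<bullet> \<phi> (s, x) \<partial>Omega) = (LBINT x. indicat_real {0<..<1} x *\<^sub>R (\<rho> (s, x) \<bullet> \<phi> (s, x)))"
 unfolding Omega_def by (rule integral_restrict_space) simp
 also have "\<dots> = (LBINT x. S s x * tt x)" by (simp add: S_def \<phi>_def inner_axis mult_ac)
 also have "\<dots> = (LBINT x. w (s, x) * tt x)"
 proof (rule integral_cong_AE)
 show "(%x. S s x * tt x) \<in> borel_measurable lborel" using Sm[OF s] by measurable
 show "(%x. w (s, x) * tt x) \<in> borel_measurable lborel" using borel_measurable_section(1)[OF wm, of s] by measurable
 show "AE x in lborel. S s x * tt x = w (s, x) * tt x" using w_eq[OF s]
 proof eventually_elim
 case (elim x)
 show ?case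
 proof (cases "x \<in> {0<..<1}")
 case False
 then have "w (s, x) = 0" by (intro w0) auto
 then show ?thesis using False by (simp add: S_def)
 qed (use elim in \<open>simp add: S_def\<close>)
 qed
 qed
 finally show ?thesis .
 qed
 have "0 = (LINT z:{0..t} \<times> {0<..<1}|QT T. weak_integrand u c f \<rho> \<phi> z)
 - (LINT z:{0..t} \<times> {0, 1}|GammaT T. \<gamma> z \<bullet> (diag (nuu u z) *v \<phi> z))
 + (\<integral>x. \<rho> (0, x) \<bullet> \<phi> (0, x) \<partial>Omega) - (\<integral>x. \<rho> (t, x) \<bullet> \<phi> (t, x) \<partial>Omega)"
 using tr t C01_axis[OF tt, of T j] unfolding is_trace_def \<phi>_def by blast
 then have eq: "(LBINT x. w (t, x) * tt x) - (LBINT x. w (0, x) * tt x) =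
 (LBINT s:{0..t}. \<integral>x. w (s, x) * vel u0 d s x * tt' x + h (s, x) * tt x \<partial>lborel)
 - (LBINT s:{0..t}. g1 s * vel u0 d s 1 * tt 1 - g0 s * u0 s * tt 0)"
 unfolding I1 I2 using I3[of 0] I3[of t] t T by simp
 have P2i: "integrable lborel (%z. w z * vel u0 d (fst z) (snd z) * tt' (snd z) + h z * tt (snd z))"
 proof -
 have [measurable]: "u0 \<in> borel_measurable borel" "d \<in> borel_measurable borel" "h \<in> borel_measurable borel" using v hi by auto
 have "integrable lborel (%z. (w z * tt' (snd z)) * (indicat_real (UNIV \<times> {0..1}) z *\<^sub>R vel u0 d (fst z) (snd z)))"
 proof (rule integrable_mult_bounded[OF integrable_vel_box[OF v(2,1), of 0 1, unfolded set_integrable_def], where B="C * L"])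
 show "AE z in lborel. \<bar>w z * tt' (snd z)\<bar> <= C * L"
 by (intro AE_I2) (simp add: abs_mult mult_mono' wC L)
 qed measurable
 moreover have "(w z * tt' (snd z)) * (indicat_real (UNIV \<times> {0..1}) z *\<^sub>R vel u0 d (fst z) (snd z)) = w z * vel u0 d (fst z) (snd z) * tt' (snd z)" for z
 using w0[of "snd z" "fst z"] by (cases "snd z \<in> {0..1}") (auto simp: indicator_def mem_Times_iff)
 ultimately have "integrable lborel (%z. w z * vel u0 d (fst z) (snd z) * tt' (snd z))" by (simp only:)
 moreover have "integrable lborel (%z. h z * tt (snd z))"
 using integrable_mult_bounded[OF hi, of "%z. tt (snd z)" L] L(2) by (simp add: mult.commute)
 ultimately show ?thesis by (rule L_integrable_add)
 qed
 have "set_integrable lborel {0..t} (%s. \<integral>x. w (s, x) * vel u0 d s x * tt' x + h (s, x) * tt x \<partial>lborel)"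
 using integrable_lborel_pair(3)[OF P2i] by (intro set_integrable_of_integrable) simp_all
 moreover have "set_integrable lborel {0..t} (%s. g1 s * vel u0 d s 1 * tt 1 - g0 s * u0 s * tt 0)"
 proof (rule set_integrable_of_integrable[OF L_integrable_diff])
 show "integrable lborel (%s. g1 s * vel u0 d s 1 * tt 1)" "integrable lborel (%s. g0 s * u0 s * tt 0)"
 by (rule gi1 gi0)+
 qed simp
 ultimately show ?thesis unfolding eq by (subst set_integral_diff(2)[symmetric]) (simp_all add: algebra_simps)
 qed
 have "balance_law T C w d h u0 g0 g1"
 by unfold_locales (use T wm wC w0 v(1,2) hi gm gC bal in \<open>auto simp: h_def fj_def cj_def\<close>)
 then show thesis
 by (rule that) (use w_eq u_bd g_bd in \<open>auto simp: d_def h_def fj_def cj_def\<close>)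
qed

section \<open>The boundary operator and the vanishing of the excess\<close>

lemma pos_def_diagonal_inner:
 fixes W :: "real^'n^'n"
 assumes "pos_def_diagonal W"
 shows "x \<bullet> (W *v v) = (\<Sum>j\<in>UNIV. W $ j $ j * (x $ j * v $ j))" "0 < W $ j $ j"
proof -
 have d: "(W *v v) $ i = W $ i $ i * v $ i" for i v
 proof -
 have "(W *v v) $ i = (\<Sum>k\<in>UNIV. if k = i then W $ i $ i * v $ i else 0)"
 proof -
 have "(W *v v) $ i = (\<Sum>k\<in>UNIV. W $ i $ k * v $ k)" by (simp add: matrix_vector_mult_def)
 also have "\<dots> = (\<Sum>k\<in>UNIV. if k = i then W $ i $ i * v $ i else 0)"
 by (rule sum.cong) (use assms in \<open>auto simp: pos_def_diagonal_def\<close>)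
 finally show ?thesis .
 qed
 then show ?thesis by simp
 qed
 show eq: "x \<bullet> (W *v v) = (\<Sum>j\<in>UNIV. W $ j $ j * (x $ j * v $ j))" for x v by (simp add: inner_vec_def d mult_ac)
 have "axis j (1::real) ~= 0" by (simp add: axis_eq_0_iff)
 then have "0 < axis j 1 \<bullet> (W *v axis j 1)" using assms unfolding pos_def_diagonal_def by blast
 moreover have "axis j 1 \<bullet> (W *v axis j 1) = W $ j $ j" by (simp add: inner_axis' d)
 ultimately show "0 < W $ j $ j" by simp
qed

locale boundary_operator =
 fixes T :: real and u ux :: "real \<times> real => real^'n" and G :: "(real \<times> real => real^'n) => real \<times> real => real^'n"
 assumes T0: "0 < T" and u: "L1_W11 T u ux" and G: "admissible_operator T u G"
begin

lemma um: "u \<in> borel_measurable (GammaT T)" using u by (simp add: L1_W11_def)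

lemma G_Linf: "g \<in> Linf (mu_pos T u) ==> G g \<in> Linf (mu_neg T u)"
 and G_linear: "g \<in> Linf (mu_pos T u) ==> h \<in> Linf (mu_pos T u) ==>
 ae_eq (mu_neg T u) (G (%z. a *\<^sub>R g z + b *\<^sub>R h z)) (%z. a *\<^sub>R G g z + b *\<^sub>R G h z)"
 and G_causal: "g \<in> Linf (mu_pos T u) ==> AE t in timeT T. ae_eq (mu_neg T u) (cut t (G (cut t g))) (cut t (G g))"
 and G_pos: "g \<in> Linf (mu_pos T u) ==> ae_nonneg (mu_pos T u) g ==> ae_nonneg (mu_neg T u) (G g)"
 using G unfolding admissible_operator_def by blast+

lemma Linf_iff: "g \<in> Linf (mu_pos T u) \<longleftrightarrow> (\<forall>j. (%z. g z $ j) \<in> borel_measurable (GammaT T) \<and> (\<exists>C. AE z in mu_pos T u j. \<bar>g z $ j\<bar> <= C))"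
 by (simp add: Linf_def measurable_mu)

lemma Linf_scale:
 assumes g: "g \<in> Linf (mu_pos T u)" and k: "k \<in> borel_measurable (GammaT T)" and b: "!!z. z \<in> {0..T} \<times> {0, 1} ==> \<bar>k z\<bar> <= B"
 shows "(%z. k z *\<^sub>R g z) \<in> Linf (mu_pos T u)"
 unfolding Linf_iff
proof (intro allI conjI)
 fix j
 have m: "(%z. g z $ j) \<in> borel_measurable (GammaT T)" using g by (simp add: Linf_iff)
 show "(%z. (k z *\<^sub>R g z) $ j) \<in> borel_measurable (GammaT T)" using m k by simp
 obtain C where C: "AE z in mu_pos T u j. \<bar>g z $ j\<bar> <= C" using g by (auto simp: Linf_iff)
 have "AE z in mu_pos T u j. \<bar>(k z *\<^sub>R g z) $ j\<bar> <= \<bar>B\<bar> * \<bar>C\<bar>"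
 using C unfolding AE_mu[OF um]
 proof eventually_elim
 case (elim t)
 have *: "\<bar>(k z *\<^sub>R g z) $ j\<bar> <= \<bar>B\<bar> * \<bar>C\<bar>" if "z \<in> {0..T} \<times> {0, 1}" "\<bar>g z $ j\<bar> <= C" for z
 using b[OF that(1)] that(2) by (simp add: abs_mult) (intro mult_mono, auto)
 show ?case using elim by (auto intro!: *[unfolded vector_scaleR_component real_scaleR_def] simp: vector_scaleR_component)
 qed
 then show "\<exists>C. AE z in mu_pos T u j. \<bar>(k z *\<^sub>R g z) $ j\<bar> <= C" ..
qed

lemma cut_measurable: "(%z. indicat_real {0..t} (fst z)) \<in> borel_measurable (GammaT T)"
 by (rule measurable_GammaT) (auto simp: timeT_def intro!: measurable_restrict_space1)

lemma Linf_cut: "g \<in> Linf (mu_pos T u) ==> cut t g \<in> Linf (mu_pos T u)"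
 unfolding cut_def[abs_def] by (rule Linf_scale[OF _ cut_measurable, where B=1]) auto

lemma Linf_add:
 assumes "g \<in> Linf (mu_pos T u)" "h \<in> Linf (mu_pos T u)"
 shows "(%z. a *\<^sub>R g z + b *\<^sub>R h z) \<in> Linf (mu_pos T u)"
 unfolding Linf_iff
proof (intro allI conjI)
 fix j
 show "(%z. (a *\<^sub>R g z + b *\<^sub>R h z) $ j) \<in> borel_measurable (GammaT T)"
 unfolding vector_add_component vector_scaleR_component real_scaleR_def
 by (intro borel_measurable_add borel_measurable_times measurable_const) (use assms in \<open>auto simp: Linf_iff\<close>)
 obtain C D where C: "AE z in mu_pos T u j. \<bar>g z $ j\<bar> <= C" and D: "AE z in mu_pos T u j. \<bar>h z $ j\<bar> <= D"
 using assms by (auto simp: Linf_iff) blast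
 from C D have "AE z in mu_pos T u j. \<bar>(a *\<^sub>R g z + b *\<^sub>R h z) $ j\<bar> <= \<bar>a\<bar> * C + \<bar>b\<bar> * D"
 proof eventually_elim
 case (elim z)
 have "\<bar>a * g z $ j\<bar> <= \<bar>a\<bar> * C" "\<bar>b * h z $ j\<bar> <= \<bar>b\<bar> * D" using elim by (simp_all add: abs_mult mult_left_mono)
 then show ?case by simp
 qed
 then show "\<exists>C. AE z in mu_pos T u j. \<bar>(a *\<^sub>R g z + b *\<^sub>R h z) $ j\<bar> <= C" ..
qed

lemma G_mono:
 assumes g: "g \<in> Linf (mu_pos T u)" and h: "h \<in> Linf (mu_pos T u)" and le: "!!j. AE z in mu_pos T u j. g z $ j <= h z $ j"
 shows "AE z in mu_neg T u j. G g z $ j <= G h z $ j"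
proof -
 have "ae_nonneg (mu_pos T u) (%z. 1 *\<^sub>R h z + (- 1) *\<^sub>R g z)" unfolding ae_nonneg_def using le by simp
 from G_pos[OF Linf_add[OF h g] this] have "AE z in mu_neg T u j. 0 <= G (%z. 1 *\<^sub>R h z + (- 1) *\<^sub>R g z) z $ j" by (simp add: ae_nonneg_def)
 moreover have "AE z in mu_neg T u j. G (%z. 1 *\<^sub>R h z + (- 1) *\<^sub>R g z) z $ j = (1 *\<^sub>R G h z + (- 1) *\<^sub>R G g z) $ j"
 using G_linear[OF h g, of 1 "- 1"] by (simp add: ae_eq_def)
 ultimately show ?thesis by eventually_elim simp
qed

lemma kappa_measurable:
 fixes \<kappa> :: "real => real"
 shows "continuous_on {0..T} \<kappa> ==> (%z. \<kappa> (fst z)) \<in> borel_measurable (GammaT T)"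
 using borel_measurable_continuous_on_indicator[of "{0..T}" \<kappa>]
 by (intro measurable_GammaT) (simp_all add: borel_measurable_timeT_iff zext_def[abs_def])

text \<open>Causality: on \<open>[0, t]\<close> the value of \<open>G g\<close> only depends on \<open>g\<close> up to time \<open>t\<close>, where
 \<open>\<kappa>(t) g <= \<kappa> g\<close>; then \<open>t\<close> decreases to the current time along a countable set.\<close>

lemma G_decreasing_factor:
 assumes g: "g \<in> Linf (mu_pos T u)" and nn: "ae_nonneg (mu_pos T u) g"
 and c: "continuous_on {0..T} \<kappa>" and mono: "!!s t. 0 <= s ==> s <= t ==> t <= T ==> \<kappa> t <= \<kappa> s"
 and pos: "!!s. s \<in> {0..T} ==> 0 <= \<kappa> s"
 shows "(%z. \<kappa> (fst z) *\<^sub>R g z) \<in> Linf (mu_pos T u)"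
 and "AE z in mu_neg T u j. \<kappa> (fst z) * G g z $ j <= G (%z. \<kappa> (fst z) *\<^sub>R g z) z $ j"
proof -
 let ?kg = "%z. \<kappa> (fst z) *\<^sub>R g z"
 show kg: "?kg \<in> Linf (mu_pos T u)"
 by (rule Linf_scale[OF g kappa_measurable[OF c], where B="\<kappa> 0"]) (use mono pos T0 in auto)
 define good where "good t \<longleftrightarrow> (AE z in mu_neg T u j. fst z <= t --> 0 <= fst z --> \<kappa> t * G g z $ j <= G ?kg z $ j)" for t
 have "AE t in lborel. t \<in> {0..T} --> good t"
 using G_causal[OF g] G_causal[OF kg] unfolding AE_timeT
 proof eventually_elim
 case (elim t)
 show ?case
 proof
 assume t: "t \<in> {0..T}"
 have c1: "AE z in mu_neg T u j. cut t (G (cut t g)) z $ j = cut t (G g) z $ j" "AE z in mu_neg T u j. cut t (G (cut t ?kg)) z $ j = cut t (G ?kg) z $ j"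
 using elim t by (auto simp: ae_eq_def)
 have "AE z in mu_neg T u j. G (%z. \<kappa> t *\<^sub>R cut t g z + 0 *\<^sub>R cut t g z) z $ j <= G (cut t ?kg) z $ j"
 proof (rule G_mono[OF Linf_add[OF Linf_cut[OF g] Linf_cut[OF g]] Linf_cut[OF kg]])
 fix i
 have "AE z in mu_pos T u i. 0 <= g z $ i" using nn by (simp add: ae_nonneg_def)
 then show "AE z in mu_pos T u i. (\<kappa> t *\<^sub>R cut t g z + 0 *\<^sub>R cut t g z) $ i <= cut t ?kg z $ i"
 by eventually_elim (use mono t in \<open>auto simp: cut_def indicator_def intro!: mult_right_mono\<close>)
 qed
 moreover have "AE z in mu_neg T u j. G (%z. \<kappa> t *\<^sub>R cut t g z + 0 *\<^sub>R cut t g z) z $ j = (\<kappa> t *\<^sub>R G (cut t g) z + 0 *\<^sub>R G (cut t g) z) $ j"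
 using G_linear[where a="\<kappa> t" and b=0, OF Linf_cut[OF g, of t] Linf_cut[OF g, of t]] by (simp only: ae_eq_def)
 ultimately show "good t" unfolding good_def using c1
 by eventually_elim (auto simp: cut_def)
 qed
 qed
 note ex = AE_imp_ex_between[OF this]
 \<comment> \<open>Causality leaves an exceptional null set of boundary points for each time. One
   good time is chosen in every rational interval, which gives a countable dense set of times and
   hence a single null set.\<close>
 define D where "D = (%(p, q). SOME t. p < t \<and> t < q \<and> (t \<in> {0..T} --> good t)) ` {(p, q) \<in> \<rat> \<times> \<rat>. p < q}"
 have cD: "countable D" unfolding D_def
 by (intro countable_image countable_subset[OF _ countable_SIGMA[OF countable_rat countable_rat]]) auto
 have D: "\<exists>t\<in>D. a < t \<and> t < b" if ab: "a < b" for a b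
 proof -
 obtain p where p: "p \<in> \<rat>" "a < p" "p < b" using Rats_dense_in_real[OF ab] by blast
 obtain q where q: "q \<in> \<rat>" "p < q" "q < b" using Rats_dense_in_real[OF p(3)] by blast
 have "p < (SOME t. p < t \<and> t < q \<and> (t \<in> {0..T} --> good t)) \<and> (SOME t. p < t \<and> t < q \<and> (t \<in> {0..T} --> good t)) < q"
 using someI_ex[OF ex[OF q(2)]] by blast
 then show ?thesis unfolding D_def using p q by (intro bexI[of _ "SOME t. p < t \<and> t < q \<and> (t \<in> {0..T} --> good t)"]) force+
 qed
 have goodD: "good t" if t: "t \<in> D \<inter> {0..T}" for t
 proof -
 obtain p q where pq: "p < q" and teq: "t = (SOME t. p < t \<and> t < q \<and> (t \<in> {0..T} --> good t))"
 using t by (auto simp: D_def)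
 have "t \<in> {0..T} --> good t" using someI_ex[OF ex[OF pq]] unfolding teq by blast
 then show ?thesis using t by blast
 qed
 have "AE z in mu_neg T u j. \<forall>t\<in>D \<inter> {0..T}. fst z <= t --> 0 <= fst z --> \<kappa> t * G g z $ j <= G ?kg z $ j"
 by (subst AE_ball_countable) (use cD goodD in \<open>auto simp: good_def\<close>)
 \<comment> \<open>The final time is discarded, since the approximating times lie strictly to the
   right of the current one.\<close>
 moreover have "AE z in mu_neg T u j. fst z \<in> {0..T} \<and> fst z ~= T"
 unfolding AE_mu[OF um] using AE_lborel_singleton[of T] by eventually_elim auto
 ultimately show "AE z in mu_neg T u j. \<kappa> (fst z) * G g z $ j <= G ?kg z $ j"
 proof eventually_elim
 case (elim z)
 then have s: "0 <= fst z" "fst z < T" by auto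
 have "\<exists>t. t \<in> D \<inter> {0..T} \<and> fst z < t \<and> t < fst z + (T - fst z) / Suc n" for n
 proof -
 obtain t where t: "t \<in> D" "fst z < t" "t < fst z + (T - fst z) / Suc n"
 using D[of "fst z" "fst z + (T - fst z) / Suc n"] s by auto
 have "(T - fst z) / Suc n <= T - fst z" using s by (simp add: divide_le_eq)
 then show ?thesis using t s by (intro exI[of _ t]) auto
 qed
 then obtain \<tau> where \<tau>: "!!n. \<tau> n \<in> D \<inter> {0..T}" "!!n. fst z < \<tau> n" "!!n. \<tau> n < fst z + (T - fst z) / Suc n" by metis
 have "(%n. fst z + (T - fst z) / Suc n) \<longlonglongrightarrow> fst z + 0"
 by (intro tendsto_add tendsto_const) (rule LIMSEQ_Suc[OF lim_const_over_n])
 then have "\<tau> \<longlonglongrightarrow> fst z"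
 by (intro real_tendsto_sandwich[OF _ _ tendsto_const, of "fst z" \<tau>]) (use \<tau> in \<open>auto simp: less_imp_le intro!: always_eventually\<close>)
 then have "(%n. \<kappa> (\<tau> n)) \<longlonglongrightarrow> \<kappa> (fst z)"
 by (rule continuous_on_tendsto_compose[OF c]) (use \<tau>(1) s in auto)
 then have "(%n. \<kappa> (\<tau> n) * G g z $ j) \<longlonglongrightarrow> \<kappa> (fst z) * G g z $ j" by (intro tendsto_intros)
 then show ?case by (rule LIMSEQ_le_const2) (use elim \<tau> s in \<open>auto simp: less_imp_le\<close>)
 qed
qed

end

text \<open>Causality yields the flux inequality for almost every time only. Continuity extends it:
  a positive value would persist on an interval to the left, and the initial time is covered by
  \<open>S 0 = 0\<close>.\<close>

lemma continuous_le_of_AE: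
 fixes S :: "real => real"
 assumes c: "continuous_on {0..T} S" and ae: "AE t in lborel. t \<in> {0..T} --> S t <= 0" and "S 0 = 0" and t: "t \<in> {0..T}"
 shows "S t <= 0"
proof (rule ccontr)
 assume pos: "\<not> S t <= 0"
 then have t0: "0 < t" using t \<open>S 0 = 0\<close> by (cases "t = 0") auto
 obtain e where e: "0 < e" "!!s. s \<in> {0..T} ==> dist s t < e ==> dist (S s) (S t) < S t"
 using c[unfolded continuous_on_iff, THEN bspec, OF t] pos by (metis not_le)
 have "max 0 (t - e) < t" using t0 e(1) by simp
 from AE_imp_ex_between[OF ae this] obtain s where s: "max 0 (t - e) < s" "s < t" "s \<in> {0..T} --> S s <= 0" by blast
 have sT: "s \<in> {0..T}" using s t by auto
 have "dist (S s) (S t) < S t" by (rule e(2)[OF sT]) (use s in \<open>auto simp: dist_real_def\<close>)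
 then show False using s(3) sT by (auto simp: dist_real_def)
qed

context boundary_operator
begin

lemma integrable_boundary_velocity: "integrable (GammaT T) (%z. nuu u z $ j)"
proof -
 note v = W11_velocity[OF T0 u, of j]
 let ?d = "%z. indicat_real (box T) z * ux z $ j" and ?u0 = "zext T (%t. u (t, 0) $ j)"
 have U1: "integrable lborel (%s. vel ?u0 ?d s 1)"
 proof (rule L_integrable_bound[OF vel_bound_integrable[OF v(2,1)]])
 have [measurable]: "?u0 \<in> borel_measurable borel"
 by (subst measurable_cong_sets[OF sets_lborel[symmetric] refl]) (rule borel_measurable_integrable[OF v(2)])
 have [measurable]: "?d \<in> borel_measurable borel"
 by (subst measurable_cong_sets[OF sets_lborel[symmetric] refl]) (rule borel_measurable_integrable[OF v(1)])
 show "(%s. vel ?u0 ?d s 1) \<in> borel_measurable lborel"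
 using borel_measurable_section(2)[OF vel_measurable[of ?u0 ?d], of 1] v(1,2) by (simp add: borel_measurable_integrable)
 show "AE s in lborel. norm (vel ?u0 ?d s 1) <= norm (\<bar>?u0 s\<bar> + (LBINT y. \<bar>?d (s, y)\<bar>))"
 using integrable_lborel_pair(1)[OF v(1)]
 proof eventually_elim
 case (elim s)
 have "0 <= (LBINT y. \<bar>?d (s, y)\<bar>)" by (intro L_integral_nonneg) simp
 then show ?case using vel_le[of ?d s ?u0 1, OF elim] by simp
 qed
 qed
 show ?thesis
 proof (rule integral_GammaT(1)[OF nuu_measurable[OF um]])
 show "integrable lborel (%t. - ?u0 t)" using v(2) by simp
 show "integrable lborel (%s. vel ?u0 ?d s 1)" by (rule U1)
 show "AE t in lborel. t \<in> {0..T} --> nuu u (t, 0) $ j = - ?u0 t \<and> nuu u (t, 1) $ j = vel ?u0 ?d t 1"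
 using v(3) by eventually_elim (auto simp: nuu_nth zext_simps)
 qed
qed

text \<open>The essential bound of \<open>g\<close> holds only where the density is positive;
  multiplied by the density, \<open>g\<close> is dominated by a multiple of the boundary velocity.
  This matters because a nonintegrable function has integral 0 by convention, and the weighted norms
  could then not be split into components.\<close>

lemma integrable_norm_integrand:
 assumes m: "(%z. g z $ j) \<in> borel_measurable (GammaT T)"
 shows "(\<exists>C. AE z in mu_neg T u j. \<bar>g z $ j\<bar> <= C) ==> integrable (GammaT T) (%z. \<bar>g z\<bar> $ j * vneg (nuu u z) $ j)"
 and "(\<exists>C. AE z in mu_pos T u j. \<bar>g z $ j\<bar> <= C) ==> integrable (GammaT T) (%z. \<bar>g z\<bar> $ j * vpos (nuu u z) $ j)"
proof -
 note [measurable] = m nuu_measurable[OF um, of j]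
 have abs_nth: "\<bar>v\<bar> $ j = \<bar>v $ j\<bar>" for v :: "real^'n" by (simp add: abs_vec_def)
 { assume "\<exists>C. AE z in mu_neg T u j. \<bar>g z $ j\<bar> <= C"
 then obtain C where C: "AE z in mu_neg T u j. \<bar>g z $ j\<bar> <= C" ..
 show "integrable (GammaT T) (%z. \<bar>g z\<bar> $ j * vneg (nuu u z) $ j)"
 unfolding abs_nth vpos_vneg_nth
 proof (rule L_integrable_bound)
 show "integrable (GammaT T) (%z. C * nuu u z $ j)" using integrable_boundary_velocity by simp
 show "AE z in GammaT T. norm (\<bar>g z $ j\<bar> * max (- (nuu u z $ j)) 0) <= norm (C * nuu u z $ j)"
 using C unfolding AE_mu[OF um] AE_GammaT
 proof eventually_elim
 case (elim t)
 have *: "norm (\<bar>g z $ j\<bar> * max (- n) 0) <= norm (C * n)" if "n < 0 --> \<bar>g z $ j\<bar> <= C" for z and n :: real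
 proof (cases "n < 0")
 case True
 then have "\<bar>g z $ j\<bar> * \<bar>n\<bar> <= \<bar>C\<bar> * \<bar>n\<bar>" using that by (intro mult_right_mono) auto
 then show ?thesis using True by (simp add: abs_mult)
 qed (simp add: max_def)
 show ?case
 proof (intro impI conjI)
 assume t: "t \<in> {0..T}"
 show "norm (\<bar>g (t, 0) $ j\<bar> * max (- (nuu u (t, 0) $ j)) 0) <= norm (C * nuu u (t, 0) $ j)"
 unfolding nuu_nth by (rule *) (use elim t in auto)
 show "norm (\<bar>g (t, 1) $ j\<bar> * max (- (nuu u (t, 1) $ j)) 0) <= norm (C * nuu u (t, 1) $ j)"
 unfolding nuu_nth by (rule *) (use elim t in auto)
 qed
 qed
 qed measurable }
 { assume "\<exists>C. AE z in mu_pos T u j. \<bar>g z $ j\<bar> <= C"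
 then obtain C where C: "AE z in mu_pos T u j. \<bar>g z $ j\<bar> <= C" ..
 show "integrable (GammaT T) (%z. \<bar>g z\<bar> $ j * vpos (nuu u z) $ j)"
 unfolding abs_nth vpos_vneg_nth
 proof (rule L_integrable_bound)
 show "integrable (GammaT T) (%z. C * nuu u z $ j)" using integrable_boundary_velocity by simp
 show "AE z in GammaT T. norm (\<bar>g z $ j\<bar> * max (nuu u z $ j) 0) <= norm (C * nuu u z $ j)"
 using C unfolding AE_mu[OF um] AE_GammaT
 proof eventually_elim
 case (elim t)
 have *: "norm (\<bar>g z $ j\<bar> * max n 0) <= norm (C * n)" if "0 < n --> \<bar>g z $ j\<bar> <= C" for z and n :: real
 proof (cases "0 < n")
 case True
 then have "\<bar>g z $ j\<bar> * \<bar>n\<bar> <= \<bar>C\<bar> * \<bar>n\<bar>" using that by (intro mult_right_mono) auto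
 then show ?thesis using True by (simp add: abs_mult)
 qed (simp add: max_def)
 show ?case
 proof (intro impI conjI)
 assume t: "t \<in> {0..T}"
 show "norm (\<bar>g (t, 0) $ j\<bar> * max (nuu u (t, 0) $ j) 0) <= norm (C * nuu u (t, 0) $ j)"
 unfolding nuu_nth by (rule *) (use elim t in auto)
 show "norm (\<bar>g (t, 1) $ j\<bar> * max (nuu u (t, 1) $ j) 0) <= norm (C * nuu u (t, 1) $ j)"
 unfolding nuu_nth by (rule *) (use elim t in auto)
 qed
 qed
 qed measurable }
qed

text \<open>The weighted boundary flux of the excess is nonpositive up to almost every time, because the
 reflection operator is a contraction of the weighted norms and is causal.\<close>

lemma excess_vanishes:
 fixes Z H d :: "'n => real \<times> real => real" and C :: "'n => real" and u0 g0 g1 :: "'n => real => real"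
 assumes X: "X \<in> Linf (mu_pos T u)" and Xm: "!!j. (%z. X z $ j) \<in> borel_measurable (GammaT T)"
 and X0: "!!z j. 0 <= X z $ j" and XG: "!!j. AE z in mu_neg T u j. X z $ j <= G X z $ j"
 and bal: "!!j. balance_law T (C j) (Z j) (d j) (H j) (u0 j) (g0 j) (g1 j)"
 and neg: "!!j. AE z in lborel. z \<in> {0..T} \<times> {0..1} --> 0 < Z j z --> H j z <= 0"
 and init: "!!j. AE x in lborel. Z j (0, x) <= 0"
 and vb: "!!j. AE t in lborel. t \<in> {0..T} --> u0 j t = u (t, 0) $ j \<and> vel (u0 j) (d j) t 1 = u (t, 1) $ j"
 and tr: "!!j. AE t in lborel. t \<in> {0..T} --> (u (t, 0) $ j ~= 0 --> max 0 (g0 j t) = X (t, 0) $ j) \<and> (u (t, 1) $ j ~= 0 --> max 0 (g1 j t) = X (t, 1) $ j)"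
 shows "t \<in> {0..T} ==> AE x in lborel. Z j (t, x) <= 0"
 and "AE t in lborel. t \<in> {0..T} --> (u (t, 0) $ j ~= 0 --> g0 j t <= 0) \<and> (u (t, 1) $ j ~= 0 --> g1 j t <= 0)"
proof -
 obtain W where W: "pos_def_diagonal W" and con: "!!g. g \<in> Linf (mu_pos T u) ==> norm_1w_neg T u W (G g) <= norm_1w_pos T u W g"
 using G unfolding admissible_operator_def by blast
 note Wi = pos_def_diagonal_inner(1)[OF W] and Wp = pos_def_diagonal_inner(2)[OF W]
 have abs_nth: "\<bar>v\<bar> $ j = \<bar>v $ j\<bar>" for v :: "real^'n" and j by (simp add: abs_vec_def)
 \<comment> \<open>Net inflow of the positive part through both ends; outflow is counted
   negatively.\<close>
 define q where "q j s = max 0 (g0 j s) * u0 j s - max 0 (g1 j s) * vel (u0 j) (d j) s 1" for j s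
 have parts: "integrable lborel (%s. max 0 (g0 j s) * u0 j s)" "integrable lborel (%s. max 0 (g1 j s) * vel (u0 j) (d j) s 1)" for j
 proof -
 interpret B: balance_law T "C j" "Z j" "d j" "H j" "u0 j" "g0 j" "g1 j" by (rule bal)
 have m: "\<bar>max 0 x\<bar> <= C j" if "\<bar>x\<bar> <= C j" for x :: real using that by auto
 show "integrable lborel (%s. max 0 (g0 j s) * u0 j s)"
 by (rule integrable_mult_bounded[OF B.u0, where B="C j"]) (use m[OF B.g_le(1)] in auto)
 show "integrable lborel (%s. max 0 (g1 j s) * vel (u0 j) (d j) s 1)"
 by (rule integrable_mult_bounded[OF B.vel_1_integrable, where B="C j"]) (use m[OF B.g_le(2)] in auto)
 qed
 have qi: "set_integrable lborel {0..T} (q j)" for j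
 unfolding q_def[abs_def] by (rule set_integrable_of_integrable[OF L_integrable_diff[OF parts]]) simp
 define I where "I j t = (LBINT s:{0..t}. q j s)" for j t
 have Ic: "continuous_on {0..T} (I j)" for j unfolding I_def[abs_def] by (rule continuous_on_set_integral[OF qi])
 have le: "(LBINT x. max 0 (Z j (t, x))) <= I j t" if t: "t \<in> {0..T}" for j t
 proof -
 interpret B: balance_law T "C j" "Z j" "d j" "H j" "u0 j" "g0 j" "g1 j" by (rule bal)
 have "(LBINT x. max 0 (Z j (0, x))) = 0"
 proof (rule integral_eq_zero_AE)
 show "AE x in lborel. max 0 (Z j (0, x)) = 0" using init[of j] by eventually_elim (simp add: max_def)
 qed
 moreover have "I j t = (LBINT s:{0..t}. max 0 (g0 j s) * u0 j s) - (LBINT s:{0..t}. max 0 (g1 j s) * vel (u0 j) (d j) s 1)"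
 unfolding I_def q_def by (rule set_integral_diff(2)) (rule set_integrable_of_integrable[OF parts(1)] set_integrable_of_integrable[OF parts(2)]; simp)+
 ultimately show ?thesis using B.positive_part_balance[OF _ _ neg, of t] t by simp
 qed
 define S where "S t = (\<Sum>j\<in>UNIV. W $ j $ j * I j t)" for t
 have Sc: "continuous_on {0..T} S" unfolding S_def[abs_def] by (intro continuous_intros Ic)
 have I0: "I j 0 = 0" for j
 proof -
 have "I j 0 - I j 0 = (LBINT s:{0..0}. q j s)"
 using ac_on_integral[OF qi[of j], unfolded ac_on_def, THEN conjunct2, THEN bspec, of 0] T0 by (simp add: I_def)
 then show ?thesis by (simp add: I_def)
 qed
 have "AE t in lborel. t \<in> {0..T} --> S t <= 0"
 using G_causal[OF X] unfolding AE_timeT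
 proof eventually_elim
 case (elim t)
 show ?case
 proof
 assume t: "t \<in> {0..T}"
 \<comment> \<open>The contraction is applied to the excess cut off at \<open>t\<close>: up to
   \<open>t\<close> its image is that of the uncut excess by causality, and after \<open>t\<close>
   the cut excess is 0 and lies below any modulus.\<close>
 let ?Y = "cut t X"
 have Y: "?Y \<in> Linf (mu_pos T u)" by (rule Linf_cut[OF X])
 have Ym: "(%z. ?Y z $ j) \<in> borel_measurable (GammaT T)" for j using Y by (simp add: Linf_iff)
 have GY: "(%z. G ?Y z $ j) \<in> borel_measurable (GammaT T)" "\<exists>C. AE z in mu_neg T u j. \<bar>G ?Y z $ j\<bar> <= C" for j
 using G_Linf[OF Y] by (auto simp: Linf_def measurable_mu)
 have Yb: "\<exists>C. AE z in mu_pos T u j. \<bar>?Y z $ j\<bar> <= C" for j using Y by (simp add: Linf_iff)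
 note i1 = integrable_norm_integrand(1)[OF GY(1) GY(2)] and i2 = integrable_norm_integrand(2)[OF Ym Yb]
 define F where "F j z = \<bar>G ?Y z\<bar> $ j * vneg (nuu u z) $ j - \<bar>?Y z\<bar> $ j * vpos (nuu u z) $ j" for j z
 define f where "f j z = ?Y z $ j * (- (nuu u z $ j))" for j z
 have F: "integrable (GammaT T) (F j)" for j unfolding F_def[abs_def] by (rule L_integrable_diff[OF i1 i2])
 have nF: "norm_1w_neg T u W (G ?Y) - norm_1w_pos T u W ?Y = (\<Sum>j\<in>UNIV. W $ j $ j * (\<integral>z. F j z \<partial>GammaT T))"
 unfolding norm_1w_neg_def norm_1w_pos_def Wi F_def using i1 i2
 by (simp add: L_integral_sum L_integral_diff right_diff_distrib sum_subtractf)
 have fm: "f j \<in> borel_measurable (GammaT T)" for j unfolding f_def[abs_def]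
 by (intro borel_measurable_times borel_measurable_uminus Ym nuu_measurable[OF um])
 have aef: "AE s in lborel. s \<in> {0..T} --> f j (s, 0) = indicat_real {0..t} s * (max 0 (g0 j s) * u0 j s) \<and> f j (s, 1) = - (indicat_real {0..t} s * (max 0 (g1 j s) * vel (u0 j) (d j) s 1))" for j
 using vb[of j] tr[of j]
 proof eventually_elim
 case (elim s)
 show ?case
 proof (intro impI conjI)
 assume s: "s \<in> {0..T}"
 have "max 0 (g0 j s) * u0 j s = X (s, 0) $ j * u (s, 0) $ j" using elim s by (cases "u (s, 0) $ j = 0") auto
 then show "f j (s, 0) = indicat_real {0..t} s * (max 0 (g0 j s) * u0 j s)" by (simp add: f_def cut_def nuu_nth)
 have "max 0 (g1 j s) * vel (u0 j) (d j) s 1 = X (s, 1) $ j * u (s, 1) $ j" using elim s by (cases "u (s, 1) $ j = 0") auto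
 then show "f j (s, 1) = - (indicat_real {0..t} s * (max 0 (g1 j s) * vel (u0 j) (d j) s 1))" by (simp add: f_def cut_def nuu_nth)
 qed
 qed
 have ip: "integrable lborel (%s. indicat_real {0..t} s * (max 0 (g0 j s) * u0 j s))" for j
 by (rule integrable_mult_bounded[OF parts(1), where B=1]) auto
 have "integrable lborel (%s. indicat_real {0..t} s * (max 0 (g1 j s) * vel (u0 j) (d j) s 1))" for j
 by (rule integrable_mult_bounded[OF parts(2), where B=1]) auto
 then have ip': "integrable lborel (%s. - (indicat_real {0..t} s * (max 0 (g1 j s) * vel (u0 j) (d j) s 1)))" for j by simp
 note fI = integral_GammaT[OF fm ip ip' aef]
 have fI2: "(\<integral>z. f j z \<partial>GammaT T) = I j t" for j
 proof -
 have "(\<integral>z. f j z \<partial>GammaT T) = (LBINT s:{0..T}. indicat_real {0..t} s * (max 0 (g0 j s) * u0 j s) + - (indicat_real {0..t} s * (max 0 (g1 j s) * vel (u0 j) (d j) s 1)))"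
 by (rule fI(2))
 also have "\<dots> = I j t" unfolding I_def q_def set_lebesgue_integral_def
 using t by (intro L_integral_cong) (auto simp: indicator_def)
 finally show ?thesis .
 qed
 have fF: "(\<integral>z. f j z \<partial>GammaT T) <= (\<integral>z. F j z \<partial>GammaT T)" for j
 proof (rule integral_mono_AE[OF fI(1) F])
 have c: "AE z in mu_neg T u j. cut t (G ?Y) z $ j = cut t (G X) z $ j" using elim t by (auto simp: ae_eq_def)
 from c XG[of j] have "AE z in mu_neg T u j. ?Y z $ j <= \<bar>G ?Y z $ j\<bar>"
 by eventually_elim (auto simp: cut_def indicator_def)
 then show "AE z in GammaT T. f j z <= F j z"
 unfolding AE_mu[OF um] AE_GammaT
 proof eventually_elim
 case (elim s)
 \<comment> \<open>\<open>n\<close> is the outward normal velocity. For \<open>n < 0\<close> the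
   inflow inequality \<open>y <= a\<close> is used; otherwise both sides equal
   \<open>- y * n\<close>.\<close>
 have *: "y * (- n) <= a * max (- n) 0 - \<bar>y\<bar> * max n 0" if "n < 0 --> y <= a" "0 <= y" for y a n :: real
 using that mult_right_mono[of y a "- n"] by (cases "n < 0") (auto simp: max_def)
 have Y0: "0 <= ?Y z $ j" for z using X0 by (simp add: cut_def)
 show ?case
 proof (intro impI conjI)
 assume s: "s \<in> {0..T}"
 show "f j (s, 0) <= F j (s, 0)" unfolding f_def F_def abs_nth vpos_vneg_nth
 by (rule *[OF _ Y0]) (use elim s in \<open>auto simp: nuu_nth\<close>)
 show "f j (s, 1) <= F j (s, 1)" unfolding f_def F_def abs_nth vpos_vneg_nth
 by (rule *[OF _ Y0]) (use elim s in \<open>auto simp: nuu_nth\<close>)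
 qed
 qed
 qed
 have "S t <= (\<Sum>j\<in>UNIV. W $ j $ j * (\<integral>z. F j z \<partial>GammaT T))"
 unfolding S_def using fF Wp by (intro sum_mono mult_left_mono) (auto simp: fI2 less_imp_le)
 also have "\<dots> <= 0" using con[OF Y] nF by simp
 finally show "S t <= 0" .
 qed
 qed
 then have S0: "S t <= 0" if "t \<in> {0..T}" for t
 by (rule continuous_le_of_AE[OF Sc]) (use that I0 in \<open>auto simp: S_def\<close>)
 have zero: "(LBINT x. max 0 (Z j (t, x))) = 0" if t: "t \<in> {0..T}" for j t
 proof -
 have nn: "0 <= (LBINT x. max 0 (Z j (t, x)))" for j by (intro L_integral_nonneg) simp
 \<comment> \<open>All weights are positive and all integrals nonnegative, so a nonpositive sum
   makes each component vanish; this is how a bound on the coupled system gives one for every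
   component.\<close>
 have "(\<Sum>j\<in>UNIV. W $ j $ j * (LBINT x. max 0 (Z j (t, x)))) <= S t"
 unfolding S_def using le[OF t] Wp by (intro sum_mono mult_left_mono) (auto simp: less_imp_le)
 also have "\<dots> <= 0" by (rule S0[OF t])
 finally have "(\<Sum>j\<in>UNIV. W $ j $ j * (LBINT x. max 0 (Z j (t, x)))) = 0"
 using nn Wp by (intro antisym sum_nonneg mult_nonneg_nonneg) (auto simp: less_imp_le)
 then have "W $ j $ j * (LBINT x. max 0 (Z j (t, x))) = 0"
 by (subst (asm) sum_nonneg_eq_0_iff) (use nn Wp in \<open>auto simp: less_imp_le\<close>)
 then show ?thesis using Wp[of j] by simp
 qed
 interpret B: balance_law T "C j" "Z j" "d j" "H j" "u0 j" "g0 j" "g1 j" by (rule bal)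
 show "AE x in lborel. Z j (t, x) <= 0" if t: "t \<in> {0..T}"
 proof -
 have i: "integrable lborel (%x. max 0 (Z j (t, x)))"
 by (rule L_integrable_bound[OF B.w_integrable_section[of t]])
 (use borel_measurable_section(1)[OF B.w_measurable, of t] in \<open>auto intro!: AE_I2\<close>)
 have "AE x in lborel. max 0 (Z j (t, x)) = 0"
 using integral_nonneg_eq_0_iff_AE[OF i] zero[OF t, of j] by simp
 then show ?thesis by eventually_elim (auto simp: max_def split: if_splits)
 qed
 have "AE s in lborel. s \<in> {0..T} --> (u0 j s ~= 0 --> g0 j s <= 0) \<and> (vel (u0 j) (d j) s 1 ~= 0 --> g1 j s <= 0)"
 by (rule B.traces_nonpos) (use zero in auto)
 then show "AE t in lborel. t \<in> {0..T} --> (u (t, 0) $ j ~= 0 --> g0 j t <= 0) \<and> (u (t, 1) $ j ~= 0 --> g1 j t <= 0)"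
 using vb[of j] by eventually_elim auto
qed

end

section \<open>Norms of the coefficients and the comparison principle\<close>

lemma ac_on_bounded:
 assumes "ac_on T V q"
 obtains R where "!!t. 0 <= t ==> t <= T ==> \<bar>V t\<bar> <= R"
proof -
 obtain R where "\<forall>x\<in>V ` {0..T}. norm x <= R"
 using compact_imp_bounded[OF compact_continuous_image[OF ac_on_continuous[OF assms] compact_Icc]] unfolding bounded_iff by blast
 then show thesis by (intro that[of R]) auto
qed

lemma ac_on_exp:
 assumes K: "ac_on T K k"
 shows "ac_on T (%t. exp (- K t)) (%t. - exp (- K t) * k t)"
proof -
 obtain R where R: "!!t. 0 <= t ==> t <= T ==> \<bar>K t\<bar> <= R" using ac_on_bounded[OF K] by blast
 show ?thesis
 proof (rule ac_on_compose[OF K, where \<beta>="%x. exp (- x)" and \<beta>'="%x. - exp (- x)" and R=R and L="exp R"])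
 show "0 <= exp R" by simp
 show "((%x. exp (- x)) has_real_derivative - exp (- x)) (at x)" for x :: real by (auto intro!: derivative_eq_intros)
 have d: "((%x. - exp (- x)) has_real_derivative exp (- x)) (at x)" for x :: real by (auto intro!: derivative_eq_intros)
 have B: "\<bar>exp (- x)\<bar> <= exp R" if "\<bar>x\<bar> <= R" for x :: real using that by auto
 show "\<bar>- exp (- y) - - exp (- x)\<bar> <= exp R * \<bar>y - x\<bar>" if "\<bar>x\<bar> <= R" "\<bar>y\<bar> <= R" for x y
 by (rule lipschitz_of_bounded_derivative[OF d B that(2,1)])
 show "\<bar>K t\<bar> <= R" if "0 <= t" "t <= T" for t by (rule R[OF that])
 qed
qed

lemma ac_on_mono:
 assumes V: "ac_on T V q" and q: "AE t in lborel. t \<in> {0..T} --> 0 <= q t" and st: "0 <= s" "s <= t" "t <= T"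
 shows "V s <= V t"
proof -
 have "0 <= (LBINT r:{s<..t}. q r)" unfolding set_lebesgue_integral_def
 proof (rule integral_nonneg_AE)
 show "AE r in lborel. 0 <= indicat_real {s<..t} r *\<^sub>R q r" using q by eventually_elim (use st in \<open>auto simp: indicator_def\<close>)
 qed
 then show ?thesis using ac_on_increment[OF V st] by simp
qed

lemma Linf_norm_cong: "(!!x. x \<in> space M ==> f x = g x) ==> Linf_norm M f = Linf_norm M g"
 unfolding Linf_norm_def esssup_def
 by (intro arg_cong[of _ _ real_of_ereal] if_cong Limsup_eq measurable_cong refl AE_I2) auto

lemma AE_lborel_pair_iff:
 assumes "{z. P z} \<in> sets (borel :: (real \<times> real) measure)" and "AE t in lborel. AE x in lborel. P (t, x)"
 shows "AE z in (lborel :: (real \<times> real) measure). P z"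
proof -
 have "{z \<in> space (lborel \<Otimes>\<^sub>M lborel). P z} \<in> sets (lborel \<Otimes>\<^sub>M lborel :: (real \<times> real) measure)"
 unfolding lborel_prod using assms(1) by simp
 from lborel_pair.AE_pair_measure[OF this assms(2)] show ?thesis unfolding lborel_prod .
qed

text \<open>The slicewise bounds hold off null sets that depend on \<open>t\<close>; joint
  measurability of the set where the comparison holds merges them into one statement in the
  plane.\<close>

lemma L1_Linf_norm:
 fixes g :: "real \<times> real => real^'n"
 assumes g: "L1_Linf T g"
 shows "set_integrable lborel {0..T} (%t. Linf_norm_vec Omega (%x. g (t, x)))"
 and "AE t in lborel. t \<in> {0..T} --> 0 <= Linf_norm_vec Omega (%x. g (t, x))"
 and "AE z in lborel. z \<in> box T --> \<bar>g z $ j\<bar> <= Linf_norm_vec Omega (%x. g (fst z, x))"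
proof -
 define N where "N t = Linf_norm_vec Omega (%x. g (t, x))" for t
 have gm: "g \<in> borel_measurable (QT T)" and gL: "AE t in lborel. t \<in> {0..T} --> (%x. g (t, x)) \<in> Linf (%_. Omega)" and Ni: "integrable (timeT T) N"
 using g unfolding L1_Linf_def N_def[abs_def] AE_timeT by blast+
 show si: "set_integrable lborel {0..T} (%t. Linf_norm_vec Omega (%x. g (t, x)))"
 using Ni by (simp add: timeT_def integrable_restrict_space set_integrable_def N_def[abs_def])
 show "AE t in lborel. t \<in> {0..T} --> 0 <= Linf_norm_vec Omega (%x. g (t, x))"
 using gL
 proof eventually_elim
 case (elim t)
 show ?case
 proof
 assume "t \<in> {0..T}"
 with elim obtain C where "(%x. g (t, x) $ j) \<in> borel_measurable Omega" "AE x in Omega. \<bar>g (t, x) $ j\<bar> <= C" by (auto simp: Linf_def)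
 from Linf_norm_le(2)[OF this Omega_nonnull] show "0 <= Linf_norm_vec Omega (%x. g (t, x))"
 by (rule order_trans[OF _ Linf_norm_le_vec[of Omega "%x. g (t, x)" j]])
 qed
 qed
 define F where "F z = indicat_real (box T) z * g z $ j" for z
 have Fm[measurable]: "F \<in> borel_measurable borel" unfolding F_def[abs_def] borel_measurable_QT_iff[symmetric] using gm by measurable
 have Nm[measurable]: "zext T N \<in> borel_measurable borel" using Ni by (auto simp: borel_measurable_timeT_iff[symmetric])
 have "AE z in lborel. \<bar>F z\<bar> <= zext T N (fst z) \<or> z \<notin> box T"
 proof (rule AE_lborel_pair_iff)
 have [measurable]: "box T \<in> sets borel" by (rule box_sets)
 show "{z. \<bar>F z\<bar> <= zext T N (fst z) \<or> z \<notin> box T} \<in> sets borel" by measurable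
 show "AE t in lborel. AE x in lborel. \<bar>F (t, x)\<bar> <= zext T N (fst (t, x)) \<or> (t, x) \<notin> box T"
 using gL
 proof eventually_elim
 case (elim t)
 show ?case
 proof (cases "t \<in> {0<..<T}")
 case True
 with elim have "AE x in Omega. \<bar>g (t, x) $ j\<bar> <= N t" unfolding N_def by (intro AE_le_Linf_norm_vec) auto
 then show ?thesis unfolding AE_Omega by eventually_elim (use True in \<open>auto simp: F_def zext_simps\<close>)
 qed auto
 qed
 qed
 then show "AE z in lborel. z \<in> box T --> \<bar>g z $ j\<bar> <= Linf_norm_vec Omega (%x. g (fst z, x))"
 by eventually_elim (auto simp: F_def zext_simps N_def)
qed

text \<open>\<open>F_plus\<close> involves the norm of one component's positive part. Its
  measurability in time comes from \<open>measurable_Linf_norm\<close>, its integrability from the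
  norm of the whole vector.\<close>

lemma L1_Linf_positive_part_norm:
 fixes f :: "real \<times> real => real^'n" and j :: 'n
 assumes f: "L1_Linf T f"
 defines "q \<equiv> (%s. Linf_norm Omega (%x. vpos (f (s, x)) $ j))"
 shows "set_integrable lborel {0..T} q"
 and "AE t in lborel. t \<in> {0..T} --> 0 <= q t"
 and "AE z in lborel. z \<in> box T --> f z $ j <= q (fst z)"
proof -
 define N where "N t = Linf_norm_vec Omega (%x. f (t, x))" for t
 have fm: "f \<in> borel_measurable (QT T)" and fL: "AE t in lborel. t \<in> {0..T} --> (%x. f (t, x)) \<in> Linf (%_. Omega)"
 using f unfolding L1_Linf_def AE_timeT by blast+
 define F where "F z = indicat_real (box T) z * max (f z $ j) 0" for z
 have Fm[measurable]: "F \<in> borel_measurable borel" unfolding F_def[abs_def] borel_measurable_QT_iff[symmetric] using fm by measurable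
 \<comment> \<open>Joint measurability is given on the open cylinder, so the end times 0 and
   \<open>T\<close> are exempted.\<close>
 have qm: "zext T q \<in> borel_measurable borel"
 proof (rule measurable_discrete_difference[where f="%s. indicat_real {0..T} s * Linf_norm Omega (%x. F (s, x))" and X="{0, T}"])
 show "(%s. indicat_real {0..T} s * Linf_norm Omega (%x. F (s, x))) \<in> borel_measurable borel"
 using measurable_Linf_norm[OF Fm] by measurable
 show "indicat_real {0..T} s * Linf_norm Omega (%x. F (s, x)) = zext T q s" if "s \<notin> {0, T}" for s
 proof (cases "s \<in> {0..T}")
 case True
 have "Linf_norm Omega (%x. F (s, x)) = q s" unfolding q_def
 by (rule Linf_norm_cong) (use True that in \<open>auto simp: F_def Omega_def space_restrict_space vpos_vneg_nth indicator_def\<close>)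
 then show ?thesis using True by (simp add: zext_def)
 qed (simp add: zext_def)
 qed auto
 have both: "AE t in lborel. t \<in> {0..T} --> 0 <= q t \<and> q t <= N t \<and> (AE x in Omega. f (t, x) $ j <= q t)"
 using fL
 proof eventually_elim
 case (elim t)
 show ?case
 proof
 assume t: "t \<in> {0..T}"
 then have L: "(%x. f (t, x)) \<in> Linf (%_. Omega)" using elim by simp
 have m: "(%x. vpos (f (t, x)) $ j) \<in> borel_measurable Omega" using L unfolding Linf_def vpos_vneg_nth by (auto intro!: borel_measurable_max)
 have b: "AE x in Omega. \<bar>vpos (f (t, x)) $ j\<bar> <= N t"
 using AE_le_Linf_norm_vec[OF L, of j] unfolding N_def vpos_vneg_nth by eventually_elim (auto simp: max_def)
 have "AE x in Omega. f (t, x) $ j <= q t" using ereal_real_of_Linf_norm[OF m b] unfolding q_def vpos_vneg_nth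
 by eventually_elim (auto simp: max_def split: if_splits)
 then show "0 <= q t \<and> q t <= N t \<and> (AE x in Omega. f (t, x) $ j <= q t)"
 using Linf_norm_le[OF m b Omega_nonnull] by (auto simp: q_def)
 qed
 qed
 then show "AE t in lborel. t \<in> {0..T} --> 0 <= q t" by eventually_elim auto
 show "set_integrable lborel {0..T} q" unfolding set_integrable_def
 proof (rule L_integrable_bound)
 show "integrable lborel (%t. indicat_real {0..T} t *\<^sub>R N t)" using L1_Linf_norm(1)[OF f] by (simp add: set_integrable_def N_def)
 show "(%t. indicat_real {0..T} t *\<^sub>R q t) \<in> borel_measurable lborel" using qm by (simp add: zext_def[abs_def])
 show "AE t in lborel. norm (indicat_real {0..T} t *\<^sub>R q t) <= norm (indicat_real {0..T} t *\<^sub>R N t)"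
 using both by eventually_elim (auto simp: indicator_def)
 qed
 have "AE z in lborel. f z $ j * indicat_real (box T) z <= zext T q (fst z) \<or> z \<notin> box T"
 proof (rule AE_lborel_pair_iff)
 have [measurable]: "box T \<in> sets borel" by (rule box_sets)
 have "(%z. indicat_real (box T) z * f z $ j) \<in> borel_measurable borel" unfolding borel_measurable_QT_iff[symmetric] using fm by measurable
 then have [measurable]: "(%z. f z $ j * indicat_real (box T) z) \<in> borel_measurable borel" by (simp add: mult.commute)
 note qm[measurable]
 show "{z. f z $ j * indicat_real (box T) z <= zext T q (fst z) \<or> z \<notin> box T} \<in> sets borel" by measurable
 show "AE t in lborel. AE x in lborel. f (t, x) $ j * indicat_real (box T) (t, x) <= zext T q (fst (t, x)) \<or> (t, x) \<notin> box T"
 using both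
 proof eventually_elim
 case (elim t)
 show ?case
 proof (cases "t \<in> {0<..<T}")
 case True
 then have "AE x in Omega. f (t, x) $ j <= q t" using elim by auto
 then show ?thesis unfolding AE_Omega by eventually_elim (use True in \<open>auto simp: zext_simps\<close>)
 qed auto
 qed
 qed
 then show "AE z in lborel. z \<in> box T --> f z $ j <= q (fst z)"
 by eventually_elim (auto simp: zext_simps)
qed

context boundary_operator
begin

text \<open>On the inflow part \<open>Y <= G Y <= G P\<close> and \<open>0 <= G P\<close>, hence
  \<open>P <= G P\<close>. A nonnegative factor decreasing in time may then be drawn into
  \<open>G\<close> by \<open>G_decreasing_factor\<close>.\<close>

lemma positive_part_factor:
 assumes Y: "Y \<in> Linf (mu_pos T u)" and YG: "!!j. AE z in mu_neg T u j. Y z $ j <= G Y z $ j"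
 and c: "continuous_on {0..T} \<kappa>" and mono: "!!s t. 0 <= s ==> s <= t ==> t <= T ==> \<kappa> t <= \<kappa> s"
 and pos: "!!s. 0 <= \<kappa> s"
 defines "P \<equiv> (%z. \<chi> j. max 0 (Y z $ j))"
 shows "(%z. \<kappa> (fst z) *\<^sub>R P z) \<in> Linf (mu_pos T u)"
 and "AE z in mu_neg T u j. (\<kappa> (fst z) *\<^sub>R P z) $ j <= G (%z. \<kappa> (fst z) *\<^sub>R P z) z $ j"
proof -
 have P: "P \<in> Linf (mu_pos T u)"
 unfolding Linf_iff
 proof (intro allI conjI)
 fix j
 have "(%z. Y z $ j) \<in> borel_measurable (GammaT T)" using Y by (simp add: Linf_iff)
 then show "(%z. P z $ j) \<in> borel_measurable (GammaT T)" unfolding P_def vec_lambda_beta by measurable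
 obtain C where "AE z in mu_pos T u j. \<bar>Y z $ j\<bar> <= C" using Y by (auto simp: Linf_iff)
 then have "AE z in mu_pos T u j. \<bar>P z $ j\<bar> <= C" by eventually_elim (auto simp: P_def max_def)
 then show "\<exists>C. AE z in mu_pos T u j. \<bar>P z $ j\<bar> <= C" ..
 qed
 have nn: "ae_nonneg (mu_pos T u) P" by (simp add: ae_nonneg_def P_def)
 show "(%z. \<kappa> (fst z) *\<^sub>R P z) \<in> Linf (mu_pos T u)" by (rule G_decreasing_factor(1)[OF P nn c mono pos])
 have f: "AE z in mu_neg T u j. \<kappa> (fst z) * G P z $ j <= G (%z. \<kappa> (fst z) *\<^sub>R P z) z $ j" for j
 by (rule G_decreasing_factor(2)[OF P nn c mono pos])
 have "AE z in mu_neg T u j. G Y z $ j <= G P z $ j" by (rule G_mono[OF Y P]) (simp add: P_def)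
 moreover have "AE z in mu_neg T u j. 0 <= G P z $ j" using G_pos[OF P nn] by (simp add: ae_nonneg_def)
 ultimately show "AE z in mu_neg T u j. (\<kappa> (fst z) *\<^sub>R P z) $ j <= G (%z. \<kappa> (fst z) *\<^sub>R P z) z $ j"
 using YG[of j] f[of j]
 proof eventually_elim
 case (elim z)
 have "P z $ j <= G P z $ j" using elim by (simp add: P_def)
 from mult_left_mono[OF this pos[of "fst z"]] elim(4) show ?case by simp
 qed
qed

text \<open>Both bounds have the shape \<open>y * \<rho> <= m\<close>: the lower one with
  \<open>y = - 1\<close> and \<open>m = 0\<close>, the upper one with
  \<open>y = exp (- int_alpha)\<close> and \<open>m = rmax + F_plus\<close>. The factor
  \<open>E\<close> leaves the sign of the excess alone but corrects that of its source; being
  decreasing, it preserves the boundary inequality.\<close>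

lemma comparison:
 fixes w d h :: "'n => real \<times> real => real" and C :: "'n => real" and u0 g0 g1 :: "'n => real => real"
 and \<rho> \<gamma> :: "real \<times> real => real^'n" and y E a' :: "real => real" and m b' :: "'n => real => real"
 assumes bal: "!!j. balance_law T (C j) (w j) (d j) (h j) (u0 j) (g0 j) (g1 j)"
 and w\<rho>: "!!j t. t \<in> {0..T} ==> AE x in lborel. x \<in> {0<..<1} --> w j (t, x) = \<rho> (t, x) $ j"
 and vb: "!!j. AE t in lborel. t \<in> {0..T} --> u0 j t = u (t, 0) $ j \<and> vel (u0 j) (d j) t 1 = u (t, 1) $ j"
 and tr: "!!j. AE t in lborel. t \<in> {0..T} --> (u (t, 0) $ j ~= 0 --> g0 j t = \<gamma> (t, 0) $ j) \<and> (u (t, 1) $ j ~= 0 --> g1 j t = \<gamma> (t, 1) $ j)"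
 and E: "continuous_on {0..T} E" "!!t. 0 < E t" "!!s t. 0 <= s ==> s <= t ==> t <= T ==> E t <= E s"
 and a: "ac_on T (%t. E t * y t) a'" and b: "!!j. ac_on T (%t. E t * m j t) (b' j)"
 and source: "!!j. AE z in lborel. z \<in> box T --> 0 < E (fst z) * y (fst z) * w j z - E (fst z) * m j (fst z) \<longrightarrow>
 E (fst z) * y (fst z) * h j z + a' (fst z) * w j z - (b' j (fst z) + E (fst z) * m j (fst z) * d j z) <= 0"
 and init: "!!j. AE x in lborel. x \<in> {0<..<1} --> y 0 * \<rho> (0, x) $ j <= m j 0"
 and Y: "(%z. \<chi> j. y (fst z) * \<gamma> z $ j - m j (fst z)) \<in> Linf (mu_pos T u)"
 and YG: "!!j. AE z in mu_neg T u j. y (fst z) * \<gamma> z $ j - m j (fst z) <= G (%z. \<chi> j. y (fst z) * \<gamma> z $ j - m j (fst z)) z $ j"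
 shows "t \<in> {0..T} ==> AE x in lborel. x \<in> {0<..<1} --> y t * \<rho> (t, x) $ j <= m j t"
 and "AE t in lborel. t \<in> {0..T} --> (u (t, 0) $ j ~= 0 --> y t * \<gamma> (t, 0) $ j <= m j t) \<and> (u (t, 1) $ j ~= 0 --> y t * \<gamma> (t, 1) $ j <= m j t)"
proof -
 let ?Y = "%z. \<chi> j. y (fst z) * \<gamma> z $ j - m j (fst z)"
 let ?a = "%t. E t * y t" and ?b = "%j t. E t * m j t"
 define Z where "Z j z = zext T ?a (fst z) * w j z - zext T (?b j) (fst z) * indicat_real {0<..<1} (snd z)" for j z
 define H where "H j z = zext T ?a (fst z) * h j z + zext T a' (fst z) * w j z
 - (zext T (b' j) (fst z) + zext T (?b j) (fst z) * d j z) * indicat_real {0<..<1} (snd z)" for j z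
 define k0 where "k0 j t = zext T ?a t * g0 j t - zext T (?b j) t" for j t
 define k1 where "k1 j t = zext T ?a t * g1 j t - zext T (?b j) t" for j t
 have "\<forall>j. \<exists>C. balance_law T C (Z j) (d j) (H j) (u0 j) (k0 j) (k1 j)"
 proof
 fix j
 obtain A where A: "!!t. 0 <= t ==> t <= T ==> \<bar>?a t\<bar> <= A" using ac_on_bounded[OF a] by blast
 obtain B where B: "!!t. 0 <= t ==> t <= T ==> \<bar>?b j t\<bar> <= B" using ac_on_bounded[OF b[of j]] by blast
 show "\<exists>C. balance_law T C (Z j) (d j) (H j) (u0 j) (k0 j) (k1 j)"
 using balance_law.balance_law_affine[OF bal[of j] a b[of j] A B]
 unfolding Z_def[abs_def] H_def[abs_def] k0_def[abs_def] k1_def[abs_def] by blast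
 qed
 then obtain C' where bal': "!!j. balance_law T (C' j) (Z j) (d j) (H j) (u0 j) (k0 j) (k1 j)" unfolding choice_iff by blast
 define X where "X z = E (fst z) *\<^sub>R (\<chi> j. max 0 (?Y z $ j))" for z
 have E0: "0 <= E t" for t using E(2)[of t] by simp
 have XL: "X \<in> Linf (mu_pos T u)" unfolding X_def[abs_def]
 by (rule positive_part_factor(1)[OF Y _ E(1,3) E0]) (use YG in simp)
 have XG: "AE z in mu_neg T u j. X z $ j <= G X z $ j" for j unfolding X_def[abs_def]
 by (rule positive_part_factor(2)[OF Y _ E(1,3) E0]) (use YG in simp)
 have mx: "max 0 (e * y) = e * max 0 y" if "0 < e" for e y :: real
 using that by (auto simp: max_def zero_le_mult_iff)
 have neg: "AE z in lborel. z \<in> {0..T} \<times> {0..1} --> 0 < Z j z --> H j z <= 0" for j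
 proof -
 have "AE z in (lborel :: (real \<times> real) measure). fst z ~= 0 \<and> fst z ~= T"
 proof (rule AE_lborel_pair_iff)
 show "{z :: real \<times> real. fst z ~= 0 \<and> fst z ~= T} \<in> sets borel" by measurable
 show "AE t in lborel. AE x in lborel. fst (t, x :: real) ~= 0 \<and> fst (t, x) ~= T"
 using AE_lborel_singleton[of "0::real"] AE_lborel_singleton[of T] by eventually_elim auto
 qed
 then show ?thesis using source[of j]
 proof eventually_elim
 case (elim z)
 show ?case
 proof (intro impI)
 assume z: "z \<in> {0..T} \<times> {0..1}" and p: "0 < Z j z"
 have "snd z \<in> {0<..<1}"
 proof (rule ccontr)
 assume "\<not> ?thesis"
 then have "w j (fst z, snd z) = 0" by (intro balance_law.w_0[OF bal]) auto
 with \<open>snd z \<notin> {0<..<1}\<close> p show False by (simp add: Z_def)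
 qed
 then have zb: "z \<in> box T" using z elim(1) by (auto simp: mem_Times_iff)
 have ze: "zext T f (fst z) = f (fst z)" for f using z by (auto simp: zext_simps mem_Times_iff)
 have i: "indicat_real {0<..<1} (snd z) = 1" using \<open>snd z \<in> {0<..<1}\<close> by simp
 show "H j z <= 0" using elim(2) zb p unfolding Z_def H_def ze i by simp
 qed
 qed
 qed
 have init': "AE x in lborel. Z j (0, x) <= 0" for j
 proof -
 have "(0::real) \<in> {0..T}" using T0 by simp
 from w\<rho>[OF this, of j] init[of j] show ?thesis
 proof eventually_elim
 case (elim x)
 show ?case
 proof (cases "x \<in> {0<..<1}")
 case True
 have "E 0 * (y 0 * w j (0, x)) <= E 0 * m j 0" using elim True E0[of 0] by (intro mult_left_mono) auto
 then show ?thesis using True T0 by (simp add: Z_def zext_simps mult.assoc)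
 next
 case False
 then have "w j (0, x) = 0" by (intro balance_law.w_0[OF bal]) auto
 then show ?thesis using False by (simp add: Z_def)
 qed
 qed
 qed
 have tr': "AE t in lborel. t \<in> {0..T} --> (u (t, 0) $ j ~= 0 --> max 0 (k0 j t) = X (t, 0) $ j) \<and> (u (t, 1) $ j ~= 0 --> max 0 (k1 j t) = X (t, 1) $ j)" for j
 using tr[of j]
 proof eventually_elim
 case (elim t)
 show ?case
 proof (intro impI conjI)
 assume t: "t \<in> {0..T}" and n: "u (t, 0) $ j ~= 0"
 have "k0 j t = E t * (y t * \<gamma> (t, 0) $ j - m j t)" using elim t n by (simp add: k0_def zext_simps algebra_simps)
 then show "max 0 (k0 j t) = X (t, 0) $ j" by (simp add: mx[OF E(2)] X_def)
 next
 assume t: "t \<in> {0..T}" and n: "u (t, 1) $ j ~= 0"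
 have "k1 j t = E t * (y t * \<gamma> (t, 1) $ j - m j t)" using elim t n by (simp add: k1_def zext_simps algebra_simps)
 then show "max 0 (k1 j t) = X (t, 1) $ j" by (simp add: mx[OF E(2)] X_def)
 qed
 qed
 have Xm: "(%z. X z $ j) \<in> borel_measurable (GammaT T)" for j using XL by (simp add: Linf_iff)
 have X0: "0 <= X z $ j" for z j using E0 by (simp add: X_def)
 note ev = excess_vanishes[OF XL Xm X0 XG bal' neg init' vb tr']
 show "AE x in lborel. x \<in> {0<..<1} --> y t * \<rho> (t, x) $ j <= m j t" if t: "t \<in> {0..T}"
 using ev(1)[OF t, of j] w\<rho>[OF t, of j]
 proof eventually_elim
 case (elim x)
 show ?case
 proof
 assume x: "x \<in> {0<..<1}"
 then have "E t * (y t * \<rho> (t, x) $ j - m j t) <= 0" using elim t by (simp add: Z_def zext_simps algebra_simps)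
 then show "y t * \<rho> (t, x) $ j <= m j t" using E(2)[of t] by (simp add: mult_le_0_iff)
 qed
 qed
 show "AE t in lborel. t \<in> {0..T} --> (u (t, 0) $ j ~= 0 --> y t * \<gamma> (t, 0) $ j <= m j t) \<and> (u (t, 1) $ j ~= 0 --> y t * \<gamma> (t, 1) $ j <= m j t)"
 using ev(2)[of j] tr[of j]
 proof eventually_elim
 case (elim t)
 show ?case
 proof (intro impI conjI)
 assume t: "t \<in> {0..T}" and n: "u (t, 0) $ j ~= 0"
 then have "E t * (y t * \<gamma> (t, 0) $ j - m j t) <= 0" using elim by (simp add: k0_def zext_simps algebra_simps)
 then show "y t * \<gamma> (t, 0) $ j <= m j t" using E(2)[of t] by (simp add: mult_le_0_iff)
 next
 assume t: "t \<in> {0..T}" and n: "u (t, 1) $ j ~= 0"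
 then have "E t * (y t * \<gamma> (t, 1) $ j - m j t) <= 0" using elim by (simp add: k1_def zext_simps algebra_simps)
 then show "y t * \<gamma> (t, 1) $ j <= m j t" using E(2)[of t] by (simp add: mult_le_0_iff)
 qed
 qed
qed

end

section \<open>The lower and the upper bound\<close>

lemma set_integral_singleton_zero: "(LBINT s:{0..0::real}. (q s :: real)) = 0"
proof -
 have "(%s. indicat_real {0..0::real} s *\<^sub>R q s) = (%s. indicat_real {0} s *\<^sub>R q 0)" by (auto simp: indicator_def)
 then show ?thesis unfolding set_lebesgue_integral_def by simp
qed

text \<open>Put \<open>V = p * W - M\<close>, the excess without the factor \<open>e\<close>. The
  left side equals \<open>- e * (p * (q - f) + (c + be + 2 * al) * V + M * (c + al + ux))\<close>,
  and the hypotheses make each of the three products nonnegative.\<close>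

lemma upper_source:
 fixes e p f q c be al W M ux :: real
 assumes "0 < e" "0 < p" "f <= q" "0 <= c + be + al" "0 <= al" "0 <= c + al + ux" "0 <= M" "0 < e * p * W - e * M"
 shows "e * p * (f - c * W) + (p * (- e * (al + be)) + e * (- p * al)) * W - ((M * (- e * (al + be)) + e * (0 + p * q)) + e * M * ux) <= 0"
proof -
 have "0 < e * (p * W - M)" using assms(8) by (simp add: algebra_simps)
 then have V: "0 < p * W - M" using assms(1) by (simp add: zero_less_mult_iff)
 have "0 <= p * (q - f)" "0 <= (c + be + 2 * al) * (p * W - M)" "0 <= M * (c + al + ux)"
 using assms V by (auto intro!: mult_nonneg_nonneg)
 then have "0 <= p * (q - f) + (c + be + 2 * al) * (p * W - M) + M * (c + al + ux)" by (intro add_nonneg_nonneg)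
 from mult_nonneg_nonneg[OF less_imp_le[OF assms(1)] this]
 have "0 <= e * (p * (q - f) + (c + be + 2 * al) * (p * W - M) + M * (c + al + ux))" .
 then show ?thesis by (simp add: algebra_simps)
qed

lemma maximum_principle:
 fixes T :: real
 and u ux c f rin \<rho> \<gamma> :: "real \<times> real => real^'n"
 and r0 :: "real => real^'n"
 and G :: "(real \<times> real => real^'n) => real \<times> real => real^'n"
 and rmax :: "real^'n"
 assumes T0: "T > 0"
 and adm: "admissible T u ux c f r0 rin G"
 and rm: "is_rho_max T u ux c f r0 rin G rmax"
 and sol: "ibvp_solution T u c f r0 rin G \<rho> \<gamma>"
 shows "(\<forall>t\<in>{0..T}. AE x in Omega.
 0 <= \<rho> (t, x) \<and>
 \<rho> (t, x) <= exp (int_alpha ux c t) *\<^sub>R (rmax + F_plus ux c f t)) \<and>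
 (\<forall>j. AE z in mu_abs T u j.
 0 <= \<gamma> z $ j \<and>
 \<gamma> z $ j <= (rmax + F_plus ux c f (fst z)) $ j * exp (int_alpha ux c (fst z)))"
proof -
 have u: "L1_W11 T u ux" and c: "integrable (QT T) c" and va: "L1_Linf T (%z. vneg (ux z + c z))"
 and vb: "L1_Linf T (%z. vpos (ux z))" and f: "L1_Linf T f" and f0: "AE z in QT T. 0 <= f z"
 and r00: "AE x in Omega. 0 <= r0 x" and rin0: "ae_nonneg (mu_neg T u) rin" and Gop: "admissible_operator T u G"
 using adm unfolding admissible_def by blast+
 have ws: "weak_solution T u c f \<rho>" and tr: "is_trace T u c f \<rho> \<gamma>" and ini: "AE x in Omega. \<rho> (0, x) = r0 x"
 and bc: "ae_eq (mu_neg T u) \<gamma> (H_op rin G \<gamma>)" and cont: "C_Lp T 1 \<rho>"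
 using sol unfolding ibvp_solution_def by auto
 interpret boundary_operator T u ux G by unfold_locales (rule T0 u Gop)+
 have "\<forall>j. \<exists>C w d h u0 g0 g1. balance_law T C w d h u0 g0 g1
 \<and> (\<forall>t\<in>{0..T}. AE x in lborel. x \<in> {0<..<1} --> w (t, x) = \<rho> (t, x) $ j)
 \<and> (\<forall>z\<in>box T. d z = ux z $ j) \<and> (\<forall>z\<in>box T. h z = f z $ j - c z $ j * w z)
 \<and> (AE t in lborel. t \<in> {0..T} --> u0 t = u (t, 0) $ j \<and> vel u0 d t 1 = u (t, 1) $ j)
 \<and> (AE t in lborel. t \<in> {0..T} --> (u (t, 0) $ j ~= 0 --> g0 t = \<gamma> (t, 0) $ j) \<and> (u (t, 1) $ j ~= 0 --> g1 t = \<gamma> (t, 1) $ j))"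
 (is "\<forall>j. \<exists>C w d h u0 g0 g1. ?CB j C w d h u0 g0 g1")
 proof
 fix j
 show "\<exists>C w d h u0 g0 g1. ?CB j C w d h u0 g0 g1"
 proof (rule component_balance[OF T0 u c f ws cont tr, of j])
 fix C w d h u0 g0 g1
 assume a: "balance_law T C w d h u0 g0 g1" "!!t. t \<in> {0..T} ==> AE x in lborel. x \<in> {0<..<1} --> w (t, x) = \<rho> (t, x) $ j"
 "!!z. z \<in> box T ==> d z = ux z $ j" "!!z. z \<in> box T ==> h z = f z $ j - c z $ j * w z"
 "AE t in lborel. t \<in> {0..T} --> u0 t = u (t, 0) $ j \<and> vel u0 d t 1 = u (t, 1) $ j"
 "AE t in lborel. t \<in> {0..T} --> (u (t, 0) $ j ~= 0 --> g0 t = \<gamma> (t, 0) $ j) \<and> (u (t, 1) $ j ~= 0 --> g1 t = \<gamma> (t, 1) $ j)"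
 have "?CB j C w d h u0 g0 g1" by (intro conjI ballI a)
 then show ?thesis by (intro exI)
 qed
 qed
 then obtain C w d h u0 g0 g1 where cb: "\<forall>j. ?CB j (C j) (w j) (d j) (h j) (u0 j) (g0 j) (g1 j)"
 unfolding choice_iff by (elim exE) (rule that)
 have bal: "!!j. balance_law T (C j) (w j) (d j) (h j) (u0 j) (g0 j) (g1 j)"
 and w\<rho>: "!!j t. t \<in> {0..T} ==> AE x in lborel. x \<in> {0<..<1} --> w j (t, x) = \<rho> (t, x) $ j"
 and dj: "!!j z. z \<in> box T ==> d j z = ux z $ j" and hj: "!!j z. z \<in> box T ==> h j z = f z $ j - c z $ j * w j z"
 and ub: "!!j. AE t in lborel. t \<in> {0..T} --> u0 j t = u (t, 0) $ j \<and> vel (u0 j) (d j) t 1 = u (t, 1) $ j"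
 and gb: "!!j. AE t in lborel. t \<in> {0..T} --> (u (t, 0) $ j ~= 0 --> g0 j t = \<gamma> (t, 0) $ j) \<and> (u (t, 1) $ j ~= 0 --> g1 j t = \<gamma> (t, 1) $ j)"
 using cb by blast+
 define al where "al t = alpha ux c t" for t
 define be where "be t = Linf_norm_vec Omega (%x. vpos (ux (t, x)))" for t
 define A where "A t = int_alpha ux c t" for t
 \<comment> \<open>Exponent of the integrating factor: \<open>ux + c >= - al\<close> and
   \<open>ux <= be\<close> give \<open>c >= - (al + be)\<close>, so the coefficient
   \<open>c + al + be\<close> that remains after multiplication is nonnegative.\<close>
 define K where "K t = (LBINT s:{0..t}. al s + be s)" for t
 define E where "E t = exp (- K t)" for t
 define EA where "EA t = exp (- A t)" for t
 have ali: "set_integrable lborel {0..T} al" unfolding al_def[abs_def] alpha_def[abs_def] by (rule L1_Linf_norm(1)[OF va])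
 have bei: "set_integrable lborel {0..T} be" unfolding be_def[abs_def] by (rule L1_Linf_norm(1)[OF vb])
 have nn: "AE t in lborel. t \<in> {0..T} --> 0 <= al t + be t"
 using L1_Linf_norm(2)[OF va] L1_Linf_norm(2)[OF vb] unfolding al_def alpha_def be_def by eventually_elim auto
 have Aeq: "A = (%t. LBINT s:{0..t}. al s)" by (rule ext) (simp add: A_def int_alpha_def al_def)
 have acA: "ac_on T A al" unfolding Aeq by (rule ac_on_integral[OF ali])
 have acK: "ac_on T K (%t. al t + be t)" unfolding K_def[abs_def] by (rule ac_on_integral[OF set_integral_add(1)[OF ali bei]])
 have acE: "ac_on T E (%t. - E t * (al t + be t))" unfolding E_def[abs_def] by (rule ac_on_exp[OF acK])
 have acEA: "ac_on T EA (%t. - EA t * al t)" unfolding EA_def[abs_def] by (rule ac_on_exp[OF acA])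
 have Epos: "0 < E t" "0 < EA t" for t by (simp_all add: E_def EA_def)
 have Emono: "E t <= E s" if "0 <= s" "s <= t" "t <= T" for s t
 using ac_on_mono[OF acK nn that] by (simp add: E_def)
 have nal: "AE t in lborel. t \<in> {0..T} --> 0 <= al t" using L1_Linf_norm(2)[OF va] unfolding al_def alpha_def .
 have EAmono: "EA t <= EA s" if "0 <= s" "s <= t" "t <= T" for s t
 using ac_on_mono[OF acA nal that] by (simp add: EA_def)
 note Ec = ac_on_continuous[OF acE] and EAc = ac_on_continuous[OF acEA]
 have b1: "AE z in lborel. z \<in> box T --> 0 <= al (fst z) \<and> 0 <= ux z $ j + c z $ j + al (fst z)" for j
 using L1_Linf_norm(3)[OF va, of j] unfolding al_def alpha_def vpos_vneg_nth by eventually_elim auto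
 have b2: "AE z in lborel. z \<in> box T --> ux z $ j <= be (fst z)" for j
 using L1_Linf_norm(3)[OF vb, of j] unfolding be_def vpos_vneg_nth by eventually_elim auto
 have f0': "AE z in lborel. z \<in> box T --> 0 <= f z $ j" for j
 using f0 unfolding AE_QT by eventually_elim (auto simp: less_eq_vec_def)
 have \<gamma>L: "\<gamma> \<in> Linf (mu_pos T u)" unfolding Linf_iff
 proof (intro allI conjI)
 fix j
 have g: "\<gamma> \<in> Linf (mu_abs T u)" using tr by (simp add: is_trace_def)
 then show "(%z. \<gamma> z $ j) \<in> borel_measurable (GammaT T)" by (simp add: Linf_def measurable_mu)
 obtain B where "AE z in mu_abs T u j. \<bar>\<gamma> z $ j\<bar> <= B" using g by (auto simp: Linf_def)
 then have "AE z in mu_pos T u j. \<bar>\<gamma> z $ j\<bar> <= B" unfolding AE_mu[OF um] by eventually_elim auto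
 then show "\<exists>B. AE z in mu_pos T u j. \<bar>\<gamma> z $ j\<bar> <= B" ..
 qed
 have bc': "AE z in mu_neg T u j. \<gamma> z $ j = rin z $ j + G \<gamma> z $ j" for j
 using bc by (simp add: ae_eq_def H_op_def)
 have rin0': "AE z in mu_neg T u j. 0 <= rin z $ j" for j using rin0 by (simp add: ae_nonneg_def)
 have ini': "AE x in lborel. x \<in> {0<..<1} --> 0 <= \<rho> (0, x) $ j \<and> \<rho> (0, x) $ j <= rmax $ j" for j
 proof -
 have "AE x in Omega. r0 x <= rmax" using rm by (simp add: is_rho_max_def)
 with ini r00 show ?thesis unfolding AE_Omega by eventually_elim (auto simp: less_eq_vec_def)
 qed

 \<comment> \<open>For \<open>- \<rho>\<close> the source is, up to the positive factor
   \<open>E\<close>, \<open>(c + al + be) * w - f\<close>, which is nonpositive where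
   \<open>w <= 0\<close>. The inflow data are nonnegative, so the boundary condition gives
   \<open>- \<gamma> <= G (- \<gamma>)\<close>.\<close>
 have lower: "(\<forall>t\<in>{0..T}. AE x in lborel. x \<in> {0<..<1} --> (- 1) * \<rho> (t, x) $ j <= 0) \<and> (AE t in lborel. t \<in> {0..T} --> (u (t, 0) $ j ~= 0 --> (- 1) * \<gamma> (t, 0) $ j <= 0) \<and> (u (t, 1) $ j ~= 0 --> (- 1) * \<gamma> (t, 1) $ j <= 0))" for j
 proof -
 have Yeq: "(%z. \<chi> j. (- 1) * \<gamma> z $ j - 0) = (%z. (- 1) *\<^sub>R \<gamma> z + 0 *\<^sub>R \<gamma> z)" by (rule ext) (simp add: vec_eq_iff)
 have a: "ac_on T (%t. E t * (- 1)) (%t. E t * (al t + be t))"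
 by (rule ac_on_cong[OF ac_on_cmult[OF acE, of "- 1"]]) simp_all
 have b: "ac_on T (%t. E t * 0) (%_. 0)" using ac_on_const[of T 0] by simp
 have src: "AE z in lborel. z \<in> box T --> 0 < E (fst z) * (- 1) * w j z - E (fst z) * 0 \<longrightarrow>
 E (fst z) * (- 1) * h j z + E (fst z) * (al (fst z) + be (fst z)) * w j z - (0 + E (fst z) * 0 * d j z) <= 0" for j
 using b1[of j] b2[of j] f0'[of j]
 proof eventually_elim
 case (elim z)
 show ?case
 proof (intro impI)
 assume z: "z \<in> box T" and "0 < E (fst z) * (- 1) * w j z - E (fst z) * 0"
 then have "0 < E (fst z) * (- w j z)" by simp
 then have wn: "w j z <= 0" using Epos(1)[of "fst z"] by (simp only: zero_less_mult_iff) auto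
 have "0 <= c z $ j + al (fst z) + be (fst z)" using elim z by force
 from mult_nonneg_nonpos[OF this wn] have "(c z $ j + al (fst z) + be (fst z)) * w j z - f z $ j <= 0" using elim z by simp
 from mult_nonneg_nonpos[OF less_imp_le[OF Epos(1)] this]
 show "E (fst z) * (- 1) * h j z + E (fst z) * (al (fst z) + be (fst z)) * w j z - (0 + E (fst z) * 0 * d j z) <= 0"
 by (simp add: hj[OF z] algebra_simps)
 qed
 qed
 have init: "AE x in lborel. x \<in> {0<..<1} --> (- 1) * \<rho> (0, x) $ j <= 0" for j using ini'[of j] by eventually_elim auto
 have Y: "(%z. \<chi> j. (- 1) * \<gamma> z $ j - 0) \<in> Linf (mu_pos T u)" unfolding Yeq by (rule Linf_add[OF \<gamma>L \<gamma>L])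
 have YG: "AE z in mu_neg T u j. (- 1) * \<gamma> z $ j - 0 <= G (%z. \<chi> j. (- 1) * \<gamma> z $ j - 0) z $ j" for j
 proof -
 have "AE z in mu_neg T u j. G (%z. (- 1) *\<^sub>R \<gamma> z + 0 *\<^sub>R \<gamma> z) z $ j = ((- 1) *\<^sub>R G \<gamma> z + 0 *\<^sub>R G \<gamma> z) $ j"
 using G_linear[where a="- 1" and b=0, OF \<gamma>L \<gamma>L] unfolding ae_eq_def by blast
 with bc'[of j] rin0'[of j] show ?thesis unfolding Yeq by eventually_elim simp
 qed
 show "(\<forall>t\<in>{0..T}. AE x in lborel. x \<in> {0<..<1} --> (- 1) * \<rho> (t, x) $ j <= 0) \<and> (AE t in lborel. t \<in> {0..T} --> (u (t, 0) $ j ~= 0 --> (- 1) * \<gamma> (t, 0) $ j <= 0) \<and> (u (t, 1) $ j ~= 0 --> (- 1) * \<gamma> (t, 1) $ j <= 0))"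
 proof (intro conjI ballI)
 show "AE x in lborel. x \<in> {0<..<1} --> (- 1) * \<rho> (t, x) $ j <= 0" if t: "t \<in> {0..T}" for t
 by (rule comparison(1)[where y="%_. - 1" and m="%_ _. 0" and b'="%_ _. 0", OF bal w\<rho> ub gb Ec Epos(1) Emono a b src init Y YG t])
 show "AE t in lborel. t \<in> {0..T} --> (u (t, 0) $ j ~= 0 --> (- 1) * \<gamma> (t, 0) $ j <= 0) \<and> (u (t, 1) $ j ~= 0 --> (- 1) * \<gamma> (t, 1) $ j <= 0)"
 by (rule comparison(2)[where y="%_. - 1" and m="%_ _. 0" and b'="%_ _. 0", OF bal w\<rho> ub gb Ec Epos(1) Emono a b src init Y YG])
 qed
 qed
 note lower1 = lower[THEN conjunct1, THEN bspec] and lower2 = lower[THEN conjunct2]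

 define F where "F = F_plus ux c f"
 define q where "q j s = Linf_norm Omega (%x. vpos (f (s, x)) $ j)" for j s
 note qf = L1_Linf_positive_part_norm[OF f, folded q_def]
 have F_nth: "F t $ j = (LBINT s:{0..t}. EA s * q j s)" for t j
 by (simp add: F_def F_plus_def EA_def A_def q_def)
 have acF: "ac_on T (%t. F t $ j) (%s. EA s * q j s)" for j
 unfolding F_nth by (rule ac_on_integral[OF set_integrable_mult_continuous[OF qf(1) EAc]])
 have acM: "ac_on T (%t. rmax $ j + F t $ j) (%s. 0 + EA s * q j s)" for j by (rule ac_on_add[OF ac_on_const acF])
 have F0: "F 0 $ j = 0" for j unfolding F_nth by (rule set_integral_singleton_zero)
 have A0: "A 0 = 0" unfolding A_def int_alpha_def by (rule set_integral_singleton_zero)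
 \<comment> \<open>At almost every point of the interval the initial value lies between 0 and
   \<open>rmax\<close>; one such point suffices.\<close>
 have rmax0: "0 <= rmax $ j" for j
 proof -
 from AE_imp_ex_between[OF ini'[of j], of 0 1] show ?thesis by force
 qed
 have M0: "0 <= rmax $ j + F t $ j" if t: "t \<in> {0..T}" for t j
 proof -
 have "AE s in lborel. s \<in> {0..T} --> 0 <= EA s * q j s" using qf(2)[of j] by eventually_elim (use Epos(2) in \<open>auto simp: less_imp_le\<close>)
 from ac_on_mono[OF acF this, of 0 t] t have "0 <= F t $ j" by (simp add: F0)
 then show ?thesis using rmax0[of j] by simp
 qed
 have upper: "(\<forall>t\<in>{0..T}. AE x in lborel. x \<in> {0<..<1} --> EA t * \<rho> (t, x) $ j <= rmax $ j + F t $ j) \<and> (AE t in lborel. t \<in> {0..T} --> (u (t, 0) $ j ~= 0 --> EA t * \<gamma> (t, 0) $ j <= rmax $ j + F t $ j) \<and> (u (t, 1) $ j ~= 0 --> EA t * \<gamma> (t, 1) $ j <= rmax $ j + F t $ j))" for j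
 proof -
 let ?R = "%_ :: real \<times> real. rmax" and ?F = "%z :: real \<times> real. F (fst z)" and ?g = "%z. EA (fst z) *\<^sub>R \<gamma> z"
 let ?M = "%z. 1 *\<^sub>R rmax + 1 *\<^sub>R F (fst z)"
 have Yeq: "(%z. \<chi> j. EA (fst z) * \<gamma> z $ j - (rmax $ j + F (fst z) $ j)) = (%z. 1 *\<^sub>R ?g z + (- 1) *\<^sub>R ?M z)"
 by (rule ext) (simp add: vec_eq_iff)
 have RL: "?R \<in> Linf (mu_pos T u)" unfolding Linf_iff by auto
 have FL: "?F \<in> Linf (mu_pos T u)" unfolding Linf_iff
 proof (intro allI conjI)
 fix j
 show "(%z. F (fst z) $ j) \<in> borel_measurable (GammaT T)" by (rule kappa_measurable[OF ac_on_continuous[OF acF]])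
 obtain B where "!!t. 0 <= t ==> t <= T ==> \<bar>F t $ j\<bar> <= B" using ac_on_bounded[OF acF[of j]] by blast
 then have "AE z in mu_pos T u j. \<bar>F (fst z) $ j\<bar> <= B" unfolding AE_mu[OF um] by (intro AE_I2) auto
 then show "\<exists>B. AE z in mu_pos T u j. \<bar>F (fst z) $ j\<bar> <= B" ..
 qed
 have MvL: "?M \<in> Linf (mu_pos T u)" by (rule Linf_add[OF RL FL])
 \<comment> \<open>The lower bound enters here: drawing the decreasing factor \<open>EA\<close> into
   \<open>G\<close> requires a nonnegative trace.\<close>
 have \<gamma>nn: "ae_nonneg (mu_pos T u) \<gamma>" unfolding ae_nonneg_def
 proof
 fix j show "AE z in mu_pos T u j. 0 <= \<gamma> z $ j" unfolding AE_mu[OF um] using lower2[of j] by eventually_elim auto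
 qed
 have gf1: "?g \<in> Linf (mu_pos T u)"
 by (rule G_decreasing_factor(1)[OF \<gamma>L \<gamma>nn EAc EAmono less_imp_le[OF Epos(2)]])
 have gf2: "AE z in mu_neg T u j. EA (fst z) * G \<gamma> z $ j <= G ?g z $ j" for j
 by (rule G_decreasing_factor(2)[OF \<gamma>L \<gamma>nn EAc EAmono less_imp_le[OF Epos(2)]])
 have Y: "(%z. \<chi> j. EA (fst z) * \<gamma> z $ j - (rmax $ j + F (fst z) $ j)) \<in> Linf (mu_pos T u)"
 unfolding Yeq by (rule Linf_add[OF gf1 MvL])
 \<comment> \<open>Multiply the boundary condition by \<open>EA\<close>, use
   \<open>EA * G \<gamma> <= G (EA * \<gamma>)\<close>, and compare with the defining inequality of
   \<open>rmax\<close>; linearity collects the three images under \<open>G\<close>.\<close>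
 have YG: "AE z in mu_neg T u j. EA (fst z) * \<gamma> z $ j - (rmax $ j + F (fst z) $ j) <= G (%z. \<chi> j. EA (fst z) * \<gamma> z $ j - (rmax $ j + F (fst z) $ j)) z $ j" for j
 proof -
 have l1: "AE z in mu_neg T u j. G (%z. 1 *\<^sub>R ?g z + (- 1) *\<^sub>R ?M z) z $ j = (1 *\<^sub>R G ?g z + (- 1) *\<^sub>R G ?M z) $ j"
 using G_linear[where a=1 and b="- 1", OF gf1 MvL] unfolding ae_eq_def by blast
 have l2: "AE z in mu_neg T u j. G ?M z $ j = (1 *\<^sub>R G ?R z + 1 *\<^sub>R G ?F z) $ j"
 using G_linear[where a=1 and b=1, OF RL FL] unfolding ae_eq_def by blast
 have l3: "AE z in mu_neg T u j. rin z $ j * EA (fst z) - F (fst z) $ j + G ?F z $ j + G ?R z $ j <= rmax $ j"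
 using rm unfolding is_rho_max_def EA_def A_def F_def by blast
 show ?thesis unfolding Yeq using l1 l2 l3 bc'[of j] gf2[of j]
 proof eventually_elim
 case (elim z)
 have "EA (fst z) * \<gamma> z $ j = rin z $ j * EA (fst z) + EA (fst z) * G \<gamma> z $ j" unfolding elim(4) by (simp add: algebra_simps)
 then show ?case using elim(1,2,3,5) by simp
 qed
 qed
 have a: "ac_on T (%t. E t * EA t) (%t. EA t * (- E t * (al t + be t)) + E t * (- EA t * al t))"
 by (rule ac_on_mult[OF acE acEA])
 have b: "ac_on T (%t. E t * (rmax $ j + F t $ j)) (%t. (rmax $ j + F t $ j) * (- E t * (al t + be t)) + E t * (0 + EA t * q j t))" for j
 by (rule ac_on_mult[OF acE acM])
 have src: "AE z in lborel. z \<in> box T --> 0 < E (fst z) * EA (fst z) * w j z - E (fst z) * (rmax $ j + F (fst z) $ j) \<longrightarrow>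
 E (fst z) * EA (fst z) * h j z + (EA (fst z) * (- E (fst z) * (al (fst z) + be (fst z))) + E (fst z) * (- EA (fst z) * al (fst z))) * w j z
 - (((rmax $ j + F (fst z) $ j) * (- E (fst z) * (al (fst z) + be (fst z))) + E (fst z) * (0 + EA (fst z) * q j (fst z))) + E (fst z) * (rmax $ j + F (fst z) $ j) * d j z) <= 0" for j
 using b1[of j] b2[of j] qf(3)[of j]
 proof eventually_elim
 case (elim z)
 show ?case
 proof (intro impI)
 assume z: "z \<in> box T" and p: "0 < E (fst z) * EA (fst z) * w j z - E (fst z) * (rmax $ j + F (fst z) $ j)"
 have M: "0 <= rmax $ j + F (fst z) $ j" by (rule M0) (use z in \<open>auto simp: mem_Times_iff\<close>)
 have e1: "0 <= c z $ j + be (fst z) + al (fst z)" "0 <= al (fst z)" "0 <= c z $ j + al (fst z) + ux z $ j" "f z $ j <= q j (fst z)"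
 using elim z by force+
 show "E (fst z) * EA (fst z) * h j z + (EA (fst z) * (- E (fst z) * (al (fst z) + be (fst z))) + E (fst z) * (- EA (fst z) * al (fst z))) * w j z
 - (((rmax $ j + F (fst z) $ j) * (- E (fst z) * (al (fst z) + be (fst z))) + E (fst z) * (0 + EA (fst z) * q j (fst z))) + E (fst z) * (rmax $ j + F (fst z) $ j) * d j z) <= 0"
 unfolding hj[OF z] dj[OF z] by (rule upper_source[OF Epos e1(4) e1(1,2,3) M p])
 qed
 qed
 have init: "AE x in lborel. x \<in> {0<..<1} --> EA 0 * \<rho> (0, x) $ j <= rmax $ j + F 0 $ j" for j
 using ini'[of j] by eventually_elim (simp add: EA_def A0 F0)
 show "(\<forall>t\<in>{0..T}. AE x in lborel. x \<in> {0<..<1} --> EA t * \<rho> (t, x) $ j <= rmax $ j + F t $ j) \<and> (AE t in lborel. t \<in> {0..T} --> (u (t, 0) $ j ~= 0 --> EA t * \<gamma> (t, 0) $ j <= rmax $ j + F t $ j) \<and> (u (t, 1) $ j ~= 0 --> EA t * \<gamma> (t, 1) $ j <= rmax $ j + F t $ j))"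
 proof (intro conjI ballI)
 show "AE x in lborel. x \<in> {0<..<1} --> EA t * \<rho> (t, x) $ j <= rmax $ j + F t $ j" if t: "t \<in> {0..T}" for t
 by (rule comparison(1)[where y=EA and m="%j t. rmax $ j + F t $ j", OF bal w\<rho> ub gb Ec Epos(1) Emono a b src init Y YG t])
 show "AE t in lborel. t \<in> {0..T} --> (u (t, 0) $ j ~= 0 --> EA t * \<gamma> (t, 0) $ j <= rmax $ j + F t $ j) \<and> (u (t, 1) $ j ~= 0 --> EA t * \<gamma> (t, 1) $ j <= rmax $ j + F t $ j)"
 by (rule comparison(2)[where y=EA and m="%j t. rmax $ j + F t $ j", OF bal w\<rho> ub gb Ec Epos(1) Emono a b src init Y YG])
 qed
 qed
 note upper1 = upper[THEN conjunct1, THEN bspec] and upper2 = upper[THEN conjunct2]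
 have conv: "y <= exp (A t) * M" if "EA t * y <= M" for t y M :: real
 proof -
 have "exp (A t) * (EA t * y) <= exp (A t) * M" using that by (intro mult_left_mono) auto
 moreover have "exp (A t) * (EA t * y) = y" by (simp add: EA_def exp_minus)
 ultimately show ?thesis by simp
 qed
 have "AE x in Omega. 0 <= \<rho> (t, x) \<and> \<rho> (t, x) <= exp (int_alpha ux c t) *\<^sub>R (rmax + F_plus ux c f t)" if t: "t \<in> {0..T}" for t
 proof -
 have "AE x in Omega. \<forall>j. 0 <= \<rho> (t, x) $ j \<and> \<rho> (t, x) $ j <= exp (A t) * (rmax $ j + F t $ j)"
 proof (rule eventually_all_finite)
 fix j
 show "AE x in Omega. 0 <= \<rho> (t, x) $ j \<and> \<rho> (t, x) $ j <= exp (A t) * (rmax $ j + F t $ j)"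
 unfolding AE_Omega using lower1[OF t, of j] upper1[OF t, of j] by eventually_elim (auto intro: conv)
 qed
 then show ?thesis by eventually_elim (simp add: less_eq_vec_def A_def F_def)
 qed
 moreover have "AE z in mu_abs T u j. 0 <= \<gamma> z $ j \<and> \<gamma> z $ j <= (rmax + F_plus ux c f (fst z)) $ j * exp (int_alpha ux c (fst z))" for j
 proof -
 have conv': "y <= (rmax + F_plus ux c f t) $ j * exp (int_alpha ux c t)" if "EA t * y <= rmax $ j + F t $ j" for t y
 using conv[OF that] by (simp add: A_def F_def mult.commute)
 show ?thesis unfolding AE_mu[OF um] fst_conv using lower2[of j] upper2[of j]
 proof eventually_elim
 case (elim t)
 show ?case
 proof (intro impI conjI)
 assume t: "t \<in> {0..T}"
 { assume n: "u (t, 0) $ j ~= 0"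
 show "0 <= \<gamma> (t, 0) $ j" using elim(1) t n by simp
 show "\<gamma> (t, 0) $ j <= (rmax + F_plus ux c f t) $ j * exp (int_alpha ux c t)" by (rule conv') (use elim(2) t n in simp) }
 { assume n: "u (t, 1) $ j ~= 0"
 show "0 <= \<gamma> (t, 1) $ j" using elim(1) t n by simp
 show "\<gamma> (t, 1) $ j <= (rmax + F_plus ux c f t) $ j * exp (int_alpha ux c t)" by (rule conv') (use elim(2) t n in simp) }
 qed
 qed
 qed
 ultimately show ?thesis by blast
qed

theorem lemma7:
  fixes T :: real
    and u u\<^sub>x c f \<rho>\<^sub>i\<^sub>n \<rho> \<gamma> :: "real \<times> real \<Rightarrow> real^'n"
    and \<rho>\<^sub>0 :: "real \<Rightarrow> real^'n"
    and G :: "(real \<times> real \<Rightarrow> real^'n) \<Rightarrow> real \<times> real \<Rightarrow> real^'n"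
    and \<rho>\<^sub>m\<^sub>a\<^sub>x :: "real^'n"
  assumes "T > 0"
    and "admissible T u u\<^sub>x c f \<rho>\<^sub>0 \<rho>\<^sub>i\<^sub>n G"
    and "is_rho_max T u u\<^sub>x c f \<rho>\<^sub>0 \<rho>\<^sub>i\<^sub>n G \<rho>\<^sub>m\<^sub>a\<^sub>x"
    and "ibvp_solution T u c f \<rho>\<^sub>0 \<rho>\<^sub>i\<^sub>n G \<rho> \<gamma>"
  shows "(\<forall>t\<in>{0..T}. AE x in Omega.
            0 \<le> \<rho> (t, x) \<and>
            \<rho> (t, x) \<le> exp (int_alpha u\<^sub>x c t) *\<^sub>R (\<rho>\<^sub>m\<^sub>a\<^sub>x + F_plus u\<^sub>x c f t)) \<and>
         (\<forall>j. AE z in mu_abs T u j.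
            0 \<le> \<gamma> z $ j \<and>
            \<gamma> z $ j \<le> (\<rho>\<^sub>m\<^sub>a\<^sub>x + F_plus u\<^sub>x c f (fst z)) $ j * exp (int_alpha u\<^sub>x c (fst z)))"
  by (rule maximum_principle[OF assms])

end
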